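(* Let $d=1$, and let $c(x)$ be a measurable function on $\mathbb R$ for which there exist constants $0<c<C<\infty$ with $c\le c(x)\le C$ for all $x\in\mathbb R$. For measurable functions $\alpha_n,\alpha$ on $[0,\infty)$ put $$J_n(x,y)=(c(x)+1)|x-y|^{-1-\alpha_n(|x-y|)},\qquad J(x,y)=(c(x)+1)|x-y|^{-1-\alpha(|x-y|)},\qquad x,y\in\mathbb R,\ x\ne y,$$ and let $$\mathcal E^n(u,v)=\frac12\iint_{x\ne y}(u(x)-u(y))(v(x)-v(y))J_n(x,y)\,dxdy,\qquad \mathcal F^n=\overline{C_0^{\mathrm{lip}}(\mathbb R)}^{\sqrt{\mathcal E^n_1}},$$ and define $(\mathcal E,\mathcal F)$ in the same way with $J$ in place of $J_n$. (i) (recurrent ones to transient one) If $\alpha_n(u)=1+1/n-\bigl(\log(u+e^2)\bigr)^{-1/2}$ and $\alpha(u)=1-\bigl(\log(u+e^2)\bigr)^{-1/2}$ for $u\ge0$ and $n\in\mathbb N$, $n\ge1$, then $(\mathcal E^n,\mathcal F^n)$ is recurrent for each $n$ and converges in the sense of Mosco to $(\mathcal E,\mathcal F)$, which is transient. (ii) (transient ones to recurrent one) If $\alpha_n(u)=1-\bigl(\log(u+e^2)\bigr)^{-(1-1/n)}$ and $\alpha(u)=1-\bigl(\log(u+e^2)\bigr)^{-1}$ for $u\ge0$ and $n\in\mathbb N$, $n\ge2$, then $(\mathcal E^n,\mathcal F^n)$ is transient for each $n$ and converges in the sense of Mosco to $(\mathcal E,\mathcal F)$, which is recurrent.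
   Context: $L^2(\mathbb R)=L^2(\mathbb R;dx)$, $dx$ Lebesgue measure. $C_0^{\mathrm{lip}}(\mathbb R)$ is the set of Lipschitz continuous functions on $\mathbb R$ with compact support; $\mathcal E_1(u,v)=\mathcal E(u,v)+(u,v)_{L^2(\mathbb R)}$ (likewise $\mathcal E^n_1$), and the domains are the closures of $C_0^{\mathrm{lip}}(\mathbb R)$ in the corresponding norms (smallest closed extensions). Recurrence/transience of a Dirichlet form are in the usual sense: with $\{T_t\}$ the associated semigroup and $Gf=\int_0^\infty T_tf\,dt$ for nonnegative $f\in L^1$, the form is transient if $Gf<\infty$ a.e. for every nonnegative $f\in L^1$, and recurrent if $Gf\in\{0,\infty\}$ a.e. for every nonnegative $f\in L^1$. Mosco convergence: a closed form means a nonnegative definite symmetric closed form on a Hilbert space $\mathcal H$ (not necessarily densely defined), and it is extended by setting $\mathcal E(u,u)=\infty$ for $u\in\mathcal H\setminus\mathcal F$. A sequence of closed forms $\mathcal E^n$ on $\mathcal H$ converges to $\mathcal E$ in the sense of Mosco if (M1) for every $u\in\mathcal H$ and every sequence $\{u_n\}$ converging to $u$ weakly in $\mathcal H$, $\liminf_{n\to\infty}\mathcal E^n(u_n,u_n)\ge\mathcal E(u,u)$; and (M2) for every $u\in\mathcal H$ there exists a sequence $\{u_n\}$ converging to $u$ (strongly) in $\mathcal H$ such that $\limsup_{n\to\infty}\mathcal E^n(u_n,u_n)\le\mathcal E(u,u)$. Here $\mathcal H=L^2(\mathbb R)$. *)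

theory Defs
  imports "HOL-Analysis.Analysis"
begin

section \<open>The Hilbert space of square-integrable functions modulo null sets\<close>

definition square_integrable :: "(real \<Rightarrow> real) \<Rightarrow> bool" where
  "square_integrable f \<longleftrightarrow>
     f \<in> borel_measurable lebesgue \<and> integrable lebesgue (\<lambda>x. (f x)\<^sup>2)"

definition L2_rel :: "(real \<Rightarrow> real) \<Rightarrow> (real \<Rightarrow> real) \<Rightarrow> bool" where
  "L2_rel f g \<longleftrightarrow>
     square_integrable f \<and> square_integrable g \<and> (AE x in lebesgue. f x = g x)"

lemma square_integrable_measurable [measurable_dest]:
  "square_integrable f \<Longrightarrow> f \<in> borel_measurable lebesgue"
  by (simp add: square_integrable_def)

lemma square_integrable_mult:
  assumes "square_integrable f" "square_integrable g"
  shows "integrable lebesgue (\<lambda>x. f x * g x)"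
proof (rule Bochner_Integration.integrable_bound)
  show "integrable lebesgue (\<lambda>x. (f x)\<^sup>2 + (g x)\<^sup>2)"
    using assms by (simp add: square_integrable_def)
  show "(\<lambda>x. f x * g x) \<in> borel_measurable lebesgue"
    using assms by measurable
  have "\<bar>a * b\<bar> \<le> a\<^sup>2 + b\<^sup>2" for a b :: real
    using sum_squares_bound[of "\<bar>a\<bar>" "\<bar>b\<bar>"]
      zero_le_power2[of a] zero_le_power2[of b] abs_ge_zero[of "a * b"]
    unfolding abs_mult power2_abs by linarith
  then show "AE x in lebesgue. norm (f x * g x) \<le> norm ((f x)\<^sup>2 + (g x)\<^sup>2)"
    by (intro AE_I2) (simp add: abs_of_nonneg)
qed

lemma square_integrable_zero: "square_integrable (\<lambda>x. 0)"
  by (simp add: square_integrable_def)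

lemma square_integrable_add:
  assumes "square_integrable f" "square_integrable g"
  shows "square_integrable (\<lambda>x. f x + g x)"
proof -
  have "integrable lebesgue (\<lambda>x. (f x)\<^sup>2 + (g x)\<^sup>2 + 2 * (f x * g x))"
    using assms square_integrable_mult[OF assms] by (simp add: square_integrable_def)
  moreover have "(\<lambda>x. f x + g x) \<in> borel_measurable lebesgue"
    using assms by measurable
  ultimately show ?thesis
    by (simp add: square_integrable_def power2_sum mult.assoc)
qed

lemma square_integrable_scale:
  assumes "square_integrable f"
  shows "square_integrable (\<lambda>x. r * f x)"
proof -
  have "(\<lambda>x. r * f x) \<in> borel_measurable lebesgue"
    using assms by measurable
  moreover have "integrable lebesgue (\<lambda>x. (r * f x)\<^sup>2)"
    using assms by (simp add: square_integrable_def power_mult_distrib)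
  ultimately show ?thesis
    unfolding square_integrable_def by (rule conjI)
qed

lemma square_integrable_diff:
  assumes "square_integrable f" "square_integrable g"
  shows "square_integrable (\<lambda>x. f x - g x)"
  using square_integrable_add[OF assms(1) square_integrable_scale[OF assms(2), of "-1"]] by simp

lemma square_integrable_clip:
  assumes "square_integrable f"
  shows "square_integrable (\<lambda>x. max 0 (min 1 (f x)))"
proof -
  have [measurable]: "f \<in> borel_measurable lebesgue"
    using assms by (simp add: square_integrable_def)
  have *: "(max 0 (min 1 a))\<^sup>2 \<le> a\<^sup>2" for a :: real
    by (rule abs_le_square_iff[THEN iffD1]) auto
  have "integrable lebesgue (\<lambda>x. (max 0 (min 1 (f x)))\<^sup>2)"
  proof (rule Bochner_Integration.integrable_bound)
    show "integrable lebesgue (\<lambda>x. (f x)\<^sup>2)"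
      using assms by (simp add: square_integrable_def)
  qed (use * in auto)
  then show ?thesis by (simp add: square_integrable_def)
qed

quotient_type L2 = "real \<Rightarrow> real" / partial: L2_rel
  morphisms rep_L2 class_L2
proof (rule part_equivpI)
  show "\<exists>f. L2_rel f f"
    using square_integrable_zero by (auto simp: L2_rel_def)
  show "symp L2_rel"
    by (auto simp: symp_def L2_rel_def)
  show "transp L2_rel"
    by (auto simp: transp_def L2_rel_def)
qed

instantiation L2 :: real_inner
begin

lift_definition zero_L2 :: L2 is "\<lambda>x. 0"
  by (simp add: L2_rel_def square_integrable_zero)

lift_definition plus_L2 :: "L2 \<Rightarrow> L2 \<Rightarrow> L2" is "\<lambda>f g x. f x + g x"
  by (auto simp: L2_rel_def square_integrable_add)

lift_definition minus_L2 :: "L2 \<Rightarrow> L2 \<Rightarrow> L2" is "\<lambda>f g x. f x - g x"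
  by (auto simp: L2_rel_def square_integrable_diff)

lift_definition uminus_L2 :: "L2 \<Rightarrow> L2" is "\<lambda>f x. - f x"
  using square_integrable_scale[of _ "-1"] by (auto simp: L2_rel_def)

lift_definition scaleR_L2 :: "real \<Rightarrow> L2 \<Rightarrow> L2" is "\<lambda>r f x. r * f x"
  by (auto simp: L2_rel_def square_integrable_scale)

lift_definition inner_L2 :: "L2 \<Rightarrow> L2 \<Rightarrow> real" is "\<lambda>f g. LINT x|lebesgue. f x * g x"
  by (intro integral_cong_AE) (auto simp: L2_rel_def square_integrable_def)

definition norm_L2 :: "L2 \<Rightarrow> real" where
  "norm_L2 u = sqrt (inner u u)"

definition dist_L2 :: "L2 \<Rightarrow> L2 \<Rightarrow> real" where
  "dist_L2 u v = norm (u - v)"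

definition sgn_L2 :: "L2 \<Rightarrow> L2" where
  "sgn_L2 u = inverse (norm u) *\<^sub>R u"

definition uniformity_L2 :: "(L2 \<times> L2) filter" where
  "uniformity_L2 = (INF e\<in>{0<..}. principal {(u, v). dist u v < e})"

definition open_L2 :: "L2 set \<Rightarrow> bool" where
  "open_L2 U \<longleftrightarrow> (\<forall>u\<in>U. eventually (\<lambda>(u', v). u' = u \<longrightarrow> v \<in> U) uniformity)"

instance
proof
  fix u v w :: L2 and r s :: real
  show "u + v + w = u + (v + w)"
    by transfer (auto simp: L2_rel_def square_integrable_add add.assoc)
  show "u + v = v + u"
    by transfer (auto simp: L2_rel_def square_integrable_add add.commute)
  show "0 + u = u"
    by transfer (auto simp: L2_rel_def)
  show "- u + u = 0"
    by transfer (auto simp: L2_rel_def square_integrable_zero)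
  show "u - v = u + - v"
    by transfer (auto simp: L2_rel_def square_integrable_diff)
  show "r *\<^sub>R (u + v) = r *\<^sub>R u + r *\<^sub>R v"
    by transfer (auto simp: L2_rel_def distrib_left square_integrable_add square_integrable_scale)
  show "(r + s) *\<^sub>R u = r *\<^sub>R u + s *\<^sub>R u"
    by transfer (auto simp: L2_rel_def distrib_right square_integrable_add square_integrable_scale)
  show "r *\<^sub>R s *\<^sub>R u = (r * s) *\<^sub>R u"
    by transfer (auto simp: L2_rel_def mult.assoc square_integrable_scale)
  show "1 *\<^sub>R u = u"
    by transfer (auto simp: L2_rel_def)
  show "dist u v = norm (u - v)"
    by (rule dist_L2_def)
  show "sgn u = inverse (norm u) *\<^sub>R u"
    by (rule sgn_L2_def)
  show "uniformity = (INF e\<in>{0<..}. principal {(u, v). dist u (v::L2) < e})"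
    by (rule uniformity_L2_def)
  show "open U \<longleftrightarrow> (\<forall>u\<in>U. \<forall>\<^sub>F (u', v) in uniformity. u' = u \<longrightarrow> v \<in> U)" for U :: "L2 set"
    by (rule open_L2_def)
  show "inner u v = inner v u"
    by transfer (simp add: mult.commute)
  show "inner (u + v) w = inner u w + inner v w"
    by transfer (simp add: L2_rel_def distrib_right square_integrable_mult)
  show "inner (r *\<^sub>R u) v = r * inner u v"
    by transfer (simp add: mult.assoc)
  show "0 \<le> inner u u"
    by transfer simp
  show "inner u u = 0 \<longleftrightarrow> u = 0"
  proof transfer
    fix f :: "real \<Rightarrow> real"
    assume "L2_rel f f"
    then have f: "square_integrable f" by (simp add: L2_rel_def)
    have "(LINT x|lebesgue. f x * f x) = 0 \<longleftrightarrow> (AE x in lebesgue. f x * f x = 0)"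
      using square_integrable_mult[OF f f] by (intro integral_nonneg_eq_0_iff_AE) auto
    then show "(LINT x|lebesgue. f x * f x) = 0 \<longleftrightarrow> L2_rel f (\<lambda>x. 0)"
      using f by (simp add: L2_rel_def square_integrable_zero)
  qed
  show "norm u = sqrt (inner u u)"
    by (rule norm_L2_def)
qed

end

lemma square_integrable_rep_L2: "square_integrable (rep_L2 u)"
  using Quotient3_rel_rep[OF Quotient3_L2, of u u] by (simp add: L2_rel_def)

lemma class_rep_L2: "class_L2 (rep_L2 u) = u"
  by (rule Quotient3_abs_rep[OF Quotient3_L2])

lemma rep_class_L2:
  assumes "square_integrable f"
  shows "AE x in lebesgue. rep_L2 (class_L2 f) x = f x"
  using rep_abs_rsp_left[OF Quotient3_L2, of f f] assms by (simp add: L2_rel_def)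

lemma norm_diff_class_L2:
  assumes f: "square_integrable f" and g: "square_integrable g"
  shows "ennreal ((norm (class_L2 f - class_L2 g))\<^sup>2)
           = (\<integral>\<^sup>+x. ennreal ((f x - g x)\<^sup>2) \<partial>lebesgue)"
proof -
  have "class_L2 f - class_L2 g = class_L2 (\<lambda>x. f x - g x)"
    by (rule minus_L2.abs_eq) (use f g in \<open>simp_all add: L2_rel_def\<close>)
  moreover have "inner (class_L2 h) (class_L2 h) = (LINT x|lebesgue. h x * h x)"
    if "square_integrable h" for h
    by (rule inner_L2.abs_eq) (use that in \<open>simp_all add: L2_rel_def\<close>)
  ultimately have "(norm (class_L2 f - class_L2 g))\<^sup>2 = (LINT x|lebesgue. (f x - g x)\<^sup>2)"
    using square_integrable_diff[OF f g] by (simp add: power2_norm_eq_inner) (simp add: power2_eq_square)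
  then show ?thesis
    using square_integrable_diff[OF f g]
    by (simp add: nn_integral_eq_integral square_integrable_def)
qed

instance L2 :: complete_space
proof
  fix X :: "nat \<Rightarrow> L2"
  assume X: "Cauchy X"
  define f where "f n = rep_L2 (X n)" for n
  have f: "square_integrable (f n)" for n
    by (simp add: f_def square_integrable_rep_L2)
  then have f_meas [measurable]: "f n \<in> borel_measurable lebesgue" for n
    by (simp add: square_integrable_def)
  have Xf: "X n = class_L2 (f n)" for n
    by (simp add: f_def class_rep_L2)
  have "\<exists>M. \<forall>m\<ge>M. \<forall>n\<ge>M. norm (X m - X n) < (1/2) ^ k" for k
    using X by (intro CauchyD) auto
  then obtain M where M: "norm (X m - X n) < (1/2) ^ k" if "m \<ge> M k" "n \<ge> M k" for k m n
    by metis
  define r where "r k = (\<Sum>j\<le>k. M j) + k" for k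
  have r: "strict_mono r"
    by (rule strict_monoI_Suc) (simp add: r_def)
  have rM: "M k \<le> r k" for k
    using member_le_sum[of k "{..k}" M] by (simp add: r_def)
  define D where "D k x = 2 ^ k * (f (r (Suc k)) x - f (r k) x)\<^sup>2" for k x
  have [measurable]: "D k \<in> borel_measurable lebesgue" for k
    unfolding D_def by measurable
  have int_D: "(\<integral>\<^sup>+x. ennreal (D k x) \<partial>lebesgue) \<le> ennreal ((1/2) ^ k)" for k
  proof -
    have "r k \<le> r (Suc k)"
      using strict_mono_mono[OF r] by (simp add: mono_def)
    then have "norm (X (r (Suc k)) - X (r k)) \<le> (1/2) ^ k"
      using rM[of k] by (intro less_imp_le[OF M]) auto
    then have "(norm (X (r (Suc k)) - X (r k)))\<^sup>2 \<le> ((1/2) ^ k)\<^sup>2"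
      by (intro power_mono) auto
    then have "2 ^ k * (norm (X (r (Suc k)) - X (r k)))\<^sup>2 \<le> 2 ^ k * ((1/2) ^ k)\<^sup>2"
      by simp
    also have "\<dots> = (1/2) ^ k"
      by (simp add: power2_eq_square power_one_over)
    finally have "ennreal (2 ^ k) * ennreal ((norm (X (r (Suc k)) - X (r k)))\<^sup>2) \<le> ennreal ((1/2) ^ k)"
      by (simp flip: ennreal_mult'')
    moreover have "(\<integral>\<^sup>+x. ennreal (D k x) \<partial>lebesgue)
        = ennreal (2 ^ k) * (\<integral>\<^sup>+x. ennreal ((f (r (Suc k)) x - f (r k) x)\<^sup>2) \<partial>lebesgue)"
      unfolding D_def by (subst nn_integral_cmult[symmetric]) (auto simp: ennreal_mult'')
    ultimately show ?thesis
      by (simp add: Xf norm_diff_class_L2[OF f f])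
  qed
  have "(\<integral>\<^sup>+x. (\<Sum>k. ennreal (D k x)) \<partial>lebesgue) = (\<Sum>k. \<integral>\<^sup>+x. ennreal (D k x) \<partial>lebesgue)"
    by (rule nn_integral_suminf) simp
  also have "\<dots> \<le> (\<Sum>k. ennreal ((1/2) ^ k))"
    by (intro suminf_le int_D) auto
  also have "\<dots> < \<infinity>"
    by (subst suminf_ennreal2) auto
  finally have "AE x in lebesgue. (\<Sum>k. ennreal (D k x)) \<noteq> \<infinity>"
    by (intro nn_integral_PInf_AE) auto
  then have conv: "AE x in lebesgue. convergent (\<lambda>k. f (r k) x)"
  proof eventually_elim
    case (elim x)
    have "summable (\<lambda>k. D k x)"
      by (rule summable_suminf_not_top) (use elim in \<open>auto simp: D_def\<close>)
    then have "summable (\<lambda>k. (1/2) ^ k + D k x)"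
      by (intro summable_add) auto
    then have "summable (\<lambda>k. f (r (Suc k)) x - f (r k) x)"
    proof (rule summable_comparison_test'[where N = 0])
      fix k :: nat
      define a where "a = \<bar>f (r (Suc k)) x - f (r k) x\<bar>"
      define b :: real where "b = 2 ^ k"
      have b: "b > 0" by (simp add: b_def)
      have "0 \<le> (1 - b * a)\<^sup>2" by simp
      then have "2 * (b * a) \<le> 1 + (b * a)\<^sup>2"
        by (simp add: power2_diff)
      moreover have "0 \<le> b * a" using b by (simp add: a_def)
      ultimately have "b * a \<le> 1 + (b * a)\<^sup>2" by linarith
      then have "a \<le> 1 / b + b * a\<^sup>2"
        using b by (simp add: field_simps power2_eq_square)
      then show "norm (f (r (Suc k)) x - f (r k) x) \<le> (1/2) ^ k + D k x"
        by (simp add: a_def b_def D_def power_one_over)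
    qed
    then have "convergent (\<lambda>k. f (r k) x - f (r 0) x)"
      using sum_lessThan_telescope[of "\<lambda>k. f (r k) x"] by (simp only: summable_iff_convergent)
    from convergent_add[OF this convergent_const[of "f (r 0) x"]] show ?case
      by simp
  qed
  define F where "F x = lim (\<lambda>k. f (r k) x)" for x
  have F_meas [measurable]: "F \<in> borel_measurable lebesgue"
    unfolding F_def by (intro borel_measurable_lim_metric) auto
  have limF: "AE x in lebesgue. (\<lambda>k. f (r k) x) \<longlonglongrightarrow> F x"
    using conv by eventually_elim (simp add: F_def convergent_LIMSEQ_iff)
  have fatou: "(\<integral>\<^sup>+x. ennreal ((f n x - F x)\<^sup>2) \<partial>lebesgue) \<le> ennreal (((1/2) ^ k)\<^sup>2)"
    if n: "M k \<le> n" for n k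
  proof -
    have "(\<integral>\<^sup>+x. ennreal ((f n x - F x)\<^sup>2) \<partial>lebesgue)
        = (\<integral>\<^sup>+x. liminf (\<lambda>j. ennreal ((f n x - f (r j) x)\<^sup>2)) \<partial>lebesgue)"
    proof (rule nn_integral_cong_AE)
      show "AE x in lebesgue. ennreal ((f n x - F x)\<^sup>2)
              = liminf (\<lambda>j. ennreal ((f n x - f (r j) x)\<^sup>2))"
        using limF
      proof eventually_elim
        case (elim x)
        have "(\<lambda>j. ennreal ((f n x - f (r j) x)\<^sup>2)) \<longlonglongrightarrow> ennreal ((f n x - F x)\<^sup>2)"
          by (intro tendsto_intros elim)
        from lim_imp_Liminf[OF sequentially_bot this] show ?case by (rule sym)
      qed
    qed
    also have "\<dots> \<le> liminf (\<lambda>j. \<integral>\<^sup>+x. ennreal ((f n x - f (r j) x)\<^sup>2) \<partial>lebesgue)"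
      by (rule nn_integral_liminf) simp
    also have "\<dots> \<le> liminf (\<lambda>j::nat. ennreal (((1/2) ^ k)\<^sup>2))"
    proof (rule Liminf_mono, rule eventually_sequentiallyI)
      fix j assume "M k \<le> j"
      then have "M k \<le> r j"
        using seq_suble[OF r, of j] by simp
      then have "norm (X n - X (r j)) \<le> (1/2) ^ k"
        using n by (intro less_imp_le[OF M])
      then have "(norm (X n - X (r j)))\<^sup>2 \<le> ((1/2) ^ k)\<^sup>2"
        by (intro power_mono) auto
      then show "(\<integral>\<^sup>+x. ennreal ((f n x - f (r j) x)\<^sup>2) \<partial>lebesgue) \<le> ennreal (((1/2) ^ k)\<^sup>2)"
        by (simp add: Xf flip: norm_diff_class_L2[OF f f])
    qed
    finally show ?thesis by (simp add: Liminf_const)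
  qed
  have "integrable lebesgue (\<lambda>x. (f (M 0) x - F x)\<^sup>2)"
    using fatou[of 0 "M 0"] by (intro integrableI_bounded) (auto intro: order.strict_trans1)
  then have "square_integrable (\<lambda>x. f (M 0) x - F x)"
    by (simp add: square_integrable_def)
  from square_integrable_diff[OF f[of "M 0"] this] have F: "square_integrable F"
    by simp
  have close: "norm (X n - class_L2 F) \<le> (1/2) ^ k" if "M k \<le> n" for n k
  proof -
    have "(norm (X n - class_L2 F))\<^sup>2 \<le> ((1/2) ^ k)\<^sup>2"
      using fatou[OF that] by (simp add: Xf flip: norm_diff_class_L2[OF f F])
    then show ?thesis by (rule power2_le_imp_le) simp
  qed
  have "X \<longlonglongrightarrow> class_L2 F"
  proof (rule LIMSEQ_I)
    fix e :: real assume "0 < e"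
    then obtain k where "(1/2) ^ k < e"
      using real_arch_pow_inv[of e "1/2"] by auto
    then show "\<exists>N. \<forall>n\<ge>N. norm (X n - class_L2 F) < e"
      using close by (intro exI[of _ "M k"]) (meson order.strict_trans1)
  qed
  then show "convergent X" by (rule convergentI)
qed

lift_definition clip_L2 :: "L2 \<Rightarrow> L2" is "\<lambda>f x. max 0 (min 1 (f x))"
  by (auto simp: L2_rel_def square_integrable_clip)


section \<open>Closed forms and Mosco convergence\<close>

text \<open>
  A form with domain \<open>F\<close> is a function \<open>E\<close> whose values matter only on \<open>F \<times> F\<close>.
  Closedness is completeness of \<open>F\<close> with respect to \<open>E\<^sub>1(u,u) = E(u,u) + (u,u)\<close>.
\<close>

definition closed_form ::
  "('a::{real_inner,complete_space} \<Rightarrow> 'a \<Rightarrow> real) \<Rightarrow> 'a set \<Rightarrow> bool" where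
  "closed_form E F \<longleftrightarrow>
     subspace F \<and>
     (\<forall>u\<in>F. \<forall>v\<in>F. E u v = E v u) \<and>
     (\<forall>u\<in>F. \<forall>v\<in>F. \<forall>w\<in>F. E (u + v) w = E u w + E v w) \<and>
     (\<forall>r. \<forall>u\<in>F. \<forall>v\<in>F. E (r *\<^sub>R u) v = r * E u v) \<and>
     (\<forall>u\<in>F. 0 \<le> E u u) \<and>
     (\<forall>X::nat \<Rightarrow> 'a.
        (\<forall>k. X k \<in> F) \<longrightarrow>
        (\<forall>e>0. \<exists>N. \<forall>j\<ge>N. \<forall>k\<ge>N. E (X j - X k) (X j - X k) + inner (X j - X k) (X j - X k) < e) \<longrightarrow>
        (\<exists>u\<in>F. (\<lambda>k. E (X k - u) (X k - u) + inner (X k - u) (X k - u)) \<longlonglongrightarrow> 0))"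

definition form_ext ::
  "('a::{real_inner,complete_space} \<Rightarrow> 'a \<Rightarrow> real) \<Rightarrow> 'a set \<Rightarrow> 'a \<Rightarrow> ereal" where
  "form_ext E F u = (if u \<in> F then ereal (E u u) else \<infinity>)"

definition weakly_tendsto :: "(nat \<Rightarrow> 'a::{real_inner,complete_space}) \<Rightarrow> 'a \<Rightarrow> bool" where
  "weakly_tendsto un u \<longleftrightarrow> (\<forall>v. (\<lambda>n. inner (un n) v) \<longlonglongrightarrow> inner u v)"

text \<open>
  Closedness is only required of all but finitely many members, so that a sequence of forms may
  start at any index; the two Mosco conditions themselves do not depend on finitely many members.
\<close>

definition mosco_converges ::
  "(nat \<Rightarrow> 'a::{real_inner,complete_space} \<Rightarrow> 'a \<Rightarrow> real) \<Rightarrow> (nat \<Rightarrow> 'a set) \<Rightarrow>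
   ('a \<Rightarrow> 'a \<Rightarrow> real) \<Rightarrow> 'a set \<Rightarrow> bool"
where
  "mosco_converges En Fn E F \<longleftrightarrow>
     (\<forall>\<^sub>F n in sequentially. closed_form (En n) (Fn n)) \<and> closed_form E F \<and>
     (\<forall>u un. weakly_tendsto un u \<longrightarrow>
        form_ext E F u \<le> liminf (\<lambda>n. form_ext (En n) (Fn n) (un n))) \<and>
     (\<forall>u. \<exists>un. un \<longlonglongrightarrow> u \<and>
        limsup (\<lambda>n. form_ext (En n) (Fn n) (un n)) \<le> form_ext E F u)"


section \<open>The semigroup of a closed form\<close>

definition symmetric_contraction_semigroup ::
  "(real \<Rightarrow> 'a::{real_inner,complete_space} \<Rightarrow> 'a) \<Rightarrow> bool" where
  "symmetric_contraction_semigroup T \<longleftrightarrow>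
     (\<forall>t>0. linear (T t) \<and> (\<forall>u v. inner (T t u) v = inner u (T t v)) \<and>
        (\<forall>u. norm (T t u) \<le> norm u)) \<and>
     (\<forall>s>0. \<forall>t>0. \<forall>u. T (s + t) u = T s (T t u)) \<and>
     (\<forall>u. ((\<lambda>t. T t u) \<longlongrightarrow> u) (at_right 0))"

text \<open>\<open>semigroup_generator T u w\<close>: \<open>u\<close> is in the domain of the generator \<open>A\<close> of \<open>T\<close>, and \<open>A u = w\<close>.\<close>

definition semigroup_generator ::
  "(real \<Rightarrow> 'a::{real_inner,complete_space} \<Rightarrow> 'a) \<Rightarrow> 'a \<Rightarrow> 'a \<Rightarrow> bool" where
  "semigroup_generator T u w \<longleftrightarrow> ((\<lambda>t. (T t u - u) /\<^sub>R t) \<longlongrightarrow> w) (at_right 0)"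

text \<open>
  The generator of the semigroup associated with \<open>(E, F)\<close> is the operator \<open>A\<close> given by
  \<open>E(u,v) = (- A u, v)\<close> for all \<open>v \<in> F\<close>, on the largest possible domain inside \<open>F\<close>. For a densely
  defined closed form such a semigroup exists, and it is unique at positive times.
\<close>

definition associated_semigroup ::
  "('a::{real_inner,complete_space} \<Rightarrow> 'a \<Rightarrow> real) \<Rightarrow> 'a set \<Rightarrow> (real \<Rightarrow> 'a \<Rightarrow> 'a) \<Rightarrow> bool" where
  "associated_semigroup E F T \<longleftrightarrow>
     symmetric_contraction_semigroup T \<and>
     (\<forall>u w. semigroup_generator T u w \<longleftrightarrow> u \<in> F \<and> (\<forall>v\<in>F. E u v = inner (- w) v))"


section \<open>Dirichlet forms on the line, transience and recurrence\<close>

definition dirichlet_form :: "(L2 \<Rightarrow> L2 \<Rightarrow> real) \<Rightarrow> L2 set \<Rightarrow> bool" where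
  "dirichlet_form E F \<longleftrightarrow>
     closed_form E F \<and> closure F = UNIV \<and>
     (\<forall>u\<in>F. clip_L2 u \<in> F \<and> E (clip_L2 u) (clip_L2 u) \<le> E u u)"

text \<open>
  \<open>L1_extension S f h\<close>: the function \<open>h\<close> represents the value at \<open>f\<close> of the extension by continuity
  to integrable functions of the restriction of \<open>S\<close> to the intersection of both spaces, which is
  dense in the integrable functions. Hence \<open>h\<close> is determined up to null sets.
\<close>

definition L1_extension :: "(L2 \<Rightarrow> L2) \<Rightarrow> (real \<Rightarrow> real) \<Rightarrow> (real \<Rightarrow> real) \<Rightarrow> bool" where
  "L1_extension S f h \<longleftrightarrow>
     integrable lebesgue f \<and> integrable lebesgue h \<and>
     (\<forall>\<phi>::nat \<Rightarrow> L2.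
        (\<forall>k. integrable lebesgue (rep_L2 (\<phi> k))) \<longrightarrow>
        (\<lambda>k. LINT x|lebesgue. \<bar>rep_L2 (\<phi> k) x - f x\<bar>) \<longlonglongrightarrow> 0 \<longrightarrow>
        (\<forall>k. integrable lebesgue (rep_L2 (S (\<phi> k)))) \<and>
        (\<lambda>k. LINT x|lebesgue. \<bar>rep_L2 (S (\<phi> k)) x - h x\<bar>) \<longlonglongrightarrow> 0)"

text \<open>
  \<open>green_function T f g\<close>: \<open>g\<close> is a version of \<open>G f = \<integral>\<^sub>0\<^sup>\<infinity> T\<^sub>t f dt\<close>. As each \<open>T\<^sub>t f\<close> is only an
  equivalence class, the pointwise integral in \<open>t\<close> is taken of a version \<open>p\<close> that is jointly
  measurable in \<open>(t, x)\<close>; by Fubini, \<open>g\<close> is determined by \<open>T\<close> and \<open>f\<close> up to null sets, so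
  the existential quantifiers over \<open>g\<close> below could equally be universal.
\<close>

definition green_function ::
  "(real \<Rightarrow> L2 \<Rightarrow> L2) \<Rightarrow> (real \<Rightarrow> real) \<Rightarrow> (real \<Rightarrow> ennreal) \<Rightarrow> bool" where
  "green_function T f g \<longleftrightarrow>
     (\<exists>p. p \<in> borel_measurable (lebesgue \<Otimes>\<^sub>M lebesgue) \<and>
          (\<forall>t x. 0 \<le> p (t, x)) \<and>
          (\<forall>t>0. L1_extension (T t) f (\<lambda>x. p (t, x))) \<and>
          (\<forall>x. g x = (\<integral>\<^sup>+t\<in>{0<..}. ennreal (p (t, x)) \<partial>lebesgue)))"

definition transient_form :: "(L2 \<Rightarrow> L2 \<Rightarrow> real) \<Rightarrow> L2 set \<Rightarrow> bool" where
  "transient_form E F \<longleftrightarrow>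
     dirichlet_form E F \<and>
     (\<exists>T. associated_semigroup E F T \<and>
        (\<forall>f. integrable lebesgue f \<longrightarrow> (\<forall>x. 0 \<le> f x) \<longrightarrow>
           (\<exists>g. green_function T f g \<and> (AE x in lebesgue. g x < \<infinity>))))"

definition recurrent_form :: "(L2 \<Rightarrow> L2 \<Rightarrow> real) \<Rightarrow> L2 set \<Rightarrow> bool" where
  "recurrent_form E F \<longleftrightarrow>
     dirichlet_form E F \<and>
     (\<exists>T. associated_semigroup E F T \<and>
        (\<forall>f. integrable lebesgue f \<longrightarrow> (\<forall>x. 0 \<le> f x) \<longrightarrow>
           (\<exists>g. green_function T f g \<and> (AE x in lebesgue. g x = 0 \<or> g x = \<infinity>))))"


section \<open>Jump-type forms\<close>

definition stable_like_kernel ::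
  "(real \<Rightarrow> real) \<Rightarrow> (real \<Rightarrow> real) \<Rightarrow> real \<Rightarrow> real \<Rightarrow> real" where
  "stable_like_kernel \<kappa> \<alpha> x y = (\<kappa> x + 1) * \<bar>x - y\<bar> powr (- 1 - \<alpha> \<bar>x - y\<bar>)"

definition jump_form :: "(real \<Rightarrow> real \<Rightarrow> real) \<Rightarrow> L2 \<Rightarrow> L2 \<Rightarrow> real" where
  "jump_form J u v =
     1/2 * (LINT (x, y):{(x, y). x \<noteq> y}|(lebesgue \<Otimes>\<^sub>M lebesgue).
              (rep_L2 u x - rep_L2 u y) * (rep_L2 v x - rep_L2 v y) * J x y)"

text \<open>The quadratic form \<open>E(u,u)\<close> for a nonnegative kernel, with value \<open>\<infinity>\<close> when the integral diverges.\<close>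

definition jump_energy :: "(real \<Rightarrow> real \<Rightarrow> real) \<Rightarrow> L2 \<Rightarrow> ennreal" where
  "jump_energy J u =
     1/2 * (\<integral>\<^sup>+(x, y)\<in>{(x, y). x \<noteq> y}.
              ennreal ((rep_L2 u x - rep_L2 u y)\<^sup>2 * J x y) \<partial>(lebesgue \<Otimes>\<^sub>M lebesgue))"

definition lip_compact :: "(real \<Rightarrow> real) set" where
  "lip_compact = {\<phi>. (\<exists>L. L-lipschitz_on UNIV \<phi>) \<and> compact (closure {x. \<phi> x \<noteq> 0})}"

text \<open>
  The closure of the compactly supported Lipschitz functions with respect to the norm \<open>\<surd>E\<^sub>1\<close>, taken
  in the space of all \<open>u\<close> with \<open>E\<^sub>1(u,u) < \<infinity>\<close>.
\<close>

definition jump_domain :: "(real \<Rightarrow> real \<Rightarrow> real) \<Rightarrow> L2 set" where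
  "jump_domain J =
     {u. jump_energy J u < \<infinity> \<and>
         (\<exists>\<phi>::nat \<Rightarrow> real \<Rightarrow> real. (\<forall>k. \<phi> k \<in> lip_compact) \<and>
            (\<lambda>k. jump_energy J (u - class_L2 (\<phi> k)) + ennreal ((norm (u - class_L2 (\<phi> k)))\<^sup>2))
              \<longlonglongrightarrow> 0)}"

end

theory Submission
  imports Defs
begin

text \<open>
  The semigroup of a closed form on \<open>L\<^sup>2\<close> is the limit of powers of its resolvents, so a Dirichlet form
  satisfies \<open>(Gf, g) = sup (R\<^sub>a f, g)\<close> over \<open>a > 0\<close>. It is therefore transient if, for every bounded interval,
  the integral of a nonnegative \<open>u\<close> over it is at most a constant times \<open>\<surd>E(u, u)\<close>. It is recurrent if there are
  cutoffs in the domain, equal to \<open>1\<close> on larger and larger intervals, that converge weakly to \<open>0\<close> for the form.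

  The forms here have kernels \<open>(\<kappa>(x) + 1) j(\<bar>x - y\<bar>)\<close> with a Levy density \<open>j\<close>, and their domain consists of all
  functions of finite energy. If \<open>j(z) \<le> M / z\<^sup>2\<close> for \<open>z \<ge> 1\<close>, then the dilations of a cutoff have bounded energy,
  and the form is recurrent. The averages of \<open>u\<close> over \<open>[-2\<^sup>k, 2\<^sup>k]\<close> and \<open>[-2\<^sup>k\<^sup>+\<^sup>1, 2\<^sup>k\<^sup>+\<^sup>1]\<close> differ by a constant
  times \<open>\<surd>E(u, u) (4\<^sup>k j(2\<^sup>k\<^sup>+\<^sup>2))\<^sup>-\<^sup>1\<^sup>/\<^sup>2\<close>, so the form is transient if \<open>(4\<^sup>k j(2\<^sup>k))\<^sup>-\<^sup>1\<^sup>/\<^sup>2\<close> is summable.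
  For the exponent \<open>1 + \<delta> - L\<^sup>-\<^sup>\<beta>\<close> with \<open>L = ln (z + e\<^sup>2)\<close>, \<open>z\<^sup>2 j(z) = exp ((L\<^sup>-\<^sup>\<beta> - \<delta>) ln z)\<close> is bounded when
  \<open>\<delta> > 0\<close> or \<open>\<beta> = 1\<close>, and it grows like \<open>exp ((ln z)\<^sup>1\<^sup>-\<^sup>\<beta>)\<close> when \<open>\<delta> = 0\<close> and \<open>\<beta> < 1\<close>.

  Mosco convergence only needs pointwise convergence and a common Levy majorant of the densities. The upper bound
  is dominated convergence on Lipschitz functions of compact support; for the lower bound, the energies of the
  truncated infima \<open>min m (inf {j\<^sub>n | n \<ge> m})\<close> are continuous on \<open>L\<^sup>2\<close>, hence weakly lower semicontinuous,
  and increase to the limit energy.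
\<close>

section \<open>Semi-inner products on subspaces\<close>

text \<open>The weight \<open>\<kappa>\<close> is merely measurable and breaks translation
  invariance: mollifying a function only bounds its energy by \<open>C + 1\<close> times the old one
  and does not make energies converge. Density of the Lipschitz functions in the finite-energy space
  is therefore proved by duality. A function that is E_1-orthogonal to them stays orthogonal to L^2
  limits of sequences with bounded energy, hence to compactly supported functions of finite energy,
  hence to itself. Transience and recurrence concern the semigroup on all integrable functions,
  while the form controls resolvents of square-integrable ones. Resolvents are linked to the
  semigroup as its Laplace transforms, and an integrable function is cut into bounded layers.
  Finiteness of the Green function of one indicator reaches all \<open>f\<close> by symmetry and a
  maximum principle. In the recurrent case, a positive and finite value of \<open>Gf\<close> would
  produce a nonzero function of finite Green energy below \<open>f\<close>. The majorant of the
  kernels rests on \<open>L powr (- \<beta>)\<close> being at least 1/3 for \<open>z \<le> 1\<close>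
  and at most 3/4 everywhere, uniformly for \<open>\<beta>\<close> between 1/2 and 1.\<close>

lemma discriminant_nonpos:
  fixes a b c :: real
  assumes "\<And>s. 0 \<le> a + 2 * s * b + s\<^sup>2 * c" and "0 \<le> c"
  shows "b\<^sup>2 \<le> a * c"
proof (cases "c = 0")
  case True
  have "b = 0"
  proof (rule ccontr)
    assume "b \<noteq> 0"
    \<comment> \<open>At this \<open>s\<close> the expression \<open>a + 2 * s * b\<close> equals
      -1.\<close>
    then show False using assms(1)[of "- (a + 1) / (2 * b)"] True by (simp add: field_simps)
  qed
  then show ?thesis using True by simp
next
  case False
  then have "c > 0" using assms(2) by simp
  have "0 \<le> a + 2 * (- b / c) * b + (- b / c)\<^sup>2 * c" by (rule assms(1))
  also have "\<dots> = a - b\<^sup>2 / c" using \<open>c > 0\<close> by (simp add: field_simps power2_eq_square)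
  finally show ?thesis using \<open>c > 0\<close> by (simp add: field_simps)
qed

text \<open>The form is only semidefinite and only meaningful on \<open>V\<close>. In this
  generality the same facts serve a closed form on its domain, its combinations with the inner
  product, and the inner product of \<open>L2\<close> itself.\<close>

locale semi_inner =
  fixes V :: "'a::real_vector set" and Q :: "'a \<Rightarrow> 'a \<Rightarrow> real"
  assumes subspace: "subspace V"
    and sym: "\<lbrakk>u \<in> V; v \<in> V\<rbrakk> \<Longrightarrow> Q u v = Q v u"
    and add_left: "\<lbrakk>u \<in> V; v \<in> V; w \<in> V\<rbrakk> \<Longrightarrow> Q (u + v) w = Q u w + Q v w"
    and scale_left: "\<lbrakk>u \<in> V; v \<in> V\<rbrakk> \<Longrightarrow> Q (r *\<^sub>R u) v = r * Q u v"
    and nonneg: "u \<in> V \<Longrightarrow> 0 \<le> Q u u"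
begin

lemma V_add [intro]: "u \<in> V \<Longrightarrow> v \<in> V \<Longrightarrow> u + v \<in> V"
  using subspace by (rule subspace_add)

lemma V_scale [intro]: "u \<in> V \<Longrightarrow> r *\<^sub>R u \<in> V"
  using subspace by (rule subspace_scale)

lemma V_diff [intro]: "u \<in> V \<Longrightarrow> v \<in> V \<Longrightarrow> u - v \<in> V"
  using subspace by (rule subspace_diff)

lemma V_zero [intro]: "0 \<in> V"
  using subspace by (rule subspace_0)

lemma add_right: "\<lbrakk>u \<in> V; v \<in> V; w \<in> V\<rbrakk> \<Longrightarrow> Q w (u + v) = Q w u + Q w v"
  using add_left[of u v w] sym[of w u] sym[of w v] sym[of w "u + v"] by auto

lemma scale_right: "\<lbrakk>u \<in> V; v \<in> V\<rbrakk> \<Longrightarrow> Q u (r *\<^sub>R v) = r * Q u v"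
  using scale_left[of v u r] sym[of u v] sym[of u "r *\<^sub>R v"] by auto

lemma diff_left: "\<lbrakk>u \<in> V; v \<in> V; w \<in> V\<rbrakk> \<Longrightarrow> Q (u - v) w = Q u w - Q v w"
  using add_left[of u "(-1) *\<^sub>R v" w] scale_left[of v w "-1"] V_scale[of v "-1"] by simp

lemma diff_right: "\<lbrakk>u \<in> V; v \<in> V; w \<in> V\<rbrakk> \<Longrightarrow> Q w (u - v) = Q w u - Q w v"
  using add_right[of u "(-1) *\<^sub>R v" w] scale_right[of w v "-1"] V_scale[of v "-1"] by simp

lemma quad_add_scale:
  assumes "u \<in> V" "v \<in> V"
  shows "Q (u + s *\<^sub>R v) (u + s *\<^sub>R v) = Q u u + 2 * s * Q u v + s\<^sup>2 * Q v v"
  using assms sym[of v u]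
  by (simp add: add_left add_right scale_left scale_right V_add V_scale power2_eq_square algebra_simps)

lemma quad_diff:
  assumes "u \<in> V" "v \<in> V"
  shows "Q (u - v) (u - v) = Q u u - 2 * Q u v + Q v v"
  using quad_add_scale[OF assms, of "-1"] by simp

lemma Cauchy_Schwarz:
  assumes "u \<in> V" "v \<in> V"
  shows "(Q u v)\<^sup>2 \<le> Q u u * Q v v"
proof (rule discriminant_nonpos)
  fix s show "0 \<le> Q u u + 2 * s * Q u v + s\<^sup>2 * Q v v"
    using quad_add_scale[OF assms, of s] nonneg[of "u + s *\<^sub>R v"] assms by auto
qed (use assms nonneg in auto)

lemma Cauchy_Schwarz_abs:
  assumes "u \<in> V" "v \<in> V"
  shows "\<bar>Q u v\<bar> \<le> sqrt (Q u u) * sqrt (Q v v)"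
  using Cauchy_Schwarz[OF assms] by (metis real_sqrt_abs real_sqrt_le_mono real_sqrt_mult)

lemma tendsto_left:
  assumes "\<And>k. X k \<in> V" "p \<in> V" "w \<in> V" and "(\<lambda>k. Q (X k - p) (X k - p)) \<longlonglongrightarrow> 0"
  shows "(\<lambda>k. Q (X k) w) \<longlonglongrightarrow> Q p w"
proof -
  have "(\<lambda>k. sqrt (Q (X k - p) (X k - p)) * sqrt (Q w w)) \<longlonglongrightarrow> sqrt 0 * sqrt (Q w w)"
    by (intro tendsto_intros assms)
  then have "(\<lambda>k. sqrt (Q (X k - p) (X k - p)) * sqrt (Q w w)) \<longlonglongrightarrow> 0" by simp
  then have "(\<lambda>k. Q (X k - p) w) \<longlonglongrightarrow> 0"
    by (rule Lim_null_comparison[rotated]) (use assms in \<open>auto intro!: always_eventually Cauchy_Schwarz_abs\<close>)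
  then show ?thesis
    using assms by (simp add: diff_left LIM_zero_iff)
qed

text \<open>Riesz representation and orthogonal projection in one: minimize the quadratic functional
  \<open>\<Phi>\<close> over \<open>W\<close> and use completeness of \<open>V\<close>. With
  \<open>W = V\<close> this represents a bounded functional; with \<open>l = Q u\<close> it projects
  \<open>u\<close> to the closure of \<open>W\<close>. The limit \<open>p\<close> need not lie in
  \<open>W\<close>, so the approximating sequence is part of the result.\<close>

lemma projection:
  assumes complete: "\<And>X. \<lbrakk>\<forall>k::nat. X k \<in> V;
        \<forall>e>0. \<exists>N. \<forall>j\<ge>N. \<forall>k\<ge>N. Q (X j - X k) (X j - X k) < e\<rbrakk>
        \<Longrightarrow> \<exists>u\<in>V. (\<lambda>k. Q (X k - u) (X k - u)) \<longlonglongrightarrow> 0"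
    and W: "subspace W" "W \<subseteq> V"
    and l_add: "\<And>u v. \<lbrakk>u \<in> W; v \<in> W\<rbrakk> \<Longrightarrow> l (u + v) = l u + l v"
    and l_scale: "\<And>r u. u \<in> W \<Longrightarrow> l (r *\<^sub>R u) = r * l u"
    and l_bound: "\<And>w. w \<in> W \<Longrightarrow> (l w)\<^sup>2 \<le> M * Q w w" and M: "0 \<le> M"
  obtains p X where "p \<in> V" "\<And>k::nat. X k \<in> W" "(\<lambda>k. Q (X k - p) (X k - p)) \<longlonglongrightarrow> 0"
    "\<And>w. w \<in> W \<Longrightarrow> Q p w = l w"
proof -
  define \<Phi> where "\<Phi> w = Q w w - 2 * l w" for w
  define i where "i = (INF w\<in>W. \<Phi> w)"
  have WV: "w \<in> V" if "w \<in> W" for w using that W by auto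
  have W0: "0 \<in> W" using W(1) by (rule subspace_0)
  \<comment> \<open>By the inequality of the means,
    \<open>\<bar>l w\<bar> \<le> (M + Q w w) / 2\<close>.\<close>
  have \<Phi>_bound: "- M \<le> \<Phi> w" if "w \<in> W" for w
  proof -
    have "0 \<le> Q w w" by (intro nonneg WV that)
    have "(l w)\<^sup>2 \<le> ((M + Q w w) / 2)\<^sup>2"
      using l_bound[OF that] zero_le_power2[of "M - Q w w"]
      by (simp add: power_divide power2_eq_square algebra_simps)
    then have "\<bar>l w\<bar> \<le> \<bar>(M + Q w w) / 2\<bar>" by (simp only: abs_le_square_iff)
    then show ?thesis using \<open>0 \<le> Q w w\<close> M by (simp add: \<Phi>_def)
  qed
  have bdd: "bdd_below (\<Phi> ` W)" using \<Phi>_bound by (intro bdd_belowI[of _ "-M"]) auto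
  have i_le: "i \<le> \<Phi> w" if "w \<in> W" for w
    unfolding i_def using bdd that by (rule cINF_lower)
  have "\<exists>w\<in>W. \<Phi> w < i + 1 / real (Suc k)" for k
    using W0 bdd by (subst cINF_less_iff[symmetric]) (auto simp: i_def[symmetric])
  then obtain X where X: "\<And>k. X k \<in> W" "\<And>k. \<Phi> (X k) < i + 1 / real (Suc k)" by metis
  \<comment> \<open>The parallelogram law at the midpoint \<open>m\<close>, where
    \<open>\<Phi>\<close> is at least the infimum \<open>i\<close>. It makes every minimizing
    sequence Cauchy.\<close>
  have par: "Q (a - b) (a - b) \<le> 2 * (\<Phi> a - i) + 2 * (\<Phi> b - i)" if ab: "a \<in> W" "b \<in> W" for a b
  proof -
    define m where "m = (1/2) *\<^sub>R (a + b)"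
    have ab_W: "a + b \<in> W" using ab W(1) by (simp add: subspace_add)
    then have "m \<in> W" using W(1) by (simp add: m_def subspace_scale)
    have "Q m m = (Q a a + 2 * Q a b + Q b b) / 4"
      using ab ab_W sym[of b a] quad_add_scale[of a b 1]
      by (simp add: m_def scale_left scale_right WV V_scale)
    moreover have "l m = (l a + l b) / 2"
      using ab ab_W by (simp add: m_def l_scale l_add)
    ultimately have "Q (a - b) (a - b) = 2 * \<Phi> a + 2 * \<Phi> b - 4 * \<Phi> m"
      using ab by (simp add: quad_diff WV \<Phi>_def)
    then show ?thesis using i_le[OF \<open>m \<in> W\<close>] by simp
  qed
  have "\<exists>u\<in>V. (\<lambda>k. Q (X k - u) (X k - u)) \<longlonglongrightarrow> 0"
  proof (rule complete; safe)
    fix e :: real assume "0 < e"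
    then obtain N where N: "4 / e < real (Suc N)"
      using reals_Archimedean2[of "4 / e"] by (metis less_trans lessI of_nat_less_iff)
    show "\<exists>N. \<forall>j\<ge>N. \<forall>k\<ge>N. Q (X j - X k) (X j - X k) < e"
    proof (intro exI[of _ N] allI impI)
      fix j k assume jk: "j \<ge> N" "k \<ge> N"
      have *: "\<Phi> (X n) - i < e / 4" if "n \<ge> N" for n
      proof -
        have "\<Phi> (X n) - i < 1 / real (Suc n)" using X(2)[of n] by simp
        also have "\<dots> \<le> 1 / real (Suc N)" using that by (simp add: field_simps)
        also have "\<dots> < e / 4" using N \<open>0 < e\<close> by (simp add: field_simps)
        finally show ?thesis .
      qed
      show "Q (X j - X k) (X j - X k) < e"
        using par[OF X(1)[of j] X(1)[of k]] *[OF jk(1)] *[OF jk(2)] by simp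
    qed
  qed (use X WV in auto)
  then obtain p where p: "p \<in> V" "(\<lambda>k. Q (X k - p) (X k - p)) \<longlonglongrightarrow> 0" by auto
  have "Q p w = l w" if w: "w \<in> W" for w
  proof -
    \<comment> \<open>First variation: \<open>\<Phi> (X k + s *\<^sub>R w)\<close> cannot fall below
      \<open>i\<close>. In the limit this is a quadratic in \<open>s\<close> without constant term,
      so its linear coefficient vanishes.\<close>
    have "0 \<le> 0 + 2 * s * (Q p w - l w) + s\<^sup>2 * Q w w" for s
    proof (rule tendsto_lowerbound)
      show "(\<lambda>k. 1 / real (Suc k) + 2 * s * (Q (X k) w - l w) + s\<^sup>2 * Q w w)
             \<longlonglongrightarrow> 0 + 2 * s * (Q p w - l w) + s\<^sup>2 * Q w w"
        by (intro tendsto_intros tendsto_left LIMSEQ_Suc[OF lim_1_over_n] p WV X w)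
      have "0 \<le> 1 / real (Suc k) + 2 * s * (Q (X k) w - l w) + s\<^sup>2 * Q w w" for k
      proof -
        have "X k + s *\<^sub>R w \<in> W" using X(1) w W(1) by (simp add: subspace_add subspace_scale)
        then have "i \<le> \<Phi> (X k + s *\<^sub>R w)" by (rule i_le)
        also have "\<dots> = \<Phi> (X k) + 2 * s * (Q (X k) w - l w) + s\<^sup>2 * Q w w"
          using X(1)[of k] w W(1)
          by (simp add: \<Phi>_def quad_add_scale WV l_add l_scale subspace_scale algebra_simps)
        finally show ?thesis using X(2)[of k] by simp
      qed
      then show "\<forall>\<^sub>F k in sequentially. 0 \<le> 1 / real (Suc k) + 2 * s * (Q (X k) w - l w) + s\<^sup>2 * Q w w"
        by simp
    qed simp
    from discriminant_nonpos[OF this] nonneg[OF WV[OF w]] show ?thesis by simp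
  qed
  with p X(1) show thesis using that by blast
qed

end

section \<open>Linear contractions\<close>

definition contr :: "('a::real_normed_vector \<Rightarrow> 'a) \<Rightarrow> bool" where
  "contr P \<longleftrightarrow> linear P \<and> (\<forall>u. norm (P u) \<le> norm u)"

lemma contr_linear: "contr P \<Longrightarrow> linear P"
  and contr_norm: "contr P \<Longrightarrow> norm (P u) \<le> norm u"
  by (simp_all add: contr_def)

lemma contr_diff: "contr P \<Longrightarrow> P (u - v) = P u - P v"
  by (simp add: contr_def linear_diff)

lemma contr_dist: "contr P \<Longrightarrow> norm (P u - P v) \<le> norm (u - v)"
  by (metis contr_diff contr_norm)

lemma contr_id: "contr id" "contr (\<lambda>x. x)"
  by (auto simp: contr_def intro!: linearI)

lemma contr_comp: "contr P \<Longrightarrow> contr R \<Longrightarrow> contr (\<lambda>x. P (R x))"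
  by (auto simp: contr_def intro: order_trans linear_compose[unfolded o_def])

lemma contr_funpow: "contr P \<Longrightarrow> contr (P ^^ n)"
  by (induction n) (auto simp: contr_id o_def intro: contr_comp)

text \<open>Telescoping. Commutation moves each difference \<open>P - R\<close> next to
  \<open>f\<close>, and the remaining factors are contractions, so each of the \<open>n\<close>
  terms costs the same.\<close>

lemma contr_funpow_diff:
  assumes P: "contr P" and R: "contr R" and comm: "\<And>x. P (R x) = R (P x)"
  shows "norm ((P ^^ n) f - (R ^^ n) f) \<le> real n * norm (P f - R f)"
proof (induction n arbitrary: f)
  case (Suc n)
  have Pn: "contr (P ^^ n)" by (rule contr_funpow[OF P])
  have "(P ^^ Suc n) f - (R ^^ Suc n) f = (P ^^ n) (P f - R f) + ((P ^^ n) (R f) - (R ^^ n) (R f))"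
    by (simp add: funpow_Suc_right contr_diff[OF Pn] del: funpow.simps)
  also have "norm \<dots> \<le> norm (P f - R f) + real n * norm (P (R f) - R (R f))"
    by (intro norm_triangle_mono contr_norm[OF Pn] Suc)
  also have "\<dots> \<le> norm (P f - R f) + real n * norm (P f - R f)"
    unfolding comm by (intro add_left_mono mult_left_mono contr_dist[OF R]) simp
  finally show ?case by (simp add: algebra_simps)
qed simp

lemma contr_convergent_dense:
  fixes T :: "nat \<Rightarrow> 'a::{real_inner,complete_space} \<Rightarrow> 'a"
  assumes T: "\<And>k. contr (T k)" and D: "closure D = UNIV"
    and conv: "\<And>g. g \<in> D \<Longrightarrow> convergent (\<lambda>k. T k g)"
  shows "convergent (\<lambda>k. T k f)"
proof -
  have "Cauchy (\<lambda>k. T k f)"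
  proof (rule metric_CauchyI)
    fix e :: real assume e: "0 < e"
    obtain g where g: "g \<in> D" "dist g f < e / 3"
      using D e by (metis UNIV_I closure_approachable divide_pos_pos zero_less_numeral)
    obtain N where N: "\<And>j k. j \<ge> N \<Longrightarrow> k \<ge> N \<Longrightarrow> dist (T j g) (T k g) < e / 3"
      using convergent_Cauchy[OF conv[OF g(1)]] e by (metis metric_CauchyD divide_pos_pos zero_less_numeral)
    have c: "dist (T k f) (T k g) < e / 3" for k
      using contr_dist[OF T, of k f g] g(2) by (simp add: dist_norm norm_minus_commute)
    have "dist (T j f) (T k f) < e" if "j \<ge> N" "k \<ge> N" for j k
      using dist_triangle[of "T j f" "T k f" "T j g"] dist_triangle[of "T j g" "T k f" "T k g"]
        c[of j] c[of k] N[OF that] by (simp add: dist_commute)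
    then show "\<exists>M. \<forall>m\<ge>M. \<forall>n\<ge>M. dist (T m f) (T n f) < e" by blast
  qed
  then show ?thesis by (rule Cauchy_convergent)
qed

lemma contr_eq_dense:
  assumes "contr P" "contr R" "closure D = UNIV" "\<And>g. g \<in> D \<Longrightarrow> P g = R g"
  shows "P f = R f"
proof -
  have "norm (P f - R f) \<le> e" if "0 < e" for e
  proof -
    obtain g where g: "g \<in> D" "dist g f < e / 2"
      using assms(3) \<open>0 < e\<close> by (metis UNIV_I closure_approachable divide_pos_pos zero_less_numeral)
    have "norm (P f - R f) \<le> norm (P f - P g) + norm (R g - R f)"
      using norm_triangle_ineq[of "P f - P g" "R g - R f"] assms(4)[OF g(1)] by simp
    also have "\<dots> \<le> norm (f - g) + norm (g - f)"
      by (intro add_mono contr_dist assms)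
    finally show ?thesis using g(2) by (simp add: dist_norm norm_minus_commute)
  qed
  then have "norm (P f - R f) \<le> 0" by (rule field_le_epsilon[of _ 0, simplified])
  then show ?thesis by simp
qed

section \<open>The resolvent of a closed form\<close>

locale dense_form =
  fixes E :: "'a::{real_inner,complete_space} \<Rightarrow> 'a \<Rightarrow> real" and F :: "'a set"
  assumes closed: "closed_form E F" and dense: "closure F = UNIV"
begin

sublocale form: semi_inner F E
proof
  show "subspace F" using closed by (simp add: closed_form_def)
  show "\<And>u v. u \<in> F \<Longrightarrow> v \<in> F \<Longrightarrow> E u v = E v u"
    and "\<And>u v w. u \<in> F \<Longrightarrow> v \<in> F \<Longrightarrow> w \<in> F \<Longrightarrow> E (u + v) w = E u w + E v w"
    and "\<And>u v r. u \<in> F \<Longrightarrow> v \<in> F \<Longrightarrow> E (r *\<^sub>R u) v = r * E u v"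
    and "\<And>u. u \<in> F \<Longrightarrow> 0 \<le> E u u"
    using closed by (auto simp: closed_form_def)
qed

lemma semi_inner_shift:
  assumes "0 \<le> h"
  shows "semi_inner F (\<lambda>u v. inner u v + h * E u v)"
proof
  fix u v w and r :: real assume "u \<in> F" "v \<in> F" "w \<in> F"
  show "inner u v + h * E u v = inner v u + h * E v u"
    using form.sym[of u v] \<open>u \<in> F\<close> \<open>v \<in> F\<close> by (simp add: inner_commute)
  show "inner (u + v) w + h * E (u + v) w = inner u w + h * E u w + (inner v w + h * E v w)"
    using form.add_left[of u v w] \<open>u \<in> F\<close> \<open>v \<in> F\<close> \<open>w \<in> F\<close> by (simp add: inner_add_left algebra_simps)
  show "inner (r *\<^sub>R u) v + h * E (r *\<^sub>R u) v = r * (inner u v + h * E u v)"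
    using form.scale_left[of u v r] \<open>u \<in> F\<close> \<open>v \<in> F\<close> by (simp add: algebra_simps)
  show "0 \<le> inner u u + h * E u u"
    using form.nonneg[of u] \<open>u \<in> F\<close> assms by auto
qed (rule form.subspace)

text \<open>Closedness speaks of E + (.,.), the resolvent equation of (.,.) + h E. The two norms are
  equivalent, with the constants \<open>b\<close> and \<open>b'\<close>.\<close>

lemma complete_shift:
  assumes h: "0 < h" and X: "\<forall>k::nat. X k \<in> F"
    and C: "\<forall>e>0. \<exists>N. \<forall>j\<ge>N. \<forall>k\<ge>N. inner (X j - X k) (X j - X k) + h * E (X j - X k) (X j - X k) < e"
  shows "\<exists>u\<in>F. (\<lambda>k. inner (X k - u) (X k - u) + h * E (X k - u) (X k - u)) \<longlonglongrightarrow> 0"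
proof -
  define Q where "Q u = E u u + inner u u" for u
  define b where "b = max 1 (1 / h)"
  define b' where "b' = max 1 h"
  have b: "b > 0" "b' > 0" by (auto simp: b_def b'_def)
  have Q1: "Q u \<le> b * (inner u u + h * E u u)" if "u \<in> F" for u
  proof -
    have "1 * E u u \<le> (b * h) * E u u"
      using h form.nonneg[OF that] by (intro mult_right_mono) (auto simp: b_def max_def field_simps)
    moreover have "1 * inner u u \<le> b * inner u u" by (intro mult_right_mono) (auto simp: b_def)
    ultimately show ?thesis by (simp add: Q_def algebra_simps)
  qed
  have Q2: "inner u u + h * E u u \<le> b' * Q u" if "u \<in> F" for u
  proof -
    have "h * E u u \<le> b' * E u u"
      using form.nonneg[OF that] by (intro mult_right_mono) (auto simp: b'_def)
    moreover have "1 * inner u u \<le> b' * inner u u" by (intro mult_right_mono) (auto simp: b'_def)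
    ultimately show ?thesis by (simp add: Q_def algebra_simps)
  qed
  have "\<forall>e>0. \<exists>N. \<forall>j\<ge>N. \<forall>k\<ge>N. E (X j - X k) (X j - X k) + inner (X j - X k) (X j - X k) < e"
  proof (intro allI impI)
    fix e :: real assume "e > 0"
    then have "e / b > 0" using b by simp
    with C obtain N where N: "\<forall>j\<ge>N. \<forall>k\<ge>N.
      inner (X j - X k) (X j - X k) + h * E (X j - X k) (X j - X k) < e / b" by blast
    have "Q (X j - X k) < e" if "j \<ge> N" "k \<ge> N" for j k
    proof -
      have "b * (inner (X j - X k) (X j - X k) + h * E (X j - X k) (X j - X k)) < e"
        using N that b by (simp add: field_simps)
      then show ?thesis using Q1[of "X j - X k"] X by (meson form.V_diff order.strict_trans1)
    qed
    then show "\<exists>N. \<forall>j\<ge>N. \<forall>k\<ge>N. E (X j - X k) (X j - X k) + inner (X j - X k) (X j - X k) < e"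
      unfolding Q_def by blast
  qed
  then obtain u where u: "u \<in> F" "(\<lambda>k. Q (X k - u)) \<longlonglongrightarrow> 0"
    using closed X unfolding closed_form_def Q_def by blast
  have "(\<lambda>k. b' * Q (X k - u)) \<longlonglongrightarrow> 0"
    using tendsto_mult_left[OF u(2), of b'] by simp
  then have "(\<lambda>k. inner (X k - u) (X k - u) + h * E (X k - u) (X k - u)) \<longlonglongrightarrow> 0"
  proof (rule Lim_null_comparison[rotated], intro always_eventually allI)
    fix k
    have "X k - u \<in> F" using X u(1) by auto
    then show "norm (inner (X k - u) (X k - u) + h * E (X k - u) (X k - u)) \<le> b' * Q (X k - u)"
      using Q2 form.nonneg h by auto
  qed
  then show ?thesis using u(1) by blast
qed

text \<open>This is (1 + h A)^(-1) for the nonnegative operator A of the form, that is, one implicit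
  Euler step of length \<open>h\<close> for u' = - A u. In this normalization it is a contraction;
  (a + A)^(-1) appears later as \<open>Res\<close>.\<close>

definition resolv :: "real \<Rightarrow> 'a \<Rightarrow> 'a" where
  "resolv h f = (SOME u. u \<in> F \<and> (\<forall>v\<in>F. inner u v + h * E u v = inner f v))"

text \<open>Riesz representation of \<open>inner f\<close> in the Hilbert space \<open>F\<close>
  with inner product (.,.) + h E.\<close>

lemma resolv:
  assumes h: "0 < h"
  shows resolv_in: "resolv h f \<in> F"
    and resolv_eq: "v \<in> F \<Longrightarrow> inner (resolv h f) v + h * E (resolv h f) v = inner f v"
proof -
  interpret Q: semi_inner F "\<lambda>u v. inner u v + h * E u v"
    by (rule semi_inner_shift) (use h in simp)
  obtain p where "p \<in> F" "\<And>w. w \<in> F \<Longrightarrow> inner p w + h * E p w = inner f w"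
  proof (rule Q.projection[where W = F and l = "inner f" and M = "(norm f)\<^sup>2"])
    fix w assume w: "w \<in> F"
    have "(inner f w)\<^sup>2 \<le> (norm f)\<^sup>2 * inner w w"
      using Cauchy_Schwarz_ineq[of f w] by (simp add: power2_norm_eq_inner)
    also have "\<dots> \<le> (norm f)\<^sup>2 * (inner w w + h * E w w)"
      using h form.nonneg[OF w] by (intro mult_left_mono) auto
    finally show "(inner f w)\<^sup>2 \<le> (norm f)\<^sup>2 * (inner w w + h * E w w)" .
  qed (use complete_shift[OF h] form.subspace in \<open>auto simp: inner_add_right\<close>)
  then have "\<exists>u. u \<in> F \<and> (\<forall>v\<in>F. inner u v + h * E u v = inner f v)" by blast
  from someI_ex[OF this] show "resolv h f \<in> F"
    "v \<in> F \<Longrightarrow> inner (resolv h f) v + h * E (resolv h f) v = inner f v"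
    by (auto simp: resolv_def)
qed

lemma resolv_unique:
  assumes h: "0 < h" and u: "u \<in> F" "\<And>v. v \<in> F \<Longrightarrow> inner u v + h * E u v = inner f v"
  shows "resolv h f = u"
proof -
  define d where "d = resolv h f - u"
  have d: "d \<in> F" using resolv_in[OF h] u(1) by (auto simp: d_def)
  have "inner d d + h * E d d = 0"
    using resolv_eq[OF h d, of f] u(2)[OF d] resolv_in[OF h, of f] u(1) d
    unfolding d_def by (simp add: inner_diff_left form.diff_left algebra_simps)
  then have "inner d d = 0"
    using form.nonneg[OF d] h by (metis add_nonneg_eq_0_iff inner_ge_zero less_imp_le mult_nonneg_nonneg)
  then show ?thesis by (simp add: d_def)
qed

text \<open>The graph of A, as a relation because A is defined on a part of \<open>F\<close> only.
  The generator of the semigroup will be - A.\<close>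

definition op :: "'a \<Rightarrow> 'a \<Rightarrow> bool" where
  "op u w \<longleftrightarrow> u \<in> F \<and> (\<forall>v\<in>F. E u v = inner w v)"

lemma op_add: "op u w \<Longrightarrow> op u' w' \<Longrightarrow> op (u + u') (w + w')"
  by (auto simp: op_def inner_add_left form.add_left)

lemma op_scale: "op u w \<Longrightarrow> op (r *\<^sub>R u) (r *\<^sub>R w)"
  by (auto simp: op_def form.scale_left)

lemma op_diff: "op u w \<Longrightarrow> op u' w' \<Longrightarrow> op (u - u') (w - w')"
  using op_add[of u w "(-1) *\<^sub>R u'" "(-1) *\<^sub>R w'"] op_scale[of u' w' "-1"] by simp

text \<open>Together with \<open>resolv_op\<close> this says that \<open>resolv h\<close> inverts 1
  + h A. Linearity and the commutation rules below are derived from these two facts by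
  algebra.\<close>

lemma op_resolv: "0 < h \<Longrightarrow> op (resolv h f) ((f - resolv h f) /\<^sub>R h)"
  using resolv_in resolv_eq[of h _ f] by (auto simp: op_def inner_diff_left field_simps)

lemma resolv_op: "0 < h \<Longrightarrow> op u w \<Longrightarrow> resolv h (u + h *\<^sub>R w) = u"
  by (intro resolv_unique) (auto simp: op_def inner_add_left)

lemma resolv_linear:
  assumes h: "0 < h"
  shows "linear (resolv h)"
proof
  show "resolv h (f + g) = resolv h f + resolv h g" for f g
    using resolv_op[OF h op_add[OF op_resolv[OF h, of f] op_resolv[OF h, of g]]] h
    by (simp add: scaleR_right_distrib algebra_simps)
  show "resolv h (r *\<^sub>R f) = r *\<^sub>R resolv h f" for r f
  proof -
    have "r *\<^sub>R resolv h f + h *\<^sub>R (r *\<^sub>R ((f - resolv h f) /\<^sub>R h)) = r *\<^sub>R f"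
      using h by (simp add: mult.left_commute[of h r] scaleR_diff_right)
    then show ?thesis
      using resolv_op[OF h op_scale[OF op_resolv[OF h, of f], of r]] by simp
  qed
qed

text \<open>Testing the resolvent equation with the solution u itself gives (u, u) \<le> (f, u), as
  E(u, u) is nonnegative.\<close>

lemma resolv_contr: "0 < h \<Longrightarrow> contr (resolv h)"
proof (unfold contr_def, intro conjI allI resolv_linear, assumption)
  fix f assume h: "0 < h"
  let ?u = "resolv h f"
  have "(norm ?u)\<^sup>2 \<le> inner f ?u"
    using resolv_eq[OF h resolv_in[OF h], of f f] form.nonneg[OF resolv_in[OF h], of f] h
    by (simp add: power2_norm_eq_inner) (smt (verit) mult_nonneg_nonneg)
  also have "\<dots> \<le> norm f * norm ?u" by (rule norm_cauchy_schwarz)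
  finally show "norm ?u \<le> norm f"
    by (cases "norm ?u = 0") (auto simp: power2_eq_square)
qed

lemma resolv_sym:
  assumes h: "0 < h"
  shows "inner (resolv h f) g = inner f (resolv h g)"
  using resolv_eq[OF h resolv_in[OF h], of f g] resolv_eq[OF h resolv_in[OF h], of g f]
    form.sym[OF resolv_in[OF h, of f] resolv_in[OF h, of g]] inner_commute
  by metis

lemma op_resolv_commute:
  assumes h: "0 < h" and "op u w"
  shows "op (resolv h u) (resolv h w)"
proof -
  have "resolv h u = u - h *\<^sub>R resolv h w"
    using resolv_op[OF assms] resolv_linear[OF h] by (simp add: linear_add linear_scale algebra_simps)
  then have "(u - resolv h u) /\<^sub>R h = resolv h w" using h by simp
  then show ?thesis using op_resolv[OF h, of u] by simp
qed

lemma resolv_commute: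
  assumes h: "0 < h" and k: "0 < k"
  shows "resolv h (resolv k f) = resolv k (resolv h f)"
  using resolv_op[OF k op_resolv_commute[OF h op_resolv[OF k, of f]]] resolv_linear[OF h] k
  by (simp add: linear_diff linear_scale algebra_simps)

lemma resolv_diff_op:
  assumes h: "0 < h" and "op f w"
  shows "f - resolv h f = h *\<^sub>R resolv h w"
  using resolv_op[OF assms] resolv_linear[OF h] by (simp add: linear_add linear_scale algebra_simps)

lemma norm_resolv_diff_op:
  assumes h: "0 < h" and "op f w"
  shows "norm (resolv h f - f) \<le> h * norm w"
  using resolv_diff_op[OF assms] contr_norm[OF resolv_contr[OF h], of w] h
  by (simp add: norm_minus_commute)

lemma resolv_tendsto:
  assumes h: "h \<longlonglongrightarrow> 0" "\<And>n. 0 < h n"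
  shows "(\<lambda>n. resolv (h n) f) \<longlonglongrightarrow> f"
proof (rule LIMSEQ_I)
  fix e :: real assume e: "0 < e"
  obtain g where g: "g \<in> F" "dist g f < e / 3"
    using dense e by (metis UNIV_I closure_approachable divide_pos_pos zero_less_numeral)
  \<comment> \<open>Testing with u - g for u = \<open>resolv k g\<close> gives |u - g|^2 = k (E(u,
    g) - E(u, u)), and the bracket is at most E(g, g) because E(u - g, u - g) is nonnegative. The
    rest is approximation of \<open>f\<close> from the dense domain.\<close>
  have *: "(norm (resolv k g - g))\<^sup>2 \<le> k * E g g" if k: "0 < k" for k
  proof -
    let ?u = "resolv k g"
    have u: "?u \<in> F" by (rule resolv_in[OF k])
    have "inner (?u - g) (?u - g) + k * E ?u (?u - g) = 0"
      using resolv_eq[OF k form.V_diff[OF u g(1)], of g] by (simp add: inner_diff_left)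
    then have "(norm (?u - g))\<^sup>2 = k * (E ?u g - E ?u ?u)"
      using u g(1) by (simp add: power2_norm_eq_inner form.diff_right algebra_simps)
    also have "E ?u g - E ?u ?u \<le> E g g"
      using form.nonneg[OF form.V_diff[OF u g(1)]] form.quad_diff[OF u g(1)] form.nonneg[OF u] form.nonneg[OF g(1)]
      by simp
    finally show ?thesis using k by simp
  qed
  have "(\<lambda>n. h n * E g g) \<longlonglongrightarrow> 0" using tendsto_mult_right[OF h(1), of "E g g"] by simp
  then have "eventually (\<lambda>n. h n * E g g < (e / 3)\<^sup>2) sequentially"
    by (rule order_tendstoD) (use e in simp)
  then obtain N where N: "\<And>n. n \<ge> N \<Longrightarrow> h n * E g g < (e / 3)\<^sup>2"
    by (auto simp: eventually_sequentially)
  have "norm (resolv (h n) f - f) < e" if "n \<ge> N" for n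
  proof -
    have "(norm (resolv (h n) g - g))\<^sup>2 < (e / 3)\<^sup>2"
      using *[OF h(2)] N[OF that] by (rule le_less_trans)
    then have 1: "norm (resolv (h n) g - g) < e / 3"
      by (rule power2_less_imp_less) (use e in simp)
    have 2: "norm (resolv (h n) f - resolv (h n) g) < e / 3"
      using contr_dist[OF resolv_contr[OF h(2)], of n f g] g(2) by (simp add: dist_norm norm_minus_commute)
    have "norm (resolv (h n) f - f) \<le>
        norm (resolv (h n) f - resolv (h n) g) + norm (resolv (h n) g - g) + norm (g - f)"
      using norm_triangle_ineq[of "resolv (h n) f - resolv (h n) g" "resolv (h n) g - g"]
        norm_triangle_ineq[of "resolv (h n) f - g" "g - f"] by simp
    then show ?thesis using 1 2 g(2) by (simp add: dist_norm)
  qed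
  then show "\<exists>N. \<forall>n\<ge>N. norm (resolv (h n) f - f) < e" by blast
qed

section \<open>The semigroup of a closed form\<close>

text \<open>The domain of A^2, on which the Euler scheme has an error quadratic in the step. It is
  dense because two resolvents applied to any vector land in it.\<close>

definition smooth :: "'a set" where
  "smooth = {f. \<exists>g w. op f g \<and> op g w}"

lemma smooth_dense: "closure smooth = UNIV"
proof -
  have "f \<in> closure smooth" for f
  proof -
    define h where "h n = 1 / real (Suc n)" for n
    have h: "h \<longlonglongrightarrow> 0" "\<And>n. 0 < h n"
      unfolding h_def by (intro LIMSEQ_Suc[OF lim_1_over_n]) auto
    have "resolv (h n) (resolv (h n) f) \<in> smooth" for n
    proof -
      let ?k = "h n"
      have "op (resolv ?k (resolv ?k f)) (resolv ?k ((f - resolv ?k f) /\<^sub>R ?k))"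
        by (intro op_resolv_commute op_resolv h)
      moreover have "\<exists>w. op (resolv ?k ((f - resolv ?k f) /\<^sub>R ?k)) w"
        using op_resolv[OF h(2)] by blast
      ultimately show ?thesis by (auto simp: smooth_def)
    qed
    moreover have "(\<lambda>n. resolv (h n) (resolv (h n) f)) \<longlonglongrightarrow> f"
    proof -
      have "(\<lambda>n. norm (resolv (h n) f - f)) \<longlonglongrightarrow> 0"
        using resolv_tendsto[OF h] by (simp add: tendsto_norm_zero LIM_zero)
      then have "(\<lambda>n. resolv (h n) (resolv (h n) f) - resolv (h n) f) \<longlonglongrightarrow> 0"
        by (rule Lim_null_comparison[rotated]) (intro always_eventually allI contr_dist resolv_contr h)
      from tendsto_add[OF this resolv_tendsto[OF h, of f]] show ?thesis by simp
    qed
    ultimately show ?thesis unfolding closure_sequential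
      by (intro exI[of _ "\<lambda>n. resolv (h n) (resolv (h n) f)"]) simp
  qed
  then show ?thesis by auto
qed

text \<open>Here \<open>w\<close> is A^2 f. Since (1 + s A)(1 + t A) = 1 + (s + t) A + s t A^2, the
  difference of the inverses is - s t A^2 f under a product of three contractions.\<close>

lemma resolv_two_step:
  assumes s: "0 < s" and t: "0 < t" and f: "op f g" "op g w"
  shows "norm (resolv s (resolv t f) - resolv (s + t) f) \<le> s * t * norm w"
proof -
  have st: "0 < s + t" using s t by simp
  define P where "P x = resolv t (resolv s x)" for x
  define R where "R = resolv (s + t)"
  have P: "linear P" unfolding P_def
    using linear_compose[OF resolv_linear[OF s] resolv_linear[OF t]] by (simp add: o_def)
  have R: "linear R" unfolding R_def by (rule resolv_linear[OF st])
  have PR: "P (R x) = R (P x)" for x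
    unfolding P_def R_def using resolv_commute s t st by simp
  have 1: "R (f + (s + t) *\<^sub>R g) = f" unfolding R_def by (rule resolv_op[OF st f(1)])
  have "op (f + t *\<^sub>R g) (g + t *\<^sub>R w)" by (intro op_add op_scale f)
  from resolv_op[OF s this] have "resolv s (f + (s + t) *\<^sub>R g + (s * t) *\<^sub>R w) = f + t *\<^sub>R g"
    by (simp add: algebra_simps)
  then have 2: "P (f + (s + t) *\<^sub>R g + (s * t) *\<^sub>R w) = f"
    unfolding P_def using resolv_op[OF t f(1)] by simp
  have "R f = R (P (f + (s + t) *\<^sub>R g)) + (s * t) *\<^sub>R R (P w)"
    unfolding linear_scale[OF R, symmetric] linear_add[OF R, symmetric] linear_scale[OF P, symmetric]
      linear_add[OF P, symmetric] 2 ..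
  also have "R (P (f + (s + t) *\<^sub>R g)) = P f" using PR 1 by metis
  finally have "P f - R f = - ((s * t) *\<^sub>R R (P w))" by simp
  moreover have "norm (R (P w)) \<le> norm w"
    unfolding R_def P_def
    using contr_norm[OF resolv_contr[OF st]] contr_norm[OF resolv_contr[OF t]] contr_norm[OF resolv_contr[OF s]]
    by (meson order_trans)
  ultimately have "norm (P f - R f) \<le> s * t * norm w"
    using s t by (simp add: mult_left_mono)
  then show ?thesis by (simp add: P_def R_def resolv_commute[OF s t])
qed

text \<open>The number of steps is a power of 2, so that passing from \<open>k\<close> to
  \<open>Suc k\<close> halves every step and \<open>resolv_two_step\<close> compares the two schemes
  step by step.\<close>

definition approx :: "nat \<Rightarrow> real \<Rightarrow> 'a \<Rightarrow> 'a" where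
  "approx k t = resolv (t / 2 ^ k) ^^ (2 ^ k)"

definition sg :: "real \<Rightarrow> 'a \<Rightarrow> 'a" where
  "sg t f = lim (\<lambda>k. approx k t f)"

lemma approx_contr: "0 < t \<Longrightarrow> contr (approx k t)"
  unfolding approx_def by (intro contr_funpow resolv_contr) simp

text \<open>Each of the 2^k double steps of half-length \<open>h = t / 2 ^ Suc k\<close> has error
  \<open>h * h * norm w\<close>; commuting contractions make these errors add up.\<close>

lemma approx_step:
  assumes t: "0 < t" and f: "op f g" "op g w"
  shows "norm (approx (Suc k) t f - approx k t f) \<le> t\<^sup>2 * norm w * (1/2) ^ k"
proof -
  define h where "h = t / 2 ^ Suc k"
  have h: "0 < h" using t by (simp add: h_def)
  have "t / 2 ^ k = h + h" by (simp add: h_def field_simps)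
  then have e1: "approx k t = resolv (h + h) ^^ (2 ^ k)" by (simp add: approx_def)
  have e2: "approx (Suc k) t = (\<lambda>x. resolv h (resolv h x)) ^^ (2 ^ k)"
  proof -
    have "approx (Suc k) t = resolv h ^^ (2 * 2 ^ k)" by (simp add: approx_def h_def)
    also have "\<dots> = (resolv h ^^ 2) ^^ (2 ^ k)" by (simp add: funpow_mult mult.commute)
    also have "resolv h ^^ 2 = (\<lambda>x. resolv h (resolv h x))" by (auto simp: numeral_2_eq_2)
    finally show ?thesis .
  qed
  have n1: "norm (((\<lambda>x. resolv h (resolv h x)) ^^ (2 ^ k)) f - (resolv (h + h) ^^ (2 ^ k)) f)
      \<le> real (2 ^ k) * norm (resolv h (resolv h f) - resolv (h + h) f)"
    by (rule contr_funpow_diff[OF contr_comp[OF resolv_contr resolv_contr] resolv_contr])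
      (use h resolv_commute in auto)
  have n2: "real (2 ^ k) * norm (resolv h (resolv h f) - resolv (h + h) f) \<le> real (2 ^ k) * (h * h * norm w)"
    by (intro mult_left_mono resolv_two_step[OF h h f]) auto
  have n3: "real (2 ^ k) * (h * h * norm w) \<le> t\<^sup>2 * norm w * (1/2) ^ k"
  proof -
    define p :: real where "p = 2 ^ k"
    have "p > 0" "h = t / (2 * p)" "(1/2) ^ k = 1 / p" by (simp_all add: p_def h_def power_one_over)
    then have "p * (h * h * norm w) = t\<^sup>2 * norm w * (1/2) ^ k / 4"
      by (simp add: power2_eq_square)
    moreover have "real (2 ^ k) = p" by (simp add: p_def)
    moreover have "0 \<le> t\<^sup>2 * norm w * (1/2) ^ k" by simp
    ultimately show ?thesis by (simp only:)
  qed
  show ?thesis unfolding e1 e2 by (rule order_trans[OF n1 order_trans[OF n2 n3]])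
qed

lemma approx_tendsto:
  assumes t: "0 < t"
  shows "(\<lambda>k. approx k t f) \<longlonglongrightarrow> sg t f"
proof -
  have "convergent (\<lambda>k. approx k t f)"
  proof (rule contr_convergent_dense[OF approx_contr[OF t] smooth_dense])
    fix g assume "g \<in> smooth"
    then obtain u w where gw: "op g u" "op u w" by (auto simp: smooth_def)
    define S where "S k = t\<^sup>2 * norm w * (1/2) ^ k" for k
    have tail: "norm (approx (k + j) t g - approx k t g) \<le> 2 * S k" for k j
    proof -
      \<comment> \<open>The subtracted term makes the induction close: \<open>S\<close> halves at
        each index, so the new error \<open>S (k + j)\<close> is exactly the decrease of
        \<open>2 * S\<close>.\<close>
      have "norm (approx (k + j) t g - approx k t g) \<le> 2 * S k - 2 * S (k + j)"
      proof (induction j)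
        case (Suc j)
        have "norm (approx (k + Suc j) t g - approx k t g)
            \<le> norm (approx (Suc (k + j)) t g - approx (k + j) t g) + norm (approx (k + j) t g - approx k t g)"
          using norm_triangle_ineq[of "approx (Suc (k + j)) t g - approx (k + j) t g" "approx (k + j) t g - approx k t g"]
          by simp
        also have "\<dots> \<le> S (k + j) + (2 * S k - 2 * S (k + j))"
          by (intro add_mono Suc) (use approx_step[OF t gw, of "k + j"] in \<open>simp only: S_def\<close>)
        also have "\<dots> = 2 * S k - 2 * S (k + Suc j)" by (simp add: S_def algebra_simps)
        finally show ?case .
      qed simp
      also have "\<dots> \<le> 2 * S k" by (simp add: S_def)
      finally show ?thesis .
    qed
    have "(\<lambda>k. 2 * S k) \<longlonglongrightarrow> 2 * (t\<^sup>2 * norm w * 0)"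
      unfolding S_def by (intro tendsto_intros LIMSEQ_power_zero) auto
    then have S0: "(\<lambda>k. 2 * S k) \<longlonglongrightarrow> 0" by simp
    show "convergent (\<lambda>k. approx k t g)"
    proof (rule Cauchy_convergent, rule CauchyI')
      fix e :: real assume "0 < e"
      then have "eventually (\<lambda>k. 2 * S k < e) sequentially" by (rule order_tendstoD(2)[OF S0])
      then obtain N where N: "\<And>k. k \<ge> N \<Longrightarrow> 2 * S k < e" by (auto simp: eventually_sequentially)
      show "\<exists>M. \<forall>m\<ge>M. \<forall>n>m. dist (approx m t g) (approx n t g) < e"
      proof (intro exI allI impI)
        fix m n assume "m \<ge> N" "n > m"
        then show "dist (approx m t g) (approx n t g) < e"
          using tail[of m "n - m"] N[of m] by (simp add: dist_norm norm_minus_commute)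
      qed
    qed
  qed
  then show ?thesis by (simp add: sg_def convergent_LIMSEQ_iff)
qed

lemma sg_contr:
  assumes t: "0 < t"
  shows "contr (sg t)"
  unfolding contr_def
proof (intro conjI allI)
  note lim = approx_tendsto[OF t]
  show "linear (sg t)"
  proof
    fix f g and r :: real
    have "(\<lambda>k. approx k t (f + g)) \<longlonglongrightarrow> sg t f + sg t g"
      using tendsto_add[OF lim[of f] lim[of g]] linear_add[OF contr_linear[OF approx_contr[OF t]]] by simp
    then show "sg t (f + g) = sg t f + sg t g" using lim LIMSEQ_unique by blast
    have "(\<lambda>k. approx k t (r *\<^sub>R f)) \<longlonglongrightarrow> r *\<^sub>R sg t f"
      using tendsto_scaleR[OF tendsto_const lim[of f], of r]
        linear_scale[OF contr_linear[OF approx_contr[OF t]]] by simp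
    then show "sg t (r *\<^sub>R f) = r *\<^sub>R sg t f" using lim LIMSEQ_unique by blast
  qed
  show "norm (sg t u) \<le> norm u" for u
    using tendsto_norm[OF lim[of u]] contr_norm[OF approx_contr[OF t]] by (auto intro: LIMSEQ_le_const2)
qed

lemma funpow_sym:
  assumes "\<And>f g. inner (P f) g = inner f (P g)"
  shows "inner ((P ^^ n) f) g = inner f ((P ^^ n) g)"
  by (induction n arbitrary: f) (simp_all add: assms funpow_swap1)

lemma sg_sym:
  assumes t: "0 < t"
  shows "inner (sg t f) g = inner f (sg t g)"
proof -
  have "inner (approx k t f) g = inner f (approx k t g)" for k
    unfolding approx_def by (intro funpow_sym resolv_sym) (use t in simp)
  moreover have "(\<lambda>k. inner (approx k t f) g) \<longlonglongrightarrow> inner (sg t f) g"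
    "(\<lambda>k. inner f (approx k t g)) \<longlonglongrightarrow> inner f (sg t g)"
    by (intro tendsto_intros approx_tendsto t)+
  ultimately show ?thesis by (simp add: LIMSEQ_unique)
qed

lemma funpow_comp:
  assumes "\<And>x. P (R x) = R (P x)"
  shows "((\<lambda>x. P (R x)) ^^ n) x = (P ^^ n) ((R ^^ n) x)"
proof (induction n)
  case (Suc n)
  have "R ((P ^^ n) y) = (P ^^ n) (R y)" for y by (induction n) (simp_all add: assms[symmetric])
  then show ?case using Suc by simp
qed simp

text \<open>On the dense set \<open>smooth\<close>, the product of the schemes for s and t is
  compared with the scheme for s + t. Each of the 2^k steps has error (s / 2^k) (t / 2^k) |A^2 g|,
  which sums to a multiple of 2^(-k).\<close>

lemma sg_add:
  assumes s: "0 < s" and t: "0 < t"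
  shows "sg (s + t) f = sg s (sg t f)"
proof -
  have st: "0 < s + t" using s t by simp
  show ?thesis
  proof (rule contr_eq_dense[OF sg_contr[OF st] contr_comp[OF sg_contr[OF s] sg_contr[OF t]] smooth_dense])
    fix g assume "g \<in> smooth"
    then obtain u w where gw: "op g u" "op u w" by (auto simp: smooth_def)
    have le: "norm (approx k s (approx k t g) - approx k (s + t) g) \<le> s * t * norm w * (1/2) ^ k" for k
    proof -
      define a b where "a = s / 2 ^ k" and "b = t / 2 ^ k"
      have ab: "0 < a" "0 < b" "(s + t) / 2 ^ k = a + b" using s t by (auto simp: a_def b_def add_divide_distrib)
      have e1: "approx k s (approx k t g) = ((\<lambda>x. resolv a (resolv b x)) ^^ (2 ^ k)) g"
        unfolding approx_def a_def[symmetric] b_def[symmetric]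
        by (rule funpow_comp[symmetric]) (use ab resolv_commute in auto)
      have e2: "approx k (s + t) g = (resolv (a + b) ^^ (2 ^ k)) g" by (simp add: approx_def ab)
      have n1: "norm (((\<lambda>x. resolv a (resolv b x)) ^^ (2 ^ k)) g - (resolv (a + b) ^^ (2 ^ k)) g)
        \<le> real (2 ^ k) * norm (resolv a (resolv b g) - resolv (a + b) g)"
        by (rule contr_funpow_diff[OF contr_comp[OF resolv_contr resolv_contr] resolv_contr])
          (use ab resolv_commute in auto)
      have n2: "real (2 ^ k) * norm (resolv a (resolv b g) - resolv (a + b) g) \<le> real (2 ^ k) * (a * b * norm w)"
        by (intro mult_left_mono resolv_two_step[OF ab(1,2) gw]) auto
      have n3: "real (2 ^ k) * (a * b * norm w) = s * t * norm w * (1/2) ^ k"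
      proof -
        define p :: real where "p = 2 ^ k"
        have "p > 0" "a = s / p" "b = t / p" "(1/2) ^ k = 1 / p"
          by (simp_all add: p_def a_def b_def power_one_over)
        then have "p * (a * b * norm w) = s * t * norm w * (1/2) ^ k" by simp
        then show ?thesis by (simp add: p_def)
      qed
      show ?thesis unfolding e1 e2 using order_trans[OF n1 n2] unfolding n3 .
    qed
    have "(\<lambda>k. s * t * norm w * (1/2) ^ k) \<longlonglongrightarrow> s * t * norm w * 0"
      by (intro tendsto_intros LIMSEQ_power_zero) auto
    then have "(\<lambda>k. s * t * norm w * (1/2) ^ k) \<longlonglongrightarrow> 0" by simp
    then have 1: "(\<lambda>k. approx k s (approx k t g) - approx k (s + t) g) \<longlonglongrightarrow> 0"
      by (rule Lim_null_comparison[rotated]) (use le in auto)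
    have "(\<lambda>k. norm (approx k t g - sg t g)) \<longlonglongrightarrow> 0"
      using approx_tendsto[OF t] by (simp add: tendsto_norm_zero LIM_zero)
    then have 2: "(\<lambda>k. approx k s (approx k t g) - approx k s (sg t g)) \<longlonglongrightarrow> 0"
      by (rule Lim_null_comparison[rotated]) (intro always_eventually allI contr_dist approx_contr s)
    have "(\<lambda>k. (approx k s (approx k t g) - approx k (s + t) g) -
       (approx k s (approx k t g) - approx k s (sg t g)) - approx k s (sg t g) + approx k (s + t) g)
      \<longlonglongrightarrow> 0 - 0 - sg s (sg t g) + sg (s + t) g"
      by (intro tendsto_intros 1 2 approx_tendsto s st)
    then have "(\<lambda>k::nat. 0::'a) \<longlonglongrightarrow> - sg s (sg t g) + sg (s + t) g" by simp
    then have "- sg s (sg t g) + sg (s + t) g = 0" by (simp add: LIMSEQ_const_iff)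
    then show "sg (s + t) g = sg s (sg t g)" by (simp add: add_eq_0_iff)
  qed
qed

text \<open>An Euler step of length h moves a vector of the domain by at most h |A f|; the estimate
  is kept in the limit of finer steps.\<close>

lemma norm_sg_diff_op:
  assumes t: "0 < t" and "op f w"
  shows "norm (sg t f - f) \<le> t * norm w"
proof -
  have "norm (approx k t f - f) \<le> t * norm w" for k
  proof -
    define h where "h = t / 2 ^ k"
    have h: "0 < h" using t by (simp add: h_def)
    have "norm ((resolv h ^^ (2 ^ k)) f - (id ^^ (2 ^ k)) f) \<le> real (2 ^ k) * norm (resolv h f - id f)"
      by (intro contr_funpow_diff resolv_contr h contr_id) simp
    also have "\<dots> \<le> real (2 ^ k) * (h * norm w)"
      using norm_resolv_diff_op[OF h assms(2)] by (intro mult_left_mono) auto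
    also have "\<dots> = t * norm w" by (simp add: h_def)
    finally show ?thesis by (simp add: approx_def h_def id_def[symmetric])
  qed
  then show ?thesis
    using tendsto_norm[OF tendsto_diff[OF approx_tendsto[OF t, of f] tendsto_const[of f]]] by (auto intro: LIMSEQ_le_const2)
qed

lemma sg_tendsto_0: "((\<lambda>t. sg t f) \<longlongrightarrow> f) (at_right 0)"
proof (rule tendstoI)
  fix e :: real assume e: "0 < e"
  obtain g where g: "g \<in> smooth" "dist g f < e / 4"
    using smooth_dense e by (metis UNIV_I closure_approachable divide_pos_pos zero_less_numeral)
  then obtain w where w: "op g w" by (auto simp: smooth_def)
  define c where "c = norm w + 1"
  have c: "c > 0" by (simp add: c_def add_nonneg_pos)
  define d where "d = e / (4 * c)"
  have d: "d > 0" using e c by (simp add: d_def)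
  have "dist (sg t f) f < e" if t: "0 < t" "t < d" for t
  proof -
    have "norm (sg t f - f) \<le> norm (sg t f - sg t g) + norm (sg t g - g) + norm (g - f)"
      using norm_triangle_ineq[of "sg t f - sg t g" "sg t g - g"] norm_triangle_ineq[of "sg t f - g" "g - f"] by simp
    moreover have "norm (sg t f - sg t g) \<le> norm (f - g)" by (rule contr_dist[OF sg_contr[OF t(1)]])
    moreover have "norm (sg t g - g) \<le> t * norm w" by (rule norm_sg_diff_op[OF t(1) w])
    moreover have "t * norm w \<le> d * c" using t d by (intro mult_mono) (auto simp: c_def)
    moreover have "d * c = e / 4"
      unfolding d_def using c by simp
    ultimately show ?thesis using g(2) e by (simp add: dist_norm norm_minus_commute)
  qed
  then show "\<forall>\<^sub>F t in at_right 0. dist (sg t f) f < e"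
    using d by (auto simp: eventually_at_right)
qed

text \<open>A Taylor estimate on the domain of A^2, proved for m Euler steps by induction: one more
  step changes the remainder by h (g - B^(m+1) g), whose norm is at most (m + 1) h^2 |w|.\<close>

lemma norm_sg_second_order:
  assumes t: "0 < t" and f: "op f g" "op g w"
  shows "norm (sg t f - f + t *\<^sub>R g) \<le> t\<^sup>2 * norm w"
proof -
  have "norm (approx k t f - f + t *\<^sub>R g) \<le> t\<^sup>2 * norm w" for k
  proof -
    define h where "h = t / 2 ^ k"
    have h: "0 < h" using t by (simp add: h_def)
    let ?B = "resolv h"
    have Bm: "contr (?B ^^ m)" for m by (intro contr_funpow resolv_contr h)
    have "norm ((?B ^^ m) f - f + (m * h) *\<^sub>R g) \<le> (m * h)\<^sup>2 * norm w" for m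
    proof (induction m)
      case (Suc m)
      have "?B f = f - h *\<^sub>R ?B g" using resolv_diff_op[OF h f(1)] by (simp add: algebra_simps)
      then have "(?B ^^ Suc m) f = (?B ^^ m) f - h *\<^sub>R (?B ^^ Suc m) g"
        by (simp add: funpow_Suc_right linear_diff[OF contr_linear[OF Bm]] linear_scale[OF contr_linear[OF Bm]] del: funpow.simps)
      then have "(?B ^^ Suc m) f - f + (Suc m * h) *\<^sub>R g
          = ((?B ^^ m) f - f + (m * h) *\<^sub>R g) + h *\<^sub>R (g - (?B ^^ Suc m) g)"
        by (simp add: algebra_simps del: funpow.simps)
      also have "norm \<dots> \<le> (m * h)\<^sup>2 * norm w + h * (Suc m * (h * norm w))"
      proof (intro norm_triangle_mono Suc)
        have "norm ((?B ^^ Suc m) g - (id ^^ Suc m) g) \<le> real (Suc m) * norm (?B g - id g)"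
          by (intro contr_funpow_diff resolv_contr h contr_id) simp
        also have "\<dots> \<le> real (Suc m) * (h * norm w)"
          using norm_resolv_diff_op[OF h f(2)] by (intro mult_left_mono) auto
        finally have "norm (g - (?B ^^ Suc m) g) \<le> real (Suc m) * (h * norm w)"
          by (simp add: norm_minus_commute id_def[symmetric])
        then show "norm (h *\<^sub>R (g - (?B ^^ Suc m) g)) \<le> h * (Suc m * (h * norm w))"
          using h by (simp add: mult_left_mono del: funpow.simps)
      qed
      also have "\<dots> \<le> (Suc m * h)\<^sup>2 * norm w"
      proof -
        have "(Suc m * h)\<^sup>2 * norm w - ((m * h)\<^sup>2 * norm w + h * (Suc m * (h * norm w))) = real m * (h * h * norm w)"
          by (simp add: power2_eq_square algebra_simps)
        moreover have "0 \<le> real m * (h * h * norm w)" using h by simp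
        ultimately show ?thesis by linarith
      qed
      finally show ?case .
    qed simp
    from this[of "2 ^ k"] show ?thesis by (simp add: approx_def h_def)
  qed
  moreover have "(\<lambda>k. norm (approx k t f - f + t *\<^sub>R g)) \<longlonglongrightarrow> norm (sg t f - f + t *\<^sub>R g)"
    by (intro tendsto_intros approx_tendsto t)
  ultimately show ?thesis by (auto intro: LIMSEQ_le_const2)
qed

text \<open>\<open>f\<close> lies only in the domain of A, where no second-order estimate is
  available. It is replaced by \<open>g = resolv (h n) f\<close>, with A g close to A f; the
  second-order bound serves \<open>g\<close> and the first-order bound serves
  \<open>f - g\<close>.\<close>

lemma generator_op:
  assumes "op f w"
  shows "((\<lambda>t. (sg t f - f) /\<^sub>R t) \<longlongrightarrow> - w) (at_right 0)"
proof (rule tendstoI)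
  fix e :: real assume e: "0 < e"
  define h where "h n = 1 / real (Suc n)" for n
  have h: "h \<longlonglongrightarrow> 0" "\<And>n. 0 < h n"
    unfolding h_def by (intro LIMSEQ_Suc[OF lim_1_over_n]) auto
  obtain n where n: "norm (resolv (h n) w - w) < e / 4"
    using LIMSEQ_D[OF resolv_tendsto[OF h, of w], of "e / 4"] e by auto
  define g u where "g = resolv (h n) f" and "u = resolv (h n) w"
  have gu: "op g u" unfolding g_def u_def by (intro op_resolv_commute h assms)
  obtain v where uv: "op u v" unfolding u_def using op_resolv[OF h(2)] by blast
  define c where "c = norm v + 1"
  have c: "c > 0" by (simp add: c_def add_nonneg_pos)
  define d where "d = e / (4 * c)"
  have d: "d > 0" using e c by (simp add: d_def)
  have "dist ((sg t f - f) /\<^sub>R t) (- w) < e" if t: "0 < t" "t < d" for t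
  proof -
    have T: "linear (sg t)" using sg_contr[OF t(1)] by (rule contr_linear)
    have "norm (sg t (f - g) - (f - g)) \<le> t * norm (w - u)"
      by (rule norm_sg_diff_op[OF t(1) op_diff[OF assms gu]])
    moreover have "norm (sg t g - g + t *\<^sub>R u) \<le> t\<^sup>2 * norm v"
      by (rule norm_sg_second_order[OF t(1) gu uv])
    moreover have eq: "sg t f - f + t *\<^sub>R w = (sg t (f - g) - (f - g)) + (sg t g - g + t *\<^sub>R u) + t *\<^sub>R (w - u)"
      by (simp add: linear_diff[OF T] algebra_simps)
    moreover have "norm (t *\<^sub>R (w - u)) = t * norm (w - u)" using t by simp
    ultimately have "norm (sg t f - f + t *\<^sub>R w) \<le> t * norm (w - u) + t\<^sup>2 * norm v + t * norm (w - u)"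
      using norm_triangle_ineq[of "sg t (f - g) - (f - g)" "sg t g - g + t *\<^sub>R u"]
        norm_triangle_ineq[of "(sg t (f - g) - (f - g)) + (sg t g - g + t *\<^sub>R u)" "t *\<^sub>R (w - u)"]
      unfolding eq by linarith
    also have "\<dots> = t * (2 * norm (w - u) + t * norm v)" by (simp add: power2_eq_square algebra_simps)
    also have "\<dots> < t * e"
    proof (intro mult_strict_left_mono t)
      have "t * norm v \<le> d * c" using t d by (intro mult_mono) (auto simp: c_def)
      also have "\<dots> = e / 4" unfolding d_def using c by simp
      finally show "2 * norm (w - u) + t * norm v < e" using n e by (simp add: u_def norm_minus_commute)
    qed
    finally have *: "norm (sg t f - f + t *\<^sub>R w) < t * e" .
    have "(sg t f - f) /\<^sub>R t - (- w) = (sg t f - f + t *\<^sub>R w) /\<^sub>R t"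
      using t by (simp add: algebra_simps)
    then have "norm ((sg t f - f) /\<^sub>R t - (- w)) = norm (sg t f - f + t *\<^sub>R w) / t"
      using t by (simp add: divide_inverse mult.commute)
    then show ?thesis using * t unfolding dist_norm
      by (simp only: pos_divide_less_eq mult.commute[of e t])
  qed
  then show "\<forall>\<^sub>F t in at_right 0. dist ((sg t f - f) /\<^sub>R t) (- w) < e"
    using d by (auto simp: eventually_at_right)
qed

text \<open>The generator is a symmetric extension of - A, and 1 + A is onto, so there is no room
  for a proper extension. Concretely, pairing with vectors \<open>resolv 1 g\<close> shows
  \<open>resolv 1 (u - w) = u\<close>, which puts \<open>u\<close> into the domain.\<close>

lemma op_of_generator:
  assumes "((\<lambda>t. (sg t u - u) /\<^sub>R t) \<longlongrightarrow> w) (at_right 0)"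
  shows "op u (- w)"
proof -
  have *: "inner w v = inner u (- a)" if "op v a" for v a
  proof (rule tendsto_unique)
    show "((\<lambda>t. inner ((sg t u - u) /\<^sub>R t) v) \<longlongrightarrow> inner w v) (at_right 0)"
      by (intro tendsto_intros assms)
    have "((\<lambda>t. inner u ((sg t v - v) /\<^sub>R t)) \<longlongrightarrow> inner u (- a)) (at_right 0)"
      by (intro tendsto_intros generator_op that)
    moreover have "\<forall>\<^sub>F t in at_right 0. inner u ((sg t v - v) /\<^sub>R t) = inner ((sg t u - u) /\<^sub>R t) v"
      using eventually_at_right_less
    proof eventually_elim
      case (elim t)
      then show ?case using sg_sym[of t u v] by (simp add: inner_diff_left inner_diff_right)
    qed
    ultimately show "((\<lambda>t. inner ((sg t u - u) /\<^sub>R t) v) \<longlongrightarrow> inner u (- a)) (at_right 0)"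
      by (rule Lim_transform_eventually)
  qed simp
  have "resolv 1 (u - w) = u"
  proof -
    have "inner (resolv 1 (u - w) - u) g = 0" for g
    proof -
      have "op (resolv 1 g) (g - resolv 1 g)" using op_resolv[of 1 g] by simp
      from *[OF this] have "inner w (resolv 1 g) = inner u (resolv 1 g) - inner u g"
        by (simp add: inner_diff_right)
      then show ?thesis using resolv_sym[of 1 "u - w" g] by (simp add: inner_diff_left)
    qed
    from this[of "resolv 1 (u - w) - u"] show ?thesis by simp
  qed
  then show ?thesis using op_resolv[of 1 "u - w"] by simp
qed

theorem associated_sg: "associated_semigroup E F sg"
  unfolding associated_semigroup_def symmetric_contraction_semigroup_def semigroup_generator_def
proof (intro conjI allI impI iffI)
  fix u w
  show "linear (sg t)" "inner (sg t u) w = inner u (sg t w)" "norm (sg t u) \<le> norm u" if "0 < t" for t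
    using that sg_contr[of t] sg_sym[of t u w] by (auto simp: contr_def)
  show "sg (s + t) u = sg s (sg t u)" if "0 < s" "0 < t" for s t using that by (rule sg_add)
  show "((\<lambda>t. sg t u) \<longlongrightarrow> u) (at_right 0)" by (rule sg_tendsto_0)
  show "u \<in> F" "\<forall>v\<in>F. E u v = inner (- w) v" if "((\<lambda>t. (sg t u - u) /\<^sub>R t) \<longlongrightarrow> w) (at_right 0)"
    using op_of_generator[OF that] by (auto simp: op_def)
  show "((\<lambda>t. (sg t u - u) /\<^sub>R t) \<longlongrightarrow> w) (at_right 0)" if "u \<in> F \<and> (\<forall>v\<in>F. E u v = inner (- w) v)"
    using generator_op[of u "- w"] that by (auto simp: op_def)
qed

section \<open>Time regularity of the semigroup and its Laplace transform\<close>

lemma norm_sg_diff: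
  assumes "0 < s" "s < t"
  shows "norm (sg t f - sg s f) \<le> norm (sg (t - s) f - f)"
  using sg_add[of s "t - s" f] contr_dist[OF sg_contr[of s], of "sg (t - s) f" f] assms by simp

lemma isCont_sg:
  assumes t: "0 < t"
  shows "isCont (\<lambda>t. sg t f) t"
proof -
  have "\<exists>d>0. \<forall>s. s \<noteq> t \<and> norm (s - t) < d \<longrightarrow> norm (sg s f - sg t f) < e" if e: "0 < e" for e
  proof -
    obtain d where d: "0 < d" "\<And>h. 0 < h \<Longrightarrow> h < d \<Longrightarrow> norm (sg h f - f) < e"
      using tendstoD[OF sg_tendsto_0[of f] e] by (auto simp: eventually_at_right_field dist_norm)
    have "norm (sg s f - sg t f) < e" if s: "s \<noteq> t" "\<bar>s - t\<bar> < min d t" for s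
    proof (cases "s < t")
      case True
      then show ?thesis using norm_sg_diff[of s t f] d(2)[of "t - s"] s by (simp add: norm_minus_commute)
    next
      case False
      then show ?thesis using norm_sg_diff[of t s f] d(2)[of "s - t"] s t by simp
    qed
    then show ?thesis using d(1) t by (intro exI[of _ "min d t"]) auto
  qed
  then show ?thesis unfolding isCont_def by (intro LIM_I)
qed

text \<open>The generator supplies the right derivative. For the left one, the increment is
  \<open>sg (t - h) (sg h v - v)\<close>; symmetry moves \<open>sg (t - h)\<close> to
  \<open>g\<close>, where it converges by continuity in time.\<close>

lemma DERIV_sg:
  assumes t: "0 < t" and v: "op v w"
  shows "DERIV (\<lambda>t. inner (sg t v) g) t :> - inner (sg t w) g"
proof -
  define \<phi> where "\<phi> t = inner (sg t v) g" for t
  have gen: "((\<lambda>h. (sg h v - v) /\<^sub>R h) \<longlongrightarrow> - w) (at_right 0)" by (rule generator_op[OF v])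
  have "((\<lambda>h. (\<phi> (t + h) - \<phi> t) / h) \<longlongrightarrow> inner (- w) (sg t g)) (at_right 0)"
  proof (rule Lim_transform_eventually)
    show "((\<lambda>h. inner ((sg h v - v) /\<^sub>R h) (sg t g)) \<longlongrightarrow> inner (- w) (sg t g)) (at_right 0)"
      by (intro tendsto_intros gen)
    show "\<forall>\<^sub>F h in at_right 0. inner ((sg h v - v) /\<^sub>R h) (sg t g) = (\<phi> (t + h) - \<phi> t) / h"
      using eventually_at_right_less
    proof eventually_elim
      case (elim h)
      have "\<phi> (t + h) - \<phi> t = inner (sg t (sg h v - v)) g"
        using sg_add[OF t elim, of v] by (simp add: \<phi>_def inner_diff_left contr_diff[OF sg_contr[OF t]])
      then show ?case using sg_sym[OF t, of "sg h v - v" g] by (simp add: divide_inverse)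
    qed
  qed
  moreover have "((\<lambda>h. (\<phi> (t + h) - \<phi> t) / h) \<longlongrightarrow> inner (- w) (sg t g)) (at_left 0)"
    unfolding filterlim_at_left_to_right
  proof (rule Lim_transform_eventually)
    have "((\<lambda>h. sg (t - h) g) \<longlongrightarrow> sg (t - 0) g) (at_right 0)"
    proof (rule isCont_tendsto_compose[where f = "\<lambda>h. t - h"])
      show "isCont (\<lambda>t. sg t g) (t - 0)" using isCont_sg[OF t] by simp
    qed (intro tendsto_intros)
    then show "((\<lambda>h. inner ((sg h v - v) /\<^sub>R h) (sg (t - h) g)) \<longlongrightarrow> inner (- w) (sg t g)) (at_right (- 0))"
      unfolding minus_zero diff_0_right by (intro tendsto_intros gen)
    have "\<forall>\<^sub>F h in at_right 0. h < t" using t eventually_at_right by blast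
    then show "\<forall>\<^sub>F h in at_right (- 0). inner ((sg h v - v) /\<^sub>R h) (sg (t - h) g)
        = (\<phi> (t + - h) - \<phi> t) / (- h)"
      using eventually_at_right_less[of 0] unfolding minus_zero
    proof eventually_elim
      case (elim h)
      have "\<phi> t - \<phi> (t - h) = inner (sg (t - h) (sg h v - v)) g"
        using sg_add[of "t - h" h v] elim by (simp add: \<phi>_def inner_diff_left contr_diff[OF sg_contr])
      then have "\<phi> (t - h) - \<phi> t = - inner (sg h v - v) (sg (t - h) g)"
        using sg_sym[of "t - h" "sg h v - v" g] elim by simp
      then show ?case by (simp add: divide_inverse)
    qed
  qed
  ultimately have "((\<lambda>h. (\<phi> (t + h) - \<phi> t) / h) \<longlongrightarrow> inner (- w) (sg t g)) (at 0)"
    by (simp add: filterlim_split_at)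
  then show ?thesis
    using sg_sym[OF t, of w g] by (simp add: DERIV_def \<phi>_def)
qed

text \<open>The resolvent (a + A)^(-1), which is the Laplace transform of the semigroup at
  \<open>a\<close>. As \<open>a\<close> tends to 0 it approaches the Green operator.\<close>

definition Res :: "real \<Rightarrow> 'a \<Rightarrow> 'a" where
  "Res a f = (1 / a) *\<^sub>R resolv (1 / a) f"

lemma Res_in: "0 < a \<Longrightarrow> Res a f \<in> F"
  unfolding Res_def by (intro form.V_scale resolv_in) simp

lemma op_Res:
  assumes a: "0 < a"
  shows "op (Res a f) (f - a *\<^sub>R Res a f)"
  using op_scale[OF op_resolv[of "1/a" f], of "1/a"] a by (simp add: Res_def scaleR_diff_right)

lemma Res_eq:
  assumes "0 < a" "v \<in> F"
  shows "E (Res a f) v + a * inner (Res a f) v = inner f v"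
  using op_Res[OF assms(1), of f] assms(2) by (auto simp: op_def inner_diff_left)

lemma Res_unique:
  assumes a: "0 < a" and u: "u \<in> F" "\<And>v. v \<in> F \<Longrightarrow> E u v + a * inner u v = inner f v"
  shows "Res a f = u"
proof -
  have "resolv (1/a) f = a *\<^sub>R u"
    by (rule resolv_unique) (use a u in \<open>auto simp: form.scale_left algebra_simps\<close>)
  then show ?thesis using a by (simp add: Res_def)
qed

lemma Res_sym: "0 < a \<Longrightarrow> inner (Res a f) g = inner f (Res a g)"
  using resolv_sym[of "1/a" f g] by (simp add: Res_def)

lemma Res_linear: "0 < a \<Longrightarrow> linear (Res a)"
  unfolding Res_def using linear_compose_scale_right[OF resolv_linear[of "1/a"], of "1/a"] by simp

lemma Res_identity:
  assumes "0 < a" "0 < b"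
  shows "Res a f - Res b f = (b - a) *\<^sub>R Res b (Res a f)"
proof -
  have "Res b (f + (b - a) *\<^sub>R Res a f) = Res a f"
    by (rule Res_unique) (use assms Res_in Res_eq[OF assms(1)] in \<open>auto simp: inner_add_left algebra_simps\<close>)
  then show ?thesis
    using Res_linear[OF assms(2)] by (simp add: linear_add linear_diff linear_scale algebra_simps)
qed

text \<open>For v = \<open>Res a f\<close> one has A v = f - a v. Hence - exp(-a t) (T_t v, g) is an
  antiderivative of the integrand; it vanishes at infinity and tends to - (v, g) at 0.\<close>

lemma nn_integral_sg_exp:
  assumes a: "0 < a" and nn: "\<And>t. 0 < t \<Longrightarrow> 0 \<le> inner (sg t f) g"
  shows "(\<integral>\<^sup>+t\<in>{0<..}. ennreal (exp (- a * t) * inner (sg t f) g) \<partial>lebesgue) = ennreal (inner (Res a f) g)"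
proof -
  define v where "v = Res a f"
  have v: "op v (f - a *\<^sub>R v)" unfolding v_def by (rule op_Res[OF a])
  define G where "G t = - (exp (- a * t) * inner (sg t v) g)" for t
  define k where "k t = exp (- a * t) * inner (sg t f) g" for t
  \<comment> \<open>Integration starts at \<open>c n\<close> instead of 0, because \<open>sg\<close>
    is controlled at positive times only.\<close>
  define c where "c n = 1 / real (Suc n)" for n
  have c: "0 < c n" for n by (simp add: c_def)
  have c0: "c \<longlonglongrightarrow> 0" unfolding c_def by (rule LIMSEQ_Suc[OF lim_1_over_n])
  have cont: "continuous_on {c n..} k" for n
    unfolding k_def
  proof (intro continuous_intros)
    show "continuous_on {c n..} (\<lambda>t. sg t f)"
      by (intro continuous_at_imp_continuous_on ballI isCont_sg) (use c[of n] in auto)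
  qed
  have int_n: "(\<integral>\<^sup>+t. ennreal (k t) * indicator {c n..} t \<partial>lborel) = ennreal (exp (- a * c n) * inner (sg (c n) v) g)" for n
  proof -
    define k' where "k' t = indicator {c n..} t *\<^sub>R k t" for t
    have "(\<integral>\<^sup>+t. ennreal (k' t) * indicator {c n..} t \<partial>lborel) = 0 - G (c n)"
    proof (rule nn_integral_FTC_atLeast)
      show "k' \<in> borel_measurable borel"
        unfolding k'_def by (intro borel_measurable_continuous_on_indicator cont) auto
      show "DERIV G t :> k' t" if "c n \<le> t" for t
      proof -
        have t: "0 < t" using that c[of n] by simp
        have T: "linear (sg t)" by (rule contr_linear[OF sg_contr[OF t]])
        have "DERIV G t :> - (exp (- a * t) * (- inner (sg t (f - a *\<^sub>R v)) g) + (exp (- a * t) * (- a)) * inner (sg t v) g)"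
          unfolding G_def by (auto intro!: derivative_eq_intros DERIV_sg[OF t v])
        also have "- (exp (- a * t) * (- inner (sg t (f - a *\<^sub>R v)) g) + (exp (- a * t) * (- a)) * inner (sg t v) g) = k' t"
          using that by (simp add: k'_def k_def linear_diff[OF T] linear_scale[OF T] inner_diff_left algebra_simps)
        finally show ?thesis .
      qed
      show "0 \<le> k' t" if "c n \<le> t" for t
        using that c[of n] nn[of t] by (simp add: k'_def k_def)
      have "((\<lambda>t. exp (- a * t) * (norm v * norm g)) \<longlongrightarrow> 0) at_top"
      proof -
        have "filterlim (\<lambda>t. a * t) at_top at_top"
          by (rule filterlim_tendsto_pos_mult_at_top[OF tendsto_const a filterlim_ident])
        then have "filterlim (\<lambda>t. - (a * t)) at_bot at_top" by (simp add: filterlim_uminus_at_bot)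
        then have "((\<lambda>t. exp (- (a * t))) \<longlongrightarrow> 0) at_top" by (rule filterlim_compose[OF exp_at_bot])
        from tendsto_mult_right[OF this, of "norm v * norm g"] show ?thesis by simp
      qed
      then show "(G \<longlongrightarrow> 0) at_top"
      proof (rule Lim_null_comparison[rotated])
        show "\<forall>\<^sub>F t in at_top. norm (G t) \<le> exp (- a * t) * (norm v * norm g)"
          using eventually_gt_at_top[of 0]
        proof eventually_elim
          case (elim t)
          have "\<bar>inner (sg t v) g\<bar> \<le> norm (sg t v) * norm g" by (rule Cauchy_Schwarz_ineq2)
          also have "\<dots> \<le> norm v * norm g" by (intro mult_right_mono contr_norm[OF sg_contr[OF elim]]) simp
          finally show ?case by (simp add: G_def abs_mult)
        qed
      qed
    qed
    moreover have "ennreal (k' t) * indicator {c n..} t = ennreal (k t) * indicator {c n..} t" for t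
      by (simp add: k'_def indicator_def)
    ultimately show ?thesis by (simp add: G_def)
  qed
  have "(\<integral>\<^sup>+t\<in>{0<..}. ennreal (k t) \<partial>lebesgue) = (\<integral>\<^sup>+t. ennreal (k t) * indicator {0<..} t \<partial>lborel)"
    by (rule nn_integral_completion)
  also have "\<dots> = (\<integral>\<^sup>+t. (SUP n. ennreal (k t) * indicator {c n..} t) \<partial>lborel)"
  proof (intro nn_integral_cong)
    fix t :: real
    show "ennreal (k t) * indicator {0<..} t = (SUP n. ennreal (k t) * indicator {c n..} t)"
    proof (cases "0 < t")
      case True
      then obtain n where n: "c n < t" using order_tendstoD(2)[OF c0] by (auto simp: eventually_sequentially)
      show ?thesis
        by (intro antisym SUP_upper2[of n] SUP_least) (use True n in \<open>auto simp: indicator_def\<close>)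
    next
      case False
      then have "indicator {c n..} t = (0::ennreal)" for n using c[of n] by (simp add: indicator_def)
      then show ?thesis using False by simp
    qed
  qed
  also have "\<dots> = (SUP n. \<integral>\<^sup>+t. ennreal (k t) * indicator {c n..} t \<partial>lborel)"
  proof (rule nn_integral_monotone_convergence_SUP)
    show "incseq (\<lambda>n t. ennreal (k t) * indicator {c n..} t)"
    proof (intro incseq_SucI le_funI mult_left_mono)
      fix n t
      have "c (Suc n) \<le> c n" by (simp add: c_def field_simps)
      then show "indicator {c n..} t \<le> (indicator {c (Suc n)..} t :: ennreal)" by (auto simp: indicator_def)
    qed simp
    show "(\<lambda>t. ennreal (k t) * indicator {c n..} t) \<in> borel_measurable lborel" for n
    proof -
      have "(\<lambda>t. ennreal (indicator {c n..} t *\<^sub>R k t)) \<in> borel_measurable borel"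
        by (intro measurable_compose[OF _ measurable_ennreal] borel_measurable_continuous_on_indicator cont) auto
      also have "(\<lambda>t. ennreal (indicator {c n..} t *\<^sub>R k t)) = (\<lambda>t. ennreal (k t) * indicator {c n..} t)"
        by (auto simp: indicator_def)
      finally show ?thesis by simp
    qed
  qed
  also have "\<dots> = (SUP n. ennreal (exp (- a * c n) * inner (sg (c n) v) g))"
    by (simp only: int_n)
  also have "\<dots> = ennreal (inner v g)"
  proof (rule LIMSEQ_unique[OF LIMSEQ_SUP])
    show "incseq (\<lambda>n. ennreal (exp (- a * c n) * inner (sg (c n) v) g))"
      unfolding int_n[symmetric]
    proof (intro incseq_SucI nn_integral_mono mult_left_mono)
      fix n t
      have "c (Suc n) \<le> c n" by (simp add: c_def field_simps)
      then show "indicator {c n..} t \<le> (indicator {c (Suc n)..} t :: ennreal)" by (auto simp: indicator_def)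
    qed simp
    have "filterlim c (at_right 0) sequentially"
      by (rule tendsto_imp_filterlim_at_right[OF c0]) (simp add: c)
    then have "(\<lambda>n. sg (c n) v) \<longlonglongrightarrow> v" by (rule filterlim_compose[OF sg_tendsto_0])
    then have "(\<lambda>n. ennreal (exp (- a * c n) * inner (sg (c n) v) g)) \<longlonglongrightarrow> ennreal (exp (- a * 0) * inner v g)"
      by (intro tendsto_intros c0)
    then show "(\<lambda>n. ennreal (exp (- a * c n) * inner (sg (c n) v) g)) \<longlonglongrightarrow> ennreal (inner v g)" by simp
  qed
  finally show ?thesis by (simp add: k_def v_def)
qed

text \<open>The limit a to 0 in the Laplace transform: exp(-a t) \<le> 1 gives one inequality, Fatou
  along a = 1/(n + 1) the other. Both sides may be infinite, which is why the identity is stated in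
  \<open>ennreal\<close>.\<close>

lemma nn_integral_sg:
  assumes nn: "\<And>t. 0 < t \<Longrightarrow> 0 \<le> inner (sg t f) g"
  shows "(\<integral>\<^sup>+t\<in>{0<..}. ennreal (inner (sg t f) g) \<partial>lebesgue) = (SUP a\<in>{0<..}. ennreal (inner (Res a f) g))"
proof (rule antisym)
  define c where "c n = 1 / real (Suc n)" for n
  have c: "0 < c n" for n by (simp add: c_def)
  have c0: "c \<longlonglongrightarrow> 0" unfolding c_def by (rule LIMSEQ_Suc[OF lim_1_over_n])
  have cont: "continuous_on {0<..} (\<lambda>t. inner (sg t f) g)"
    by (intro continuous_intros continuous_at_imp_continuous_on ballI isCont_sg) auto
  have meas: "(\<lambda>t. ennreal (exp (- a * t) * inner (sg t f) g) * indicator {0<..} t) \<in> borel_measurable lebesgue" for a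
  proof -
    have "(\<lambda>t. ennreal (indicator {0<..} t *\<^sub>R (exp (- a * t) * inner (sg t f) g))) \<in> borel_measurable borel"
      by (intro measurable_compose[OF _ measurable_ennreal] borel_measurable_continuous_on_indicator
          continuous_intros cont) auto
    also have "(\<lambda>t. ennreal (indicator {0<..} t *\<^sub>R (exp (- a * t) * inner (sg t f) g)))
        = (\<lambda>t. ennreal (exp (- a * t) * inner (sg t f) g) * indicator {0<..} t)"
      by (auto simp: indicator_def)
    finally show ?thesis by (simp add: measurable_completion)
  qed
  have "(\<integral>\<^sup>+t\<in>{0<..}. ennreal (inner (sg t f) g) \<partial>lebesgue)
      = (\<integral>\<^sup>+t. liminf (\<lambda>n. ennreal (exp (- c n * t) * inner (sg t f) g) * indicator {0<..} t) \<partial>lebesgue)"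
  proof (intro nn_integral_cong)
    fix t :: real
    have "(\<lambda>n. ennreal (exp (- c n * t) * inner (sg t f) g) * indicator {0<..} t)
        \<longlonglongrightarrow> ennreal (exp (- 0 * t) * inner (sg t f) g) * indicator {0<..} t"
      by (cases "0 < t") (auto intro!: tendsto_eq_intros c0 tendsto_ennrealI)
    from lim_imp_Liminf[OF sequentially_bot this]
    show "ennreal (inner (sg t f) g) * indicator {0<..} t
        = liminf (\<lambda>n. ennreal (exp (- c n * t) * inner (sg t f) g) * indicator {0<..} t)" by simp
  qed
  also have "\<dots> \<le> liminf (\<lambda>n. \<integral>\<^sup>+t\<in>{0<..}. ennreal (exp (- c n * t) * inner (sg t f) g) \<partial>lebesgue)"
    by (rule nn_integral_liminf[OF meas])
  also have "\<dots> = liminf (\<lambda>n. ennreal (inner (Res (c n) f) g))"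
    by (simp only: nn_integral_sg_exp[OF c nn])
  also have "\<dots> \<le> (SUP n. ennreal (inner (Res (c n) f) g))"
    by (rule order_trans[OF Liminf_le_Limsup[OF sequentially_bot] Limsup_bounded])
      (auto intro!: always_eventually SUP_upper)
  also have "\<dots> \<le> (SUP a\<in>{0<..}. ennreal (inner (Res a f) g))"
    by (intro SUP_least SUP_upper) (use c in auto)
  finally show "(\<integral>\<^sup>+t\<in>{0<..}. ennreal (inner (sg t f) g) \<partial>lebesgue) \<le> (SUP a\<in>{0<..}. ennreal (inner (Res a f) g))" .
  show "(SUP a\<in>{0<..}. ennreal (inner (Res a f) g)) \<le> (\<integral>\<^sup>+t\<in>{0<..}. ennreal (inner (sg t f) g) \<partial>lebesgue)"
  proof (intro SUP_least)
    fix a :: real assume "a \<in> {0<..}"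
    then have a: "0 < a" by simp
    have "ennreal (inner (Res a f) g) = (\<integral>\<^sup>+t\<in>{0<..}. ennreal (exp (- a * t) * inner (sg t f) g) \<partial>lebesgue)"
      by (rule nn_integral_sg_exp[OF a nn, symmetric])
    also have "\<dots> \<le> (\<integral>\<^sup>+t\<in>{0<..}. ennreal (inner (sg t f) g) \<partial>lebesgue)"
    proof (intro nn_integral_mono)
      fix t :: real
      have "exp (- a * t) * inner (sg t f) g \<le> 1 * inner (sg t f) g" if "0 < t"
        using nn[OF that] a that by (intro mult_right_mono) auto
      then show "ennreal (exp (- a * t) * inner (sg t f) g) * indicator {0<..} t \<le> ennreal (inner (sg t f) g) * indicator {0<..} t"
        by (auto simp: indicator_def intro: ennreal_leI)
    qed
    finally show "ennreal (inner (Res a f) g) \<le> (\<integral>\<^sup>+t\<in>{0<..}. ennreal (inner (sg t f) g) \<partial>lebesgue)" .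
  qed
qed

end

section \<open>Pointwise operations on square-integrable functions\<close>

lemma sigma_finite_lebesgue: "sigma_finite_measure (lebesgue :: real measure)"
proof
  obtain A :: "real set set" where "countable A" "A \<subseteq> sets lborel" "\<Union>A = space lborel"
      "\<forall>a\<in>A. emeasure lborel a \<noteq> \<infinity>"
    using lborel.sigma_finite_countable by blast
  then show "\<exists>A. countable A \<and> A \<subseteq> sets lebesgue \<and> \<Union> A = space (lebesgue :: real measure) \<and>
      (\<forall>a\<in>A. emeasure lebesgue a \<noteq> \<infinity>)"
    by (intro exI[of _ A]) (auto simp: emeasure_completion)
qed

interpretation lebesgue: sigma_finite_measure "lebesgue :: real measure"
  by (rule sigma_finite_lebesgue)

interpretation lebesgue_pair: pair_sigma_finite "lebesgue :: real measure" "lebesgue :: real measure" ..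

text \<open>Registers the coordinates as Borel functions on products of Lebesgue measures, so that
  expressions such as \<open>\<bar>x - y\<bar>\<close> are recognized as measurable there.\<close>

lemma lebesgue_borel_measurable [measurable (raw)]:
  "(\<lambda>x. x) \<in> borel_measurable (lebesgue :: real measure)"
  "fst \<in> borel_measurable (lebesgue \<Otimes>\<^sub>M M :: (real \<times> 'a) measure)"
  "snd \<in> borel_measurable (M \<Otimes>\<^sub>M lebesgue :: ('a \<times> real) measure)"
proof -
  show *: "(\<lambda>x. x) \<in> borel_measurable (lebesgue :: real measure)"
    by (intro measurable_completion measurable_ident_sets) simp
  show "fst \<in> borel_measurable (lebesgue \<Otimes>\<^sub>M M :: (real \<times> 'a) measure)"
    "snd \<in> borel_measurable (M \<Otimes>\<^sub>M lebesgue :: ('a \<times> real) measure)"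
    by (rule measurable_compose[OF measurable_fst *] measurable_compose[OF measurable_snd *])+
qed

lemma rep_L2_measurable [measurable]: "rep_L2 u \<in> borel_measurable lebesgue"
  using square_integrable_rep_L2 by (rule square_integrable_measurable)

lemma L2_rel_refl: "square_integrable f \<Longrightarrow> L2_rel f f"
  by (simp add: L2_rel_def)

lemma class_L2_cong:
  assumes "square_integrable f" "square_integrable g" "AE x in lebesgue. f x = g x"
  shows "class_L2 f = class_L2 g"
  by (rule Quotient3_rel_abs[OF Quotient3_L2]) (use assms in \<open>simp add: L2_rel_def\<close>)

lemma L2_eqI: "AE x in lebesgue. rep_L2 u x = rep_L2 v x \<Longrightarrow> u = v"
  using class_L2_cong[of "rep_L2 u" "rep_L2 v"] by (simp add: square_integrable_rep_L2 class_rep_L2)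

lemma rep_L2_add: "AE x in lebesgue. rep_L2 (u + v) x = rep_L2 u x + rep_L2 v x"
  using rep_class_L2[OF square_integrable_add[OF square_integrable_rep_L2[of u] square_integrable_rep_L2[of v]]]
    plus_L2.abs_eq[OF L2_rel_refl[OF square_integrable_rep_L2[of u]] L2_rel_refl[OF square_integrable_rep_L2[of v]]]
  by (simp add: class_rep_L2)

lemma rep_L2_diff: "AE x in lebesgue. rep_L2 (u - v) x = rep_L2 u x - rep_L2 v x"
  using rep_class_L2[OF square_integrable_diff[OF square_integrable_rep_L2[of u] square_integrable_rep_L2[of v]]]
    minus_L2.abs_eq[OF L2_rel_refl[OF square_integrable_rep_L2[of u]] L2_rel_refl[OF square_integrable_rep_L2[of v]]]
  by (simp add: class_rep_L2)

lemma rep_L2_scale: "AE x in lebesgue. rep_L2 (r *\<^sub>R u) x = r * rep_L2 u x"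
  using rep_class_L2[OF square_integrable_scale[OF square_integrable_rep_L2[of u], of r]]
    scaleR_L2.abs_eq[OF L2_rel_refl[OF square_integrable_rep_L2[of u]], of r]
  by (simp add: class_rep_L2)

lemma rep_L2_zero: "AE x in lebesgue. rep_L2 0 x = 0"
  using rep_class_L2[OF square_integrable_zero] by (simp add: zero_L2.abs_eq)

lemma rep_L2_sum:
  fixes n :: nat
  shows "AE x in lebesgue. rep_L2 (\<Sum>k<n. u k) x = (\<Sum>k<n. rep_L2 (u k) x)"
proof (induction n)
  case (Suc n)
  then show ?case using rep_L2_add[of "\<Sum>k<n. u k" "u n"] by eventually_elim (simp add: add.commute)
qed (use rep_L2_zero in simp)

lemma inner_L2_eq: "inner u v = (LINT x|lebesgue. rep_L2 u x * rep_L2 v x)"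
  using inner_L2.abs_eq[OF L2_rel_refl[OF square_integrable_rep_L2[of u]] L2_rel_refl[OF square_integrable_rep_L2[of v]]]
  by (simp add: class_rep_L2)

lemma integrable_rep_L2_mult: "integrable lebesgue (\<lambda>x. rep_L2 u x * rep_L2 v x)"
  by (intro square_integrable_mult square_integrable_rep_L2)

lemma norm_L2_eq_nn_integral: "ennreal ((norm u)\<^sup>2) = (\<integral>\<^sup>+x. ennreal ((rep_L2 u x)\<^sup>2) \<partial>lebesgue)"
  unfolding power2_norm_eq_inner inner_L2_eq
  using integrable_rep_L2_mult[of u u] by (subst nn_integral_eq_integral) (auto simp: power2_eq_square)

lemma norm_L2_le_iff:
  "norm u \<le> norm v \<longleftrightarrow> (\<integral>\<^sup>+x. ennreal ((rep_L2 u x)\<^sup>2) \<partial>lebesgue) \<le> (\<integral>\<^sup>+x. ennreal ((rep_L2 v x)\<^sup>2) \<partial>lebesgue)"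
  unfolding norm_L2_eq_nn_integral[symmetric] by (simp add: abs_le_square_iff[symmetric])

section \<open>Normal contractions, the positive cone and indicators in L2\<close>

definition contraction :: "(real \<Rightarrow> real) \<Rightarrow> bool" where
  "contraction \<phi> \<longleftrightarrow> \<phi> 0 = 0 \<and> (\<forall>a b. \<bar>\<phi> a - \<phi> b\<bar> \<le> \<bar>a - b\<bar>)"

definition app :: "(real \<Rightarrow> real) \<Rightarrow> L2 \<Rightarrow> L2" where
  "app \<phi> u = class_L2 (\<lambda>x. \<phi> (rep_L2 u x))"

lemma contraction_abs: "contraction \<phi> \<Longrightarrow> \<bar>\<phi> a\<bar> \<le> \<bar>a\<bar>"
  unfolding contraction_def by (metis diff_zero)

lemma contraction_measurable:
  assumes "contraction \<phi>" shows "\<phi> \<in> borel_measurable borel"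
proof -
  have "1-lipschitz_on UNIV \<phi>"
    using assms by (intro lipschitz_onI) (auto simp: contraction_def dist_real_def)
  then have "continuous_on UNIV \<phi>" by (rule lipschitz_on_continuous_on)
  then show ?thesis by (rule borel_measurable_continuous_onI)
qed

lemma square_integrable_dominated:
  assumes "square_integrable g" "f \<in> borel_measurable lebesgue" "AE x in lebesgue. \<bar>f x\<bar> \<le> \<bar>g x\<bar>"
  shows "square_integrable f"
proof -
  have "integrable lebesgue (\<lambda>x. (f x)\<^sup>2)"
  proof (rule Bochner_Integration.integrable_bound)
    show "integrable lebesgue (\<lambda>x. (g x)\<^sup>2)" using assms(1) by (simp add: square_integrable_def)
    show "(\<lambda>x. (f x)\<^sup>2) \<in> borel_measurable lebesgue" using assms(2) by simp
    show "AE x in lebesgue. norm ((f x)\<^sup>2) \<le> norm ((g x)\<^sup>2)"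
      using assms(3) by eventually_elim (simp add: abs_le_square_iff)
  qed
  then show ?thesis using assms(2) by (simp add: square_integrable_def)
qed

lemma square_integrable_app:
  assumes "contraction \<phi>"
  shows "square_integrable (\<lambda>x. \<phi> (rep_L2 u x))"
proof (rule square_integrable_dominated[OF square_integrable_rep_L2[of u]])
  show "(\<lambda>x. \<phi> (rep_L2 u x)) \<in> borel_measurable lebesgue"
    using contraction_measurable[OF assms] by simp
  show "AE x in lebesgue. \<bar>\<phi> (rep_L2 u x)\<bar> \<le> \<bar>rep_L2 u x\<bar>"
    using contraction_abs[OF assms] by simp
qed

lemma rep_app:
  assumes "contraction \<phi>"
  shows "AE x in lebesgue. rep_L2 (app \<phi> u) x = \<phi> (rep_L2 u x)"
  unfolding app_def by (rule rep_class_L2[OF square_integrable_app[OF assms]])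

lemma app_lipschitz:
  assumes \<phi>: "contraction \<phi>"
  shows "norm (app \<phi> u - app \<phi> v) \<le> norm (u - v)"
  unfolding norm_L2_le_iff
proof (rule nn_integral_mono_AE)
  show "AE x in lebesgue. ennreal ((rep_L2 (app \<phi> u - app \<phi> v) x)\<^sup>2) \<le> ennreal ((rep_L2 (u - v) x)\<^sup>2)"
    using rep_app[OF \<phi>, of u] rep_app[OF \<phi>, of v] rep_L2_diff[of "app \<phi> u" "app \<phi> v"] rep_L2_diff[of u v]
  proof eventually_elim
    case (elim x)
    then show ?case using \<phi> by (auto simp: contraction_def abs_le_square_iff[symmetric] intro!: ennreal_leI)
  qed
qed

lemma app_eq_iff:
  assumes "contraction \<phi>"
  shows "app \<phi> u = u \<longleftrightarrow> (AE x in lebesgue. \<phi> (rep_L2 u x) = rep_L2 u x)"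
proof
  assume "app \<phi> u = u"
  then show "AE x in lebesgue. \<phi> (rep_L2 u x) = rep_L2 u x" using rep_app[OF assms, of u] by auto
next
  assume *: "AE x in lebesgue. \<phi> (rep_L2 u x) = rep_L2 u x"
  show "app \<phi> u = u"
    by (rule L2_eqI) (use * rep_app[OF assms, of u] in eventually_elim, simp)
qed

text \<open>Conditions of the form \<open>app \<phi> u = u\<close> are closed because
  \<open>app \<phi>\<close> is 1-Lipschitz. For \<open>max 0\<close> this is the positive cone, for
  the unit clip the functions between 0 and 1; so both properties pass to L^2 limits.\<close>

lemma app_fixed_limit:
  assumes \<phi>: "contraction \<phi>" and X: "\<And>n. app \<phi> (X n) = X n" "X \<longlonglongrightarrow> u"
  shows "app \<phi> u = u"
proof (rule LIMSEQ_unique)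
  have "(\<lambda>n. norm (X n - u)) \<longlonglongrightarrow> 0" using X(2) by (simp add: tendsto_norm_zero LIM_zero)
  then have "(\<lambda>n. app \<phi> (X n) - app \<phi> u) \<longlonglongrightarrow> 0"
    by (rule Lim_null_comparison[rotated]) (intro always_eventually allI app_lipschitz \<phi>)
  then show "X \<longlonglongrightarrow> app \<phi> u" using X(1) by (simp add: LIM_zero_iff)
qed (rule X)

lemma contractions:
  "contraction (\<lambda>a. max 0 (min 1 a))" "contraction (\<lambda>a. max 0 a)" "contraction abs"
  "0 \<le> K \<Longrightarrow> contraction (\<lambda>a. max 0 (min K a))"
  by (auto simp: contraction_def)

lemma clip_L2_eq_app: "clip_L2 u = app (\<lambda>a. max 0 (min 1 a)) u"
  using clip_L2.abs_eq[OF L2_rel_refl[OF square_integrable_rep_L2[of u]]]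
  by (simp add: class_rep_L2 app_def)

definition nonneg_L2 :: "L2 \<Rightarrow> bool" where
  "nonneg_L2 u \<longleftrightarrow> (AE x in lebesgue. 0 \<le> rep_L2 u x)"

lemma nonneg_L2_iff: "nonneg_L2 u \<longleftrightarrow> app (max 0) u = u"
proof -
  have "max 0 a = a \<longleftrightarrow> 0 \<le> a" for a :: real by linarith
  then show ?thesis unfolding app_eq_iff[OF contractions(2)] nonneg_L2_def by simp
qed

lemma nonneg_L2_limit: "(\<And>n. nonneg_L2 (X n)) \<Longrightarrow> X \<longlonglongrightarrow> u \<Longrightarrow> nonneg_L2 u"
  unfolding nonneg_L2_iff by (rule app_fixed_limit[OF contractions(2)])

lemma nonneg_L2_scale: "nonneg_L2 u \<Longrightarrow> 0 \<le> r \<Longrightarrow> nonneg_L2 (r *\<^sub>R u)"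
  unfolding nonneg_L2_def using rep_L2_scale[of r u] by (auto elim: AE_mp)

lemma ennreal_inner_L2:
  assumes "nonneg_L2 u" "nonneg_L2 v"
  shows "0 \<le> inner u v" "ennreal (inner u v) = (\<integral>\<^sup>+x. ennreal (rep_L2 u x) * ennreal (rep_L2 v x) \<partial>lebesgue)"
proof -
  have nn: "AE x in lebesgue. 0 \<le> rep_L2 u x * rep_L2 v x"
    using assms unfolding nonneg_L2_def by eventually_elim simp
  show "0 \<le> inner u v" unfolding inner_L2_eq by (rule integral_nonneg_AE[OF nn])
  have "ennreal (inner u v) = (\<integral>\<^sup>+x. ennreal (rep_L2 u x * rep_L2 v x) \<partial>lebesgue)"
    unfolding inner_L2_eq by (rule nn_integral_eq_integral[OF integrable_rep_L2_mult nn, symmetric])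
  also have "\<dots> = (\<integral>\<^sup>+x. ennreal (rep_L2 u x) * ennreal (rep_L2 v x) \<partial>lebesgue)"
    using assms unfolding nonneg_L2_def by (intro nn_integral_cong_AE) (auto simp: ennreal_mult elim: eventually_elim2)
  finally show "ennreal (inner u v) = (\<integral>\<^sup>+x. ennreal (rep_L2 u x) * ennreal (rep_L2 v x) \<partial>lebesgue)" .
qed

lemma square_integrable_indicator:
  assumes "A \<in> sets lebesgue" "emeasure lebesgue A < \<infinity>"
  shows "square_integrable (indicator A)"
proof -
  have "(\<lambda>x. (indicator A x :: real)\<^sup>2) = indicator A" by (auto simp: indicator_def)
  then show ?thesis using assms by (simp add: square_integrable_def integrable_indicator_iff)
qed

definition ind_L2 :: "real set \<Rightarrow> L2" where
  "ind_L2 A = class_L2 (indicator A)"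

lemma rep_ind_L2:
  "A \<in> sets lebesgue \<Longrightarrow> emeasure lebesgue A < \<infinity> \<Longrightarrow> AE x in lebesgue. rep_L2 (ind_L2 A) x = indicator A x"
  unfolding ind_L2_def by (intro rep_class_L2 square_integrable_indicator)

lemma nonneg_ind_L2: "A \<in> sets lebesgue \<Longrightarrow> emeasure lebesgue A < \<infinity> \<Longrightarrow> nonneg_L2 (ind_L2 A)"
  unfolding nonneg_L2_def by (drule (1) rep_ind_L2) (auto elim: eventually_mono)

lemma ennreal_inner_ind_L2:
  assumes "nonneg_L2 u" "A \<in> sets lebesgue" "emeasure lebesgue A < \<infinity>"
  shows "ennreal (inner u (ind_L2 A)) = (\<integral>\<^sup>+x\<in>A. ennreal (rep_L2 u x) \<partial>lebesgue)"
proof -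
  have "ennreal (inner u (ind_L2 A)) = (\<integral>\<^sup>+x. ennreal (rep_L2 u x) * ennreal (rep_L2 (ind_L2 A) x) \<partial>lebesgue)"
    by (rule ennreal_inner_L2(2)[OF assms(1) nonneg_ind_L2[OF assms(2,3)]])
  also have "\<dots> = (\<integral>\<^sup>+x\<in>A. ennreal (rep_L2 u x) \<partial>lebesgue)"
  proof (rule nn_integral_cong_AE)
    show "AE x in lebesgue. ennreal (rep_L2 u x) * ennreal (rep_L2 (ind_L2 A) x) = ennreal (rep_L2 u x) * indicator A x"
      using rep_ind_L2[OF assms(2,3)] by eventually_elim (simp add: indicator_def)
  qed
  finally show ?thesis .
qed

lemma emeasure_interval_finite: "emeasure lebesgue {- real n..real n} < \<infinity>"
  by simp

lemma emeasure_Int_interval_finite: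
  assumes "A \<in> sets lebesgue" shows "emeasure lebesgue (A \<inter> {- real n..real n}) < \<infinity>"
  by (rule le_less_trans[OF emeasure_mono emeasure_interval_finite[of n]]) auto

lemma nn_integral_SUP_interval:
  assumes [measurable]: "h \<in> borel_measurable lebesgue"
  shows "(\<integral>\<^sup>+x. h x \<partial>lebesgue) = (SUP n. \<integral>\<^sup>+x\<in>{- real n..real n}. h x \<partial>lebesgue)"
proof -
  have "(\<integral>\<^sup>+x. h x \<partial>lebesgue) = (\<integral>\<^sup>+x. (SUP n. h x * indicator {- real n..real n} x) \<partial>lebesgue)"
  proof (intro nn_integral_cong)
    fix x :: real
    obtain n where n: "\<bar>x\<bar> \<le> real n" using real_arch_simple by blast
    show "h x = (SUP n. h x * indicator {- real n..real n} x)"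
      by (intro antisym SUP_upper2[of n] SUP_least) (use n in \<open>auto simp: indicator_def abs_le_iff\<close>)
  qed
  also have "\<dots> = (SUP n. \<integral>\<^sup>+x\<in>{- real n..real n}. h x \<partial>lebesgue)"
  proof (rule nn_integral_monotone_convergence_SUP)
    show "incseq (\<lambda>n x. h x * indicator {- real n..real n} x)"
      by (auto intro!: incseq_SucI le_funI mult_left_mono simp: indicator_def)
  qed measurable
  finally show ?thesis .
qed

section \<open>Dirichlet forms and sub-Markov semigroups\<close>

locale dirichlet =
  fixes E :: "L2 \<Rightarrow> L2 \<Rightarrow> real" and F :: "L2 set"
  assumes dirichlet: "dirichlet_form E F"
begin

sublocale dense_form E F
  using dirichlet by unfold_locales (auto simp: dirichlet_form_def)

lemma clip:
  assumes "u \<in> F"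
  shows "clip_L2 u \<in> F" "E (clip_L2 u) (clip_L2 u) \<le> E u u"
  using dirichlet assms by (auto simp: dirichlet_form_def)

abbreviation clips :: "L2 \<Rightarrow> L2" where "clips \<equiv> app (\<lambda>a. max 0 (min 1 a))"

lemma resolv_clip:
  assumes h: "0 < h" and f: "clips f = f"
  shows "clips (resolv h f) = resolv h f"
proof -
  let ?u = "resolv h f" and ?v = "clips (resolv h f)"
  have u: "?u \<in> F" by (rule resolv_in[OF h])
  have v: "?v \<in> F" and Ev: "E ?v ?v \<le> E ?u ?u"
    using clip[OF u] by (simp_all add: clip_L2_eq_app)
  have "norm (?v - f) \<le> norm (?u - f)"
    using app_lipschitz[OF contractions(1), of ?u f] f by simp
  then have "(norm (?v - f))\<^sup>2 \<le> (norm (?u - f))\<^sup>2" by (intro power_mono) auto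
  then have n: "inner ?v ?v - 2 * inner f ?v \<le> inner ?u ?u - 2 * inner f ?u"
    by (simp add: power2_norm_eq_inner inner_diff_left inner_diff_right inner_commute)
  have "inner ?u (?v - ?u) + h * E ?u (?v - ?u) = inner f (?v - ?u)"
    by (rule resolv_eq[OF h]) (use u v in auto)
  then have e: "inner ?u ?v - inner ?u ?u + h * (E ?u ?v - E ?u ?u) = inner f ?v - inner f ?u"
    by (simp add: inner_diff_right form.diff_right u v)
  have "h * E ?v ?v \<le> h * E ?u ?u" using Ev h by simp
  moreover have "inner (?v - ?u) (?v - ?u) = inner ?v ?v - 2 * inner ?u ?v + inner ?u ?u"
    by (simp add: inner_diff_left inner_diff_right inner_commute)
  moreover have "h * E (?v - ?u) (?v - ?u) = h * E ?v ?v - 2 * (h * E ?u ?v) + h * E ?u ?u"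
    unfolding form.quad_diff[OF v u] form.sym[OF v u] by (simp add: algebra_simps)
  moreover have "0 \<le> h * E (?v - ?u) (?v - ?u)"
    using h form.nonneg[OF form.V_diff[OF v u]] by simp
  ultimately have "inner (?v - ?u) (?v - ?u) \<le> 0"
    using n e by (simp add: algebra_simps)
  then have "inner (?v - ?u) (?v - ?u) = 0" using inner_ge_zero by (rule antisym)
  then show ?thesis by simp
qed

lemma funpow_clip: "(\<And>f. clips f = f \<Longrightarrow> clips (P f) = P f) \<Longrightarrow> clips f = f \<Longrightarrow> clips ((P ^^ n) f) = (P ^^ n) f"
  by (induction n) auto

lemma sg_clip:
  assumes t: "0 < t" and f: "clips f = f"
  shows "clips (sg t f) = sg t f"
proof (rule app_fixed_limit[OF contractions(1) _ approx_tendsto[OF t]])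
  show "clips (approx n t f) = approx n t f" for n
    unfolding approx_def by (rule funpow_clip[OF resolv_clip f]) (use t in simp)
qed

text \<open>A nonnegative \<open>f\<close> is the L^2 limit of its truncations at height n + 1, and
  each truncation is a multiple of a function between 0 and 1.\<close>

lemma nonneg_of_clip:
  assumes S: "contr S" and cl: "\<And>f. clips f = f \<Longrightarrow> clips (S f) = S f" and f: "nonneg_L2 f"
  shows "nonneg_L2 (S f)"
proof -
  define X where "X n = app (\<lambda>a. max 0 (min (real (Suc n)) a)) f" for n
  have cK: "contraction (\<lambda>a. max 0 (min (real (Suc n)) a))" for n by (rule contractions) simp
  have rX: "AE x in lebesgue. rep_L2 (X n) x = max 0 (min (real (Suc n)) (rep_L2 f x))" for n
    unfolding X_def by (rule rep_app[OF cK])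
  have "nonneg_L2 (S (X n))" for n
  proof -
    let ?g = "(1 / real (Suc n)) *\<^sub>R X n"
    have "clips ?g = ?g"
      unfolding app_eq_iff[OF contractions(1)]
      using rX[of n] rep_L2_scale[of "1 / real (Suc n)" "X n"]
    proof eventually_elim
      case (elim x)
      have "0 \<le> rep_L2 (X n) x" "rep_L2 (X n) x \<le> real (Suc n)" unfolding elim(1) by auto
      then have "0 \<le> rep_L2 ?g x" "rep_L2 ?g x \<le> 1" unfolding elim(2) by (simp_all add: divide_le_eq)
      then show ?case by simp
    qed
    then have "clips (S ?g) = S ?g" by (rule cl)
    then have "nonneg_L2 (S ?g)"
      unfolding app_eq_iff[OF contractions(1)] nonneg_L2_def by eventually_elim (auto simp: max_def min_def split: if_splits)
    then have "nonneg_L2 (real (Suc n) *\<^sub>R S ?g)" by (rule nonneg_L2_scale) simp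
    then show ?thesis using contr_linear[OF S] by (simp add: linear_scale)
  qed
  moreover have "X \<longlonglongrightarrow> f"
  proof -
    have "(\<lambda>n. \<integral>\<^sup>+x. ennreal ((rep_L2 (X n - f) x)\<^sup>2) \<partial>lebesgue) \<longlonglongrightarrow> (\<integral>\<^sup>+x. 0 \<partial>(lebesgue::real measure))"
    proof (rule nn_integral_dominated_convergence[where w = "\<lambda>x. ennreal ((rep_L2 f x)\<^sup>2)"])
      show "AE x in lebesgue. ennreal ((rep_L2 (X n - f) x)\<^sup>2) \<le> ennreal ((rep_L2 f x)\<^sup>2)" for n
        using rX[of n] rep_L2_diff[of "X n" f]
        by eventually_elim (auto simp: abs_le_square_iff[symmetric] intro!: ennreal_leI)
      show "(\<integral>\<^sup>+x. ennreal ((rep_L2 f x)\<^sup>2) \<partial>lebesgue) < \<infinity>"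
        unfolding norm_L2_eq_nn_integral[symmetric] by simp
      have "AE x in lebesgue. \<forall>n. rep_L2 (X n - f) x = max 0 (min (real (Suc n)) (rep_L2 f x)) - rep_L2 f x"
        unfolding AE_all_countable
      proof
        fix n show "AE x in lebesgue. rep_L2 (X n - f) x = max 0 (min (real (Suc n)) (rep_L2 f x)) - rep_L2 f x"
          using rX[of n] rep_L2_diff[of "X n" f] by eventually_elim simp
      qed
      with f show "AE x in lebesgue. (\<lambda>n. ennreal ((rep_L2 (X n - f) x)\<^sup>2)) \<longlonglongrightarrow> 0"
        unfolding nonneg_L2_def
      proof eventually_elim
        case (elim x)
        obtain N where "rep_L2 f x \<le> real N" using real_arch_simple by blast
        then have "rep_L2 (X n - f) x = 0" if "n \<ge> N" for n
          using elim that by (simp add: max_def min_def)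
        then show ?case by (intro tendsto_eventually) (auto simp: eventually_sequentially)
      qed
    qed auto
    then have "(\<lambda>n. ennreal ((norm (X n - f))\<^sup>2)) \<longlonglongrightarrow> ennreal 0"
      by (simp add: norm_L2_eq_nn_integral)
    then have "(\<lambda>n. (norm (X n - f))\<^sup>2) \<longlonglongrightarrow> 0" by (subst (asm) tendsto_ennreal_iff) auto
    then have "(\<lambda>n. sqrt ((norm (X n - f))\<^sup>2)) \<longlonglongrightarrow> sqrt 0" by (intro tendsto_intros)
    then have "(\<lambda>n. norm (X n - f)) \<longlonglongrightarrow> 0" by simp
    then show ?thesis by (simp add: tendsto_norm_zero_iff LIM_zero_iff)
  qed
  then have "(\<lambda>n. norm (X n - f)) \<longlonglongrightarrow> 0" by (simp add: tendsto_norm_zero_iff LIM_zero_iff)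
  then have "(\<lambda>n. S (X n) - S f) \<longlonglongrightarrow> 0"
    by (rule Lim_null_comparison[rotated]) (intro always_eventually allI contr_dist S)
  then have "(\<lambda>n. S (X n)) \<longlonglongrightarrow> S f" by (simp add: LIM_zero_iff)
  ultimately show ?thesis by (rule nonneg_L2_limit)
qed

lemma sg_nonneg: "0 < t \<Longrightarrow> nonneg_L2 f \<Longrightarrow> nonneg_L2 (sg t f)"
  by (rule nonneg_of_clip[OF sg_contr sg_clip])

lemma resolv_nonneg: "0 < h \<Longrightarrow> nonneg_L2 f \<Longrightarrow> nonneg_L2 (resolv h f)"
  by (rule nonneg_of_clip[OF resolv_contr resolv_clip])

lemma Res_nonneg: "0 < a \<Longrightarrow> nonneg_L2 f \<Longrightarrow> nonneg_L2 (Res a f)"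
  unfolding Res_def by (intro nonneg_L2_scale resolv_nonneg) auto

text \<open>Duality: for an interval I, the integral of S|u| over I equals (|u|, S 1_I), and S 1_I
  is between 0 and 1. Positivity of S gives |S u| \<le> S|u|, obtained from \<open>w + u\<close> and
  \<open>w - u\<close>.\<close>

lemma L1_contr_of_clip:
  assumes S: "contr S" and cl: "\<And>f. clips f = f \<Longrightarrow> clips (S f) = S f"
    and sym: "\<And>f g. inner (S f) g = inner f (S g)"
  shows "(\<integral>\<^sup>+x. ennreal \<bar>rep_L2 (S u) x\<bar> \<partial>lebesgue) \<le> (\<integral>\<^sup>+x. ennreal \<bar>rep_L2 u x\<bar> \<partial>lebesgue)"
proof -
  define w where "w = app abs u"
  have w: "AE x in lebesgue. rep_L2 w x = \<bar>rep_L2 u x\<bar>" unfolding w_def by (rule rep_app[OF contractions(3)])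
  then have nw: "nonneg_L2 w" unfolding nonneg_L2_def by eventually_elim simp
  have "nonneg_L2 (w + u)" "nonneg_L2 (w - u)"
    unfolding nonneg_L2_def
    subgoal using w rep_L2_add[of w u] by eventually_elim simp
    subgoal using w rep_L2_diff[of w u] by eventually_elim simp
    done
  then have "nonneg_L2 (S w + S u)" "nonneg_L2 (S w - S u)"
    using nonneg_of_clip[OF S cl, of "w + u"] nonneg_of_clip[OF S cl, of "w - u"]
    by (simp_all add: linear_add[OF contr_linear[OF S]] linear_diff[OF contr_linear[OF S]])
  then have *: "AE x in lebesgue. \<bar>rep_L2 (S u) x\<bar> \<le> rep_L2 (S w) x"
    unfolding nonneg_L2_def using rep_L2_add[of "S w" "S u"] rep_L2_diff[of "S w" "S u"]
    by eventually_elim auto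
  have nSw: "nonneg_L2 (S w)" by (rule nonneg_of_clip[OF S cl nw])
  have "(\<integral>\<^sup>+x. ennreal \<bar>rep_L2 (S u) x\<bar> \<partial>lebesgue) \<le> (\<integral>\<^sup>+x. ennreal (rep_L2 (S w) x) \<partial>lebesgue)"
    using * by (intro nn_integral_mono_AE) (auto elim: eventually_mono intro: ennreal_leI)
  also have "\<dots> = (SUP n. \<integral>\<^sup>+x\<in>{- real n..real n}. ennreal (rep_L2 (S w) x) \<partial>lebesgue)"
    by (rule nn_integral_SUP_interval) simp
  also have "\<dots> \<le> (\<integral>\<^sup>+x. ennreal (rep_L2 w x) \<partial>lebesgue)"
  proof (intro SUP_least)
    fix n :: nat
    let ?i = "ind_L2 {- real n..real n}"
    have "clips ?i = ?i"
      unfolding app_eq_iff[OF contractions(1)]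
      using rep_ind_L2[of "{- real n..real n}"] by (auto simp: indicator_def elim: eventually_mono)
    then have "clips (S ?i) = S ?i" by (rule cl)
    then have b: "AE x in lebesgue. 0 \<le> rep_L2 (S ?i) x \<and> rep_L2 (S ?i) x \<le> 1"
      unfolding app_eq_iff[OF contractions(1)] by eventually_elim (auto simp: max_def min_def split: if_splits)
    then have nS: "nonneg_L2 (S ?i)" unfolding nonneg_L2_def by eventually_elim simp
    have "(\<integral>\<^sup>+x\<in>{- real n..real n}. ennreal (rep_L2 (S w) x) \<partial>lebesgue) = ennreal (inner (S w) ?i)"
      by (rule ennreal_inner_ind_L2[symmetric, OF nSw]) auto
    also have "\<dots> = ennreal (inner w (S ?i))" by (simp only: sym)
    also have "\<dots> = (\<integral>\<^sup>+x. ennreal (rep_L2 w x) * ennreal (rep_L2 (S ?i) x) \<partial>lebesgue)"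
      by (rule ennreal_inner_L2(2)[OF nw nS])
    also have "\<dots> \<le> (\<integral>\<^sup>+x. ennreal (rep_L2 w x) \<partial>lebesgue)"
    proof (rule nn_integral_mono_AE)
      show "AE x in lebesgue. ennreal (rep_L2 w x) * ennreal (rep_L2 (S ?i) x) \<le> ennreal (rep_L2 w x)"
        using b
      proof eventually_elim
        case (elim x)
        then show ?case using mult_left_mono[of "ennreal (rep_L2 (S ?i) x)" 1 "ennreal (rep_L2 w x)"] by simp
      qed
    qed
    finally show "(\<integral>\<^sup>+x\<in>{- real n..real n}. ennreal (rep_L2 (S w) x) \<partial>lebesgue) \<le> (\<integral>\<^sup>+x. ennreal (rep_L2 w x) \<partial>lebesgue)" .
  qed
  also have "\<dots> = (\<integral>\<^sup>+x. ennreal \<bar>rep_L2 u x\<bar> \<partial>lebesgue)"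
    using w by (intro nn_integral_cong_AE) (auto elim: eventually_mono)
  finally show ?thesis .
qed

lemma sg_L1_contr: "0 < t \<Longrightarrow>
    (\<integral>\<^sup>+x. ennreal \<bar>rep_L2 (sg t u) x\<bar> \<partial>lebesgue) \<le> (\<integral>\<^sup>+x. ennreal \<bar>rep_L2 u x\<bar> \<partial>lebesgue)"
  by (rule L1_contr_of_clip[OF sg_contr sg_clip sg_sym])

section \<open>Jointly measurable versions and Green functions\<close>

text \<open>Time is discretized on grids of mesh \<open>d k\<close>. The mesh is chosen so that the
  L^2 error is below 2^(-k) uniformly in \<open>t\<close>, by contractivity; the squared errors are
  then summable, which forces convergence almost everywhere for every \<open>t\<close>.\<close>

lemma ex_version:
  "\<exists>p\<in>borel_measurable (lebesgue \<Otimes>\<^sub>M lebesgue). \<forall>t>0. AE x in lebesgue. p (t, x) = rep_L2 (sg t f) x"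
proof -
  have "\<exists>d>0. \<forall>h. 0 < h \<and> h \<le> d \<longrightarrow> norm (sg h f - f) < (1/2) ^ k" for k :: nat
  proof -
    have "\<forall>\<^sub>F h in at_right 0. dist (sg h f) f < (1/2) ^ k"
      by (rule tendstoD[OF sg_tendsto_0]) simp
    then obtain b where "b > 0" "\<And>h. 0 < h \<Longrightarrow> h < b \<Longrightarrow> norm (sg h f - f) < (1/2) ^ k"
      by (auto simp: eventually_at_right_field dist_norm)
    then show ?thesis by (intro exI[of _ "b/2"]) auto
  qed
  then obtain d where d: "\<And>k::nat. d k > 0" "\<And>k h. 0 < h \<Longrightarrow> h \<le> d k \<Longrightarrow> norm (sg h f - f) < (1/2) ^ k"
    by metis
  \<comment> \<open>\<open>s k t\<close> is the grid point strictly to the right of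
    \<open>t\<close>, so that \<open>s k t - t\<close> is a positive time at which the choice of
    \<open>d k\<close> applies.\<close>
  define s where "s k t = d k * (of_int \<lfloor>t / d k\<rfloor> + 1)" for k :: nat and t :: real
  have s: "t < s k t" "s k t \<le> t + d k" for k :: nat and t :: real
  proof -
    have fl: "t / d k < of_int \<lfloor>t / d k\<rfloor> + 1" "of_int \<lfloor>t / d k\<rfloor> \<le> t / d k" by linarith+
    have "t < d k * (of_int \<lfloor>t / d k\<rfloor> + 1)" "d k * of_int \<lfloor>t / d k\<rfloor> \<le> t"
      using mult_strict_left_mono[OF fl(1) d(1)[of k]] mult_left_mono[OF fl(2) less_imp_le[OF d(1)[of k]]]
        d(1)[of k] by simp_all
    then show "t < s k t" "s k t \<le> t + d k" by (simp_all add: s_def distrib_left)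
  qed
  define q where "q k \<omega> = rep_L2 (sg (s k (fst \<omega>)) f) (snd \<omega>)" for k and \<omega> :: "real \<times> real"
  \<comment> \<open>In \<open>t\<close>, only the integer part of \<open>t / d k\<close> enters;
    there are countably many cells, with a fixed measurable function of \<open>x\<close> on
    each.\<close>
  have q_meas [measurable]: "q k \<in> borel_measurable (lebesgue \<Otimes>\<^sub>M lebesgue)" for k
  proof -
    have "(\<lambda>\<omega>. (\<lambda>i \<omega>. rep_L2 (sg (d k * (of_int i + 1)) f) (snd \<omega>)) \<lfloor>fst \<omega> / d k\<rfloor> \<omega>)
      \<in> borel_measurable (lebesgue \<Otimes>\<^sub>M (lebesgue :: real measure))"
    proof (rule measurable_compose_countable)
      show "(\<lambda>\<omega>. \<lfloor>fst \<omega> / d k\<rfloor>) \<in> (lebesgue \<Otimes>\<^sub>M (lebesgue :: real measure)) \<rightarrow>\<^sub>M count_space UNIV"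
        by measurable
    qed measurable
    then show ?thesis by (simp add: q_def[abs_def] s_def)
  qed
  define p where "p \<omega> = lim (\<lambda>k. q k \<omega>)" for \<omega>
  have "p \<in> borel_measurable (lebesgue \<Otimes>\<^sub>M lebesgue)"
    unfolding p_def by (intro borel_measurable_lim_metric) auto
  moreover have "AE x in lebesgue. p (t, x) = rep_L2 (sg t f) x" if t: "0 < t" for t
  proof -
    have n: "norm (sg (s k t) f - sg t f) \<le> (1/2) ^ k" for k
      using norm_sg_diff[OF t s(1)[where k = k and t = t], of f] d(2)[where h = "s k t - t" and k = k] s[where k = k and t = t] by simp
    define D where "D k x = (rep_L2 (sg (s k t) f - sg t f) x)\<^sup>2" for k x
    have [measurable]: "D k \<in> borel_measurable lebesgue" for k unfolding D_def by measurable
    have "(\<integral>\<^sup>+x. (\<Sum>k. ennreal (D k x)) \<partial>lebesgue) = (\<Sum>k. \<integral>\<^sup>+x. ennreal (D k x) \<partial>lebesgue)"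
      by (rule nn_integral_suminf) simp
    also have "\<dots> \<le> (\<Sum>k. ennreal ((1/2) ^ k))"
    proof (intro suminf_le)
      fix k
      have "(norm (sg (s k t) f - sg t f))\<^sup>2 \<le> ((1/2) ^ k)\<^sup>2" by (intro power_mono n) auto
      also have "\<dots> \<le> (1/2) ^ k"
        using power_le_one[of "1/2::real" k] by (simp add: power2_eq_square mult_left_le)
      finally show "(\<integral>\<^sup>+x. ennreal (D k x) \<partial>lebesgue) \<le> ennreal ((1/2) ^ k)"
        unfolding D_def norm_L2_eq_nn_integral[symmetric] by (rule ennreal_leI)
    qed auto
    also have "\<dots> < \<infinity>" by (subst suminf_ennreal2) auto
    finally have "AE x in lebesgue. (\<Sum>k. ennreal (D k x)) \<noteq> \<infinity>"
      by (intro nn_integral_PInf_AE) auto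
    moreover have "AE x in lebesgue. \<forall>k. rep_L2 (sg (s k t) f - sg t f) x = rep_L2 (sg (s k t) f) x - rep_L2 (sg t f) x"
      unfolding AE_all_countable by (intro allI rep_L2_diff)
    ultimately show ?thesis
    proof eventually_elim
      case (elim x)
      have "summable (\<lambda>k. D k x)"
        by (rule summable_suminf_not_top) (use elim in \<open>auto simp: D_def\<close>)
      then have "(\<lambda>k. D k x) \<longlonglongrightarrow> 0" by (rule summable_LIMSEQ_zero)
      then have "(\<lambda>k. sqrt (D k x)) \<longlonglongrightarrow> sqrt 0" by (intro tendsto_intros)
      then have "(\<lambda>k. \<bar>q k (t, x) - rep_L2 (sg t f) x\<bar>) \<longlonglongrightarrow> 0"
        using elim(2) by (simp add: D_def q_def)
      then have "(\<lambda>k. q k (t, x)) \<longlonglongrightarrow> rep_L2 (sg t f) x"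
        by (simp add: tendsto_rabs_zero_iff LIM_zero_iff)
      then show ?case by (simp add: p_def limI)
    qed
  qed
  ultimately show ?thesis by blast
qed

definition version :: "L2 \<Rightarrow> real \<times> real \<Rightarrow> real" where
  "version f = (SOME p. p \<in> borel_measurable (lebesgue \<Otimes>\<^sub>M lebesgue) \<and>
     (\<forall>t>0. AE x in lebesgue. p (t, x) = rep_L2 (sg t f) x))"

lemma version:
  shows version_measurable [measurable]: "version f \<in> borel_measurable (lebesgue \<Otimes>\<^sub>M lebesgue)"
    and version_AE: "0 < t \<Longrightarrow> AE x in lebesgue. version f (t, x) = rep_L2 (sg t f) x"
proof -
  have "\<exists>p. p \<in> borel_measurable (lebesgue \<Otimes>\<^sub>M lebesgue) \<and>
     (\<forall>t>0. AE x in lebesgue. p (t, x) = rep_L2 (sg t f) x)" using ex_version[of f] by blast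
  from someI_ex[OF this] show "version f \<in> borel_measurable (lebesgue \<Otimes>\<^sub>M lebesgue)"
    "0 < t \<Longrightarrow> AE x in lebesgue. version f (t, x) = rep_L2 (sg t f) x"
    by (auto simp: version_def)
qed

definition Green :: "L2 \<Rightarrow> real \<Rightarrow> ennreal" where
  "Green f x = (\<integral>\<^sup>+t\<in>{0<..}. ennreal (version f (t, x)) \<partial>lebesgue)"

lemma Green_measurable [measurable]: "Green f \<in> borel_measurable lebesgue"
proof -
  have "(\<lambda>\<omega>. ennreal (version f (snd \<omega>, fst \<omega>)) * indicator {0<..} (snd \<omega>))
      \<in> borel_measurable (lebesgue \<Otimes>\<^sub>M lebesgue)"
    by measurable
  from lebesgue.borel_measurable_nn_integral_fst[OF this] show ?thesis
    by (simp add: Green_def[abs_def])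
qed

text \<open>Tonelli reduces the pairing to the time integral of (T_t f, g), which resolvents
  compute. All later information on Green functions comes through this identity.\<close>

lemma Green_pairing:
  assumes f: "nonneg_L2 f" and g: "nonneg_L2 g"
  shows "(\<integral>\<^sup>+x. ennreal (rep_L2 g x) * Green f x \<partial>lebesgue) = (SUP a\<in>{0<..}. ennreal (inner (Res a f) g))"
proof -
  have "(\<integral>\<^sup>+x. ennreal (rep_L2 g x) * Green f x \<partial>lebesgue)
      = (\<integral>\<^sup>+x. \<integral>\<^sup>+t. ennreal (rep_L2 g x) * (ennreal (version f (t, x)) * indicator {0<..} t) \<partial>lebesgue \<partial>lebesgue)"
    unfolding Green_def by (intro nn_integral_cong nn_integral_cmult[symmetric]) measurable
  also have "\<dots> = (\<integral>\<^sup>+t. \<integral>\<^sup>+x. ennreal (rep_L2 g x) * (ennreal (version f (t, x)) * indicator {0<..} t) \<partial>lebesgue \<partial>lebesgue)"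
    using lebesgue_pair.Fubini'[of "\<lambda>x t. ennreal (rep_L2 g x) * (ennreal (version f (t, x)) * indicator {0<..} t)"]
    by (simp add: case_prod_beta')
  also have "\<dots> = (\<integral>\<^sup>+t\<in>{0<..}. ennreal (inner (sg t f) g) \<partial>lebesgue)"
  proof (intro nn_integral_cong)
    fix t :: real
    show "(\<integral>\<^sup>+x. ennreal (rep_L2 g x) * (ennreal (version f (t, x)) * indicator {0<..} t) \<partial>lebesgue)
        = ennreal (inner (sg t f) g) * indicator {0<..} t"
    proof (cases "0 < t")
      case True
      have "(\<integral>\<^sup>+x. ennreal (rep_L2 g x) * (ennreal (version f (t, x)) * indicator {0<..} t) \<partial>lebesgue)
          = (\<integral>\<^sup>+x. ennreal (rep_L2 (sg t f) x) * ennreal (rep_L2 g x) \<partial>lebesgue)"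
        using version_AE[OF True, of f] True
        by (intro nn_integral_cong_AE) (auto elim!: eventually_mono simp: mult.commute)
      also have "\<dots> = ennreal (inner (sg t f) g)"
        by (rule ennreal_inner_L2(2)[symmetric, OF sg_nonneg[OF True f] g])
      finally show ?thesis using True by simp
    qed simp
  qed
  also have "\<dots> = (SUP a\<in>{0<..}. ennreal (inner (Res a f) g))"
    by (rule nn_integral_sg) (intro ennreal_inner_L2 sg_nonneg f g)
  finally show ?thesis .
qed

end

section \<open>Evolution and Green functions of integrable functions\<close>

context dirichlet
begin

definition layer :: "(real \<Rightarrow> real) \<Rightarrow> nat \<Rightarrow> L2" where
  "layer f k = class_L2 (\<lambda>x. min (f x) (real (Suc k)) - min (f x) (real k))"

text \<open>
  An integrable \<open>f \<ge> 0\<close> is the sum of its layers, which are also square-integrable. Summing the versions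
  of their evolutions gives a version of the evolution of \<open>f\<close> that is monotone in the partial sums
  at every point, not only almost everywhere.
\<close>

definition L1_version :: "(real \<Rightarrow> real) \<Rightarrow> real \<times> real \<Rightarrow> real" where
  "L1_version f \<omega> = enn2real (\<Sum>k. ennreal (version (layer f k) \<omega>))"

lemma L1_version_measurable [measurable]: "L1_version f \<in> borel_measurable (lebesgue \<Otimes>\<^sub>M lebesgue)"
  unfolding L1_version_def[abs_def] by measurable

lemma L1_version_nonneg: "0 \<le> L1_version f \<omega>"
  by (simp add: L1_version_def)

context
  fixes f :: "real \<Rightarrow> real"
  assumes f: "integrable lebesgue f" "\<And>x. 0 \<le> f x"
begin

lemma f_meas [measurable]: "f \<in> borel_measurable lebesgue"
  using f(1) by (rule borel_measurable_integrable)

lemma rep_layer: "AE x in lebesgue. rep_L2 (layer f k) x = min (f x) (real (Suc k)) - min (f x) (real k)"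
  unfolding layer_def
proof (rule rep_class_L2)
  let ?g = "\<lambda>x. min (f x) (real (Suc k)) - min (f x) (real k)"
  have "integrable lebesgue (\<lambda>x. (?g x)\<^sup>2)"
  proof (rule Bochner_Integration.integrable_bound[OF f(1)])
    show "AE x in lebesgue. norm ((?g x)\<^sup>2) \<le> norm (f x)"
    proof (intro AE_I2)
      fix x
      have "0 \<le> ?g x" "?g x \<le> 1" "?g x \<le> f x" using f(2)[of x] by auto
      then have "(?g x)\<^sup>2 \<le> f x" using mult_mono[of "?g x" 1 "?g x" "f x"] by (simp add: power2_eq_square)
      then show "norm ((?g x)\<^sup>2) \<le> norm (f x)" using f(2)[of x] by simp
    qed
  qed measurable
  then show "square_integrable ?g" by (simp add: square_integrable_def)
qed

lemma nonneg_layer: "nonneg_L2 (layer f k)"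
  unfolding nonneg_L2_def using rep_layer[of k] by eventually_elim auto

lemma rep_sum_layer: "AE x in lebesgue. rep_L2 (\<Sum>k<n. layer f k) x = min (f x) (real n)"
proof -
  have "AE x in lebesgue. \<forall>k. rep_L2 (layer f k) x = min (f x) (real (Suc k)) - min (f x) (real k)"
    unfolding AE_all_countable by (intro allI rep_layer)
  then show ?thesis using rep_L2_sum[of "layer f" n]
  proof eventually_elim
    case (elim x)
    then show ?case
      using sum_lessThan_telescope[of "\<lambda>k. min (f x) (real k)" n] f(2)[of x] by simp
  qed
qed

lemma suminf_nn_integral_layer: "(\<Sum>k. \<integral>\<^sup>+x. ennreal (rep_L2 (layer f k) x) \<partial>lebesgue) \<le> (\<integral>\<^sup>+x. ennreal (f x) \<partial>lebesgue)"
  unfolding suminf_eq_SUP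
proof (intro SUP_least)
  fix n
  have "(\<Sum>k<n. \<integral>\<^sup>+x. ennreal (rep_L2 (layer f k) x) \<partial>lebesgue) = (\<integral>\<^sup>+x. (\<Sum>k<n. ennreal (rep_L2 (layer f k) x)) \<partial>lebesgue)"
    by (rule nn_integral_sum[symmetric]) measurable
  also have "\<dots> \<le> (\<integral>\<^sup>+x. ennreal (f x) \<partial>lebesgue)"
  proof (rule nn_integral_mono_AE)
    have "AE x in lebesgue. \<forall>k. 0 \<le> rep_L2 (layer f k) x"
      unfolding AE_all_countable using nonneg_layer by (simp add: nonneg_L2_def)
    then show "AE x in lebesgue. (\<Sum>k<n. ennreal (rep_L2 (layer f k) x)) \<le> ennreal (f x)"
      using rep_sum_layer[of n] rep_L2_sum[of "layer f" n]
      by eventually_elim (auto simp: sum_ennreal intro!: ennreal_leI)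
  qed
  finally show "(\<Sum>k<n. \<integral>\<^sup>+x. ennreal (rep_L2 (layer f k) x) \<partial>lebesgue) \<le> (\<integral>\<^sup>+x. ennreal (f x) \<partial>lebesgue)" .
qed

lemma nn_integral_f: "(\<integral>\<^sup>+x. ennreal (f x) \<partial>lebesgue) < \<infinity>"
  using f by (simp add: nn_integral_eq_integral)

lemma suminf_version_finite:
  assumes t: "0 < t"
  shows "AE x in lebesgue. (\<Sum>k. ennreal (version (layer f k) (t, x))) < \<infinity>"
proof -
  have "(\<integral>\<^sup>+x. (\<Sum>k. ennreal (version (layer f k) (t, x))) \<partial>lebesgue)
      = (\<Sum>k. \<integral>\<^sup>+x. ennreal (version (layer f k) (t, x)) \<partial>lebesgue)"
    by (rule nn_integral_suminf) measurable
  also have "\<dots> \<le> (\<Sum>k. \<integral>\<^sup>+x. ennreal (rep_L2 (layer f k) x) \<partial>lebesgue)"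
  proof (intro suminf_le)
    fix k
    have "(\<integral>\<^sup>+x. ennreal (version (layer f k) (t, x)) \<partial>lebesgue) \<le> (\<integral>\<^sup>+x. ennreal \<bar>rep_L2 (sg t (layer f k)) x\<bar> \<partial>lebesgue)"
      using version_AE[OF t, of "layer f k"] by (intro nn_integral_mono_AE) (auto elim!: eventually_mono intro: ennreal_leI)
    also have "\<dots> \<le> (\<integral>\<^sup>+x. ennreal \<bar>rep_L2 (layer f k) x\<bar> \<partial>lebesgue)" by (rule sg_L1_contr[OF t])
    also have "\<dots> = (\<integral>\<^sup>+x. ennreal (rep_L2 (layer f k) x) \<partial>lebesgue)"
      using nonneg_layer[of k] unfolding nonneg_L2_def by (intro nn_integral_cong_AE) (auto elim!: eventually_mono)
    finally show "(\<integral>\<^sup>+x. ennreal (version (layer f k) (t, x)) \<partial>lebesgue) \<le> (\<integral>\<^sup>+x. ennreal (rep_L2 (layer f k) x) \<partial>lebesgue)" .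
  qed auto
  also have "\<dots> < \<infinity>" using suminf_nn_integral_layer nn_integral_f by (rule le_less_trans)
  finally have "AE x in lebesgue. (\<Sum>k. ennreal (version (layer f k) (t, x))) \<noteq> \<infinity>"
    by (intro nn_integral_PInf_AE) auto
  then show ?thesis by (simp add: less_top)
qed

lemma L1_version_tendsto:
  assumes t: "0 < t"
  shows "AE x in lebesgue. (\<lambda>n. rep_L2 (sg t (\<Sum>k<n. layer f k)) x) \<longlonglongrightarrow> L1_version f (t, x)"
proof -
  have "AE x in lebesgue. \<forall>k. version (layer f k) (t, x) = rep_L2 (sg t (layer f k)) x \<and> 0 \<le> rep_L2 (sg t (layer f k)) x"
    unfolding AE_all_countable
    using version_AE[OF t] sg_nonneg[OF t nonneg_layer] by (auto simp: nonneg_L2_def)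
  moreover have "AE x in lebesgue. \<forall>n. rep_L2 (sg t (\<Sum>k<n. layer f k)) x = (\<Sum>k<n. rep_L2 (sg t (layer f k)) x)"
    unfolding AE_all_countable
  proof
    fix n show "AE x in lebesgue. rep_L2 (sg t (\<Sum>k<n. layer f k)) x = (\<Sum>k<n. rep_L2 (sg t (layer f k)) x)"
      using rep_L2_sum[of "\<lambda>k. sg t (layer f k)" n] by (simp add: linear_sum[OF contr_linear[OF sg_contr[OF t]]])
  qed
  ultimately show ?thesis using suminf_version_finite[OF t]
  proof eventually_elim
    case (elim x)
    have "summable (\<lambda>k. version (layer f k) (t, x))"
      by (rule summable_suminf_not_top) (use elim in auto)
    then have s: "(\<lambda>k. version (layer f k) (t, x)) sums (\<Sum>k. version (layer f k) (t, x))" by (rule summable_sums)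
    moreover have "L1_version f (t, x) = (\<Sum>k. version (layer f k) (t, x))"
      unfolding L1_version_def using elim s by (subst suminf_ennreal2) (auto simp: sums_iff suminf_nonneg)
    ultimately show ?case using elim by (simp add: sums_def)
  qed
qed

text \<open>Fatou along the partial sums of layers. Partial sums are truncations of
  \<open>f\<close>, and the semigroup contracts L^1 distances between them.\<close>

lemma L1_version_tail:
  assumes t: "0 < t"
  shows "(\<integral>\<^sup>+x. ennreal \<bar>L1_version f (t, x) - rep_L2 (sg t (\<Sum>k<n. layer f k)) x\<bar> \<partial>lebesgue)
    \<le> (\<integral>\<^sup>+x. ennreal (f x - min (f x) (real n)) \<partial>lebesgue)"
proof -
  define s where "s m = (\<Sum>k<m. layer f k)" for m :: nat
  have "(\<integral>\<^sup>+x. ennreal \<bar>L1_version f (t, x) - rep_L2 (sg t (s n)) x\<bar> \<partial>lebesgue)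
     = (\<integral>\<^sup>+x. liminf (\<lambda>m. ennreal \<bar>rep_L2 (sg t (s m)) x - rep_L2 (sg t (s n)) x\<bar>) \<partial>lebesgue)"
  proof (rule nn_integral_cong_AE)
    show "AE x in lebesgue. ennreal \<bar>L1_version f (t, x) - rep_L2 (sg t (s n)) x\<bar>
        = liminf (\<lambda>m. ennreal \<bar>rep_L2 (sg t (s m)) x - rep_L2 (sg t (s n)) x\<bar>)"
      using L1_version_tendsto[OF t]
    proof eventually_elim
      case (elim x)
      have "(\<lambda>m. ennreal \<bar>rep_L2 (sg t (s m)) x - rep_L2 (sg t (s n)) x\<bar>)
          \<longlonglongrightarrow> ennreal \<bar>L1_version f (t, x) - rep_L2 (sg t (s n)) x\<bar>"
        unfolding s_def by (intro tendsto_intros elim)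
      from lim_imp_Liminf[OF sequentially_bot this] show ?case by (rule sym)
    qed
  qed
  also have "\<dots> \<le> liminf (\<lambda>m. \<integral>\<^sup>+x. ennreal \<bar>rep_L2 (sg t (s m)) x - rep_L2 (sg t (s n)) x\<bar> \<partial>lebesgue)"
    by (rule nn_integral_liminf) measurable
  also have "\<dots> \<le> liminf (\<lambda>m::nat. \<integral>\<^sup>+x. ennreal (f x - min (f x) (real n)) \<partial>lebesgue)"
  proof (rule Liminf_mono, rule eventually_sequentiallyI)
    fix m assume m: "n \<le> m"
    have "(\<integral>\<^sup>+x. ennreal \<bar>rep_L2 (sg t (s m)) x - rep_L2 (sg t (s n)) x\<bar> \<partial>lebesgue)
        = (\<integral>\<^sup>+x. ennreal \<bar>rep_L2 (sg t (s m - s n)) x\<bar> \<partial>lebesgue)"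
      using rep_L2_diff[of "sg t (s m)" "sg t (s n)"]
      by (intro nn_integral_cong_AE) (auto elim!: eventually_mono simp: contr_diff[OF sg_contr[OF t]])
    also have "\<dots> \<le> (\<integral>\<^sup>+x. ennreal \<bar>rep_L2 (s m - s n) x\<bar> \<partial>lebesgue)"
      by (rule sg_L1_contr[OF t])
    also have "\<dots> \<le> (\<integral>\<^sup>+x. ennreal (f x - min (f x) (real n)) \<partial>lebesgue)"
    proof (rule nn_integral_mono_AE)
      show "AE x in lebesgue. ennreal \<bar>rep_L2 (s m - s n) x\<bar> \<le> ennreal (f x - min (f x) (real n))"
        using rep_L2_diff[of "s m" "s n"] rep_sum_layer[of m] rep_sum_layer[of n]
      proof eventually_elim
        case (elim x)
        then show ?case using m by (intro ennreal_leI) (auto simp: s_def min_def)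
      qed
    qed
    finally show "(\<integral>\<^sup>+x. ennreal \<bar>rep_L2 (sg t (s m)) x - rep_L2 (sg t (s n)) x\<bar> \<partial>lebesgue)
        \<le> (\<integral>\<^sup>+x. ennreal (f x - min (f x) (real n)) \<partial>lebesgue)" .
  qed
  finally show ?thesis by (simp add: Liminf_const s_def)
qed

lemma integrable_f_tail: "integrable lebesgue (\<lambda>x. f x - min (f x) (real n))"
  by (rule Bochner_Integration.integrable_bound[OF f(1)]) (use f(2) in \<open>auto simp: min_def\<close>)

lemma f_tail_tendsto: "(\<lambda>n. LINT x|lebesgue. f x - min (f x) (real n)) \<longlonglongrightarrow> 0"
proof -
  have "(\<lambda>n. LINT x|lebesgue. f x - min (f x) (real n)) \<longlonglongrightarrow> (LINT x|(lebesgue::real measure). 0)"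
  proof (rule integral_dominated_convergence[OF _ _ f(1)])
    show "AE x in lebesgue. (\<lambda>n. f x - min (f x) (real n)) \<longlonglongrightarrow> 0"
    proof (intro AE_I2 tendsto_eventually)
      fix x
      obtain N where "f x \<le> real N" using real_arch_simple by blast
      then show "\<forall>\<^sub>F n in sequentially. f x - min (f x) (real n) = 0"
        by (auto simp: eventually_sequentially intro!: exI[of _ N])
    qed
    show "AE x in lebesgue. norm (f x - min (f x) (real n)) \<le> f x" for n
      using f(2) by (auto simp: min_def)
  qed measurable
  then show ?thesis by simp
qed

text \<open>The truncations of \<open>f\<close> lie in both spaces and approximate \<open>f\<close>
  in L^1, and their evolutions approximate the chosen version. Any other approximating sequence is
  compared with them through the L^1 contraction.\<close>

lemma L1_extension_sg:
  assumes t: "0 < t"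
  shows "L1_extension (sg t) f (\<lambda>x. L1_version f (t, x))"
proof -
  define h where "h x = L1_version f (t, x)" for x
  define s where "s m = (\<Sum>k<m. layer f k)" for m :: nat
  define e where "e n = (LINT x|lebesgue. f x - min (f x) (real n))" for n :: nat
  have hm [measurable]: "h \<in> borel_measurable lebesgue"
    unfolding h_def by (rule measurable_Pair2[OF L1_version_measurable]) simp
  have e: "(\<integral>\<^sup>+x. ennreal (f x - min (f x) (real n)) \<partial>lebesgue) = ennreal (e n)" for n
    unfolding e_def by (rule nn_integral_eq_integral[OF integrable_f_tail]) (auto simp: min_def)
  have tail: "(\<integral>\<^sup>+x. ennreal \<bar>h x - rep_L2 (sg t (s n)) x\<bar> \<partial>lebesgue) \<le> ennreal (e n)" for n
    unfolding h_def s_def e[symmetric] by (rule L1_version_tail[OF t])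
  have int_h: "integrable lebesgue h"
  proof (rule integrableI_bounded[OF hm])
    have "(\<integral>\<^sup>+x. ennreal (norm (h x)) \<partial>lebesgue) = (\<integral>\<^sup>+x. ennreal \<bar>h x - rep_L2 (sg t (s 0)) x\<bar> \<partial>lebesgue)"
      using rep_L2_zero by (intro nn_integral_cong_AE)
        (auto elim!: eventually_mono simp: s_def linear_0[OF contr_linear[OF sg_contr[OF t]]])
    also have "\<dots> < \<infinity>" using tail[of 0] by (rule le_less_trans) simp
    finally show "(\<integral>\<^sup>+x. ennreal (norm (h x)) \<partial>lebesgue) < \<infinity>" .
  qed
  have main: "(\<forall>k. integrable lebesgue (rep_L2 (sg t (\<phi> k)))) \<and>
      (\<lambda>k. LINT x|lebesgue. \<bar>rep_L2 (sg t (\<phi> k)) x - h x\<bar>) \<longlonglongrightarrow> 0"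
    if \<phi>: "\<forall>k::nat. integrable lebesgue (rep_L2 (\<phi> k))"
      and lim: "(\<lambda>k. LINT x|lebesgue. \<bar>rep_L2 (\<phi> k) x - f x\<bar>) \<longlonglongrightarrow> 0" for \<phi>
  proof -
    have int: "integrable lebesgue (rep_L2 (sg t (\<phi> k)))" for k
    proof (rule integrableI_bounded)
      have "(\<integral>\<^sup>+x. ennreal (norm (rep_L2 (sg t (\<phi> k)) x)) \<partial>lebesgue) \<le> (\<integral>\<^sup>+x. ennreal \<bar>rep_L2 (\<phi> k) x\<bar> \<partial>lebesgue)"
        using sg_L1_contr[OF t, of "\<phi> k"] by simp
      also have "\<dots> < \<infinity>" using \<phi> by (simp add: integrable_iff_bounded)
      finally show "(\<integral>\<^sup>+x. ennreal (norm (rep_L2 (sg t (\<phi> k)) x)) \<partial>lebesgue) < \<infinity>" .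
    qed simp
    define a where "a k = (LINT x|lebesgue. \<bar>rep_L2 (sg t (\<phi> k)) x - h x\<bar>)" for k
    define b where "b k = (LINT x|lebesgue. \<bar>rep_L2 (\<phi> k) x - f x\<bar>)" for k
    have e_nonneg: "0 \<le> e n" for n unfolding e_def by (intro integral_nonneg_AE) auto
    have b_nonneg: "0 \<le> b k" for k unfolding b_def by (intro integral_nonneg_AE) auto
    \<comment> \<open>With s_n the truncation of \<open>f\<close> at height n: the evolution of
      \<phi>_k - s_n costs at most b_k + e_n, and T_t s_n differs from \<open>h\<close> by at most
      e_n.\<close>
    have le: "a k \<le> b k + 2 * e n" for k n
    proof -
      have "ennreal (a k) = (\<integral>\<^sup>+x. ennreal \<bar>rep_L2 (sg t (\<phi> k)) x - h x\<bar> \<partial>lebesgue)"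
        unfolding a_def using int[of k] int_h by (subst nn_integral_eq_integral) auto
      also have "\<dots> \<le> (\<integral>\<^sup>+x. ennreal \<bar>rep_L2 (sg t (\<phi> k - s n)) x\<bar> + ennreal \<bar>h x - rep_L2 (sg t (s n)) x\<bar> \<partial>lebesgue)"
      proof (rule nn_integral_mono_AE)
        show "AE x in lebesgue. ennreal \<bar>rep_L2 (sg t (\<phi> k)) x - h x\<bar>
          \<le> ennreal \<bar>rep_L2 (sg t (\<phi> k - s n)) x\<bar> + ennreal \<bar>h x - rep_L2 (sg t (s n)) x\<bar>"
          using rep_L2_diff[of "sg t (\<phi> k)" "sg t (s n)"]
          by eventually_elim (auto simp: contr_diff[OF sg_contr[OF t]] simp flip: ennreal_plus intro!: ennreal_leI)
      qed
      also have "\<dots> = (\<integral>\<^sup>+x. ennreal \<bar>rep_L2 (sg t (\<phi> k - s n)) x\<bar> \<partial>lebesgue)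
          + (\<integral>\<^sup>+x. ennreal \<bar>h x - rep_L2 (sg t (s n)) x\<bar> \<partial>lebesgue)"
        by (rule nn_integral_add) measurable
      also have "\<dots> \<le> (\<integral>\<^sup>+x. ennreal \<bar>rep_L2 (\<phi> k - s n) x\<bar> \<partial>lebesgue) + ennreal (e n)"
        by (intro add_mono sg_L1_contr[OF t] tail)
      also have "(\<integral>\<^sup>+x. ennreal \<bar>rep_L2 (\<phi> k - s n) x\<bar> \<partial>lebesgue)
          \<le> (\<integral>\<^sup>+x. ennreal \<bar>rep_L2 (\<phi> k) x - f x\<bar> + ennreal (f x - min (f x) (real n)) \<partial>lebesgue)"
      proof (rule nn_integral_mono_AE)
        show "AE x in lebesgue. ennreal \<bar>rep_L2 (\<phi> k - s n) x\<bar>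
          \<le> ennreal \<bar>rep_L2 (\<phi> k) x - f x\<bar> + ennreal (f x - min (f x) (real n))"
          using rep_L2_diff[of "\<phi> k" "s n"] rep_sum_layer[of n]
          by eventually_elim (auto simp: s_def simp flip: ennreal_plus intro!: ennreal_leI)
      qed
      also have "\<dots> = (\<integral>\<^sup>+x. ennreal \<bar>rep_L2 (\<phi> k) x - f x\<bar> \<partial>lebesgue) + (\<integral>\<^sup>+x. ennreal (f x - min (f x) (real n)) \<partial>lebesgue)"
        by (rule nn_integral_add) measurable
      also have "(\<integral>\<^sup>+x. ennreal \<bar>rep_L2 (\<phi> k) x - f x\<bar> \<partial>lebesgue) = ennreal (b k)"
        unfolding b_def using \<phi> f(1) by (subst nn_integral_eq_integral) auto
      finally have "ennreal (a k) \<le> ennreal (b k) + ennreal (e n) + ennreal (e n)"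
        by (simp add: e add_right_mono)
      also have "\<dots> = ennreal (b k + 2 * e n)" using e_nonneg[of n] b_nonneg[of k]
        by (simp flip: ennreal_plus)
      finally show ?thesis
        by (subst (asm) ennreal_le_iff) (use e_nonneg[of n] b_nonneg[of k] in simp_all)
    qed
    have a_nonneg: "0 \<le> a k" for k unfolding a_def by (intro integral_nonneg_AE) auto
    have "a \<longlonglongrightarrow> 0"
    proof (rule LIMSEQ_I)
      fix r :: real assume r: "0 < r"
      have "\<forall>\<^sub>F n in sequentially. e n < r / 4"
        using f_tail_tendsto r unfolding e_def[abs_def] by (intro order_tendstoD) auto
      then obtain n where n: "e n < r / 4" by (auto simp: eventually_sequentially)
      have "\<forall>\<^sub>F k in sequentially. b k < r / 2"
        using lim r unfolding b_def[abs_def] by (intro order_tendstoD) auto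
      then obtain N where "\<And>k. k \<ge> N \<Longrightarrow> b k < r / 2" by (auto simp: eventually_sequentially)
      then have "norm (a k - 0) < r" if "k \<ge> N" for k
        using le[of k n] n that a_nonneg[of k] by fastforce
      then show "\<exists>N. \<forall>k\<ge>N. norm (a k - 0) < r" by blast
    qed
    then show ?thesis using int by (simp add: a_def[abs_def])
  qed
  then show ?thesis
    using f(1) int_h unfolding L1_extension_def h_def[symmetric] by blast
qed

lemma green_L1_version: "green_function sg f (\<lambda>x. \<integral>\<^sup>+t\<in>{0<..}. ennreal (L1_version f (t, x)) \<partial>lebesgue)"
  unfolding green_function_def
  by (intro exI[of _ "L1_version f"]) (auto intro: L1_extension_sg L1_version_nonneg)

text \<open>\<open>enn2real\<close> sends an infinite sum of versions to 0, so the two sides agree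
  only where these sums are finite. That is known for each \<open>t\<close> and almost every
  \<open>x\<close>; Fubini for null sets turns it into almost every \<open>x\<close> and almost
  every \<open>t\<close>.\<close>

lemma green_L1_version_eq:
  "AE x in lebesgue. (\<integral>\<^sup>+t\<in>{0<..}. ennreal (L1_version f (t, x)) \<partial>lebesgue) = (\<Sum>k. Green (layer f k) x)"
proof -
  have m: "{\<omega> \<in> space (lebesgue \<Otimes>\<^sub>M lebesgue). 0 < fst \<omega> \<longrightarrow> (\<Sum>k. ennreal (version (layer f k) (fst \<omega>, snd \<omega>))) < \<infinity>}
      \<in> sets (lebesgue \<Otimes>\<^sub>M (lebesgue :: real measure))"
    unfolding prod.collapse by measurable
  have "AE t in lebesgue. AE x in lebesgue. 0 < t \<longrightarrow> (\<Sum>k. ennreal (version (layer f k) (t, x))) < \<infinity>"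
  proof (rule AE_I2)
    fix t show "AE x in lebesgue. 0 < t \<longrightarrow> (\<Sum>k. ennreal (version (layer f k) (t, x))) < \<infinity>"
      using suminf_version_finite by (cases "0 < t") auto
  qed
  then have "AE x in lebesgue. AE t in lebesgue. 0 < t \<longrightarrow> (\<Sum>k. ennreal (version (layer f k) (t, x))) < \<infinity>"
    by (subst (asm) lebesgue_pair.AE_commute[OF m])
  then show ?thesis
  proof eventually_elim
    case (elim x)
    have "(\<integral>\<^sup>+t\<in>{0<..}. ennreal (L1_version f (t, x)) \<partial>lebesgue)
       = (\<integral>\<^sup>+t. (\<Sum>k. ennreal (version (layer f k) (t, x)) * indicator {0<..} t) \<partial>lebesgue)"
    proof (rule nn_integral_cong_AE)
      show "AE t in lebesgue. ennreal (L1_version f (t, x)) * indicator {0<..} t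
          = (\<Sum>k. ennreal (version (layer f k) (t, x)) * indicator {0<..} t)"
        using elim by eventually_elim (auto simp: L1_version_def indicator_def)
    qed
    also have "\<dots> = (\<Sum>k. Green (layer f k) x)"
      unfolding Green_def by (rule nn_integral_suminf) measurable
    finally show ?case .
  qed
qed

end

section \<open>Transience and recurrence criteria\<close>

text \<open>Truncating u = \<open>Res a g\<close> at K gives v with no larger energy E_a = E + a
  (.,.), and with the same pairing with \<open>g\<close>, which vanishes where u exceeds K. Then
  E_a(v - u, v - u) = E_a(v, v) - 2 (g, v) + (g, u) \<le> 0, so v = u.\<close>

lemma maximum_principle:
  assumes a: "0 < a" and g: "nonneg_L2 g" and K: "0 < K"
    and supp: "AE x in lebesgue. rep_L2 g x = 0 \<or> rep_L2 (Res a g) x \<le> K"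
  shows "AE x in lebesgue. rep_L2 (Res a g) x \<le> K"
proof -
  define u where "u = Res a g"
  define v where "v = K *\<^sub>R clip_L2 ((1 / K) *\<^sub>R u)"
  have u: "u \<in> F" unfolding u_def by (rule Res_in[OF a])
  have uK: "(1 / K) *\<^sub>R u \<in> F" using u by auto
  have v: "v \<in> F" unfolding v_def using clip[OF uK] by auto
  have nu: "nonneg_L2 u" unfolding u_def by (rule Res_nonneg[OF a g])
  have rv: "AE x in lebesgue. rep_L2 v x = min K (rep_L2 u x)"
    unfolding v_def clip_L2_eq_app
    using nu[unfolded nonneg_L2_def] rep_L2_scale[of "1 / K" u] rep_app[OF contractions(1), of "(1 / K) *\<^sub>R u"]
      rep_L2_scale[of K "app (\<lambda>a. max 0 (min 1 a)) ((1 / K) *\<^sub>R u)"]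
  proof eventually_elim
    case (elim x)
    have "K * max 0 (min 1 (1 / K * rep_L2 u x)) = min K (rep_L2 u x)"
      using K elim(1) by (cases "rep_L2 u x \<le> K") (auto simp: min_def max_def field_simps)
    then show ?case by (simp only: elim)
  qed
  have "E v v = K\<^sup>2 * E (clip_L2 ((1 / K) *\<^sub>R u)) (clip_L2 ((1 / K) *\<^sub>R u))"
    unfolding v_def using clip(1)[OF uK] by (simp add: form.scale_left form.scale_right form.V_scale power2_eq_square)
  also have "\<dots> \<le> K\<^sup>2 * E ((1 / K) *\<^sub>R u) ((1 / K) *\<^sub>R u)"
    by (intro mult_left_mono clip(2)[OF uK]) simp
  also have "\<dots> = E u u"
    using K u by (simp add: form.scale_left form.scale_right form.V_scale power2_eq_square)
  finally have Ev: "E v v \<le> E u u" .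
  have "norm v \<le> norm u"
    unfolding norm_L2_le_iff
  proof (rule nn_integral_mono_AE)
    show "AE x in lebesgue. ennreal ((rep_L2 v x)\<^sup>2) \<le> ennreal ((rep_L2 u x)\<^sup>2)"
      using rv nu[unfolded nonneg_L2_def]
    proof eventually_elim
      case (elim x)
      then show ?case using K by (intro ennreal_leI) (auto simp: abs_le_square_iff[symmetric])
    qed
  qed
  then have "(norm v)\<^sup>2 \<le> (norm u)\<^sup>2" by (intro power_mono) auto
  then have nv: "a * inner v v \<le> a * inner u u" using a by (simp add: power2_norm_eq_inner)
  have gv: "inner g v = inner g u"
    unfolding inner_L2_eq
  proof (rule integral_cong_AE)
    show "AE x in lebesgue. rep_L2 g x * rep_L2 v x = rep_L2 g x * rep_L2 u x"
      using rv supp by eventually_elim (auto simp: u_def)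
  qed measurable
  have 1: "E u v + a * inner u v = inner g v" "E u u + a * inner u u = inner g u"
    unfolding u_def using Res_eq[OF a] u v by (auto simp: u_def)
  have "E (v - u) (v - u) + a * inner (v - u) (v - u) = (E v v + a * inner v v) - 2 * (E u v + a * inner u v) + (E u u + a * inner u u)"
    using form.sym[OF u v]
    by (simp add: form.quad_diff[OF v u] inner_diff_left inner_diff_right inner_commute algebra_simps)
  also have "\<dots> \<le> 0" using 1 gv Ev nv by simp
  finally have "a * inner (v - u) (v - u) \<le> 0" using form.nonneg[OF form.V_diff[OF v u]] by simp
  then have "inner (v - u) (v - u) \<le> 0" using a by (simp add: mult_le_0_iff)
  then have "inner (v - u) (v - u) = 0" using inner_ge_zero by (rule antisym)
  then have "v = u" by simp
  with rv have "AE x in lebesgue. rep_L2 u x = min K (rep_L2 u x)" by simp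
  then show ?thesis unfolding u_def[symmetric] by eventually_elim linarith
qed

text \<open>The comparison is known only after integration. On a bounded set where the Green
  function is at most K and the resolvent exceeds K, integrating gives a contradiction unless the
  set is null; rational K and integer intervals leave countably many such sets.\<close>

lemma Res_le_Green:
  assumes a: "0 < a" and g: "nonneg_L2 g"
  shows "AE x in lebesgue. ennreal (rep_L2 (Res a g) x) \<le> Green g x"
proof -
  have null: "AE x in lebesgue. \<not> (x \<in> {- real n..real n} \<and> Green g x \<le> ennreal (real m / real (Suc k)) \<and>
      real m / real (Suc k) < rep_L2 (Res a g) x)" for n m k :: nat
  proof -
    define K where "K = real m / real (Suc k)"
    have K0: "0 \<le> K" by (simp add: K_def)
    define B where "B = {x\<in>space lebesgue. Green g x \<le> ennreal K \<and> K < rep_L2 (Res a g) x} \<inter> {- real n..real n}"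
    have B [measurable]: "B \<in> sets lebesgue" unfolding B_def by measurable
    have Bfin: "emeasure lebesgue B < \<infinity>" unfolding B_def by (rule emeasure_Int_interval_finite) measurable
    have "(\<integral>\<^sup>+x\<in>B. ennreal (rep_L2 (Res a g) x) \<partial>lebesgue) = ennreal (inner (Res a g) (ind_L2 B))"
      by (rule ennreal_inner_ind_L2[symmetric, OF Res_nonneg[OF a g] B Bfin])
    also have "\<dots> \<le> (\<integral>\<^sup>+x. ennreal (rep_L2 (ind_L2 B) x) * Green g x \<partial>lebesgue)"
      unfolding Green_pairing[OF g nonneg_ind_L2[OF B Bfin]] by (rule SUP_upper) (use a in simp)
    also have "\<dots> = (\<integral>\<^sup>+x\<in>B. Green g x \<partial>lebesgue)"
      using rep_ind_L2[OF B Bfin]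
      by (intro nn_integral_cong_AE) (auto elim!: eventually_mono simp: indicator_def mult.commute)
    also have "\<dots> \<le> (\<integral>\<^sup>+x\<in>B. ennreal K \<partial>lebesgue)"
      by (intro nn_integral_mono) (auto simp: B_def indicator_def)
    also have "\<dots> = ennreal K * emeasure lebesgue B" by (rule nn_integral_cmult_indicator[OF B])
    finally have 1: "(\<integral>\<^sup>+x\<in>B. ennreal (rep_L2 (Res a g) x) \<partial>lebesgue) \<le> ennreal K * emeasure lebesgue B" .
    have "(\<integral>\<^sup>+x\<in>B. ennreal (rep_L2 (Res a g) x) \<partial>lebesgue)
        = (\<integral>\<^sup>+x. ennreal K * indicator B x + ennreal (rep_L2 (Res a g) x - K) * indicator B x \<partial>lebesgue)"
      using K0 by (intro nn_integral_cong) (auto simp: B_def indicator_def simp flip: ennreal_plus)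
    also have "\<dots> = (\<integral>\<^sup>+x\<in>B. ennreal K \<partial>lebesgue) + (\<integral>\<^sup>+x\<in>B. ennreal (rep_L2 (Res a g) x - K) \<partial>lebesgue)"
      by (rule nn_integral_add) measurable
    also have "(\<integral>\<^sup>+x\<in>B. ennreal K \<partial>lebesgue) = ennreal K * emeasure lebesgue B" by (rule nn_integral_cmult_indicator[OF B])
    finally have "ennreal K * emeasure lebesgue B + (\<integral>\<^sup>+x\<in>B. ennreal (rep_L2 (Res a g) x - K) \<partial>lebesgue)
        \<le> ennreal K * emeasure lebesgue B + 0" using 1 by simp
    moreover have "ennreal K * emeasure lebesgue B \<noteq> \<infinity>" using Bfin by (simp add: ennreal_mult_eq_top_iff)
    ultimately have "(\<integral>\<^sup>+x\<in>B. ennreal (rep_L2 (Res a g) x - K) \<partial>lebesgue) = 0"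
      by (subst (asm) ennreal_add_left_cancel_le) auto
    then have "AE x in lebesgue. ennreal (rep_L2 (Res a g) x - K) * indicator B x = 0"
      by (subst (asm) nn_integral_0_iff_AE) auto
    then show ?thesis unfolding K_def[symmetric]
      by eventually_elim (auto simp: B_def ennreal_eq_0_iff)
  qed
  have "AE x in lebesgue. \<forall>n m k. \<not> (x \<in> {- real n..real n} \<and> Green g x \<le> ennreal (real m / real (Suc k)) \<and>
      real m / real (Suc k) < rep_L2 (Res a g) x)"
    unfolding AE_all_countable using null by blast
  then show ?thesis
  proof eventually_elim
    case (elim x)
    show ?case
    proof (rule ccontr)
      assume "\<not> ?case"
      then have lt: "Green g x < ennreal (rep_L2 (Res a g) x)" by simp
      then obtain c where c: "Green g x = ennreal c" "0 \<le> c" by (cases "Green g x") auto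
      with lt have cr: "c < rep_L2 (Res a g) x" by (simp add: ennreal_less_iff)
      then obtain q where q: "c < of_rat q" "of_rat q < rep_L2 (Res a g) x" using of_rat_dense by blast
      have "0 < q" using q(1) c(2) by (metis le_less_trans zero_less_of_rat_iff)
      then obtain m k where "q = Fract (int m) (int (Suc k))"
      proof -
        obtain i j where ij: "q = Fract i j" "0 < j" by (cases q) auto
        then have "0 < i" using \<open>0 < q\<close> by (simp add: zero_less_Fract_iff)
        then have "q = Fract (int (nat i)) (int (Suc (nat j - 1)))" using ij by simp
        then show ?thesis by (rule that)
      qed
      then have qe: "of_rat q = real m / real (Suc k)" by (simp add: of_rat_rat)
      obtain n where "\<bar>x\<bar> \<le> real n" using real_arch_simple by blast
      then have "x \<in> {- real n..real n}" by auto
      moreover have "Green g x \<le> ennreal (real m / real (Suc k))"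
        unfolding c(1) using q(1) qe by (intro ennreal_leI) auto
      ultimately show False using elim q(2) qe by metis
    qed
  qed
qed

lemma nn_integral_ind_L2_Green:
  assumes "A \<in> sets lebesgue" "emeasure lebesgue A < \<infinity>"
  shows "(\<integral>\<^sup>+x. ennreal (rep_L2 (ind_L2 A) x) * Green f x \<partial>lebesgue) = (\<integral>\<^sup>+x\<in>A. Green f x \<partial>lebesgue)"
  using rep_ind_L2[OF assms]
  by (intro nn_integral_cong_AE) (auto elim!: eventually_mono simp: indicator_def mult.commute)

text \<open>The hypothesis makes the Green function of g = 1_I finite almost everywhere on the
  interval I. Where it is at most K + 1, the indicator g' of that set has resolvents bounded by K +
  1 everywhere, by the maximum principle; symmetry then bounds the integral of G f over the set by
  (K + 1) times the integral of f.\<close>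

theorem transient_criterion:
  assumes bound: "\<And>m::nat. \<exists>C. \<forall>u\<in>F. nonneg_L2 u \<longrightarrow> inner u (ind_L2 {- real m..real m}) \<le> C * sqrt (E u u)"
  shows "transient_form E F"
  unfolding transient_form_def
proof (intro conjI exI[of _ sg] allI impI)
  show "dirichlet_form E F" by (rule dirichlet)
  show "associated_semigroup E F sg" by (rule associated_sg)
  fix f :: "real \<Rightarrow> real" assume f: "integrable lebesgue f" "\<forall>x. 0 \<le> f x"
  then have f': "\<And>x. 0 \<le> f x" by simp
  note layer = nonneg_layer[OF f(1) f']
  have "AE x in lebesgue. x \<in> {- real m..real m} \<longrightarrow> (\<Sum>k. Green (layer f k) x) < \<infinity>" for m :: nat
  proof -
    let ?I = "{- real m..real m}"
    define g where "g = ind_L2 ?I"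
    have g: "nonneg_L2 g" unfolding g_def by (rule nonneg_ind_L2) auto
    obtain C where C: "\<And>u. u \<in> F \<Longrightarrow> nonneg_L2 u \<Longrightarrow> inner u g \<le> C * sqrt (E u u)"
      using bound[of m] by (auto simp: g_def)
    \<comment> \<open>For w = \<open>Res a g\<close>, E(w, w) \<le> (w, g) \<le> C sqrt(E(w, w)).
      Hence sqrt(E(w, w)) vanishes or is at most C, and (w, g) is at most C^2 for all
      \<open>a\<close>.\<close>
    have Cg: "inner (Res a g) g \<le> C\<^sup>2" if a: "0 < a" for a
    proof -
      let ?w = "Res a g"
      have w: "?w \<in> F" by (rule Res_in[OF a])
      have w0: "0 \<le> E ?w ?w" by (rule form.nonneg[OF w])
      have "E ?w ?w + a * inner ?w ?w = inner ?w g" using Res_eq[OF a w] by (simp add: inner_commute)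
      then have le: "E ?w ?w \<le> inner ?w g" using a by (smt (verit) inner_ge_zero mult_nonneg_nonneg)
      have b: "inner ?w g \<le> C * sqrt (E ?w ?w)" by (rule C[OF w Res_nonneg[OF a g]])
      define r where "r = sqrt (E ?w ?w)"
      have r: "0 \<le> r" "r * r = E ?w ?w" using w0 by (simp_all add: r_def)
      have "r * r \<le> C * r" using le b r by (simp add: r_def)
      then have "r = 0 \<or> r \<le> C" using r(1) by (auto simp: mult_le_cancel_right)
      then have "C * r \<le> C\<^sup>2" using r(1) mult_left_mono[of r C C] by (auto simp: power2_eq_square)
      then show ?thesis using b by (simp add: r_def)
    qed
    have "(\<integral>\<^sup>+x\<in>?I. Green g x \<partial>lebesgue) = (\<integral>\<^sup>+x. ennreal (rep_L2 g x) * Green g x \<partial>lebesgue)"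
      unfolding g_def by (rule nn_integral_ind_L2_Green[symmetric]) auto
    also have "\<dots> \<le> ennreal (C\<^sup>2)"
      unfolding Green_pairing[OF g g] by (intro SUP_least ennreal_leI Cg) simp
    finally have "(\<integral>\<^sup>+x\<in>?I. Green g x \<partial>lebesgue) \<noteq> \<infinity>" by (auto simp: top_unique)
    then have "AE x in lebesgue. Green g x * indicator ?I x \<noteq> \<infinity>"
      by (intro nn_integral_PInf_AE) auto
    then have fin: "AE x in lebesgue. x \<in> ?I \<longrightarrow> Green g x < \<infinity>"
      by eventually_elim (auto simp: less_top)
    have "AE x in lebesgue. x \<in> ?I \<and> Green g x \<le> ennreal (real (Suc K)) \<longrightarrow> (\<Sum>k. Green (layer f k) x) < \<infinity>" for K
    proof -
      \<comment> \<open>On \<open>A\<close> the resolvents of 1_A lie below those of g, hence below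
        the Green function of g, hence below K + 1. This is the hypothesis of the maximum principle
        for 1_A.\<close>
      define A where "A = {x\<in>space lebesgue. Green g x \<le> ennreal (real (Suc K))} \<inter> ?I"
      have A [measurable]: "A \<in> sets lebesgue" unfolding A_def by measurable
      have Afin: "emeasure lebesgue A < \<infinity>" unfolding A_def by (rule emeasure_Int_interval_finite) measurable
      define g' where "g' = ind_L2 A"
      have g': "nonneg_L2 g'" unfolding g'_def by (rule nonneg_ind_L2[OF A Afin])
      have rg': "AE x in lebesgue. rep_L2 g' x = indicator A x" unfolding g'_def by (rule rep_ind_L2[OF A Afin])
      have rg: "AE x in lebesgue. rep_L2 g x = indicator ?I x" unfolding g_def by (rule rep_ind_L2) auto
      have "nonneg_L2 (g - g')"
        unfolding nonneg_L2_def using rg rg' rep_L2_diff[of g g']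
        by eventually_elim (auto simp: A_def indicator_def)
      then have d: "nonneg_L2 (Res a g - Res a g')" if "0 < a" for a
        using Res_nonneg[OF that, of "g - g'"] by (simp add: linear_diff[OF Res_linear[OF that]])
      have Kbound: "AE x in lebesgue. rep_L2 (Res a g') x \<le> real (Suc K)" if a: "0 < a" for a
      proof (rule maximum_principle[OF a g'])
        show "AE x in lebesgue. rep_L2 g' x = 0 \<or> rep_L2 (Res a g') x \<le> real (Suc K)"
          using rg' Res_le_Green[OF a g] d[OF a, unfolded nonneg_L2_def] rep_L2_diff[of "Res a g" "Res a g'"]
        proof eventually_elim
          case (elim x)
          show ?case
          proof (cases "x \<in> A")
            case True
            then have "ennreal (rep_L2 (Res a g) x) \<le> ennreal (real (Suc K))"
              using elim(2) by (auto simp: A_def intro: order_trans)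
            then have "rep_L2 (Res a g) x \<le> real (Suc K)" by (subst (asm) ennreal_le_iff) auto
            then show ?thesis using elim(3,4) by auto
          qed (use elim in simp)
        qed
      qed simp
      have le: "(\<integral>\<^sup>+x\<in>A. Green v x \<partial>lebesgue) \<le> ennreal (real (Suc K)) * (\<integral>\<^sup>+x. ennreal (rep_L2 v x) \<partial>lebesgue)"
        if v: "nonneg_L2 v" for v
        unfolding nn_integral_ind_L2_Green[OF A Afin, symmetric] Green_pairing[OF v nonneg_ind_L2[OF A Afin]]
      proof (intro SUP_least)
        fix a :: real assume "a \<in> {0<..}"
        then have a: "0 < a" by simp
        have "ennreal (inner (Res a v) (ind_L2 A)) = ennreal (inner v (Res a g'))"
          using Res_sym[OF a, of v g'] by (simp add: g'_def)
        also have "\<dots> = (\<integral>\<^sup>+x. ennreal (rep_L2 v x) * ennreal (rep_L2 (Res a g') x) \<partial>lebesgue)"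
          by (rule ennreal_inner_L2(2)[OF v Res_nonneg[OF a g']])
        also have "\<dots> \<le> (\<integral>\<^sup>+x. ennreal (real (Suc K)) * ennreal (rep_L2 v x) \<partial>lebesgue)"
        proof (rule nn_integral_mono_AE)
          show "AE x in lebesgue. ennreal (rep_L2 v x) * ennreal (rep_L2 (Res a g') x) \<le> ennreal (real (Suc K)) * ennreal (rep_L2 v x)"
            using Kbound[OF a] by eventually_elim (subst mult.commute, intro mult_right_mono ennreal_leI, auto)
        qed
        also have "\<dots> = ennreal (real (Suc K)) * (\<integral>\<^sup>+x. ennreal (rep_L2 v x) \<partial>lebesgue)"
          by (rule nn_integral_cmult) measurable
        finally show "ennreal (inner (Res a v) (ind_L2 A)) \<le> ennreal (real (Suc K)) * (\<integral>\<^sup>+x. ennreal (rep_L2 v x) \<partial>lebesgue)" .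
      qed
      have "(\<integral>\<^sup>+x\<in>A. (\<Sum>k. Green (layer f k) x) \<partial>lebesgue) = (\<integral>\<^sup>+x. (\<Sum>k. Green (layer f k) x * indicator A x) \<partial>lebesgue)"
        by (simp add: ennreal_suminf_multc)
      also have "\<dots> = (\<Sum>k. \<integral>\<^sup>+x\<in>A. Green (layer f k) x \<partial>lebesgue)"
        by (rule nn_integral_suminf) measurable
      also have "\<dots> \<le> (\<Sum>k. ennreal (real (Suc K)) * (\<integral>\<^sup>+x. ennreal (rep_L2 (layer f k) x) \<partial>lebesgue))"
        by (intro suminf_le le layer) auto
      also have "\<dots> = ennreal (real (Suc K)) * (\<Sum>k. \<integral>\<^sup>+x. ennreal (rep_L2 (layer f k) x) \<partial>lebesgue)"
        by (rule ennreal_suminf_cmult)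
      also have "\<dots> \<le> ennreal (real (Suc K)) * (\<integral>\<^sup>+x. ennreal (f x) \<partial>lebesgue)"
        by (intro mult_left_mono suminf_nn_integral_layer[OF f(1) f']) simp
      also have "\<dots> < \<infinity>"
        using nn_integral_f[OF f(1) f'] by (simp add: ennreal_mult_less_top)
      finally have "AE x in lebesgue. (\<Sum>k. Green (layer f k) x) * indicator A x \<noteq> \<infinity>"
        by (intro nn_integral_PInf_AE) auto
      then show ?thesis by eventually_elim (auto simp: A_def less_top)
    qed
    then have "AE x in lebesgue. \<forall>K. x \<in> ?I \<and> Green g x \<le> ennreal (real (Suc K)) \<longrightarrow> (\<Sum>k. Green (layer f k) x) < \<infinity>"
      unfolding AE_all_countable by blast
    then show ?thesis using fin
    proof eventually_elim
      case (elim x)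
      show ?case
      proof
        assume x: "x \<in> ?I"
        then obtain c where c: "Green g x = ennreal c" "0 \<le> c" using elim(2) by (cases "Green g x") auto
        obtain K where "c \<le> real K" using real_arch_simple by blast
        then have "Green g x \<le> ennreal (real (Suc K))" unfolding c(1) by (intro ennreal_leI) auto
        then show "(\<Sum>k. Green (layer f k) x) < \<infinity>" using elim(1) x by blast
      qed
    qed
  qed
  then have "AE x in lebesgue. \<forall>m::nat. x \<in> {- real m..real m} \<longrightarrow> (\<Sum>k. Green (layer f k) x) < \<infinity>"
    unfolding AE_all_countable by blast
  then have "AE x in lebesgue. (\<integral>\<^sup>+t\<in>{0<..}. ennreal (L1_version f (t, x)) \<partial>lebesgue) < \<infinity>"
    using green_L1_version_eq[OF f(1) f']
  proof eventually_elim
    case (elim x)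
    obtain n where "\<bar>x\<bar> \<le> real n" using real_arch_simple by blast
    then have "x \<in> {- real n..real n}" by auto
    then show ?case using elim by metis
  qed
  then show "\<exists>g. green_function sg f g \<and> (AE x in lebesgue. g x < \<infinity>)"
    using green_L1_version[OF f(1) f'] by blast
qed

section \<open>Recurrence from cutoffs that vanish weakly\<close>

lemma inner_nonneg_mono:
  assumes "nonneg_L2 (v - u)" "nonneg_L2 w"
  shows "inner u w \<le> inner v w"
  using ennreal_inner_L2(1)[OF assms] by (simp add: inner_diff_left)

lemma Res_mono:
  assumes "0 < a" "nonneg_L2 (v - u)"
  shows "nonneg_L2 (Res a v - Res a u)"
  using Res_nonneg[OF assms] by (simp add: linear_diff[OF Res_linear[OF assms(1)]])

lemma Res_antimono:
  assumes "0 < a" "a \<le> b" "nonneg_L2 f"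
  shows "nonneg_L2 (Res a f - Res b f)"
proof -
  have "0 < b" using assms by simp
  then show ?thesis
    using Res_identity[of a b f] assms by (simp add: nonneg_L2_scale Res_nonneg)
qed

lemma nonneg_L2_eq_0I:
  assumes "nonneg_L2 f" "\<And>m::nat. inner f (ind_L2 {- real m..real m}) \<le> 0"
  shows "AE x in lebesgue. rep_L2 f x = 0"
proof -
  have "AE x in lebesgue. x \<in> {- real m..real m} \<longrightarrow> rep_L2 f x = 0" for m :: nat
  proof -
    let ?I = "{- real m..real m}"
    have "inner f (ind_L2 ?I) = 0"
      using assms(2)[of m] ennreal_inner_L2(1)[OF assms(1) nonneg_ind_L2[of ?I]] by simp
    then have "(\<integral>\<^sup>+x\<in>?I. ennreal (rep_L2 f x) \<partial>lebesgue) = 0"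
      using ennreal_inner_ind_L2[OF assms(1), of ?I] by simp
    then have "AE x in lebesgue. ennreal (rep_L2 f x) * indicator ?I x = 0"
      by (subst (asm) nn_integral_0_iff_AE) auto
    then show ?thesis using assms(1)[unfolded nonneg_L2_def]
      by eventually_elim (auto simp: ennreal_eq_0_iff)
  qed
  then have "AE x in lebesgue. \<forall>m::nat. x \<in> {- real m..real m} \<longrightarrow> rep_L2 f x = 0"
    unfolding AE_all_countable by blast
  then show ?thesis
  proof eventually_elim
    case (elim x)
    obtain n where "\<bar>x\<bar> \<le> real n" using real_arch_simple by blast
    then have "x \<in> {- real n..real n}" by auto
    then show ?case using elim by blast
  qed
qed

context
  fixes \<eta> :: "nat \<Rightarrow> L2" and S :: real
  assumes \<eta>: "\<And>n. \<eta> n \<in> F" "\<And>n. nonneg_L2 (\<eta> n)"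
    "\<And>n. AE x in lebesgue. x \<in> {- real n..real n} \<longrightarrow> rep_L2 (\<eta> n) x = 1"
    "\<And>n. E (\<eta> n) (\<eta> n) \<le> S"
    "\<And>w. w \<in> F \<Longrightarrow> (\<lambda>n. E w (\<eta> n)) \<longlonglongrightarrow> 0"
begin

text \<open>
  Resolvents of a function with finite Green energy are Cauchy for the form, and the cutoffs
  \<open>\<eta> n\<close> tend to \<open>0\<close> weakly for the form but to \<open>1\<close> pointwise.
\<close>

lemma finite_energy_imp_0:
  assumes f: "nonneg_L2 f" and M: "\<And>a. 0 < a \<Longrightarrow> inner (Res a f) f \<le> M"
  shows "AE x in lebesgue. rep_L2 f x = 0"
proof (rule nonneg_L2_eq_0I[OF f])
  fix m :: nat
  define B where "B = (SUP a\<in>{0<..}. inner (Res a f) f)"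
  have bdd: "bdd_above ((\<lambda>a. inner (Res a f) f) ` {0<..})"
    using M by (intro bdd_aboveI[of _ M]) auto
  have B: "inner (Res a f) f \<le> B" if "0 < a" for a
    unfolding B_def using bdd that by (intro cSUP_upper) auto
  have S: "0 \<le> S" using \<eta>(4)[of 0] form.nonneg[OF \<eta>(1), of 0] by simp
  have main: "inner f (ind_L2 {- real m..real m}) \<le> sqrt (B - inner (Res a f) f) * sqrt S" if a: "0 < a" for a
  proof -
    let ?w = "\<lambda>a. Res a f"
    have wF: "?w a \<in> F" by (rule Res_in[OF a])
    have step: "inner f (\<eta> n) \<le> sqrt (B - inner (?w a) f) * sqrt S + \<bar>E (?w a) (\<eta> n)\<bar>" for n
    proof -
      \<comment> \<open>The resolvent equation at \<open>b\<close> splits (f, \<eta>_n) into E(w_b -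
        w_a, \<eta>_n) + E(w_a, \<eta>_n) + b (w_b, \<eta>_n). Sending b to 0 removes the last term,
        then n to infinity the second; the first is small once (w_a, f) is near its supremum
        \<open>B\<close>.\<close>
      have le: "inner f (\<eta> n) \<le> sqrt (B - inner (?w a) f) * sqrt S + \<bar>E (?w a) (\<eta> n)\<bar> + sqrt (b * B) * norm (\<eta> n)"
        if b: "0 < b" "b \<le> a" for b
      proof -
        have wb: "?w b \<in> F" by (rule Res_in[OF b(1)])
        have ea: "E (?w a) (?w a) + a * inner (?w a) (?w a) = inner (?w a) f"
          using Res_eq[OF a wF, of f] by (simp add: inner_commute)
        have eb: "E (?w b) (?w b) + b * inner (?w b) (?w b) = inner (?w b) f"
          using Res_eq[OF b(1) wb, of f] by (simp add: inner_commute)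
        have eab: "E (?w b) (?w a) + b * inner (?w b) (?w a) = inner (?w a) f"
          using Res_eq[OF b(1) wF, of f] by (simp add: inner_commute)
        have "E (?w b - ?w a) (?w b - ?w a) + b * inner (?w b - ?w a) (?w b - ?w a)
            = (E (?w b) (?w b) + b * inner (?w b) (?w b)) - 2 * (E (?w b) (?w a) + b * inner (?w b) (?w a))
              + (E (?w a) (?w a) + b * inner (?w a) (?w a))"
          by (simp add: form.quad_diff[OF wb wF] inner_diff_left inner_diff_right inner_commute algebra_simps)
        also have "\<dots> \<le> inner (?w b) f - inner (?w a) f"
          using ea eb eab mult_right_mono[OF b(2) inner_ge_zero[of "?w a"]] by simp
        finally have "E (?w b - ?w a) (?w b - ?w a) \<le> B - inner (?w a) f"
          using B[OF b(1)] b(1) mult_nonneg_nonneg[of b "inner (?w b - ?w a) (?w b - ?w a)"] inner_ge_zero[of "?w b - ?w a"]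
          by linarith
        then have d: "sqrt (E (?w b - ?w a) (?w b - ?w a)) \<le> sqrt (B - inner (?w a) f)" by simp
        have "\<bar>E (?w b - ?w a) (\<eta> n)\<bar> \<le> sqrt (E (?w b - ?w a) (?w b - ?w a)) * sqrt (E (\<eta> n) (\<eta> n))"
          by (rule form.Cauchy_Schwarz_abs) (use wb wF \<eta>(1) in auto)
        also have "\<dots> \<le> sqrt (B - inner (?w a) f) * sqrt S"
          using d \<eta>(4)[of n] B[OF a] by (intro mult_mono) (auto intro: form.nonneg \<eta>(1))
        finally have 1: "\<bar>E (?w b - ?w a) (\<eta> n)\<bar> \<le> sqrt (B - inner (?w a) f) * sqrt S" .
        have "(b * norm (?w b))\<^sup>2 = b * (b * inner (?w b) (?w b))"
          by (simp add: power2_eq_square flip: power2_norm_eq_inner)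
        also have "\<dots> \<le> b * B"
          using eb form.nonneg[OF wb] B[OF b(1)] b(1) by (intro mult_left_mono) auto
        finally have "b * norm (?w b) \<le> sqrt (b * B)" by (rule real_le_rsqrt)
        then have 2: "b * norm (?w b) * norm (\<eta> n) \<le> sqrt (b * B) * norm (\<eta> n)" by (intro mult_right_mono) auto
        have "b * inner (?w b) (\<eta> n) \<le> b * (norm (?w b) * norm (\<eta> n))"
          using b(1) by (intro mult_left_mono norm_cauchy_schwarz) auto
        moreover have "inner f (\<eta> n) = E (?w b - ?w a) (\<eta> n) + E (?w a) (\<eta> n) + b * inner (?w b) (\<eta> n)"
          using Res_eq[OF b(1) \<eta>(1)[of n], of f] by (simp add: form.diff_left[OF wb wF \<eta>(1)])
        ultimately show ?thesis using 1 2 by (simp add: mult.assoc)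
      qed
      define c where "c k = a / real (Suc k)" for k
      have c: "0 < c k" "c k \<le> a" for k using a by (auto simp: c_def field_simps)
      have "(\<lambda>k. a * (1 / real (Suc k))) \<longlonglongrightarrow> a * 0"
        by (intro tendsto_intros LIMSEQ_Suc[OF lim_1_over_n])
      then have c0: "c \<longlonglongrightarrow> 0" by (simp add: c_def[abs_def])
      have "(\<lambda>k. sqrt (B - inner (?w a) f) * sqrt S + \<bar>E (?w a) (\<eta> n)\<bar> + sqrt (c k * B) * norm (\<eta> n))
          \<longlonglongrightarrow> sqrt (B - inner (?w a) f) * sqrt S + \<bar>E (?w a) (\<eta> n)\<bar> + sqrt (0 * B) * norm (\<eta> n)"
        by (intro tendsto_intros c0)
      then show ?thesis using le[OF c] by (auto intro: LIMSEQ_le_const)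
    qed
    have ge: "inner f (ind_L2 {- real m..real m}) \<le> inner f (\<eta> n)" if "m \<le> n" for n
    proof -
      have "nonneg_L2 (\<eta> n - ind_L2 {- real m..real m})"
        unfolding nonneg_L2_def
        using \<eta>(3)[of n] \<eta>(2)[of n, unfolded nonneg_L2_def] rep_L2_diff[of "\<eta> n" "ind_L2 {- real m..real m}"]
          rep_ind_L2[of "{- real m..real m}", simplified]
      proof eventually_elim
        case (elim x)
        then show ?case using that by (auto simp: indicator_def)
      qed
      from inner_nonneg_mono[OF this f] show ?thesis by (simp add: inner_commute)
    qed
    have "(\<lambda>n. sqrt (B - inner (?w a) f) * sqrt S + \<bar>E (?w a) (\<eta> n)\<bar>) \<longlonglongrightarrow> sqrt (B - inner (?w a) f) * sqrt S + \<bar>0\<bar>"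
      by (intro tendsto_intros \<eta>(5) wF)
    then have "inner f (ind_L2 {- real m..real m}) \<le> sqrt (B - inner (?w a) f) * sqrt S + \<bar>0\<bar>"
      by (rule LIMSEQ_le_const) (use ge step in \<open>auto intro!: exI[of _ m] intro: order_trans\<close>)
    then show ?thesis by simp
  qed
  have "inner f (ind_L2 {- real m..real m}) \<le> e" if e: "0 < e" for e
  proof -
    \<comment> \<open>Chosen so that sqrt d * sqrt (S + 1) = e; the summand 1 covers the case S =
      0.\<close>
    define d where "d = e\<^sup>2 / (S + 1)"
    have d: "0 < d" using e S by (simp add: d_def)
    have "\<exists>a\<in>{0<..}. B - d < inner (Res a f) f"
      using less_cSUP_iff[OF _ bdd, of "B - d"] d by (simp add: B_def)
    then obtain a where a: "0 < a" "B - d < inner (Res a f) f" by auto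
    have "inner f (ind_L2 {- real m..real m}) \<le> sqrt (B - inner (Res a f) f) * sqrt S" by (rule main[OF a(1)])
    also have "\<dots> \<le> sqrt d * sqrt (S + 1)"
      using a(2) S B[OF a(1)] d by (intro mult_mono) auto
    also have "\<dots> = e"
      using e S by (simp add: d_def real_sqrt_mult[symmetric])
    finally show ?thesis .
  qed
  then show "inner f (ind_L2 {- real m..real m}) \<le> 0" by (rule field_le_epsilon[of _ 0, simplified])
qed

text \<open>On a bounded set A where the Green function is bounded, with \<psi> its indicator, the
  minimum q of f and \<open>Res c \<psi>\<close> has finite Green energy and so vanishes. Then f and
  \<open>Res c \<psi>\<close> have disjoint supports, (R_c f, \<psi>) = 0 for all c, and the Green
  function is 0 on A.\<close>

lemma Green_0_or_top:
  assumes f: "nonneg_L2 f"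
  shows "AE x in lebesgue. Green f x = 0 \<or> Green f x = \<infinity>"
proof -
  have "AE x in lebesgue. x \<in> {- real m..real m} \<and> Green f x \<le> ennreal (real m) \<longrightarrow> Green f x = 0" for m :: nat
  proof -
    define A where "A = {x\<in>space lebesgue. Green f x \<le> ennreal (real m)} \<inter> {- real m..real m}"
    have A [measurable]: "A \<in> sets lebesgue" unfolding A_def by measurable
    have Afin: "emeasure lebesgue A < \<infinity>" unfolding A_def by (rule emeasure_Int_interval_finite) measurable
    define \<psi> where "\<psi> = ind_L2 A"
    have \<psi>: "nonneg_L2 \<psi>" unfolding \<psi>_def by (rule nonneg_ind_L2[OF A Afin])
    have pair: "(\<integral>\<^sup>+x\<in>A. Green f x \<partial>lebesgue) = (SUP a\<in>{0<..}. ennreal (inner (Res a f) \<psi>))"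
      unfolding \<psi>_def nn_integral_ind_L2_Green[OF A Afin, symmetric] by (rule Green_pairing[OF f nonneg_ind_L2[OF A Afin]])
    have "(\<integral>\<^sup>+x\<in>A. Green f x \<partial>lebesgue) \<le> (\<integral>\<^sup>+x\<in>A. ennreal (real m) \<partial>lebesgue)"
      by (intro nn_integral_mono) (auto simp: A_def indicator_def)
    also have "\<dots> = ennreal (real m) * emeasure lebesgue A" by (rule nn_integral_cmult_indicator[OF A])
    also have "\<dots> < \<infinity>" using Afin by (simp add: ennreal_mult_less_top)
    finally obtain N where N: "(\<integral>\<^sup>+x\<in>A. Green f x \<partial>lebesgue) = ennreal N" "0 \<le> N"
      by (cases "\<integral>\<^sup>+x\<in>A. Green f x \<partial>lebesgue") auto
    have leN: "inner (Res a f) \<psi> \<le> N" if "0 < a" for a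
    proof -
      have "ennreal (inner (Res a f) \<psi>) \<le> ennreal N"
        unfolding N(1)[symmetric] pair by (rule SUP_upper) (use that in simp)
      then show ?thesis using N(2) by (simp add: ennreal_le_iff)
    qed
    have zero: "inner (Res c f) \<psi> = 0" if c: "0 < c" for c
    proof -
      have nR: "nonneg_L2 (Res c \<psi>)" by (rule Res_nonneg[OF c \<psi>])
      define q where "q = class_L2 (\<lambda>x. min (rep_L2 f x) (rep_L2 (Res c \<psi>) x))"
      have rq: "AE x in lebesgue. rep_L2 q x = min (rep_L2 f x) (rep_L2 (Res c \<psi>) x)"
        unfolding q_def
      proof (rule rep_class_L2, rule square_integrable_dominated[OF square_integrable_rep_L2[of f]])
        show "AE x in lebesgue. \<bar>min (rep_L2 f x) (rep_L2 (Res c \<psi>) x)\<bar> \<le> \<bar>rep_L2 f x\<bar>"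
          using f[unfolded nonneg_L2_def] nR[unfolded nonneg_L2_def] by eventually_elim auto
      qed measurable
      have q: "nonneg_L2 q" unfolding nonneg_L2_def
        using rq f[unfolded nonneg_L2_def] nR[unfolded nonneg_L2_def] by eventually_elim auto
      have qf: "nonneg_L2 (f - q)" unfolding nonneg_L2_def
        using rq rep_L2_diff[of f q] by eventually_elim auto
      have qR: "nonneg_L2 (Res c \<psi> - q)" unfolding nonneg_L2_def
        using rq rep_L2_diff[of "Res c \<psi>" q] by eventually_elim auto
      \<comment> \<open>(R_a q, q) \<le> (R_a f, R_c \<psi>) = (R_c R_a f, \<psi>), and the
        resolvent identity bounds this by N / (c - a), which is at most 2 N / c for a \<le> c / 2.
        Larger a follow by monotonicity.\<close>
      have small: "inner (Res a q) q \<le> 2 * N / c" if a: "0 < a" "a \<le> c / 2" for a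
      proof -
        have "inner (Res a q) q \<le> inner (Res a f) q"
          by (rule inner_nonneg_mono[OF Res_mono[OF a(1) qf] q])
        also have "\<dots> \<le> inner (Res a f) (Res c \<psi>)"
          using inner_nonneg_mono[OF qR Res_nonneg[OF a(1) f]] by (simp add: inner_commute)
        also have "\<dots> = inner (Res c (Res a f)) \<psi>" by (simp add: Res_sym[OF c])
        finally have 1: "inner (Res a q) q \<le> inner (Res c (Res a f)) \<psi>" .
        have "(c - a) * inner (Res c (Res a f)) \<psi> = inner (Res a f) \<psi> - inner (Res c f) \<psi>"
          using Res_identity[OF a(1) c, of f] by (metis inner_diff_left inner_scaleR_left)
        also have "\<dots> \<le> N" using leN[OF a(1)] ennreal_inner_L2(1)[OF Res_nonneg[OF c f] \<psi>] by simp
        finally have 2: "(c - a) * inner (Res c (Res a f)) \<psi> \<le> N" .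
        have "0 \<le> inner (Res c (Res a f)) \<psi>" by (intro ennreal_inner_L2(1) Res_nonneg c a f \<psi>)
        then have "c / 2 * inner (Res c (Res a f)) \<psi> \<le> (c - a) * inner (Res c (Res a f)) \<psi>"
          using a by (intro mult_right_mono) auto
        then have "inner (Res c (Res a f)) \<psi> \<le> 2 * N / c" using 2 c by (simp add: field_simps)
        then show ?thesis using 1 by simp
      qed
      have "inner (Res a q) q \<le> 2 * N / c" if a: "0 < a" for a
      proof (cases "a \<le> c / 2")
        case False
        then have "inner (Res a q) q \<le> inner (Res (c / 2) q) q"
          using c by (intro inner_nonneg_mono Res_antimono q) auto
        then show ?thesis using small[of "c/2"] c by simp
      qed (use small a in auto)
      then have "AE x in lebesgue. rep_L2 q x = 0" by (rule finite_energy_imp_0[OF q])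
      then have "AE x in lebesgue. rep_L2 f x * rep_L2 (Res c \<psi>) x = 0"
        using rq f[unfolded nonneg_L2_def] nR[unfolded nonneg_L2_def]
        by eventually_elim (auto simp: min_def split: if_splits)
      then have "inner f (Res c \<psi>) = 0" unfolding inner_L2_eq by (rule integral_eq_zero_AE)
      then show ?thesis by (simp add: Res_sym[OF c])
    qed
    have "(\<integral>\<^sup>+x\<in>A. Green f x \<partial>lebesgue) = 0"
      unfolding pair by (intro antisym SUP_least) (auto simp: zero)
    then have "AE x in lebesgue. Green f x * indicator A x = 0"
      by (subst (asm) nn_integral_0_iff_AE) auto
    then show ?thesis by eventually_elim (auto simp: A_def)
  qed
  then have "AE x in lebesgue. \<forall>m::nat. x \<in> {- real m..real m} \<and> Green f x \<le> ennreal (real m) \<longrightarrow> Green f x = 0"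
    unfolding AE_all_countable by blast
  then show ?thesis
  proof eventually_elim
    case (elim x)
    show ?case
    proof (cases "Green f x = \<infinity>")
      case False
      then obtain c where c: "Green f x = ennreal c" "0 \<le> c" by (cases "Green f x") auto
      obtain n where "max \<bar>x\<bar> c \<le> real n" using real_arch_simple by blast
      then have "x \<in> {- real n..real n}" "Green f x \<le> ennreal (real n)"
        unfolding c(1) by (auto intro!: ennreal_leI)
      then show ?thesis using elim by blast
    qed simp
  qed
qed

theorem recurrent_criterion: "recurrent_form E F"
  unfolding recurrent_form_def
proof (intro conjI exI[of _ sg] allI impI)
  show "dirichlet_form E F" by (rule dirichlet)
  show "associated_semigroup E F sg" by (rule associated_sg)
  fix f :: "real \<Rightarrow> real" assume f: "integrable lebesgue f" "\<forall>x. 0 \<le> f x"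
  then have f': "\<And>x. 0 \<le> f x" by simp
  have "AE x in lebesgue. \<forall>k. Green (layer f k) x = 0 \<or> Green (layer f k) x = \<infinity>"
    unfolding AE_all_countable by (intro allI Green_0_or_top nonneg_layer[OF f(1) f'])
  then have "AE x in lebesgue. (\<integral>\<^sup>+t\<in>{0<..}. ennreal (L1_version f (t, x)) \<partial>lebesgue) = 0 \<or>
      (\<integral>\<^sup>+t\<in>{0<..}. ennreal (L1_version f (t, x)) \<partial>lebesgue) = \<infinity>"
    using green_L1_version_eq[OF f(1) f']
  proof eventually_elim
    case (elim x)
    have "(\<Sum>k. Green (layer f k) x) = 0 \<or> (\<Sum>k. Green (layer f k) x) = \<infinity>"
    proof (cases "\<exists>k. Green (layer f k) x = \<infinity>")
      case True
      then obtain k where "Green (layer f k) x = \<infinity>" by blast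
      then have "\<infinity> \<le> (\<Sum>k. Green (layer f k) x)"
        using sum_le_suminf[of "\<lambda>k. Green (layer f k) x" "{k}"] by simp
      then show ?thesis by (simp add: top_unique)
    next
      case False
      then have "Green (layer f k) x = 0" for k using elim(1) by blast
      then show ?thesis by simp
    qed
    then show ?case by (simp only: elim(2))
  qed
  then show "\<exists>g. green_function sg f g \<and> (AE x in lebesgue. g x = 0 \<or> g x = \<infinity>)"
    using green_L1_version[OF f(1) f'] by blast
qed

end

end

section \<open>Jump energies\<close>

definition jump_kernel :: "(real \<Rightarrow> real) \<Rightarrow> bool" where
  "jump_kernel j \<longleftrightarrow> j \<in> borel_measurable borel \<and> (\<forall>z. 0 \<le> j z)"

lemma kernel_measurable [measurable_dest]: "jump_kernel j \<Longrightarrow> j \<in> borel_measurable borel"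
  and kernel_nonneg: "jump_kernel j \<Longrightarrow> 0 \<le> j z"
  by (simp_all add: jump_kernel_def)

lemma nn_integral_reflect:
  fixes H :: "real \<Rightarrow> ennreal"
  assumes "H \<in> borel_measurable borel"
  shows "(\<integral>\<^sup>+y. H (x - y) \<partial>lebesgue) = (\<integral>\<^sup>+z. H z \<partial>lborel)"
  unfolding nn_integral_completion using nn_integral_real_affine[OF assms, of "-1" x] by simp

lemma nn_integral_shift:
  fixes H :: "real \<Rightarrow> ennreal"
  assumes "H \<in> borel_measurable borel"
  shows "(\<integral>\<^sup>+y. H (y - x) \<partial>lebesgue) = (\<integral>\<^sup>+z. H z \<partial>lborel)"
  unfolding nn_integral_completion using nn_integral_real_affine[OF assms, of 1 "- x"] by (simp add: algebra_simps)

lemma nn_integral_conv_left: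
  fixes g H :: "real \<Rightarrow> ennreal"
  assumes [measurable]: "g \<in> borel_measurable lebesgue" "H \<in> borel_measurable borel"
  shows "(\<integral>\<^sup>+x. \<integral>\<^sup>+y. g x * H (x - y) \<partial>lebesgue \<partial>lebesgue) = (\<integral>\<^sup>+x. g x \<partial>lebesgue) * (\<integral>\<^sup>+z. H z \<partial>lborel)"
proof -
  have "(\<integral>\<^sup>+x. \<integral>\<^sup>+y. g x * H (x - y) \<partial>lebesgue \<partial>lebesgue) = (\<integral>\<^sup>+x. g x * (\<integral>\<^sup>+z. H z \<partial>lborel) \<partial>lebesgue)"
    by (intro nn_integral_cong) (simp add: nn_integral_cmult nn_integral_reflect)
  then show ?thesis by (simp add: nn_integral_multc)
qed

lemma nn_integral_conv_right:
  fixes g H :: "real \<Rightarrow> ennreal"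
  assumes [measurable]: "g \<in> borel_measurable lebesgue" "H \<in> borel_measurable borel"
  shows "(\<integral>\<^sup>+x. \<integral>\<^sup>+y. g y * H (x - y) \<partial>lebesgue \<partial>lebesgue) = (\<integral>\<^sup>+x. g x \<partial>lebesgue) * (\<integral>\<^sup>+z. H z \<partial>lborel)"
proof -
  have "(\<integral>\<^sup>+x. \<integral>\<^sup>+y. g y * H (x - y) \<partial>lebesgue \<partial>lebesgue) = (\<integral>\<^sup>+y. \<integral>\<^sup>+x. g y * H (x - y) \<partial>lebesgue \<partial>lebesgue)"
    using lebesgue_pair.Fubini'[of "\<lambda>x y. g y * H (x - y)"] by (simp add: case_prod_beta')
  also have "\<dots> = (\<integral>\<^sup>+y. g y * (\<integral>\<^sup>+z. H z \<partial>lborel) \<partial>lebesgue)"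
    by (intro nn_integral_cong) (simp add: nn_integral_cmult nn_integral_shift)
  finally show ?thesis by (simp add: nn_integral_multc)
qed

lemma semi_inner_L2: "semi_inner (UNIV :: L2 set) inner"
  by unfold_locales (rule inner_commute | simp add: inner_add_left)+

lemma Cauchy_L2:
  fixes X :: "nat \<Rightarrow> L2"
  assumes "\<forall>e>0. \<exists>N. \<forall>j\<ge>N. \<forall>k\<ge>N. inner (X j - X k) (X j - X k) < e"
  shows "Cauchy X"
proof (rule metric_CauchyI)
  fix e :: real assume "0 < e"
  then obtain N where N: "\<forall>j\<ge>N. \<forall>k\<ge>N. inner (X j - X k) (X j - X k) < e\<^sup>2" using assms by (meson zero_less_power)
  have "dist (X j) (X k) < e" if "j \<ge> N" "k \<ge> N" for j k
    using N that \<open>0 < e\<close> by (intro power2_less_imp_less[of _ e]) (auto simp: dist_norm power2_norm_eq_inner)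
  then show "\<exists>M. \<forall>m\<ge>M. \<forall>n\<ge>M. dist (X m) (X n) < e" by blast
qed

lemma L2_complete:
  fixes X :: "nat \<Rightarrow> L2"
  assumes "\<forall>e>0. \<exists>N. \<forall>j\<ge>N. \<forall>k\<ge>N. inner (X j - X k) (X j - X k) < e"
  shows "\<exists>u\<in>UNIV. (\<lambda>k. inner (X k - u) (X k - u)) \<longlonglongrightarrow> 0"
proof -
  obtain u where u: "X \<longlonglongrightarrow> u"
    using Cauchy_convergent[OF Cauchy_L2[OF assms]] by (auto simp: convergent_def)
  have "(\<lambda>k. inner (X k - u) (X k - u)) \<longlonglongrightarrow> inner (u - u) (u - u)" by (intro tendsto_intros u)
  then show ?thesis by auto
qed

text \<open>Carries almost-everywhere identities between representatives of classes into the double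
  integrals.\<close>

lemma AE_fst_snd:
  fixes P :: "real \<Rightarrow> bool"
  assumes "AE x in lebesgue. P x"
  shows "AE \<omega> in lebesgue \<Otimes>\<^sub>M lebesgue. P (fst \<omega>) \<and> P (snd \<omega>)"
proof -
  obtain N where N: "{x. \<not> P x} \<subseteq> N" "N \<in> null_sets lebesgue"
    using assms by (auto simp: eventually_ae_filter)
  then have [measurable]: "N \<in> sets lebesgue" by auto
  have ae: "AE x in lebesgue. x \<notin> N" using N(2) by (rule AE_not_in)
  have "AE \<omega> in lebesgue \<Otimes>\<^sub>M lebesgue. fst \<omega> \<notin> N \<and> snd \<omega> \<notin> N"
  proof (rule lebesgue_pair.AE_pair_measure)
    show "{\<omega> \<in> space (lebesgue \<Otimes>\<^sub>M lebesgue). fst \<omega> \<notin> N \<and> snd \<omega> \<notin> N} \<in> sets (lebesgue \<Otimes>\<^sub>M lebesgue)"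
      by measurable
    show "AE x in lebesgue. AE y in lebesgue. fst (x, y) \<notin> N \<and> snd (x, y) \<notin> N"
      using ae
    proof eventually_elim
      case (elim x)
      then show ?case using ae by (auto elim: eventually_mono)
    qed
  qed
  then show ?thesis by eventually_elim (use N(1) in blast)
qed

section \<open>Jump kernels with a bounded measurable weight\<close>

locale coefficient =
  fixes \<kappa> :: "real \<Rightarrow> real" and c C :: real
  assumes \<kappa>_measurable [measurable]: "\<kappa> \<in> borel_measurable lebesgue"
    and c_pos: "0 < c" and \<kappa>_bounds: "\<And>x. c \<le> \<kappa> x \<and> \<kappa> x \<le> C"
begin

lemma \<kappa>_pos: "0 < \<kappa> x" using \<kappa>_bounds[of x] c_pos by simp

lemma C_nonneg: "0 \<le> C" using \<kappa>_bounds[of 0] c_pos by simp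

text \<open>The weight sits at the first variable, so \<open>J\<close> is not symmetric in x and y.
  The form is symmetric in its two arguments all the same, and estimates compare \<open>J\<close>
  with the convolution kernel, the ratio lying between 1 and \<open>C + 1\<close>.\<close>

definition J :: "(real \<Rightarrow> real) \<Rightarrow> real \<Rightarrow> real \<Rightarrow> real" where
  "J j x y = (\<kappa> x + 1) * j \<bar>x - y\<bar>"

lemma J_nonneg: "jump_kernel j \<Longrightarrow> 0 \<le> J j x y"
  unfolding J_def by (intro mult_nonneg_nonneg) (auto simp: kernel_nonneg less_imp_le[OF \<kappa>_pos] add_nonneg_nonneg)

lemma J_le: "jump_kernel j \<Longrightarrow> J j x y \<le> (C + 1) * j \<bar>x - y\<bar>"
  unfolding J_def by (intro mult_right_mono) (auto simp: kernel_nonneg \<kappa>_bounds)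

lemma J_ge: "jump_kernel j \<Longrightarrow> j \<bar>x - y\<bar> \<le> J j x y"
  unfolding J_def using mult_right_mono[of 1 "\<kappa> x + 1" "j \<bar>x - y\<bar>"] \<kappa>_pos[of x] kernel_nonneg[of j] by simp

lemma J_measurable [measurable]:
  assumes [measurable]: "jump_kernel j"
  shows "(\<lambda>\<omega>. J j (fst \<omega>) (snd \<omega>)) \<in> borel_measurable (lebesgue \<Otimes>\<^sub>M lebesgue)"
    "(\<lambda>y. J j x y) \<in> borel_measurable lebesgue"
proof -
  have [measurable]: "j \<in> borel_measurable borel" using assms by (rule kernel_measurable)
  have [measurable]: "(\<lambda>\<omega>. \<kappa> (fst \<omega>)) \<in> borel_measurable (lebesgue \<Otimes>\<^sub>M (lebesgue :: real measure))"
    by (rule measurable_compose[OF measurable_fst \<kappa>_measurable])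
  show "(\<lambda>\<omega>. J j (fst \<omega>) (snd \<omega>)) \<in> borel_measurable (lebesgue \<Otimes>\<^sub>M lebesgue)"
    "(\<lambda>y. J j x y) \<in> borel_measurable lebesgue"
    unfolding J_def by measurable
qed

text \<open>Twice the form. The diagonal may be included since the integrand vanishes there, and a
  pointwise function as argument avoids choosing representatives.\<close>

definition energy :: "(real \<Rightarrow> real) \<Rightarrow> (real \<Rightarrow> real) \<Rightarrow> ennreal" where
  "energy j f = (\<integral>\<^sup>+\<omega>. ennreal ((f (fst \<omega>) - f (snd \<omega>))\<^sup>2 * J j (fst \<omega>) (snd \<omega>)) \<partial>(lebesgue \<Otimes>\<^sub>M lebesgue))"

lemma jump_energy_eq: "jump_energy (J j) u = 1/2 * energy j (rep_L2 u)"
  unfolding jump_energy_def energy_def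
  by (intro arg_cong[where f = "\<lambda>x. 1/2 * x"] nn_integral_cong) (auto simp: indicator_def)

lemma energy_iterated:
  assumes [measurable]: "jump_kernel j" "f \<in> borel_measurable lebesgue"
  shows "energy j f = (\<integral>\<^sup>+x. \<integral>\<^sup>+y. ennreal ((f x - f y)\<^sup>2 * J j x y) \<partial>lebesgue \<partial>lebesgue)"
  unfolding energy_def by (subst lebesgue.nn_integral_fst[symmetric]) (simp_all add: case_prod_beta')

lemma energy_cong:
  assumes [measurable]: "jump_kernel j" "f \<in> borel_measurable lebesgue" "g \<in> borel_measurable lebesgue"
    and ae: "AE x in lebesgue. f x = g x"
  shows "energy j f = energy j g"
  unfolding energy_iterated[OF assms(1,2)] energy_iterated[OF assms(1,3)]
proof (rule nn_integral_cong_AE)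
  show "AE x in lebesgue. (\<integral>\<^sup>+y. ennreal ((f x - f y)\<^sup>2 * J j x y) \<partial>lebesgue) = (\<integral>\<^sup>+y. ennreal ((g x - g y)\<^sup>2 * J j x y) \<partial>lebesgue)"
    using ae
  proof eventually_elim
    case (elim x)
    show ?case
      by (rule nn_integral_cong_AE) (use ae elim in \<open>auto elim!: eventually_mono\<close>)
  qed
qed

lemma energy_mono:
  assumes "\<And>x y. x \<noteq> y \<Longrightarrow> (f x - f y)\<^sup>2 * J j x y \<le> (g x - g y)\<^sup>2 * J k x y"
  shows "energy j f \<le> energy k g"
  unfolding energy_def
proof (intro nn_integral_mono ennreal_leI)
  fix \<omega> :: "real \<times> real"
  show "(f (fst \<omega>) - f (snd \<omega>))\<^sup>2 * J j (fst \<omega>) (snd \<omega>) \<le> (g (fst \<omega>) - g (snd \<omega>))\<^sup>2 * J k (fst \<omega>) (snd \<omega>)"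
    using assms by (cases "fst \<omega> = snd \<omega>") auto
qed

lemma energy_kernel_mono:
  assumes "jump_kernel j" "jump_kernel k" "\<And>z. 0 < z \<Longrightarrow> j z \<le> k z"
  shows "energy j f \<le> energy k f"
proof (rule energy_mono)
  fix x y :: real assume "x \<noteq> y"
  then show "(f x - f y)\<^sup>2 * J j x y \<le> (f x - f y)\<^sup>2 * J k x y"
    using \<kappa>_pos[of x] unfolding J_def by (intro mult_left_mono assms(3)) auto
qed

text \<open>With \<open>energy_ge\<close>, a two-sided comparison with the translation-invariant
  energy, to which substitutions and convolutions apply.\<close>

lemma energy_le:
  assumes [measurable]: "jump_kernel j" "f \<in> borel_measurable lebesgue"
  shows "energy j f \<le> ennreal (C + 1) * (\<integral>\<^sup>+x. \<integral>\<^sup>+y. ennreal ((f x - f y)\<^sup>2) * ennreal (j \<bar>x - y\<bar>) \<partial>lebesgue \<partial>lebesgue)"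
proof -
  have [measurable]: "j \<in> borel_measurable borel" using assms(1) by (rule kernel_measurable)
  have "energy j f \<le> (\<integral>\<^sup>+x. \<integral>\<^sup>+y. ennreal (C + 1) * (ennreal ((f x - f y)\<^sup>2) * ennreal (j \<bar>x - y\<bar>)) \<partial>lebesgue \<partial>lebesgue)"
    unfolding energy_iterated[OF assms]
  proof (intro nn_integral_mono)
    fix x y
    have "(f x - f y)\<^sup>2 * J j x y \<le> (f x - f y)\<^sup>2 * ((C + 1) * j \<bar>x - y\<bar>)"
      by (intro mult_left_mono J_le assms) auto
    then have "ennreal ((f x - f y)\<^sup>2 * J j x y) \<le> ennreal ((C + 1) * ((f x - f y)\<^sup>2 * j \<bar>x - y\<bar>))"
      by (intro ennreal_leI) (simp add: algebra_simps)
    then show "ennreal ((f x - f y)\<^sup>2 * J j x y) \<le> ennreal (C + 1) * (ennreal ((f x - f y)\<^sup>2) * ennreal (j \<bar>x - y\<bar>))"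
      using C_nonneg kernel_nonneg[OF assms(1)] by (simp add: ennreal_mult)
  qed
  also have "\<dots> = ennreal (C + 1) * (\<integral>\<^sup>+x. \<integral>\<^sup>+y. ennreal ((f x - f y)\<^sup>2) * ennreal (j \<bar>x - y\<bar>) \<partial>lebesgue \<partial>lebesgue)"
    by (simp add: nn_integral_cmult)
  finally show ?thesis .
qed

lemma energy_ge:
  assumes [measurable]: "jump_kernel j" "f \<in> borel_measurable lebesgue"
  shows "(\<integral>\<^sup>+x. \<integral>\<^sup>+y. ennreal ((f x - f y)\<^sup>2) * ennreal (j \<bar>x - y\<bar>) \<partial>lebesgue \<partial>lebesgue) \<le> energy j f"
  unfolding energy_iterated[OF assms]
proof (intro nn_integral_mono)
  fix x y
  have "(f x - f y)\<^sup>2 * j \<bar>x - y\<bar> \<le> (f x - f y)\<^sup>2 * J j x y"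
    by (intro mult_left_mono J_ge assms) auto
  then have "ennreal ((f x - f y)\<^sup>2 * j \<bar>x - y\<bar>) \<le> ennreal ((f x - f y)\<^sup>2 * J j x y)" by (rule ennreal_leI)
  then show "ennreal ((f x - f y)\<^sup>2) * ennreal (j \<bar>x - y\<bar>) \<le> ennreal ((f x - f y)\<^sup>2 * J j x y)"
    using kernel_nonneg[OF assms(1)] by (simp add: ennreal_mult)
qed

definition finite_energy :: "(real \<Rightarrow> real) \<Rightarrow> L2 set" where
  "finite_energy j = {u. energy j (rep_L2 u) < \<infinity>}"

definition diff_form :: "(real \<Rightarrow> real) \<Rightarrow> L2 \<Rightarrow> L2 \<Rightarrow> real \<times> real \<Rightarrow> real" where
  "diff_form j u v \<omega> = (rep_L2 u (fst \<omega>) - rep_L2 u (snd \<omega>)) * (rep_L2 v (fst \<omega>) - rep_L2 v (snd \<omega>)) * J j (fst \<omega>) (snd \<omega>)"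

lemma diff_form_measurable [measurable]:
  assumes [measurable]: "jump_kernel j"
  shows "diff_form j u v \<in> borel_measurable (lebesgue \<Otimes>\<^sub>M lebesgue)"
  unfolding diff_form_def[abs_def] by measurable

lemma jump_form_eq: "jump_form (J j) u v = 1/2 * (LINT \<omega>|(lebesgue \<Otimes>\<^sub>M lebesgue). diff_form j u v \<omega>)"
  unfolding jump_form_def set_lebesgue_integral_def diff_form_def
  by (intro arg_cong[where f = "\<lambda>x. 1/2 * x"] Bochner_Integration.integral_cong) (auto simp: indicator_def)

lemma energy_eq_diff_form: "energy j (rep_L2 u) = (\<integral>\<^sup>+\<omega>. ennreal (diff_form j u u \<omega>) \<partial>(lebesgue \<Otimes>\<^sub>M lebesgue))"
  by (simp add: energy_def diff_form_def power2_eq_square)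

lemma diff_form_nonneg: "jump_kernel j \<Longrightarrow> 0 \<le> diff_form j u u \<omega>"
  unfolding diff_form_def by (rule mult_nonneg_nonneg[OF zero_le_square J_nonneg])

lemma integrable_diff_form_self:
  assumes [measurable]: "jump_kernel j" and "u \<in> finite_energy j"
  shows "integrable (lebesgue \<Otimes>\<^sub>M lebesgue) (diff_form j u u)"
proof (rule integrableI_bounded)
  show "(\<integral>\<^sup>+\<omega>. ennreal (norm (diff_form j u u \<omega>)) \<partial>(lebesgue \<Otimes>\<^sub>M lebesgue)) < \<infinity>"
    using assms(2) by (simp add: finite_energy_def energy_eq_diff_form diff_form_nonneg[OF assms(1)])
qed measurable

lemma integrable_diff_form:
  assumes [measurable]: "jump_kernel j" and "u \<in> finite_energy j" "v \<in> finite_energy j"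
  shows "integrable (lebesgue \<Otimes>\<^sub>M lebesgue) (diff_form j u v)"
proof (rule Bochner_Integration.integrable_bound)
  show "integrable (lebesgue \<Otimes>\<^sub>M lebesgue) (\<lambda>\<omega>. diff_form j u u \<omega> + diff_form j v v \<omega>)"
    by (intro Bochner_Integration.integrable_add integrable_diff_form_self assms)
  show "AE \<omega> in lebesgue \<Otimes>\<^sub>M lebesgue. norm (diff_form j u v \<omega>) \<le> norm (diff_form j u u \<omega> + diff_form j v v \<omega>)"
  proof (intro AE_I2)
    fix \<omega> :: "real \<times> real"
    define a b k where "a = rep_L2 u (fst \<omega>) - rep_L2 u (snd \<omega>)" "b = rep_L2 v (fst \<omega>) - rep_L2 v (snd \<omega>)"
      "k = J j (fst \<omega>) (snd \<omega>)"
    note d = this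
    have k: "0 \<le> k" unfolding d by (rule J_nonneg[OF assms(1)])
    have "\<bar>a * b\<bar> \<le> a * a + b * b"
      using sum_squares_bound[of "\<bar>a\<bar>" "\<bar>b\<bar>"] zero_le_power2[of a] zero_le_power2[of b] abs_ge_zero[of "a * b"]
      unfolding abs_mult power2_abs power2_eq_square by linarith
    then have "\<bar>a * b\<bar> * k \<le> (a * a + b * b) * k" using k by (rule mult_right_mono)
    then have "norm (diff_form j u v \<omega>) \<le> diff_form j u u \<omega> + diff_form j v v \<omega>"
      using k by (simp add: diff_form_def d[symmetric] abs_mult distrib_right)
    then show "norm (diff_form j u v \<omega>) \<le> norm (diff_form j u u \<omega> + diff_form j v v \<omega>)" by simp
  qed
qed measurable

lemma jump_energy_jump_form:
  assumes "jump_kernel j" "u \<in> finite_energy j"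
  shows "jump_energy (J j) u = ennreal (jump_form (J j) u u)" "0 \<le> jump_form (J j) u u"
    "energy j (rep_L2 u) = ennreal (2 * jump_form (J j) u u)"
proof -
  have nn: "0 \<le> (LINT \<omega>|(lebesgue \<Otimes>\<^sub>M lebesgue). diff_form j u u \<omega>)"
    by (intro integral_nonneg_AE AE_I2 diff_form_nonneg assms)
  have e: "energy j (rep_L2 u) = ennreal (LINT \<omega>|(lebesgue \<Otimes>\<^sub>M lebesgue). diff_form j u u \<omega>)"
    unfolding energy_eq_diff_form
    by (intro nn_integral_eq_integral integrable_diff_form_self AE_I2 diff_form_nonneg assms)
  then show "energy j (rep_L2 u) = ennreal (2 * jump_form (J j) u u)" by (simp add: jump_form_eq)
  show "0 \<le> jump_form (J j) u u" unfolding jump_form_eq using nn by simp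
  have half: "1/2 = ennreal (1/2)"
    by (metis divide_ennreal ennreal_1 ennreal_numeral zero_le_numeral zero_le_one zero_less_numeral)
  show "jump_energy (J j) u = ennreal (jump_form (J j) u u)"
    unfolding jump_energy_eq e half jump_form_eq by (rule ennreal_mult[symmetric]) (use nn in auto)
qed

lemma energy_add_le:
  assumes [measurable]: "jump_kernel j" "f \<in> borel_measurable lebesgue" "g \<in> borel_measurable lebesgue"
  shows "energy j (\<lambda>x. f x + g x) \<le> 2 * energy j f + 2 * energy j g"
proof -
  have "energy j (\<lambda>x. f x + g x)
      \<le> (\<integral>\<^sup>+\<omega>. 2 * ennreal ((f (fst \<omega>) - f (snd \<omega>))\<^sup>2 * J j (fst \<omega>) (snd \<omega>))
          + 2 * ennreal ((g (fst \<omega>) - g (snd \<omega>))\<^sup>2 * J j (fst \<omega>) (snd \<omega>)) \<partial>(lebesgue \<Otimes>\<^sub>M lebesgue))"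
    unfolding energy_def
  proof (intro nn_integral_mono)
    fix \<omega> :: "real \<times> real"
    define a b k where "a = f (fst \<omega>) - f (snd \<omega>)" "b = g (fst \<omega>) - g (snd \<omega>)" "k = J j (fst \<omega>) (snd \<omega>)"
    note d = this
    have k: "0 \<le> k" unfolding d by (rule J_nonneg[OF assms(1)])
    have "(a + b)\<^sup>2 \<le> 2 * a\<^sup>2 + 2 * b\<^sup>2" using sum_squares_bound[of a b] by (simp add: power2_sum)
    then have "(a + b)\<^sup>2 * k \<le> (2 * a\<^sup>2 + 2 * b\<^sup>2) * k" using k by (rule mult_right_mono)
    then have "ennreal ((a + b)\<^sup>2 * k) \<le> ennreal (2 * (a\<^sup>2 * k) + 2 * (b\<^sup>2 * k))"
      by (intro ennreal_leI) (simp add: algebra_simps)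
    also have "\<dots> = 2 * ennreal (a\<^sup>2 * k) + 2 * ennreal (b\<^sup>2 * k)"
      using k by (simp add: ennreal_mult'')
    finally show "ennreal ((f (fst \<omega>) + g (fst \<omega>) - (f (snd \<omega>) + g (snd \<omega>)))\<^sup>2 * J j (fst \<omega>) (snd \<omega>))
      \<le> 2 * ennreal ((f (fst \<omega>) - f (snd \<omega>))\<^sup>2 * J j (fst \<omega>) (snd \<omega>))
          + 2 * ennreal ((g (fst \<omega>) - g (snd \<omega>))\<^sup>2 * J j (fst \<omega>) (snd \<omega>))"
      by (simp add: d algebra_simps)
  qed
  also have "\<dots> = 2 * energy j f + 2 * energy j g"
    unfolding energy_def by (simp add: nn_integral_add nn_integral_cmult)
  finally show ?thesis .
qed

lemma energy_scale:
  assumes [measurable]: "jump_kernel j" "f \<in> borel_measurable lebesgue"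
  shows "energy j (\<lambda>x. r * f x) = ennreal (r\<^sup>2) * energy j f"
proof -
  have "(r * f x - r * f y)\<^sup>2 * J j x y = r\<^sup>2 * ((f x - f y)\<^sup>2 * J j x y)" for x y
    unfolding right_diff_distrib[symmetric] power_mult_distrib by (rule mult.assoc)
  then have "ennreal ((r * f x - r * f y)\<^sup>2 * J j x y) = ennreal (r\<^sup>2) * ennreal ((f x - f y)\<^sup>2 * J j x y)" for x y
    by (simp only: ennreal_mult' zero_le_power2)
  then show ?thesis
    unfolding energy_def by (simp add: nn_integral_cmult case_prod_beta')
qed

lemma energy_rep_add: "jump_kernel j \<Longrightarrow> energy j (rep_L2 (u + v)) = energy j (\<lambda>x. rep_L2 u x + rep_L2 v x)"
  by (rule energy_cong) (auto intro: rep_L2_add)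

lemma energy_rep_scale: "jump_kernel j \<Longrightarrow> energy j (rep_L2 (r *\<^sub>R u)) = ennreal (r\<^sup>2) * energy j (rep_L2 u)"
  by (subst energy_scale[symmetric]) (auto intro: rep_L2_scale energy_cong)

lemma subspace_finite_energy:
  assumes k: "jump_kernel j"
  shows "subspace (finite_energy j)"
  unfolding subspace_def
proof (intro conjI ballI allI)
  have "energy j (rep_L2 0) = energy j (\<lambda>x. 0)" by (rule energy_cong[OF k]) (auto intro: rep_L2_zero)
  then show "0 \<in> finite_energy j" by (simp add: finite_energy_def energy_def)
  fix u v and r :: real assume u: "u \<in> finite_energy j"
  then show "r *\<^sub>R u \<in> finite_energy j"
    by (simp add: finite_energy_def energy_rep_scale[OF k] ennreal_mult_less_top)
  assume v: "v \<in> finite_energy j"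
  have "energy j (rep_L2 (u + v)) \<le> 2 * energy j (rep_L2 u) + 2 * energy j (rep_L2 v)"
    unfolding energy_rep_add[OF k] by (rule energy_add_le) (use k in auto)
  also have "\<dots> < \<infinity>" using u v by (simp add: finite_energy_def ennreal_mult_less_top)
  finally show "u + v \<in> finite_energy j" by (simp add: finite_energy_def)
qed

lemma semi_inner_jump_form:
  assumes k [measurable]: "jump_kernel j"
  shows "semi_inner (finite_energy j) (jump_form (J j))"
proof
  show "subspace (finite_energy j)" by (rule subspace_finite_energy[OF k])
  note sub = subspace_add[OF this] subspace_scale[OF this]
  fix u v w and r :: real assume u: "u \<in> finite_energy j"
  show "0 \<le> jump_form (J j) u u" by (rule jump_energy_jump_form[OF k u])
  assume v: "v \<in> finite_energy j"
  show "jump_form (J j) u v = jump_form (J j) v u"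
    by (simp add: jump_form_eq diff_form_def mult.commute)
  have "(LINT \<omega>|(lebesgue \<Otimes>\<^sub>M lebesgue). diff_form j (r *\<^sub>R u) v \<omega>) = (LINT \<omega>|(lebesgue \<Otimes>\<^sub>M lebesgue). r * diff_form j u v \<omega>)"
  proof (rule integral_cong_AE)
    show "AE \<omega> in lebesgue \<Otimes>\<^sub>M lebesgue. diff_form j (r *\<^sub>R u) v \<omega> = r * diff_form j u v \<omega>"
      using AE_fst_snd[OF rep_L2_scale[of r u]] by eventually_elim (simp add: diff_form_def algebra_simps)
  qed measurable
  then show "jump_form (J j) (r *\<^sub>R u) v = r * jump_form (J j) u v" by (simp add: jump_form_eq)
  assume w: "w \<in> finite_energy j"
  have "(LINT \<omega>|(lebesgue \<Otimes>\<^sub>M lebesgue). diff_form j (u + v) w \<omega>)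
      = (LINT \<omega>|(lebesgue \<Otimes>\<^sub>M lebesgue). diff_form j u w \<omega> + diff_form j v w \<omega>)"
  proof (rule integral_cong_AE)
    show "AE \<omega> in lebesgue \<Otimes>\<^sub>M lebesgue. diff_form j (u + v) w \<omega> = diff_form j u w \<omega> + diff_form j v w \<omega>"
      using AE_fst_snd[OF rep_L2_add[of u v]] by eventually_elim (simp add: diff_form_def algebra_simps)
  qed measurable
  also have "\<dots> = (LINT \<omega>|(lebesgue \<Otimes>\<^sub>M lebesgue). diff_form j u w \<omega>) + (LINT \<omega>|(lebesgue \<Otimes>\<^sub>M lebesgue). diff_form j v w \<omega>)"
    by (intro Bochner_Integration.integral_add integrable_diff_form k u v w)
  finally show "jump_form (J j) (u + v) w = jump_form (J j) u w + jump_form (J j) v w"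
    by (simp add: jump_form_eq)
qed

section \<open>Lower semicontinuity\<close>

text \<open>An integrable kernel gives a bounded form: (a - b)^2 \<le> 2 a^2 + 2 b^2, and each of
  the two terms integrates to 2 |u|^2 times the mass of the kernel.\<close>

lemma energy_le_norm:
  assumes k [measurable]: "jump_kernel j" and I: "(\<integral>\<^sup>+z. ennreal (j \<bar>z\<bar>) \<partial>lborel) \<le> ennreal B" "0 \<le> B"
  shows "energy j (rep_L2 u) \<le> ennreal (4 * (C + 1) * B * (norm u)\<^sup>2)"
proof -
  have [measurable]: "j \<in> borel_measurable borel" using k by (rule kernel_measurable)
  define g where "g x = ennreal (2 * (rep_L2 u x)\<^sup>2)" for x
  have [measurable]: "g \<in> borel_measurable lebesgue" unfolding g_def by measurable
  have ig: "(\<integral>\<^sup>+x. g x \<partial>lebesgue) = ennreal (2 * (norm u)\<^sup>2)"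
    unfolding g_def by (simp add: ennreal_mult' nn_integral_cmult norm_L2_eq_nn_integral)
  have "(\<integral>\<^sup>+x. \<integral>\<^sup>+y. ennreal ((rep_L2 u x - rep_L2 u y)\<^sup>2) * ennreal (j \<bar>x - y\<bar>) \<partial>lebesgue \<partial>lebesgue)
      \<le> (\<integral>\<^sup>+x. \<integral>\<^sup>+y. g x * ennreal (j \<bar>x - y\<bar>) + g y * ennreal (j \<bar>x - y\<bar>) \<partial>lebesgue \<partial>lebesgue)"
  proof (intro nn_integral_mono)
    fix x y
    have "(rep_L2 u x - rep_L2 u y)\<^sup>2 \<le> 2 * (rep_L2 u x)\<^sup>2 + 2 * (rep_L2 u y)\<^sup>2"
      using zero_le_power2[of "rep_L2 u x + rep_L2 u y"] by (simp add: power2_sum power2_diff)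
    then have "ennreal ((rep_L2 u x - rep_L2 u y)\<^sup>2) \<le> ennreal (2 * (rep_L2 u x)\<^sup>2 + 2 * (rep_L2 u y)\<^sup>2)"
      by (rule ennreal_leI)
    also have "\<dots> = g x + g y" by (simp add: g_def)
    finally have "ennreal ((rep_L2 u x - rep_L2 u y)\<^sup>2) \<le> g x + g y" .
    then show "ennreal ((rep_L2 u x - rep_L2 u y)\<^sup>2) * ennreal (j \<bar>x - y\<bar>) \<le> g x * ennreal (j \<bar>x - y\<bar>) + g y * ennreal (j \<bar>x - y\<bar>)"
      unfolding distrib_right[symmetric] by (rule mult_right_mono) simp
  qed
  also have "\<dots> = (\<integral>\<^sup>+x. (\<integral>\<^sup>+y. g x * ennreal (j \<bar>x - y\<bar>) \<partial>lebesgue) + (\<integral>\<^sup>+y. g y * ennreal (j \<bar>x - y\<bar>) \<partial>lebesgue) \<partial>lebesgue)"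
    by (intro nn_integral_cong nn_integral_add) measurable
  also have "\<dots> = (\<integral>\<^sup>+x. \<integral>\<^sup>+y. g x * ennreal (j \<bar>x - y\<bar>) \<partial>lebesgue \<partial>lebesgue) + (\<integral>\<^sup>+x. \<integral>\<^sup>+y. g y * ennreal (j \<bar>x - y\<bar>) \<partial>lebesgue \<partial>lebesgue)"
    by (intro nn_integral_add) measurable
  also have "\<dots> = ennreal (2 * (norm u)\<^sup>2) * (\<integral>\<^sup>+z. ennreal (j \<bar>z\<bar>) \<partial>lborel) + ennreal (2 * (norm u)\<^sup>2) * (\<integral>\<^sup>+z. ennreal (j \<bar>z\<bar>) \<partial>lborel)"
    using nn_integral_conv_left[of g "\<lambda>z. ennreal (j \<bar>z\<bar>)"] nn_integral_conv_right[of g "\<lambda>z. ennreal (j \<bar>z\<bar>)"]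
    by (simp add: ig)
  also have "\<dots> \<le> ennreal (2 * (norm u)\<^sup>2) * ennreal B + ennreal (2 * (norm u)\<^sup>2) * ennreal B"
    by (intro add_mono mult_left_mono I) auto
  also have "\<dots> = ennreal (4 * B * (norm u)\<^sup>2)"
    using I(2) by (simp add: ennreal_mult[symmetric] ennreal_plus[symmetric] del: ennreal_plus)
  finally have "ennreal (C + 1) * (\<integral>\<^sup>+x. \<integral>\<^sup>+y. ennreal ((rep_L2 u x - rep_L2 u y)\<^sup>2) * ennreal (j \<bar>x - y\<bar>) \<partial>lebesgue \<partial>lebesgue)
      \<le> ennreal (C + 1) * ennreal (4 * B * (norm u)\<^sup>2)" by (rule mult_left_mono) simp
  also have "\<dots> = ennreal (4 * (C + 1) * B * (norm u)\<^sup>2)"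
    using I(2) C_nonneg by (simp add: ennreal_mult[symmetric] algebra_simps)
  finally show ?thesis using energy_le[OF k rep_L2_measurable, of u] by (rule order_trans[rotated])
qed

text \<open>A bounded nonnegative form is continuous, and a continuous convex function is weakly lower semicontinuous.\<close>

lemma energy_lsc_bounded:
  assumes k: "jump_kernel j" and I: "(\<integral>\<^sup>+z. ennreal (j \<bar>z\<bar>) \<partial>lborel) \<le> ennreal B" "0 \<le> B"
    and w: "weakly_tendsto un u"
  shows "energy j (rep_L2 u) \<le> liminf (\<lambda>n. energy j (rep_L2 (un n)))"
proof -
  define Q where "Q = jump_form (J j)"
  have fin: "v \<in> finite_energy j" for v
    using energy_le_norm[OF k I, of v] by (auto simp: finite_energy_def intro: le_less_trans)
  interpret Q: semi_inner "finite_energy j" Q unfolding Q_def by (rule semi_inner_jump_form[OF k])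
  interpret L: semi_inner "UNIV :: L2 set" inner by (rule semi_inner_L2)
  define D where "D = 2 * (C + 1) * B"
  have D: "0 \<le> D" using C_nonneg I(2) by (simp add: D_def)
  have Qle: "Q v v \<le> D * inner v v" for v
  proof -
    have "ennreal (2 * Q v v) \<le> ennreal (2 * (D * inner v v))"
      using energy_le_norm[OF k I, of v] unfolding jump_energy_jump_form(3)[OF k fin] Q_def
      by (simp add: D_def power2_norm_eq_inner algebra_simps)
    then show ?thesis using D by (subst (asm) ennreal_le_iff) auto
  qed
  \<comment> \<open>The functional \<open>\<lambda>v. Q v u\<close> is bounded on L^2, so it is an
    inner product with some \<open>p\<close>; weak convergence then applies to it. The conclusion
    uses 2 Q(u_n, u) - Q(u, u) \<le> Q(u_n, u_n).\<close>
  obtain p where p: "\<And>v. inner p v = Q v u"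
  proof (rule L.projection[where W = UNIV and l = "\<lambda>v. Q v u" and M = "D * Q u u"])
    show "(Q v u)\<^sup>2 \<le> D * Q u u * inner v v" for v
    proof -
      have "(Q v u)\<^sup>2 \<le> Q v v * Q u u" by (rule Q.Cauchy_Schwarz[OF fin fin])
      also have "\<dots> \<le> (D * inner v v) * Q u u" by (intro mult_right_mono Qle Q.nonneg fin)
      finally show ?thesis by (simp add: algebra_simps)
    qed
    show "0 \<le> D * Q u u" using D Q.nonneg[OF fin] by simp
  qed (use L2_complete Q.add_left Q.scale_left fin in auto)
  have "(\<lambda>n. Q (un n) u) \<longlonglongrightarrow> Q u u"
    using w unfolding weakly_tendsto_def p[symmetric] inner_commute[of p] by blast
  then have "(\<lambda>n. ennreal (4 * Q (un n) u - 2 * Q u u)) \<longlonglongrightarrow> ennreal (4 * Q u u - 2 * Q u u)"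
    by (intro tendsto_intros)
  then have "ennreal (2 * Q u u) = liminf (\<lambda>n. ennreal (4 * Q (un n) u - 2 * Q u u))"
    using lim_imp_Liminf[OF sequentially_bot] by fastforce
  also have "\<dots> \<le> liminf (\<lambda>n. energy j (rep_L2 (un n)))"
  proof (intro Liminf_mono always_eventually allI)
    fix n
    have "0 \<le> Q (un n - u) (un n - u)" by (intro Q.nonneg fin)
    then have "4 * Q (un n) u - 2 * Q u u \<le> 2 * Q (un n) (un n)" by (simp add: Q.quad_diff fin)
    then show "ennreal (4 * Q (un n) u - 2 * Q u u) \<le> energy j (rep_L2 (un n))"
      unfolding jump_energy_jump_form(3)[OF k fin] Q_def by (rule ennreal_leI)
  qed
  finally show ?thesis unfolding jump_energy_jump_form(3)[OF k fin] Q_def .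
qed

lemma energy_lsc:
  assumes k: "\<And>n. jump_kernel (jn n)" "jump_kernel j" and lim: "\<And>z. 0 < z \<Longrightarrow> (\<lambda>n. jn n z) \<longlonglongrightarrow> j z"
    and w: "weakly_tendsto un u"
  shows "energy j (rep_L2 u) \<le> liminf (\<lambda>n. energy (jn n) (rep_L2 (un n)))"
proof -
  define i where "i m z = (INF n\<in>{m..}. ennreal (jn n z))" for m z
  \<comment> \<open>Both cuts, at height m and at distance m, are for integrability: the mass is at
    most 2 m^2. At a fixed z neither acts once m is large, so \<open>K m z\<close> still tends to
    \<open>j z\<close>.\<close>
  define K where "K m z = (if 0 < z \<and> z < real m then min (real m) (enn2real (i m z)) else 0)" for m z
  have [measurable]: "jn n \<in> borel_measurable borel" for n using k(1)[of n] by (rule kernel_measurable)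
  have i_meas [measurable]: "i m \<in> borel_measurable borel" for m unfolding i_def by measurable
  have K: "jump_kernel (K m)" for m
    unfolding jump_kernel_def K_def by (auto intro!: measurable_If)
  have Kle: "K m z \<le> jn n z" if "m \<le> n" "0 < z" for m n z
  proof -
    have "i m z \<le> ennreal (jn n z)" unfolding i_def by (rule INF_lower) (use that in simp)
    then have "enn2real (i m z) \<le> enn2real (ennreal (jn n z))" by (rule enn2real_mono) simp
    also have "\<dots> = jn n z" by (simp add: kernel_nonneg[OF k(1)])
    finally show ?thesis using kernel_nonneg[OF k(1), of n z] by (auto simp: K_def)
  qed
  have Klim: "(\<lambda>m. K m z) \<longlonglongrightarrow> j z" if z: "0 < z" for z
  proof -
    have "incseq (\<lambda>m. i m z)" unfolding i_def by (intro incseq_SucI INF_superset_mono) auto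
    then have "(\<lambda>m. i m z) \<longlonglongrightarrow> (SUP m. i m z)" by (rule LIMSEQ_SUP)
    also have "(SUP m. i m z) = liminf (\<lambda>n. ennreal (jn n z))" by (simp add: i_def liminf_SUP_INF)
    also have "\<dots> = ennreal (j z)"
      by (rule lim_imp_Liminf[OF sequentially_bot]) (intro tendsto_intros lim z)
    finally have "(\<lambda>m. enn2real (i m z)) \<longlonglongrightarrow> enn2real (ennreal (j z))" by (intro tendsto_enn2real) auto
    then have e: "(\<lambda>m. enn2real (i m z)) \<longlonglongrightarrow> j z" by (simp add: kernel_nonneg[OF k(2)])
    have "\<forall>\<^sub>F m in sequentially. enn2real (i m z) < j z + 1" by (rule order_tendstoD(2)[OF e]) simp
    moreover have "\<forall>\<^sub>F m in sequentially. max z (j z + 1) < real m"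
      using filterlim_real_sequentially by (simp add: filterlim_at_top_dense eventually_conj_iff)
    ultimately have "\<forall>\<^sub>F m in sequentially. enn2real (i m z) = K m z"
      by eventually_elim (use z in \<open>auto simp: K_def\<close>)
    then show ?thesis by (rule Lim_transform_eventually[OF e])
  qed
  have bd: "(\<integral>\<^sup>+z. ennreal (K m \<bar>z\<bar>) \<partial>lborel) \<le> ennreal (real m * (2 * real m))" for m
  proof -
    have "(\<integral>\<^sup>+z. ennreal (K m \<bar>z\<bar>) \<partial>lborel) \<le> (\<integral>\<^sup>+z. ennreal (real m) * indicator {- real m..real m} z \<partial>lborel)"
      by (intro nn_integral_mono) (auto simp: K_def indicator_def intro!: ennreal_leI)
    also have "\<dots> = ennreal (real m) * emeasure lborel {- real m..real m}" by (rule nn_integral_cmult_indicator) simp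
    also have "\<dots> = ennreal (real m * (2 * real m))" by (simp add: ennreal_mult[symmetric])
    finally show ?thesis .
  qed
  have Kbound: "energy (K m) (rep_L2 u) \<le> liminf (\<lambda>n. energy (jn n) (rep_L2 (un n)))" for m
  proof -
    have "energy (K m) (rep_L2 u) \<le> liminf (\<lambda>n. energy (K m) (rep_L2 (un n)))"
      by (rule energy_lsc_bounded[OF K bd _ w]) simp
    also have "\<dots> \<le> liminf (\<lambda>n. energy (jn n) (rep_L2 (un n)))"
      by (rule Liminf_mono, rule eventually_sequentiallyI[of m]) (intro energy_kernel_mono K k Kle)
    finally show ?thesis .
  qed
  have "energy j (rep_L2 u) = (\<integral>\<^sup>+\<omega>. liminf (\<lambda>m. ennreal ((rep_L2 u (fst \<omega>) - rep_L2 u (snd \<omega>))\<^sup>2 * J (K m) (fst \<omega>) (snd \<omega>)))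
      \<partial>(lebesgue \<Otimes>\<^sub>M lebesgue))"
    unfolding energy_def
  proof (intro nn_integral_cong)
    fix \<omega> :: "real \<times> real"
    have "(\<lambda>m. (rep_L2 u (fst \<omega>) - rep_L2 u (snd \<omega>))\<^sup>2 * J (K m) (fst \<omega>) (snd \<omega>))
        \<longlonglongrightarrow> (rep_L2 u (fst \<omega>) - rep_L2 u (snd \<omega>))\<^sup>2 * J j (fst \<omega>) (snd \<omega>)"
      by (cases "fst \<omega> = snd \<omega>") (auto simp: J_def intro!: tendsto_intros Klim)
    then have "(\<lambda>m. ennreal ((rep_L2 u (fst \<omega>) - rep_L2 u (snd \<omega>))\<^sup>2 * J (K m) (fst \<omega>) (snd \<omega>)))
        \<longlonglongrightarrow> ennreal ((rep_L2 u (fst \<omega>) - rep_L2 u (snd \<omega>))\<^sup>2 * J j (fst \<omega>) (snd \<omega>))"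
      by (rule tendsto_ennrealI)
    from lim_imp_Liminf[OF sequentially_bot this]
    show "ennreal ((rep_L2 u (fst \<omega>) - rep_L2 u (snd \<omega>))\<^sup>2 * J j (fst \<omega>) (snd \<omega>))
        = liminf (\<lambda>m. ennreal ((rep_L2 u (fst \<omega>) - rep_L2 u (snd \<omega>))\<^sup>2 * J (K m) (fst \<omega>) (snd \<omega>)))" by simp
  qed
  also have "\<dots> \<le> liminf (\<lambda>m. energy (K m) (rep_L2 u))"
    unfolding energy_def by (rule nn_integral_liminf) (use K in measurable)
  also have "\<dots> \<le> liminf (\<lambda>m::nat. liminf (\<lambda>n. energy (jn n) (rep_L2 (un n))))"
    by (intro Liminf_mono always_eventually allI Kbound)
  finally show ?thesis by (simp add: Liminf_const)
qed

lemma tendsto_imp_weakly_tendsto: "un \<longlonglongrightarrow> u \<Longrightarrow> weakly_tendsto un u"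
  unfolding weakly_tendsto_def by (intro allI tendsto_intros)

lemma energy_lsc_strong:
  assumes "jump_kernel j" "un \<longlonglongrightarrow> u"
  shows "energy j (rep_L2 u) \<le> liminf (\<lambda>n. energy j (rep_L2 (un n)))"
  by (rule energy_lsc[where jn = "\<lambda>_. j"]) (use assms tendsto_imp_weakly_tendsto in auto)

lemma energy_le_limit:
  assumes "jump_kernel j" "un \<longlonglongrightarrow> u" "\<forall>\<^sub>F n in sequentially. energy j (rep_L2 (un n)) \<le> M"
  shows "energy j (rep_L2 u) \<le> M"
proof -
  have "energy j (rep_L2 u) \<le> liminf (\<lambda>n. energy j (rep_L2 (un n)))" by (rule energy_lsc_strong[OF assms(1,2)])
  also have "\<dots> \<le> liminf (\<lambda>n::nat. M)" by (rule Liminf_mono[OF assms(3)])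
  finally show ?thesis by (simp add: Liminf_const)
qed

text \<open>A Cauchy sequence has an L^2 limit u, and lower semicontinuity gives E(X_a - u, X_a - u)
  \<le> liminf E(X_a - X_n, X_a - X_n). Hence u has finite energy and is the limit for the form
  too.\<close>

lemma closed_form_finite_energy:
  assumes k: "jump_kernel j"
  shows "closed_form (jump_form (J j)) (finite_energy j)"
proof -
  interpret Q: semi_inner "finite_energy j" "jump_form (J j)" by (rule semi_inner_jump_form[OF k])
  let ?Q = "jump_form (J j)"
  have complete: "\<exists>u\<in>finite_energy j. (\<lambda>k. ?Q (X k - u) (X k - u) + inner (X k - u) (X k - u)) \<longlonglongrightarrow> 0"
    if X: "\<forall>k::nat. X k \<in> finite_energy j"
      and C: "\<forall>e>0. \<exists>N. \<forall>j\<ge>N. \<forall>k\<ge>N. ?Q (X j - X k) (X j - X k) + inner (X j - X k) (X j - X k) < e" for X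
  proof -
    have Xd: "X a - X b \<in> finite_energy j" for a b using X by auto
    have C': "\<exists>N. \<forall>j\<ge>N. \<forall>k\<ge>N. ?Q (X j - X k) (X j - X k) < e \<and> inner (X j - X k) (X j - X k) < e" if "0 < e" for e
    proof -
      obtain N where "\<forall>j\<ge>N. \<forall>k\<ge>N. ?Q (X j - X k) (X j - X k) + inner (X j - X k) (X j - X k) < e"
        using C \<open>0 < e\<close> by blast
      moreover have "0 \<le> ?Q (X j - X k) (X j - X k)" "0 \<le> inner (X j - X k) (X j - X k)" for j k
        using Q.nonneg[OF Xd] by auto
      ultimately show ?thesis
        by (intro exI[of _ N] allI impI conjI) (smt (verit, best))+
    qed
    have "Cauchy X" by (rule Cauchy_L2) (use C' in blast)
    then obtain u where u: "X \<longlonglongrightarrow> u" using Cauchy_convergent by (auto simp: convergent_def)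
    have near: "X a - u \<in> finite_energy j \<and> ?Q (X a - u) (X a - u) \<le> e"
      if N: "\<forall>j\<ge>N. \<forall>k\<ge>N. ?Q (X j - X k) (X j - X k) < e \<and> inner (X j - X k) (X j - X k) < e" and a: "N \<le> a" for a e N
    proof -
      have "?Q (X N - X N) (X N - X N) < e" using N by blast
      then have e: "0 \<le> e" using Q.nonneg[OF Xd, of N N] by linarith
      have "energy j (rep_L2 (X a - u)) \<le> ennreal (2 * e)"
      proof (rule energy_le_limit[OF k])
        show "(\<lambda>n. X a - X n) \<longlonglongrightarrow> X a - u" by (intro tendsto_intros u)
        show "\<forall>\<^sub>F n in sequentially. energy j (rep_L2 (X a - X n)) \<le> ennreal (2 * e)"
        proof (rule eventually_sequentiallyI[of N])
          fix n assume "N \<le> n"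
          then have "?Q (X a - X n) (X a - X n) < e" using N a by blast
          then show "energy j (rep_L2 (X a - X n)) \<le> ennreal (2 * e)"
            unfolding jump_energy_jump_form(3)[OF k Xd] by (intro ennreal_leI) simp
        qed
      qed
      then have fe: "X a - u \<in> finite_energy j" by (auto simp: finite_energy_def intro: le_less_trans)
      have "ennreal (2 * ?Q (X a - u) (X a - u)) \<le> ennreal (2 * e)"
        using \<open>energy j (rep_L2 (X a - u)) \<le> ennreal (2 * e)\<close> unfolding jump_energy_jump_form(3)[OF k fe] .
      then have "?Q (X a - u) (X a - u) \<le> e" using e by (subst (asm) ennreal_le_iff) auto
      with fe show ?thesis by blast
    qed
    obtain N where N1: "\<forall>j\<ge>N. \<forall>k\<ge>N. ?Q (X j - X k) (X j - X k) < 1 \<and> inner (X j - X k) (X j - X k) < 1"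
      using C'[of 1] by auto
    have "X N - u \<in> finite_energy j" using near[OF N1] by blast
    then have uf: "u \<in> finite_energy j" using Q.V_diff[of "X N" "X N - u"] X by simp
    have "(\<lambda>k. ?Q (X k - u) (X k - u)) \<longlonglongrightarrow> 0"
    proof (rule LIMSEQ_I)
      fix r :: real assume r: "0 < r"
      obtain N where N: "\<forall>j\<ge>N. \<forall>k\<ge>N. ?Q (X j - X k) (X j - X k) < r/2 \<and> inner (X j - X k) (X j - X k) < r/2"
        using C'[of "r/2"] r by auto
      have "norm (?Q (X a - u) (X a - u) - 0) < r" if "a \<ge> N" for a
        using near[OF N that] Q.nonneg[of "X a - u"] r by auto
      then show "\<exists>N. \<forall>n\<ge>N. norm (?Q (X n - u) (X n - u) - 0) < r" by blast
    qed
    moreover have "(\<lambda>k. inner (X k - u) (X k - u)) \<longlonglongrightarrow> inner (u - u) (u - u)" by (intro tendsto_intros u)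
    ultimately have "(\<lambda>k. ?Q (X k - u) (X k - u) + inner (X k - u) (X k - u)) \<longlonglongrightarrow> 0 + inner (u - u) (u - u)"
      by (rule tendsto_add)
    then show ?thesis using uf by auto
  qed
  show ?thesis
    unfolding closed_form_def
  proof (intro conjI)
    show "subspace (finite_energy j)" by (rule Q.subspace)
    show "\<forall>u\<in>finite_energy j. \<forall>v\<in>finite_energy j. ?Q u v = ?Q v u" using Q.sym by blast
    show "\<forall>u\<in>finite_energy j. \<forall>v\<in>finite_energy j. \<forall>w\<in>finite_energy j. ?Q (u + v) w = ?Q u w + ?Q v w"
      using Q.add_left by blast
    show "\<forall>r. \<forall>u\<in>finite_energy j. \<forall>v\<in>finite_energy j. ?Q (r *\<^sub>R u) v = r * ?Q u v" using Q.scale_left by blast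
    show "\<forall>u\<in>finite_energy j. 0 \<le> ?Q u u" using Q.nonneg by blast
  qed (intro allI impI, erule (1) complete)
qed

lemma clip_finite_energy:
  assumes k [measurable]: "jump_kernel j" and u: "u \<in> finite_energy j"
  shows "clip_L2 u \<in> finite_energy j" "jump_form (J j) (clip_L2 u) (clip_L2 u) \<le> jump_form (J j) u u"
proof -
  let ?f = "\<lambda>x. max 0 (min 1 (rep_L2 u x))"
  have "energy j (rep_L2 (clip_L2 u)) = energy j ?f"
    unfolding clip_L2_eq_app by (rule energy_cong[OF k]) (auto intro: rep_app contractions)
  also have "\<dots> \<le> energy j (rep_L2 u)"
    by (intro energy_mono mult_right_mono J_nonneg k) (auto simp: abs_le_square_iff[symmetric])
  finally have le: "energy j (rep_L2 (clip_L2 u)) \<le> energy j (rep_L2 u)" .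
  then show fe: "clip_L2 u \<in> finite_energy j" using u by (simp add: finite_energy_def)
  show "jump_form (J j) (clip_L2 u) (clip_L2 u) \<le> jump_form (J j) u u"
    using le unfolding jump_energy_jump_form(3)[OF k fe] jump_energy_jump_form(3)[OF k u]
    using jump_energy_jump_form(2)[OF k u] by (subst (asm) ennreal_le_iff) auto
qed

end

section \<open>Lipschitz functions with compact support\<close>

lemma lip_compact_iff:
  "\<phi> \<in> lip_compact \<longleftrightarrow> (\<exists>L. L-lipschitz_on UNIV \<phi>) \<and> (\<exists>R. \<forall>x. R < \<bar>x\<bar> \<longrightarrow> \<phi> x = 0)"
proof -
  have "bounded {x. \<phi> x \<noteq> 0} \<longleftrightarrow> (\<exists>R. \<forall>x. R < \<bar>x\<bar> \<longrightarrow> \<phi> x = 0)"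
    unfolding bounded_iff by (auto simp: not_le[symmetric])
  then show ?thesis by (simp add: lip_compact_def compact_closure)
qed

lemma lip_compactE:
  assumes "\<phi> \<in> lip_compact"
  obtains L R B where "0 \<le> L" "\<And>x y. \<bar>\<phi> x - \<phi> y\<bar> \<le> L * \<bar>x - y\<bar>" "0 \<le> R" "\<And>x. R < \<bar>x\<bar> \<Longrightarrow> \<phi> x = 0"
    "0 \<le> B" "\<And>x. \<bar>\<phi> x\<bar> \<le> B"
proof -
  obtain L R where L: "L-lipschitz_on UNIV \<phi>" and R: "\<And>x. R < \<bar>x\<bar> \<Longrightarrow> \<phi> x = 0"
    using assms by (auto simp: lip_compact_iff)
  have L0: "0 \<le> L" using L by (rule lipschitz_on_nonneg)
  have L': "\<bar>\<phi> x - \<phi> y\<bar> \<le> L * \<bar>x - y\<bar>" for x y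
    using lipschitz_onD[OF L, of x y] by (simp add: dist_real_def)
  have R': "\<phi> x = 0" if "max R 0 < \<bar>x\<bar>" for x using R that by simp
  have bd: "\<bar>\<phi> x\<bar> \<le> \<bar>\<phi> 0\<bar> + L * max R 0" for x
  proof (cases "max R 0 < \<bar>x\<bar>")
    case False
    have "\<bar>\<phi> x\<bar> \<le> \<bar>\<phi> 0\<bar> + L * \<bar>x\<bar>" using L'[of x 0] by simp
    also have "\<dots> \<le> \<bar>\<phi> 0\<bar> + L * max R 0" using False L0 by (intro add_left_mono mult_left_mono) auto
    finally show ?thesis .
  qed (use R' L0 in auto)
  show thesis by (rule that[of L "max R 0" "\<bar>\<phi> 0\<bar> + L * max R 0"]) (use L0 L' R' bd in auto)
qed

lemma lip_compactI:
  assumes "\<And>x y. \<bar>\<phi> x - \<phi> y\<bar> \<le> L * \<bar>x - y\<bar>" "\<And>x. R < \<bar>x\<bar> \<Longrightarrow> \<phi> x = 0" "0 \<le> L"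
  shows "\<phi> \<in> lip_compact"
  unfolding lip_compact_iff
proof
  show "\<exists>L. L-lipschitz_on UNIV \<phi>"
    using assms by (intro exI[of _ L] lipschitz_onI) (auto simp: dist_real_def)
qed (use assms(2) in blast)

lemma lip_compact_measurable [measurable_dest]:
  assumes "\<phi> \<in> lip_compact" shows "\<phi> \<in> borel_measurable borel"
proof -
  obtain L where "L-lipschitz_on UNIV \<phi>" using assms by (auto simp: lip_compact_iff)
  then show ?thesis by (intro borel_measurable_continuous_onI lipschitz_on_continuous_on)
qed

lemma borel_imp_lebesgue_measurable: "f \<in> borel_measurable borel \<Longrightarrow> f \<in> borel_measurable lebesgue"
  by (intro measurable_completion) simp

lemma square_integrable_bounded_support:
  assumes "f \<in> borel_measurable lebesgue" "\<And>x. \<bar>f x\<bar> \<le> B" "\<And>x. R < \<bar>x\<bar> \<Longrightarrow> f x = 0"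
  shows "square_integrable f"
proof (rule square_integrable_dominated)
  show "square_integrable (\<lambda>x. B * indicator {- R..R} x)"
    by (intro square_integrable_scale square_integrable_indicator) (auto simp: emeasure_lborel_Icc_eq)
  show "AE x in lebesgue. \<bar>f x\<bar> \<le> \<bar>B * indicator {- R..R} x\<bar>"
  proof (intro AE_I2)
    fix x
    show "\<bar>f x\<bar> \<le> \<bar>B * indicator {- R..R} x\<bar>"
      using assms(2)[of x] assms(3)[of x] by (cases "R < \<bar>x\<bar>") (auto simp: indicator_def abs_le_iff)
  qed
qed (rule assms)

lemma lip_compact_square_integrable:
  assumes "\<phi> \<in> lip_compact" shows "square_integrable \<phi>"
proof -
  obtain L R B where "\<And>x. R < \<bar>x\<bar> \<Longrightarrow> \<phi> x = 0" "\<And>x. \<bar>\<phi> x\<bar> \<le> B"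
    by (rule lip_compactE[OF assms]) blast
  then show ?thesis
    by (intro square_integrable_bounded_support[of \<phi> B R] borel_imp_lebesgue_measurable lip_compact_measurable assms)
qed

lemma lip_compact_add:
  assumes "\<phi> \<in> lip_compact" "\<psi> \<in> lip_compact"
  shows "(\<lambda>x. \<phi> x + \<psi> x) \<in> lip_compact"
proof -
  obtain L R B where 1: "0 \<le> L" "\<And>x y. \<bar>\<phi> x - \<phi> y\<bar> \<le> L * \<bar>x - y\<bar>" "\<And>x. R < \<bar>x\<bar> \<Longrightarrow> \<phi> x = 0"
    using assms(1) by (metis lip_compactE)
  obtain L' R' B' where 2: "0 \<le> L'" "\<And>x y. \<bar>\<psi> x - \<psi> y\<bar> \<le> L' * \<bar>x - y\<bar>" "\<And>x. R' < \<bar>x\<bar> \<Longrightarrow> \<psi> x = 0"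
    using assms(2) by (metis lip_compactE)
  show ?thesis
  proof (rule lip_compactI[where L = "L + L'" and R = "max R R'"])
    fix x y show "\<bar>\<phi> x + \<psi> x - (\<phi> y + \<psi> y)\<bar> \<le> (L + L') * \<bar>x - y\<bar>"
      using 1(2)[of x y] 2(2)[of x y] by (simp add: distrib_right)
  qed (use 1 2 in auto)
qed

lemma lip_compact_scale:
  assumes "\<phi> \<in> lip_compact"
  shows "(\<lambda>x. r * \<phi> x) \<in> lip_compact"
proof -
  obtain L R B where 1: "0 \<le> L" "\<And>x y. \<bar>\<phi> x - \<phi> y\<bar> \<le> L * \<bar>x - y\<bar>" "\<And>x. R < \<bar>x\<bar> \<Longrightarrow> \<phi> x = 0"
    using assms(1) by (metis lip_compactE)
  show ?thesis
  proof (rule lip_compactI[where L = "\<bar>r\<bar> * L" and R = R])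
    fix x y show "\<bar>r * \<phi> x - r * \<phi> y\<bar> \<le> \<bar>r\<bar> * L * \<bar>x - y\<bar>"
      using mult_left_mono[OF 1(2)[of x y], of "\<bar>r\<bar>"] by (simp add: abs_mult[symmetric] right_diff_distrib mult.assoc)
  qed (use 1 in auto)
qed

definition lip_L2 :: "L2 set" where
  "lip_L2 = class_L2 ` lip_compact"

lemma class_L2_add:
  "square_integrable f \<Longrightarrow> square_integrable g \<Longrightarrow> class_L2 f + class_L2 g = class_L2 (\<lambda>x. f x + g x)"
  by (rule plus_L2.abs_eq) (auto intro: L2_rel_refl)

lemma class_L2_diff:
  "square_integrable f \<Longrightarrow> square_integrable g \<Longrightarrow> class_L2 f - class_L2 g = class_L2 (\<lambda>x. f x - g x)"
  by (rule minus_L2.abs_eq) (auto intro: L2_rel_refl)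

lemma class_L2_scale: "square_integrable f \<Longrightarrow> r *\<^sub>R class_L2 f = class_L2 (\<lambda>x. r * f x)"
  by (rule scaleR_L2.abs_eq) (auto intro: L2_rel_refl)

lemma subspace_lip_L2: "subspace lip_L2"
  unfolding subspace_def
proof (intro conjI ballI allI)
  have "(\<lambda>x. 0) \<in> lip_compact" by (rule lip_compactI[of _ 0 0]) auto
  then show "0 \<in> lip_L2" by (force simp: lip_L2_def zero_L2.abs_eq)
  fix u v and r :: real assume "u \<in> lip_L2"
  then obtain \<phi> where \<phi>: "\<phi> \<in> lip_compact" "u = class_L2 \<phi>" by (auto simp: lip_L2_def)
  show "r *\<^sub>R u \<in> lip_L2"
    using \<phi> class_L2_scale[OF lip_compact_square_integrable[OF \<phi>(1)], of r] lip_compact_scale[OF \<phi>(1), of r]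
    by (auto simp: lip_L2_def)
  assume "v \<in> lip_L2"
  then obtain \<psi> where \<psi>: "\<psi> \<in> lip_compact" "v = class_L2 \<psi>" by (auto simp: lip_L2_def)
  show "u + v \<in> lip_L2"
    using \<phi> \<psi> class_L2_add[OF lip_compact_square_integrable[OF \<phi>(1)] lip_compact_square_integrable[OF \<psi>(1)]]
      lip_compact_add[OF \<phi>(1) \<psi>(1)] by (auto simp: lip_L2_def)
qed

text \<open>Tents \<open>max 0 (1 - (n + 1) * infdist x K)\<close> are Lipschitz with compact
  support and decrease to the indicator of \<open>K\<close>.\<close>

lemma orthogonal_lip_compact_set:
  assumes f: "square_integrable f" and orth: "\<And>\<phi>. \<phi> \<in> lip_compact \<Longrightarrow> (LINT x|lebesgue. f x * \<phi> x) = 0"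
    and K: "compact K"
  shows "(LINT x|lebesgue. f x * indicator K x) = 0"
proof (cases "K = {}")
  case False
  obtain R where R: "\<And>x. x \<in> K \<Longrightarrow> \<bar>x\<bar> \<le> R" using compact_imp_bounded[OF K] by (auto simp: bounded_iff)
  have [measurable]: "f \<in> borel_measurable lebesgue" using f by (rule square_integrable_measurable)
  define \<phi> where "\<phi> n x = max 0 (1 - real (Suc n) * infdist x K)" for n x
  have supp: "\<phi> n x = 0" if "R + 1 < \<bar>x\<bar>" for n x
  proof -
    obtain y where y: "y \<in> K" "infdist x K = dist x y"
      using infdist_attains_inf[OF compact_imp_closed[OF K] False] by blast
    then have "1 \<le> infdist x K" using R[OF y(1)] that by (auto simp: dist_real_def)
    then have "1 * 1 \<le> real (Suc n) * infdist x K" by (intro mult_mono) auto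
    then show ?thesis by (simp add: \<phi>_def)
  qed
  have lip: "\<phi> n \<in> lip_compact" for n
  proof (rule lip_compactI[where L = "real (Suc n)" and R = "R + 1"])
    fix x y
    have "\<bar>\<phi> n x - \<phi> n y\<bar> \<le> \<bar>real (Suc n) * infdist x K - real (Suc n) * infdist y K\<bar>"
      unfolding \<phi>_def by linarith
    also have "\<dots> = real (Suc n) * \<bar>infdist x K - infdist y K\<bar>"
      by (metis abs_mult abs_of_nat right_diff_distrib)
    also have "\<dots> \<le> real (Suc n) * \<bar>x - y\<bar>"
      using infdist_triangle_abs[of x K y] by (intro mult_left_mono) (auto simp: dist_real_def)
    finally show "\<bar>\<phi> n x - \<phi> n y\<bar> \<le> real (Suc n) * \<bar>x - y\<bar>" .
  qed (use supp in auto)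
  have b: "\<bar>\<phi> n x\<bar> \<le> indicator {- (R + 1)..R + 1} x" for n x
  proof (cases "R + 1 < \<bar>x\<bar>")
    case False
    have "0 \<le> real (Suc n) * infdist x K" by (intro mult_nonneg_nonneg infdist_nonneg) auto
    then have "\<bar>\<phi> n x\<bar> \<le> 1" by (simp add: \<phi>_def del: of_nat_Suc)
    then show ?thesis using False by (auto simp: indicator_def abs_le_iff)
  qed (simp add: supp)
  have "(\<lambda>n. LINT x|lebesgue. f x * \<phi> n x) \<longlonglongrightarrow> (LINT x|lebesgue. f x * indicator K x)"
  proof (rule integral_dominated_convergence)
    have "square_integrable (indicator {- (R + 1)..R + 1})" by (rule square_integrable_indicator) (auto simp: emeasure_lborel_Icc_eq)
    then have "integrable lebesgue (\<lambda>x. f x * indicator {- (R + 1)..R + 1} x)" by (rule square_integrable_mult[OF f])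
    then show "integrable lebesgue (\<lambda>x. norm (f x * indicator {- (R + 1)..R + 1} x))" by (rule integrable_norm)
    show "AE x in lebesgue. norm (f x * \<phi> n x) \<le> norm (f x * indicator {- (R + 1)..R + 1} x)" for n
      using b[of n] by (intro AE_I2) (auto simp: abs_mult intro!: mult_left_mono)
    show "AE x in lebesgue. (\<lambda>n. f x * \<phi> n x) \<longlonglongrightarrow> f x * indicator K x"
    proof (intro AE_I2 tendsto_mult_left)
      fix x
      show "(\<lambda>n. \<phi> n x) \<longlonglongrightarrow> indicator K x"
      proof (cases "x \<in> K")
        case True
        then show ?thesis by (simp add: \<phi>_def)
      next
        case x: False
        then have "0 < infdist x K"
          using in_closed_iff_infdist_zero[OF compact_imp_closed[OF K] False, of x] infdist_nonneg[of x K] by auto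
        then obtain N where N: "1 / infdist x K < real N" using reals_Archimedean2 by blast
        have "\<phi> n x = 0" if "n \<ge> N" for n
        proof -
          have "1 < real N * infdist x K" using N \<open>0 < infdist x K\<close> by (simp add: field_simps)
          also have "\<dots> \<le> real (Suc n) * infdist x K" using that \<open>0 < infdist x K\<close> by (intro mult_right_mono) auto
          finally show ?thesis by (simp add: \<phi>_def)
        qed
        then show ?thesis using x by (intro tendsto_eventually) (auto simp: eventually_sequentially)
      qed
    qed
    show "(\<lambda>x. f x * indicator K x) \<in> borel_measurable lebesgue"
      using borel_compact[OF K] by (intro borel_measurable_times borel_measurable_indicator) auto
    show "(\<lambda>x. f x * \<phi> n x) \<in> borel_measurable lebesgue" for n
      using borel_imp_lebesgue_measurable[OF lip_compact_measurable[OF lip[of n]]] by measurable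
  qed
  then show ?thesis using orth[OF lip] by (simp add: LIMSEQ_const_iff)
qed simp

text \<open>Inside {f > 0} and an interval take a closed set T of nearly full measure. The integral
  of f over T is 0 while f > 0 there, so T is null, and the whole set has arbitrarily small
  measure.\<close>

lemma orthogonal_lip_compact_nonpos:
  assumes f: "square_integrable f" and orth: "\<And>\<phi>. \<phi> \<in> lip_compact \<Longrightarrow> (LINT x|lebesgue. f x * \<phi> x) = 0"
  shows "AE x in lebesgue. f x \<le> 0"
proof -
  have [measurable]: "f \<in> borel_measurable lebesgue" using f by (rule square_integrable_measurable)
  have "AE x in lebesgue. \<not> (x \<in> {- real m..real m} \<and> 0 < f x)" for m :: nat
  proof -
    define A where "A = {x \<in> space lebesgue. 0 < f x} \<inter> {- real m..real m}"
    have A [measurable]: "A \<in> sets lebesgue" unfolding A_def by measurable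
    have small: "emeasure lebesgue A \<le> ennreal e" if e: "0 < e" for e
    proof -
      obtain T where T: "closed T" "T \<subseteq> A" "A - T \<in> lmeasurable" "emeasure lebesgue (A - T) < ennreal e"
        using sets_lebesgue_inner_closed[OF A e] by blast
      have "bounded T"
        by (rule bounded_subset[OF bounded_closed_interval[of "- real m" "real m"]]) (use T(2) in \<open>auto simp: A_def\<close>)
      then have cT: "compact T" using T(1) by (simp add: compact_eq_bounded_closed)
      have [measurable]: "T \<in> sets lebesgue" using borel_closed[OF T(1)] by auto
      have "square_integrable (indicator T)"
        using lmeasurable_compact[OF cT] by (intro square_integrable_indicator) (auto simp: fmeasurable_def)
      then have int: "integrable lebesgue (\<lambda>x. f x * indicator T x)" by (rule square_integrable_mult[OF f])
      have "AE x in lebesgue. f x * indicator T x = 0"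
        using orthogonal_lip_compact_set[OF f orth cT] integral_nonneg_eq_0_iff_AE[OF int] T(2)
        by (auto simp: A_def indicator_def subset_iff less_imp_le)
      then have "AE x in lebesgue. x \<notin> T" by eventually_elim (use T(2) in \<open>auto simp: A_def indicator_def\<close>)
      then have "emeasure lebesgue T = 0" by (subst (asm) AE_iff_measurable[OF _ refl]) auto
      moreover have "emeasure lebesgue A \<le> emeasure lebesgue T + emeasure lebesgue (A - T)"
      proof -
        have "A = T \<union> (A - T)" using T(2) by auto
        then show ?thesis using emeasure_subadditive[of T lebesgue "A - T"] by simp
      qed
      ultimately show ?thesis using T(4) by simp
    qed
    have "emeasure lebesgue A \<le> 0" by (rule ennreal_le_epsilon) (unfold add_0, rule small)
    then have "emeasure lebesgue A = 0" by simp
    then have "AE x in lebesgue. x \<notin> A" by (intro AE_not_in) (auto simp: null_sets_def)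
    then show ?thesis by eventually_elim (auto simp: A_def)
  qed
  then have "AE x in lebesgue. \<forall>m::nat. \<not> (x \<in> {- real m..real m} \<and> 0 < f x)"
    unfolding AE_all_countable by blast
  then show ?thesis
  proof eventually_elim
    case (elim x)
    obtain n where "\<bar>x\<bar> \<le> real n" using real_arch_simple by blast
    then have "x \<in> {- real n..real n}" by auto
    then show ?case using elim by (meson not_le)
  qed
qed

lemma orthogonal_lip_imp_0:
  assumes "\<And>w. w \<in> lip_L2 \<Longrightarrow> inner q w = 0"
  shows "q = 0"
proof -
  have 1: "(LINT x|lebesgue. rep_L2 q x * \<phi> x) = 0" if \<phi>: "\<phi> \<in> lip_compact" for \<phi>
  proof -
    have "inner q (class_L2 \<phi>) = 0" using assms \<phi> by (auto simp: lip_L2_def)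
    moreover have "inner q (class_L2 \<phi>) = (LINT x|lebesgue. rep_L2 q x * \<phi> x)"
      unfolding inner_L2_eq
    proof (rule integral_cong_AE)
      show "AE x in lebesgue. rep_L2 q x * rep_L2 (class_L2 \<phi>) x = rep_L2 q x * \<phi> x"
        using rep_class_L2[OF lip_compact_square_integrable[OF \<phi>]] by eventually_elim simp
    qed (use borel_imp_lebesgue_measurable[OF lip_compact_measurable[OF \<phi>]] in measurable)
    ultimately show ?thesis by simp
  qed
  have "AE x in lebesgue. rep_L2 q x \<le> 0"
    by (rule orthogonal_lip_compact_nonpos[OF square_integrable_rep_L2 1])
  moreover have "AE x in lebesgue. - rep_L2 q x \<le> 0"
    by (rule orthogonal_lip_compact_nonpos)
      (use 1 square_integrable_scale[OF square_integrable_rep_L2[of q], of "-1"] in auto)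
  ultimately have "AE x in lebesgue. rep_L2 q x = rep_L2 0 x"
    using rep_L2_zero by eventually_elim auto
  then show ?thesis by (rule L2_eqI)
qed

text \<open>The projection of \<open>u\<close> to the closure of the subspace differs from
  \<open>u\<close> by a vector orthogonal to all Lipschitz functions, which is 0. The same scheme is
  used later for the energy norm.\<close>

lemma lip_L2_dense: "closure lip_L2 = UNIV"
proof -
  interpret L: semi_inner "UNIV :: L2 set" inner by (rule semi_inner_L2)
  have "u \<in> closure lip_L2" for u
  proof -
    obtain p X where p: "\<And>k::nat. X k \<in> lip_L2" "(\<lambda>k. inner (X k - p) (X k - p)) \<longlonglongrightarrow> 0"
      "\<And>w. w \<in> lip_L2 \<Longrightarrow> inner p w = inner u w"
    proof (rule L.projection[where W = lip_L2 and l = "inner u" and M = "inner u u"])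
      show "(inner u w)\<^sup>2 \<le> inner u u * inner w w" for w by (rule Cauchy_Schwarz_ineq)
    qed (use L2_complete subspace_lip_L2 in \<open>auto simp: inner_add_right\<close>)
    have "u - p = 0" by (rule orthogonal_lip_imp_0) (simp add: inner_diff_left p)
    then have "(\<lambda>k. sqrt (inner (X k - u) (X k - u))) \<longlonglongrightarrow> sqrt 0"
      using p(2) by (intro tendsto_intros) simp
    then have "(\<lambda>k. norm (X k - u)) \<longlonglongrightarrow> 0" by (simp add: norm_eq_sqrt_inner)
    then have "X \<longlonglongrightarrow> u" by (simp add: tendsto_norm_zero_iff LIM_zero_iff)
    then show ?thesis using p(1) unfolding closure_sequential by blast
  qed
  then show ?thesis by auto
qed

section \<open>Mollification\<close>

lemma nn_integral_lborel_shift: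
  fixes f :: "real \<Rightarrow> ennreal"
  assumes "f \<in> borel_measurable borel"
  shows "(\<integral>\<^sup>+x. f (x - s) \<partial>lborel) = (\<integral>\<^sup>+x. f x \<partial>lborel)"
  using nn_integral_real_affine[OF assms, of 1 "- s"] by (simp add: algebra_simps)

text \<open>A Lipschitz bump turns a compactly supported integrable function into a Lipschitz one
  with compact support, which is the regularity of \<open>lip_compact\<close>.\<close>

locale mollifier =
  fixes \<rho> :: "real \<Rightarrow> real" and \<epsilon> K :: real
  assumes \<rho>_measurable [measurable]: "\<rho> \<in> borel_measurable borel"
    and \<rho>_nonneg: "0 \<le> \<rho> x" and \<rho>_integral: "(\<integral>\<^sup>+x. ennreal (\<rho> x) \<partial>lborel) = 1"
    and \<rho>_support: "\<epsilon> < \<bar>x\<bar> \<Longrightarrow> \<rho> x = 0" and \<rho>_lipschitz: "\<bar>\<rho> x - \<rho> y\<bar> \<le> K * \<bar>x - y\<bar>"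
    and \<epsilon>_pos: "0 < \<epsilon>"
begin

lemma K_nonneg: "0 \<le> K"
  using \<rho>_lipschitz[of 1 0] by simp

lemma \<rho>_bounded: "\<rho> x \<le> K * (2 * \<epsilon> + 1)"
proof (cases "\<epsilon> < \<bar>x\<bar>")
  case False
  \<comment> \<open>A shift by 2 \<epsilon> + 1 takes every point of the support out of it, so the
    Lipschitz bound over that distance bounds \<rho>.\<close>
  then have "\<rho> (x + (2 * \<epsilon> + 1)) = 0" using \<epsilon>_pos by (intro \<rho>_support) auto
  then show ?thesis using \<rho>_lipschitz[of x "x + (2 * \<epsilon> + 1)"] \<epsilon>_pos by (simp add: add.commute)
qed (use \<rho>_support K_nonneg \<epsilon>_pos in simp)

lemma \<rho>_integrable: "integrable lborel \<rho>" and \<rho>_LINT: "(LINT x|lborel. \<rho> x) = 1"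
proof -
  show i: "integrable lborel \<rho>" by (rule integrableI_bounded) (use \<rho>_nonneg \<rho>_integral in auto)
  have "ennreal (LINT x|lborel. \<rho> x) = 1"
    using nn_integral_eq_integral[OF i] \<rho>_nonneg \<rho>_integral by simp
  then show "(LINT x|lborel. \<rho> x) = 1" by (simp add: ennreal_eq_1)
qed

definition moll :: "(real \<Rightarrow> real) \<Rightarrow> real \<Rightarrow> real" where
  "moll g x = (LINT z|lborel. \<rho> (x - z) * g z)"

text \<open>The variance of \<open>h\<close> under the probability density \<rho> is
  nonnegative.\<close>

lemma jensen:
  assumes [measurable]: "h \<in> borel_measurable borel" and i: "integrable lborel (\<lambda>s. \<rho> s * h s)"
  shows "ennreal ((LINT s|lborel. \<rho> s * h s)\<^sup>2) \<le> (\<integral>\<^sup>+s. ennreal (\<rho> s) * ennreal ((h s)\<^sup>2) \<partial>lborel)"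
proof (cases "(\<integral>\<^sup>+s. ennreal (\<rho> s) * ennreal ((h s)\<^sup>2) \<partial>lborel) = \<infinity>")
  case False
  have e: "(\<integral>\<^sup>+s. ennreal (\<rho> s) * ennreal ((h s)\<^sup>2) \<partial>lborel) = (\<integral>\<^sup>+s. ennreal (\<rho> s * (h s)\<^sup>2) \<partial>lborel)"
    by (simp add: ennreal_mult \<rho>_nonneg)
  have i2: "integrable lborel (\<lambda>s. \<rho> s * (h s)\<^sup>2)"
    by (rule integrableI_bounded) (use False in \<open>auto simp: e[symmetric] \<rho>_nonneg abs_mult less_top ennreal_mult\<close>)
  define m where "m = (LINT s|lborel. \<rho> s * h s)"
  have "0 \<le> (LINT s|lborel. \<rho> s * (h s - m)\<^sup>2)" by (intro integral_nonneg_AE AE_I2) (simp add: \<rho>_nonneg)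
  also have "\<dots> = (LINT s|lborel. \<rho> s * (h s)\<^sup>2 - (2 * m) * (\<rho> s * h s) + m\<^sup>2 * \<rho> s)"
    by (intro Bochner_Integration.integral_cong) (auto simp: power2_diff algebra_simps)
  also have "\<dots> = (LINT s|lborel. \<rho> s * (h s)\<^sup>2) - (2 * m) * m + m\<^sup>2 * 1"
    using i i2 \<rho>_integrable \<rho>_LINT by (simp add: m_def)
  finally have "m\<^sup>2 \<le> (LINT s|lborel. \<rho> s * (h s)\<^sup>2)" by (simp add: power2_eq_square)
  then have "ennreal (m\<^sup>2) \<le> ennreal (LINT s|lborel. \<rho> s * (h s)\<^sup>2)" by (rule ennreal_leI)
  also have "\<dots> = (\<integral>\<^sup>+s. ennreal (\<rho> s) * ennreal ((h s)\<^sup>2) \<partial>lborel)"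
    unfolding e by (rule nn_integral_eq_integral[OF i2, symmetric]) (simp add: \<rho>_nonneg)
  finally show ?thesis by (simp add: m_def)
qed simp

context
  fixes g :: "real \<Rightarrow> real"
  assumes g: "integrable lborel g"
begin

lemma g_measurable [measurable]: "g \<in> borel_measurable borel"
  using borel_measurable_integrable[OF g] by simp

lemma moll_integrable: "integrable lborel (\<lambda>z. \<rho> (x - z) * g z)"
proof (rule Bochner_Integration.integrable_bound)
  show "integrable lborel (\<lambda>z. K * (2 * \<epsilon> + 1) * g z)" using g by simp
  show "AE z in lborel. norm (\<rho> (x - z) * g z) \<le> norm (K * (2 * \<epsilon> + 1) * g z)"
    using \<rho>_bounded \<rho>_nonneg K_nonneg \<epsilon>_pos by (intro AE_I2) (auto simp: abs_mult intro!: mult_right_mono)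
qed measurable

lemma moll_shift: "moll g x = (LINT s|lborel. \<rho> s * g (x - s))"
  unfolding moll_def using lborel_integral_real_affine[of "-1" "\<lambda>z. \<rho> (x - z) * g z" x] by simp

lemma moll_shift_integrable: "integrable lborel (\<lambda>s. \<rho> s * g (x - s))"
  using lborel_integrable_real_affine[OF moll_integrable[of x], of "-1" x] by simp

lemma moll_lip_compact:
  assumes support: "\<And>x. R < \<bar>x\<bar> \<Longrightarrow> g x = 0"
  shows "moll g \<in> lip_compact"
proof (rule lip_compactI[where L = "K * (LINT z|lborel. \<bar>g z\<bar>)" and R = "R + \<epsilon>"])
  fix x y
  have "\<bar>moll g x - moll g y\<bar> = \<bar>LINT z|lborel. \<rho> (x - z) * g z - \<rho> (y - z) * g z\<bar>"
    unfolding moll_def by (simp add: moll_integrable)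
  also have "\<dots> \<le> (LINT z|lborel. \<bar>\<rho> (x - z) * g z - \<rho> (y - z) * g z\<bar>)"
    by (rule integral_abs_bound)
  also have "\<dots> \<le> (LINT z|lborel. K * \<bar>x - y\<bar> * \<bar>g z\<bar>)"
  proof (rule integral_mono)
    show "integrable lborel (\<lambda>z. \<bar>\<rho> (x - z) * g z - \<rho> (y - z) * g z\<bar>)" by (simp add: moll_integrable)
    show "integrable lborel (\<lambda>z. K * \<bar>x - y\<bar> * \<bar>g z\<bar>)" using g by simp
    show "\<bar>\<rho> (x - z) * g z - \<rho> (y - z) * g z\<bar> \<le> K * \<bar>x - y\<bar> * \<bar>g z\<bar>" for z
      unfolding left_diff_distrib[symmetric] abs_mult
      using \<rho>_lipschitz[of "x - z" "y - z"] by (intro mult_right_mono) auto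
  qed
  finally show "\<bar>moll g x - moll g y\<bar> \<le> K * (LINT z|lborel. \<bar>g z\<bar>) * \<bar>x - y\<bar>"
    by (simp add: algebra_simps)
next
  fix x assume "R + \<epsilon> < \<bar>x\<bar>"
  then have "\<rho> s * g (x - s) = 0" for s
    using \<rho>_support[of s] support[of "x - s"] by (cases "\<epsilon> < \<bar>s\<bar>") auto
  then have "(\<lambda>s. \<rho> s * g (x - s)) = (\<lambda>s. 0)" by (intro ext)
  then show "moll g x = 0" unfolding moll_shift by simp
next
  show "0 \<le> K * (LINT z|lborel. \<bar>g z\<bar>)" using K_nonneg by simp
qed

lemma moll_L2_le: "(\<integral>\<^sup>+x. ennreal ((moll g x)\<^sup>2) \<partial>lborel) \<le> (\<integral>\<^sup>+x. ennreal ((g x)\<^sup>2) \<partial>lborel)"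
proof -
  have "(\<integral>\<^sup>+x. ennreal ((moll g x)\<^sup>2) \<partial>lborel) \<le> (\<integral>\<^sup>+x. \<integral>\<^sup>+s. ennreal (\<rho> s) * ennreal ((g (x - s))\<^sup>2) \<partial>lborel \<partial>lborel)"
    unfolding moll_shift by (intro nn_integral_mono jensen moll_shift_integrable) measurable
  also have "\<dots> = (\<integral>\<^sup>+s. \<integral>\<^sup>+x. ennreal (\<rho> s) * ennreal ((g (x - s))\<^sup>2) \<partial>lborel \<partial>lborel)"
    using lborel_pair.Fubini'[of "\<lambda>x s. ennreal (\<rho> s) * ennreal ((g (x - s))\<^sup>2)"] by (simp add: case_prod_beta')
  also have "\<dots> = (\<integral>\<^sup>+s. ennreal (\<rho> s) * (\<integral>\<^sup>+x. ennreal ((g x)\<^sup>2) \<partial>lborel) \<partial>lborel)"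
    by (simp add: nn_integral_cmult nn_integral_lborel_shift[of "\<lambda>x. ennreal ((g x)\<^sup>2)"])
  also have "\<dots> = (\<integral>\<^sup>+x. ennreal ((g x)\<^sup>2) \<partial>lborel)"
    by (simp add: nn_integral_multc \<rho>_integral)
  finally show ?thesis .
qed

text \<open>A mollified function is an average of translates, all of which have the same energy for
  a kernel of |x - y|; Jensen's inequality concludes. The weight \<kappa> would spoil this
  invariance, so it is absent here and costs a factor \<open>C + 1\<close> when it is put
  back.\<close>

lemma moll_energy_le:
  assumes [measurable]: "j \<in> borel_measurable borel"
  shows "(\<integral>\<^sup>+x. \<integral>\<^sup>+y. ennreal ((moll g x - moll g y)\<^sup>2) * ennreal (j \<bar>x - y\<bar>) \<partial>lborel \<partial>lborel)
    \<le> (\<integral>\<^sup>+x. \<integral>\<^sup>+y. ennreal ((g x - g y)\<^sup>2) * ennreal (j \<bar>x - y\<bar>) \<partial>lborel \<partial>lborel)" (is "?L \<le> ?E")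
proof -
  define G where "G x y = ennreal ((g x - g y)\<^sup>2) * ennreal (j \<bar>x - y\<bar>)" for x y
  have G [measurable]: "(\<lambda>\<omega>. G (fst \<omega>) (snd \<omega>)) \<in> borel_measurable (borel \<Otimes>\<^sub>M borel)" unfolding G_def by measurable
  have G' [measurable]: "(\<lambda>y. G x y) \<in> borel_measurable borel" for x unfolding G_def by measurable
  have "?L \<le> (\<integral>\<^sup>+x. \<integral>\<^sup>+y. \<integral>\<^sup>+s. ennreal (\<rho> s) * G (x - s) (y - s) \<partial>lborel \<partial>lborel \<partial>lborel)"
  proof (intro nn_integral_mono)
    fix x y
    have i: "integrable lborel (\<lambda>s. \<rho> s * (g (x - s) - g (y - s)))"
      using moll_shift_integrable[of x] moll_shift_integrable[of y] by (simp add: right_diff_distrib)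
    have "moll g x - moll g y = (LINT s|lborel. \<rho> s * (g (x - s) - g (y - s)))"
      unfolding moll_shift using moll_shift_integrable[of x] moll_shift_integrable[of y]
      by (simp add: right_diff_distrib)
    then have "ennreal ((moll g x - moll g y)\<^sup>2) \<le> (\<integral>\<^sup>+s. ennreal (\<rho> s) * ennreal ((g (x - s) - g (y - s))\<^sup>2) \<partial>lborel)"
      using jensen[OF _ i] by simp
    then have "ennreal ((moll g x - moll g y)\<^sup>2) * ennreal (j \<bar>x - y\<bar>)
        \<le> (\<integral>\<^sup>+s. ennreal (\<rho> s) * ennreal ((g (x - s) - g (y - s))\<^sup>2) \<partial>lborel) * ennreal (j \<bar>x - y\<bar>)"
      by (rule mult_right_mono) simp
    also have "\<dots> = (\<integral>\<^sup>+s. ennreal (\<rho> s) * ennreal ((g (x - s) - g (y - s))\<^sup>2) * ennreal (j \<bar>x - y\<bar>) \<partial>lborel)"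
      by (rule nn_integral_multc[symmetric]) measurable
    finally show "ennreal ((moll g x - moll g y)\<^sup>2) * ennreal (j \<bar>x - y\<bar>)
        \<le> (\<integral>\<^sup>+s. ennreal (\<rho> s) * G (x - s) (y - s) \<partial>lborel)" by (simp add: G_def mult.assoc)
  qed
  also have "\<dots> = (\<integral>\<^sup>+x. \<integral>\<^sup>+s. \<integral>\<^sup>+y. ennreal (\<rho> s) * G (x - s) (y - s) \<partial>lborel \<partial>lborel \<partial>lborel)"
    unfolding G_def
    by (intro nn_integral_cong lborel_pair.Fubini'[symmetric]) measurable
  also have "\<dots> = (\<integral>\<^sup>+s. \<integral>\<^sup>+x. \<integral>\<^sup>+y. ennreal (\<rho> s) * G (x - s) (y - s) \<partial>lborel \<partial>lborel \<partial>lborel)"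
    unfolding G_def by (intro lborel_pair.Fubini'[symmetric]) measurable
  also have "\<dots> = (\<integral>\<^sup>+s. ennreal (\<rho> s) * (\<integral>\<^sup>+x. \<integral>\<^sup>+y. G x y \<partial>lborel \<partial>lborel) \<partial>lborel)"
  proof (intro nn_integral_cong)
    fix s
    have m: "(\<lambda>x. \<integral>\<^sup>+y. G x y \<partial>lborel) \<in> borel_measurable borel" unfolding G_def by measurable
    have "(\<integral>\<^sup>+x. \<integral>\<^sup>+y. ennreal (\<rho> s) * G (x - s) (y - s) \<partial>lborel \<partial>lborel)
        = (\<integral>\<^sup>+x. ennreal (\<rho> s) * (\<integral>\<^sup>+y. G (x - s) y \<partial>lborel) \<partial>lborel)"
      by (intro nn_integral_cong) (simp add: nn_integral_cmult nn_integral_lborel_shift)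
    also have "\<dots> = ennreal (\<rho> s) * (\<integral>\<^sup>+x. \<integral>\<^sup>+y. G (x - s) y \<partial>lborel \<partial>lborel)"
      by (rule nn_integral_cmult) (rule measurable_compose[OF _ m], simp)
    also have "(\<integral>\<^sup>+x. \<integral>\<^sup>+y. G (x - s) y \<partial>lborel \<partial>lborel) = (\<integral>\<^sup>+x. \<integral>\<^sup>+y. G x y \<partial>lborel \<partial>lborel)"
      by (rule nn_integral_lborel_shift[OF m])
    finally show "(\<integral>\<^sup>+x. \<integral>\<^sup>+y. ennreal (\<rho> s) * G (x - s) (y - s) \<partial>lborel \<partial>lborel)
        = ennreal (\<rho> s) * (\<integral>\<^sup>+x. \<integral>\<^sup>+y. G x y \<partial>lborel \<partial>lborel)" .
  qed
  also have "\<dots> = ?E" by (simp add: nn_integral_multc \<rho>_integral G_def)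
  finally show ?thesis .
qed

end

lemma moll_diff:
  assumes "integrable lborel g" "integrable lborel h"
  shows "moll (\<lambda>x. g x - h x) x = moll g x - moll h x"
  unfolding moll_def using moll_integrable[OF assms(1)] moll_integrable[OF assms(2)]
  by (simp add: right_diff_distrib)

lemma moll_close:
  assumes i: "integrable lborel \<phi>" and L: "\<And>x y. \<bar>\<phi> x - \<phi> y\<bar> \<le> L * \<bar>x - y\<bar>" "0 \<le> L"
  shows "\<bar>moll \<phi> x - \<phi> x\<bar> \<le> L * \<epsilon>"
proof -
  have i': "integrable lborel (\<lambda>s. \<rho> s * \<phi> (x - s))" by (rule moll_shift_integrable[OF i])
  have "moll \<phi> x - \<phi> x = (LINT s|lborel. \<rho> s * \<phi> (x - s)) - (LINT s|lborel. \<rho> s * \<phi> x)"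
    using \<rho>_integrable \<rho>_LINT by (simp add: moll_shift[OF i])
  also have "\<dots> = (LINT s|lborel. \<rho> s * \<phi> (x - s) - \<rho> s * \<phi> x)"
    using i' \<rho>_integrable by simp
  also have "\<bar>\<dots>\<bar> \<le> (LINT s|lborel. \<bar>\<rho> s * \<phi> (x - s) - \<rho> s * \<phi> x\<bar>)" by (rule integral_abs_bound)
  also have "\<dots> \<le> (LINT s|lborel. \<rho> s * (L * \<epsilon>))"
  proof (rule integral_mono)
    show "integrable lborel (\<lambda>s. \<bar>\<rho> s * \<phi> (x - s) - \<rho> s * \<phi> x\<bar>)" using i' \<rho>_integrable by simp
    show "integrable lborel (\<lambda>s. \<rho> s * (L * \<epsilon>))" using \<rho>_integrable by simp
    show "\<bar>\<rho> s * \<phi> (x - s) - \<rho> s * \<phi> x\<bar> \<le> \<rho> s * (L * \<epsilon>)" for s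
    proof (cases "\<epsilon> < \<bar>s\<bar>")
      case False
      have "\<bar>\<phi> (x - s) - \<phi> x\<bar> \<le> L * \<bar>s\<bar>" using L(1)[of "x - s" x] by simp
      also have "\<dots> \<le> L * \<epsilon>" using False L(2) by (intro mult_left_mono) auto
      finally show ?thesis
        unfolding right_diff_distrib[symmetric] abs_mult using \<rho>_nonneg[of s] by (simp add: mult_left_mono)
    qed (simp add: \<rho>_support)
  qed
  also have "\<dots> = L * \<epsilon>" using \<rho>_LINT \<rho>_integrable by simp
  finally show ?thesis .
qed

end

text \<open>The tent of half-width \<epsilon>, divided by its integral. The integral is positive
  because the tent is at least 1/2 on half of its support.\<close>

lemma ex_mollifier:
  assumes \<epsilon>: "0 < \<epsilon>"
  obtains \<rho> K where "mollifier \<rho> \<epsilon> K"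
proof -
  define h where "h x = max 0 (1 - \<bar>x\<bar> / \<epsilon>)" for x
  have [measurable]: "h \<in> borel_measurable borel" unfolding h_def by measurable
  define I where "I = (\<integral>\<^sup>+x. ennreal (h x) \<partial>lborel)"
  have "I \<le> (\<integral>\<^sup>+x. indicator {- \<epsilon>..\<epsilon>} x \<partial>lborel)"
    unfolding I_def using \<epsilon> by (intro nn_integral_mono) (auto simp: h_def indicator_def ennreal_le_1 abs_le_iff field_simps max_def)
  also have "\<dots> < \<infinity>" using \<epsilon> by simp
  finally have fin: "I < \<infinity>" .
  define d :: real where "d = 1/2"
  have d: "0 < d" by (simp add: d_def)
  have "(\<integral>\<^sup>+x. ennreal d * indicator {- (\<epsilon>/2)..\<epsilon>/2} x \<partial>lborel) \<le> I"
    unfolding I_def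
  proof (intro nn_integral_mono)
    fix x
    have "d \<le> h x" if "x \<in> {- (\<epsilon>/2)..\<epsilon>/2}"
    proof -
      have "\<bar>x\<bar> \<le> \<epsilon> / 2" using that by (auto simp: abs_le_iff)
      then have "\<bar>x\<bar> / \<epsilon> \<le> 1/2" using \<epsilon> by (simp add: pos_divide_le_eq)
      then show ?thesis unfolding h_def d_def by linarith
    qed
    then show "ennreal d * indicator {- (\<epsilon>/2)..\<epsilon>/2} x \<le> ennreal (h x)"
      by (cases "x \<in> {- (\<epsilon>/2)..\<epsilon>/2}") (auto intro: ennreal_leI)
  qed
  moreover have "(\<integral>\<^sup>+x. ennreal d * indicator {- (\<epsilon>/2)..\<epsilon>/2} x \<partial>lborel) = ennreal (d * \<epsilon>)"
    using \<epsilon> d by (subst nn_integral_cmult_indicator) (auto simp: ennreal_mult[symmetric])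
  moreover have "0 < ennreal (d * \<epsilon>)" using \<epsilon> d by (simp add: ennreal_less_zero_iff)
  ultimately have pos: "0 < I" by (metis order.strict_trans2)
  obtain i where i: "I = ennreal i" "0 < i" using fin pos by (cases I) (auto simp: ennreal_less_zero_iff)
  have "mollifier (\<lambda>x. h x / i) \<epsilon> (1 / (\<epsilon> * i))"
  proof
    show "(\<lambda>x. h x / i) \<in> borel_measurable borel" by measurable
    show "0 \<le> h x / i" for x using i by (simp add: h_def)
    have "(\<integral>\<^sup>+x. ennreal (h x / i) \<partial>lborel) = (\<integral>\<^sup>+x. ennreal (1 / i) * ennreal (h x) \<partial>lborel)"
      using i by (intro nn_integral_cong) (simp add: ennreal_mult[symmetric] h_def)
    also have "\<dots> = ennreal (1 / i) * I" by (simp add: nn_integral_cmult I_def)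
    also have "\<dots> = 1" using i by (simp add: ennreal_mult[symmetric])
    finally show "(\<integral>\<^sup>+x. ennreal (h x / i) \<partial>lborel) = 1" .
    show "h x / i = 0" if "\<epsilon> < \<bar>x\<bar>" for x using that \<epsilon> by (simp add: h_def field_simps)
    show "\<bar>h x / i - h y / i\<bar> \<le> 1 / (\<epsilon> * i) * \<bar>x - y\<bar>" for x y
    proof -
      have "\<bar>h x - h y\<bar> \<le> \<bar>\<bar>x\<bar> / \<epsilon> - \<bar>y\<bar> / \<epsilon>\<bar>" unfolding h_def by linarith
      also have "\<dots> = \<bar>\<bar>x\<bar> - \<bar>y\<bar>\<bar> / \<epsilon>" using \<epsilon> by (simp add: diff_divide_distrib[symmetric])
      also have "\<dots> \<le> \<bar>x - y\<bar> / \<epsilon>" using \<epsilon> by (intro divide_right_mono) auto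
      finally have "\<bar>h x - h y\<bar> / i \<le> \<bar>x - y\<bar> / \<epsilon> / i" using i by (intro divide_right_mono) auto
      then show ?thesis using i by (simp add: diff_divide_distrib[symmetric] abs_divide)
    qed
    show "0 < \<epsilon>" by (rule \<epsilon>)
  qed
  then show thesis by (rule that)
qed

lemma norm_class_L2:
  assumes "square_integrable f"
  shows "ennreal ((norm (class_L2 f))\<^sup>2) = (\<integral>\<^sup>+x. ennreal ((f x)\<^sup>2) \<partial>lebesgue)"
  unfolding norm_L2_eq_nn_integral
  using rep_class_L2[OF assms] by (intro nn_integral_cong_AE) (auto elim!: eventually_mono)

lemma norm_class_L2_mono:
  assumes "square_integrable f" "square_integrable g"
    and "(\<integral>\<^sup>+x. ennreal ((f x)\<^sup>2) \<partial>lebesgue) \<le> (\<integral>\<^sup>+x. ennreal ((g x)\<^sup>2) \<partial>lebesgue)"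
  shows "norm (class_L2 f) \<le> norm (class_L2 g)"
proof -
  have "ennreal ((norm (class_L2 f))\<^sup>2) \<le> ennreal ((norm (class_L2 g))\<^sup>2)"
    unfolding norm_class_L2[OF assms(1)] norm_class_L2[OF assms(2)] by (rule assms(3))
  then have "(norm (class_L2 f))\<^sup>2 \<le> (norm (class_L2 g))\<^sup>2" by (subst (asm) ennreal_le_iff) auto
  then show ?thesis by (rule power2_le_imp_le) simp
qed

lemma norm_class_L2_bounded_support:
  assumes "f \<in> borel_measurable lebesgue" "\<And>x. \<bar>f x\<bar> \<le> B" "\<And>x. R < \<bar>x\<bar> \<Longrightarrow> f x = 0" "0 \<le> B" "0 \<le> R"
  shows "norm (class_L2 f) \<le> B * sqrt (2 * R)"
proof -
  have sq: "square_integrable f" by (rule square_integrable_bounded_support[OF assms(1-3)])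
  have "(\<integral>\<^sup>+x. ennreal ((f x)\<^sup>2) \<partial>lebesgue) \<le> (\<integral>\<^sup>+x. ennreal (B\<^sup>2) * indicator {- R..R} x \<partial>lebesgue)"
  proof (intro nn_integral_mono)
    fix x
    have "(f x)\<^sup>2 \<le> B\<^sup>2" using assms(2)[of x] assms(4) by (simp add: abs_le_square_iff[symmetric])
    then show "ennreal ((f x)\<^sup>2) \<le> ennreal (B\<^sup>2) * indicator {- R..R} x"
      using assms(3)[of x] by (cases "R < \<bar>x\<bar>") (auto simp: indicator_def abs_le_iff intro: ennreal_leI)
  qed
  also have "\<dots> = ennreal (B\<^sup>2 * (2 * R))"
    using assms(5) by (subst nn_integral_cmult_indicator) (auto simp: emeasure_lborel_Icc_eq ennreal_mult[symmetric])
  finally have "ennreal ((norm (class_L2 f))\<^sup>2) \<le> ennreal (B\<^sup>2 * (2 * R))" by (simp only: norm_class_L2[OF sq])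
  then have "(norm (class_L2 f))\<^sup>2 \<le> (B * sqrt (2 * R))\<^sup>2"
    using assms(5) by (subst (asm) ennreal_le_iff) (auto simp: power_mult_distrib)
  then show ?thesis by (rule power2_le_imp_le) (use assms in simp)
qed

text \<open>On the bounded support, |g| \<le> g^2 + 1.\<close>

lemma integrable_of_square_integrable:
  assumes "g \<in> borel_measurable borel" "square_integrable g" "\<And>x. R < \<bar>x\<bar> \<Longrightarrow> g x = 0"
  shows "integrable lborel g"
proof -
  have "integrable lebesgue (\<lambda>x. (g x)\<^sup>2)" using assms(2) by (simp add: square_integrable_def)
  then have i: "integrable lborel (\<lambda>x. (g x)\<^sup>2)" using assms(1) by (subst (asm) integrable_completion) auto
  show ?thesis
  proof (rule Bochner_Integration.integrable_bound)
    have "integrable lborel (indicator {- R..R} :: real \<Rightarrow> real)"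
      by (rule integrable_real_indicator) (auto simp: emeasure_lborel_Icc_eq)
    then show "integrable lborel (\<lambda>x. (g x)\<^sup>2 + indicator {- R..R} x)" using i by (rule Bochner_Integration.integrable_add[rotated])
    show "AE x in lborel. norm (g x) \<le> norm ((g x)\<^sup>2 + indicator {- R..R} x)"
    proof (intro AE_I2)
      fix x
      have "2 * \<bar>g x\<bar> \<le> (g x)\<^sup>2 + 1" using zero_le_power2[of "\<bar>g x\<bar> - 1"] by (simp add: power2_diff)
      then have "\<bar>g x\<bar> \<le> (g x)\<^sup>2 + 1" by (smt (verit) abs_ge_zero)
      then show "norm (g x) \<le> norm ((g x)\<^sup>2 + indicator {- R..R} x)"
        using assms(3)[of x] by (cases "R < \<bar>x\<bar>") (auto simp: indicator_def abs_le_iff)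
    qed
  qed (use assms(1) in auto)
qed

text \<open>Mollification integrates a Borel function that vanishes at every point outside an
  interval; a class supplies both properties only up to null sets.\<close>

lemma ex_borel_version:
  assumes "AE x in lebesgue. R < \<bar>x\<bar> \<longrightarrow> rep_L2 u x = 0"
  obtains g where "g \<in> borel_measurable borel" "AE x in lebesgue. rep_L2 u x = g x" "\<And>x. R < \<bar>x\<bar> \<Longrightarrow> g x = 0"
    "square_integrable g" "class_L2 g = u"
proof -
  obtain g0 where [measurable]: "g0 \<in> borel_measurable lborel" and g0: "AE x in lborel. rep_L2 u x = g0 x"
    using completion_ex_borel_measurable_real[OF rep_L2_measurable[of u]] by blast
  define g where "g x = (if R < \<bar>x\<bar> then 0 else g0 x)" for x
  have gm: "g \<in> borel_measurable borel" unfolding g_def by measurable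
  have ae: "AE x in lebesgue. rep_L2 u x = g x"
    using AE_completion[OF g0] assms by eventually_elim (auto simp: g_def)
  have sq: "square_integrable g"
    by (rule square_integrable_dominated[OF square_integrable_rep_L2[of u] borel_imp_lebesgue_measurable[OF gm]])
      (use ae in \<open>auto elim: eventually_mono\<close>)
  have "class_L2 g = class_L2 (rep_L2 u)"
    by (rule class_L2_cong[OF sq square_integrable_rep_L2]) (use ae in \<open>auto elim: eventually_mono\<close>)
  then show thesis using that[of g] gm ae sq by (simp add: class_rep_L2 g_def)
qed

text \<open>Mollification contracts L^2 distances, so a Lipschitz function near \<open>g\<close> may
  replace it, and for that one the error is uniformly at most L / (n + 1) on a fixed bounded
  set.\<close>

lemma moll_tendsto:
  assumes gm: "g \<in> borel_measurable borel" and sq: "square_integrable g" and supp: "\<And>x. R < \<bar>x\<bar> \<Longrightarrow> g x = 0"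
    and moll: "\<And>n. mollifier (\<rho> n) (1 / real (Suc n)) (K n)"
  shows "(\<lambda>n. class_L2 (mollifier.moll (\<rho> n) g)) \<longlonglongrightarrow> class_L2 g"
proof (rule LIMSEQ_I)
  fix e :: real assume e: "0 < e"
  have ig: "integrable lborel g" by (rule integrable_of_square_integrable[OF gm sq supp])
  have "\<exists>v\<in>lip_L2. dist v (class_L2 g) < e / 4"
    using lip_L2_dense e by (intro closure_approachable[THEN iffD1, rule_format]) auto
  then obtain \<psi> where \<psi>: "\<psi> \<in> lip_compact" "norm (class_L2 g - class_L2 \<psi>) < e / 4"
    by (auto simp: lip_L2_def dist_norm norm_minus_commute)
  obtain L R' B where L: "0 \<le> L" "\<And>x y. \<bar>\<psi> x - \<psi> y\<bar> \<le> L * \<bar>x - y\<bar>" "0 \<le> R'" "\<And>x. R' < \<bar>x\<bar> \<Longrightarrow> \<psi> x = 0"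
    by (rule lip_compactE[OF \<psi>(1)]) blast
  note \<psi>m = lip_compact_measurable[OF \<psi>(1)] and \<psi>sq = lip_compact_square_integrable[OF \<psi>(1)]
  have i\<psi>: "integrable lborel \<psi>" by (rule integrable_of_square_integrable[OF \<psi>m \<psi>sq L(4)])
  \<comment> \<open>Two errors e / 4 come from replacing \<open>g\<close> by \<open>\<psi>\<close>
    before and after mollifying. The difference for \<open>\<psi>\<close> lives on
    [- (R' + 1), R' + 1], as all mollifiers have radius at most 1.\<close>
  have le: "norm (class_L2 (mollifier.moll (\<rho> n) g) - class_L2 g) \<le> e / 2 + L / real (Suc n) * sqrt (2 * (R' + 1))" for n
  proof -
    interpret mollifier "\<rho> n" "1 / real (Suc n)" "K n" by (rule moll)
    have mg: "moll g \<in> lip_compact" by (rule moll_lip_compact[OF ig supp])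
    have m\<psi>: "moll \<psi> \<in> lip_compact" by (rule moll_lip_compact[OF i\<psi> L(4)])
    note sq' = lip_compact_square_integrable[OF mg] lip_compact_square_integrable[OF m\<psi>]
    define w where "w x = g x - \<psi> x" for x
    have sw: "square_integrable w" unfolding w_def[abs_def] by (rule square_integrable_diff[OF sq \<psi>sq])
    have mw: "moll w = (\<lambda>x. moll g x - moll \<psi> x)" unfolding w_def[abs_def] by (rule ext, rule moll_diff[OF ig i\<psi>])
    have iw: "integrable lborel w" unfolding w_def[abs_def] using ig i\<psi> by simp
    have "norm (class_L2 (moll g) - class_L2 (moll \<psi>)) \<le> norm (class_L2 g - class_L2 \<psi>)"
      unfolding class_L2_diff[OF sq'] class_L2_diff[OF sq \<psi>sq] mw[symmetric] w_def[symmetric]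
    proof (rule norm_class_L2_mono[OF _ sw])
      show "square_integrable (moll w)" unfolding mw by (rule square_integrable_diff[OF sq'])
      show "(\<integral>\<^sup>+x. ennreal ((moll w x)\<^sup>2) \<partial>lebesgue) \<le> (\<integral>\<^sup>+x. ennreal ((w x)\<^sup>2) \<partial>lebesgue)"
        unfolding nn_integral_completion by (rule moll_L2_le[OF iw])
    qed
    moreover have "norm (class_L2 (moll \<psi>) - class_L2 \<psi>) \<le> L / real (Suc n) * sqrt (2 * (R' + 1))"
      unfolding class_L2_diff[OF sq'(2) \<psi>sq]
    proof (rule norm_class_L2_bounded_support)
      show "(\<lambda>x. moll \<psi> x - \<psi> x) \<in> borel_measurable lebesgue"
        by (intro borel_imp_lebesgue_measurable borel_measurable_diff lip_compact_measurable m\<psi> \<psi>(1))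
      show "\<bar>moll \<psi> x - \<psi> x\<bar> \<le> L / real (Suc n)" for x
        using moll_close[OF i\<psi> L(2,1)] by simp
      fix x assume x: "R' + 1 < \<bar>x\<bar>"
      have "\<rho> n s * \<psi> (x - s) = 0" for s
      proof (cases "1 / real (Suc n) < \<bar>s\<bar>")
        case False
        have "1 / real (Suc n) \<le> 1" by simp
        then have "R' < \<bar>x - s\<bar>" using x False by linarith
        then show ?thesis by (simp add: L(4))
      qed (simp add: \<rho>_support)
      then have "(\<lambda>s. \<rho> n s * \<psi> (x - s)) = (\<lambda>s. 0)" by (intro ext)
      then show "moll \<psi> x - \<psi> x = 0" using x L(4)[of x] unfolding moll_shift[OF i\<psi>] by simp
    qed (use L in auto)
    moreover have "norm (class_L2 (moll g) - class_L2 g) \<le> norm (class_L2 (moll g) - class_L2 (moll \<psi>))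
        + norm (class_L2 (moll \<psi>) - class_L2 \<psi>) + norm (class_L2 g - class_L2 \<psi>)"
      using norm_triangle_ineq[of "class_L2 (moll g) - class_L2 (moll \<psi>)" "class_L2 (moll \<psi>) - class_L2 \<psi>"]
        norm_triangle_ineq[of "class_L2 (moll g) - class_L2 \<psi>" "class_L2 \<psi> - class_L2 g"]
      by (simp add: norm_minus_commute)
    ultimately show ?thesis using \<psi>(2) by linarith
  qed
  have "(\<lambda>n. L * (1 / real (Suc n)) * sqrt (2 * (R' + 1))) \<longlonglongrightarrow> L * 0 * sqrt (2 * (R' + 1))"
    by (intro tendsto_intros LIMSEQ_Suc[OF lim_1_over_n])
  then have "(\<lambda>n. L / real (Suc n) * sqrt (2 * (R' + 1))) \<longlonglongrightarrow> 0" by simp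
  then have "\<forall>\<^sub>F n in sequentially. L / real (Suc n) * sqrt (2 * (R' + 1)) < e / 2"
    by (rule order_tendstoD(2)) (use e in simp)
  then obtain N where N: "\<And>n. n \<ge> N \<Longrightarrow> L / real (Suc n) * sqrt (2 * (R' + 1)) < e / 2" by (auto simp: eventually_sequentially)
  have "norm (class_L2 (mollifier.moll (\<rho> n) g) - class_L2 g) < e" if "n \<ge> N" for n
    using le[of n] N[OF that] by linarith
  then show "\<exists>N. \<forall>n\<ge>N. norm (class_L2 (mollifier.moll (\<rho> n) g) - class_L2 g) < e" by blast
qed

section \<open>The domain of a jump form\<close>

definition levy :: "(real \<Rightarrow> real) \<Rightarrow> bool" where
  "levy j \<longleftrightarrow> jump_kernel j \<and> (\<integral>\<^sup>+z. ennreal (min 1 (z\<^sup>2) * j \<bar>z\<bar>) \<partial>lborel) < \<infinity>"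

lemma levy_kernel: "levy j \<Longrightarrow> jump_kernel j" by (simp add: levy_def)

lemma pair_bound:
  fixes H :: "real \<Rightarrow> ennreal"
  assumes [measurable]: "H \<in> borel_measurable borel" and R: "0 \<le> R"
  shows "(\<integral>\<^sup>+x. \<integral>\<^sup>+y. (indicator {- R..R} x + indicator {- R..R} y) * H (x - y) \<partial>lebesgue \<partial>lebesgue)
    = ennreal (4 * R) * (\<integral>\<^sup>+z. H z \<partial>lborel)"
proof -
  let ?i = "indicator {- R..R} :: real \<Rightarrow> ennreal"
  have i: "(\<integral>\<^sup>+x. ?i x \<partial>lebesgue) = ennreal (2 * R)" using R by (simp add: emeasure_lborel_Icc_eq)
  have im: "?i \<in> borel_measurable lebesgue" by (rule borel_measurable_indicator) auto
  have "(\<integral>\<^sup>+x. \<integral>\<^sup>+y. (?i x + ?i y) * H (x - y) \<partial>lebesgue \<partial>lebesgue)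
     = (\<integral>\<^sup>+x. (\<integral>\<^sup>+y. ?i x * H (x - y) \<partial>lebesgue) + (\<integral>\<^sup>+y. ?i y * H (x - y) \<partial>lebesgue) \<partial>lebesgue)"
    unfolding distrib_right by (intro nn_integral_cong nn_integral_add) measurable
  also have "\<dots> = (\<integral>\<^sup>+x. \<integral>\<^sup>+y. ?i x * H (x - y) \<partial>lebesgue \<partial>lebesgue) + (\<integral>\<^sup>+x. \<integral>\<^sup>+y. ?i y * H (x - y) \<partial>lebesgue \<partial>lebesgue)"
    by (intro nn_integral_add) measurable
  also have "\<dots> = ennreal (2 * R) * (\<integral>\<^sup>+z. H z \<partial>lborel) + ennreal (2 * R) * (\<integral>\<^sup>+z. H z \<partial>lborel)"
    unfolding nn_integral_conv_left[OF im assms(1)] nn_integral_conv_right[OF im assms(1)] i ..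
  also have "\<dots> = ennreal (4 * R) * (\<integral>\<^sup>+z. H z \<partial>lborel)"
    using R by (simp add: distrib_right[symmetric] ennreal_plus[symmetric] del: ennreal_plus)
  finally show ?thesis .
qed

text \<open>The shape needed against a Levy kernel: \<open>min 1 ((x - y)\<^sup>2)\<close> matches
  the Levy integral, and the sum of indicators reflects that one of the two points must lie in the
  support.\<close>

lemma lip_compact_diff_bound:
  assumes "\<phi> \<in> lip_compact"
  obtains B R where "0 \<le> B" "0 \<le> R"
    "\<And>x y. (\<phi> x - \<phi> y)\<^sup>2 \<le> B * min 1 ((x - y)\<^sup>2) * (indicator {- R..R} x + indicator {- R..R} y)"
proof -
  obtain L R M where L: "0 \<le> L" "\<And>x y. \<bar>\<phi> x - \<phi> y\<bar> \<le> L * \<bar>x - y\<bar>" "0 \<le> R" "\<And>x. R < \<bar>x\<bar> \<Longrightarrow> \<phi> x = 0"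
      "0 \<le> M" "\<And>x. \<bar>\<phi> x\<bar> \<le> M"
    by (rule lip_compactE[OF assms]) blast
  define B where "B = L\<^sup>2 + (2 * M)\<^sup>2"
  have B: "0 \<le> B" by (simp add: B_def)
  have "(\<phi> x - \<phi> y)\<^sup>2 \<le> B * min 1 ((x - y)\<^sup>2) * (indicator {- R..R} x + indicator {- R..R} y)" for x y
  proof (cases "R < \<bar>x\<bar> \<and> R < \<bar>y\<bar>")
    case True
    then show ?thesis using L(4) B by simp
  next
    case False
    then have "1 \<le> (indicator {- R..R} x + indicator {- R..R} y :: real)" by (auto simp: indicator_def abs_le_iff)
    have "(\<phi> x - \<phi> y)\<^sup>2 \<le> (L * \<bar>x - y\<bar>)\<^sup>2" using L(2)[of x y] L(1) by (simp add: abs_le_square_iff[symmetric])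
    then have 1: "(\<phi> x - \<phi> y)\<^sup>2 \<le> L\<^sup>2 * (x - y)\<^sup>2" by (simp add: power_mult_distrib)
    have "\<bar>\<phi> x - \<phi> y\<bar> \<le> 2 * M" using L(6)[of x] L(6)[of y] by linarith
    from power_mono[OF this, of 2] have 2: "(\<phi> x - \<phi> y)\<^sup>2 \<le> (2 * M)\<^sup>2" by simp
    have "(\<phi> x - \<phi> y)\<^sup>2 \<le> B * min 1 ((x - y)\<^sup>2)"
    proof (cases "(x - y)\<^sup>2 \<le> 1")
      case True
      then have "B * min 1 ((x - y)\<^sup>2) = L\<^sup>2 * (x - y)\<^sup>2 + (2 * M)\<^sup>2 * (x - y)\<^sup>2"
        by (simp add: min_def B_def distrib_right)
      moreover have "0 \<le> (2 * M)\<^sup>2 * (x - y)\<^sup>2" by simp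
      ultimately show ?thesis using 1 by linarith
    next
      case False
      then have "B * min 1 ((x - y)\<^sup>2) = L\<^sup>2 + (2 * M)\<^sup>2" by (simp add: min_def B_def)
      moreover have "0 \<le> L\<^sup>2" by simp
      ultimately show ?thesis using 2 by linarith
    qed
    also have "\<dots> \<le> B * min 1 ((x - y)\<^sup>2) * (indicator {- R..R} x + indicator {- R..R} y)"
      using mult_left_mono[OF \<open>1 \<le> _\<close>, of "B * min 1 ((x - y)\<^sup>2)"] B by simp
    finally show ?thesis .
  qed
  then show thesis using that B L(3) by blast
qed

definition cutoff :: "real \<Rightarrow> real \<Rightarrow> real" where
  "cutoff R x = max 0 (min 1 (2 - \<bar>x\<bar> / R))"

lemma cutoff_range: "0 \<le> cutoff R x" "cutoff R x \<le> 1"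
  by (auto simp: cutoff_def)

lemma cutoff_eq_1: "0 < R \<Longrightarrow> \<bar>x\<bar> \<le> R \<Longrightarrow> cutoff R x = 1"
  by (simp add: cutoff_def field_simps)

lemma cutoff_eq_0: "0 < R \<Longrightarrow> 2 * R < \<bar>x\<bar> \<Longrightarrow> cutoff R x = 0"
  by (simp add: cutoff_def field_simps)

lemma cutoff_lipschitz:
  assumes R: "0 < R"
  shows "\<bar>cutoff R x - cutoff R y\<bar> \<le> 1 / R * \<bar>x - y\<bar>"
proof -
  have "\<bar>cutoff R x - cutoff R y\<bar> \<le> \<bar>\<bar>x\<bar> / R - \<bar>y\<bar> / R\<bar>" unfolding cutoff_def by linarith
  also have "\<dots> = \<bar>\<bar>x\<bar> - \<bar>y\<bar>\<bar> / R" using R by (simp add: diff_divide_distrib[symmetric])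
  also have "\<dots> \<le> \<bar>x - y\<bar> / R" using R by (intro divide_right_mono) auto
  finally show ?thesis by simp
qed

lemma cutoff_lip_compact: "0 < R \<Longrightarrow> cutoff R \<in> lip_compact"
  by (rule lip_compactI[where L = "1 / R" and R = "2 * R"]) (auto simp: cutoff_lipschitz[simplified] cutoff_eq_0)

lemma cutoff_diff_square:
  assumes R: "0 < R"
  shows "(cutoff R x - cutoff R y)\<^sup>2 \<le> min 1 ((x - y)\<^sup>2 / R\<^sup>2)"
proof -
  have "\<bar>cutoff R x - cutoff R y\<bar> \<le> 1" using cutoff_range[of R x] cutoff_range[of R y] by auto
  then have "(cutoff R x - cutoff R y)\<^sup>2 \<le> 1" by (simp add: abs_square_le_1)
  moreover have "(cutoff R x - cutoff R y)\<^sup>2 \<le> (1 / R * \<bar>x - y\<bar>)\<^sup>2"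
    using cutoff_lipschitz[OF R, of x y] R by (simp add: abs_le_square_iff[symmetric])
  ultimately show ?thesis by (simp add: power_mult_distrib power_divide)
qed

context coefficient
begin

lemma energy_le_bound:
  assumes k: "jump_kernel j" and f: "f \<in> borel_measurable lebesgue" and H: "H \<in> borel_measurable borel" "\<And>z. 0 \<le> H z"
    and R: "0 \<le> R" and bound: "\<And>x y. (f x - f y)\<^sup>2 \<le> H (x - y) * (indicator {- R..R} x + indicator {- R..R} y)"
  shows "energy j f \<le> ennreal ((C + 1) * (4 * R)) * (\<integral>\<^sup>+z. ennreal (H z * j \<bar>z\<bar>) \<partial>lborel)"
proof -
  have [measurable]: "j \<in> borel_measurable borel" "H \<in> borel_measurable borel"
    using k H(1) by (auto intro: kernel_measurable)
  have "(\<integral>\<^sup>+x. \<integral>\<^sup>+y. ennreal ((f x - f y)\<^sup>2) * ennreal (j \<bar>x - y\<bar>) \<partial>lebesgue \<partial>lebesgue)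
      \<le> (\<integral>\<^sup>+x. \<integral>\<^sup>+y. (indicator {- R..R} x + indicator {- R..R} y) * ennreal (H (x - y) * j \<bar>x - y\<bar>) \<partial>lebesgue \<partial>lebesgue)"
  proof (intro nn_integral_mono)
    fix x y
    have "ennreal ((f x - f y)\<^sup>2) \<le> ennreal (H (x - y) * (indicator {- R..R} x + indicator {- R..R} y))"
      by (intro ennreal_leI bound)
    also have "\<dots> = ennreal (H (x - y)) * (indicator {- R..R} x + indicator {- R..R} y)"
      using H(2) by (auto simp: ennreal_mult indicator_def)
    finally have "ennreal ((f x - f y)\<^sup>2) * ennreal (j \<bar>x - y\<bar>)
        \<le> ennreal (H (x - y)) * (indicator {- R..R} x + indicator {- R..R} y) * ennreal (j \<bar>x - y\<bar>)"
      by (rule mult_right_mono) simp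
    also have "\<dots> = (indicator {- R..R} x + indicator {- R..R} y) * ennreal (H (x - y) * j \<bar>x - y\<bar>)"
      using H(2) kernel_nonneg[OF k] by (simp add: ennreal_mult mult_ac)
    finally show "ennreal ((f x - f y)\<^sup>2) * ennreal (j \<bar>x - y\<bar>)
        \<le> (indicator {- R..R} x + indicator {- R..R} y) * ennreal (H (x - y) * j \<bar>x - y\<bar>)" .
  qed
  also have "\<dots> = ennreal (4 * R) * (\<integral>\<^sup>+z. ennreal (H z * j \<bar>z\<bar>) \<partial>lborel)"
    by (rule pair_bound[OF _ R]) measurable
  finally have "ennreal (C + 1) * (\<integral>\<^sup>+x. \<integral>\<^sup>+y. ennreal ((f x - f y)\<^sup>2) * ennreal (j \<bar>x - y\<bar>) \<partial>lebesgue \<partial>lebesgue)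
      \<le> ennreal (C + 1) * (ennreal (4 * R) * (\<integral>\<^sup>+z. ennreal (H z * j \<bar>z\<bar>) \<partial>lborel))" by (rule mult_left_mono) simp
  also have "\<dots> = ennreal ((C + 1) * (4 * R)) * (\<integral>\<^sup>+z. ennreal (H z * j \<bar>z\<bar>) \<partial>lborel)"
    using R C_nonneg by (simp add: ennreal_mult mult.assoc)
  finally show ?thesis using energy_le[OF k f] by (rule order_trans[rotated])
qed

lemma energy_class:
  assumes "jump_kernel j" "square_integrable f"
  shows "energy j (rep_L2 (class_L2 f)) = energy j f"
  by (rule energy_cong) (use assms rep_class_L2[OF assms(2)] in auto)

lemma energy_lip_finite:
  assumes j: "levy j" and \<phi>: "\<phi> \<in> lip_compact"
  shows "energy j \<phi> < \<infinity>"
proof -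
  obtain B R where B: "0 \<le> B" "0 \<le> R"
    "\<And>x y. (\<phi> x - \<phi> y)\<^sup>2 \<le> B * min 1 ((x - y)\<^sup>2) * (indicator {- R..R} x + indicator {- R..R} y)"
    by (rule lip_compact_diff_bound[OF \<phi>]) blast
  have [measurable]: "j \<in> borel_measurable borel" using levy_kernel[OF j] by (rule kernel_measurable)
  have "energy j \<phi> \<le> ennreal ((C + 1) * (4 * R)) * (\<integral>\<^sup>+z. ennreal (B * min 1 (z\<^sup>2) * j \<bar>z\<bar>) \<partial>lborel)"
    by (rule energy_le_bound[OF levy_kernel[OF j] _ _ _ B(2)])
      (use B borel_imp_lebesgue_measurable[OF lip_compact_measurable[OF \<phi>]] in auto)
  also have "(\<integral>\<^sup>+z. ennreal (B * min 1 (z\<^sup>2) * j \<bar>z\<bar>) \<partial>lborel) = (\<integral>\<^sup>+z. ennreal B * ennreal (min 1 (z\<^sup>2) * j \<bar>z\<bar>) \<partial>lborel)"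
    using B(1) kernel_nonneg[OF levy_kernel[OF j]] by (intro nn_integral_cong) (simp add: ennreal_mult[symmetric] mult.assoc)
  also have "\<dots> = ennreal B * (\<integral>\<^sup>+z. ennreal (min 1 (z\<^sup>2) * j \<bar>z\<bar>) \<partial>lborel)"
    by (rule nn_integral_cmult) measurable
  also have "ennreal ((C + 1) * (4 * R)) * \<dots> < \<infinity>"
    using j by (simp add: levy_def ennreal_mult_less_top)
  finally show ?thesis .
qed

lemma lip_L2_subset: "levy j \<Longrightarrow> lip_L2 \<subseteq> finite_energy j"
  unfolding lip_L2_def finite_energy_def
  using energy_lip_finite by (auto simp: energy_class[OF levy_kernel] lip_compact_square_integrable)

lemma semi_inner_E1:
  assumes "jump_kernel j"
  shows "semi_inner (finite_energy j) (\<lambda>u v. jump_form (J j) u v + inner u v)"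
proof -
  interpret Q: semi_inner "finite_energy j" "jump_form (J j)" by (rule semi_inner_jump_form[OF assms])
  show ?thesis
    by unfold_locales
      (use Q.subspace Q.sym Q.add_left Q.scale_left Q.nonneg in
        \<open>auto simp: inner_commute inner_add_left inner_add_right algebra_simps intro: Q.sym\<close>)
qed

text \<open>
  Orthogonality for \<open>E\<^sub>1\<close> passes to limits in \<open>L\<^sup>2\<close> of sequences of bounded energy: such sequences converge
  weakly for \<open>E\<^sub>1\<close>, which only enters through lower semicontinuity of \<open>s \<mapsto> E(q + s v)\<close>.
\<close>

lemma orthogonal_limit:
  assumes k: "jump_kernel j" and q: "q \<in> finite_energy j" and v: "\<And>n. v n \<in> finite_energy j" "v \<longlonglongrightarrow> w"
    and bound: "\<And>n. energy j (rep_L2 (v n)) \<le> ennreal (2 * M)" and M: "0 \<le> M"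
    and orth: "\<And>n. jump_form (J j) q (v n) + inner q (v n) = 0"
  shows "w \<in> finite_energy j" "jump_form (J j) q w + inner q w = 0"
proof -
  interpret Q: semi_inner "finite_energy j" "jump_form (J j)" by (rule semi_inner_jump_form[OF k])
  let ?Q = "jump_form (J j)"
  have "energy j (rep_L2 w) \<le> ennreal (2 * M)"
    by (rule energy_le_limit[OF k v(2)]) (simp add: bound)
  then show w: "w \<in> finite_energy j" by (auto simp: finite_energy_def intro: le_less_trans)
  have Qv: "?Q (v n) (v n) \<le> M" for n
    using bound[of n] M unfolding jump_energy_jump_form(3)[OF k v(1)] by (subst (asm) ennreal_le_iff) auto
  have "0 \<le> 0 + 2 * s * (- (?Q q w + inner q w)) + s\<^sup>2 * M" for s
  proof -
    define c where "c n = ?Q q q - 2 * s * inner q (v n) + s\<^sup>2 * M" for n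
    define c' where "c' = ?Q q q - 2 * s * inner q w + s\<^sup>2 * M"
    have lim: "c \<longlonglongrightarrow> c'" unfolding c_def c'_def by (intro tendsto_intros v(2))
    have qv: "q + s *\<^sub>R v n \<in> finite_energy j" for n using q v(1) by auto
    have qw: "q + s *\<^sub>R w \<in> finite_energy j" using q w by auto
    have le: "?Q (q + s *\<^sub>R v n) (q + s *\<^sub>R v n) \<le> c n" for n
    proof -
      have "?Q q (v n) = - inner q (v n)" using orth[of n] by simp
      then show ?thesis
        using mult_left_mono[OF Qv[of n], of "s\<^sup>2"] by (simp add: Q.quad_add_scale[OF q v(1)] c_def)
    qed
    have c0: "0 \<le> c'"
      by (rule LIMSEQ_le_const[OF lim]) (use le Q.nonneg[OF qv] in \<open>auto intro: order_trans\<close>)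
    have "energy j (rep_L2 (q + s *\<^sub>R w)) \<le> liminf (\<lambda>n. energy j (rep_L2 (q + s *\<^sub>R v n)))"
      by (rule energy_lsc_strong[OF k]) (intro tendsto_intros v(2))
    also have "\<dots> \<le> liminf (\<lambda>n. ennreal (2 * c n))"
      unfolding jump_energy_jump_form(3)[OF k qv] using le
      by (intro Liminf_mono always_eventually allI ennreal_leI) simp
    also have "\<dots> = ennreal (2 * c')"
      by (rule lim_imp_Liminf[OF sequentially_bot]) (intro tendsto_intros lim)
    finally have "?Q (q + s *\<^sub>R w) (q + s *\<^sub>R w) \<le> c'"
      unfolding jump_energy_jump_form(3)[OF k qw] using c0 by (subst (asm) ennreal_le_iff) auto
    moreover have "0 \<le> s\<^sup>2 * ?Q w w" using Q.nonneg[OF w] by simp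
    ultimately show ?thesis by (simp add: Q.quad_add_scale[OF q w] c'_def algebra_simps)
  qed
  from discriminant_nonpos[OF this M] show "?Q q w + inner q w = 0" by simp
qed

text \<open>Mollifications of \<open>v\<close> are Lipschitz, converge to \<open>v\<close> in L^2
  and have energies at most \<open>C + 1\<close> times that of \<open>v\<close>. Bounded energy is
  all that \<open>orthogonal_limit\<close> asks for.\<close>

lemma orthogonal_compact_support:
  assumes j: "levy j" and q: "q \<in> finite_energy j" "\<And>w. w \<in> lip_L2 \<Longrightarrow> jump_form (J j) q w + inner q w = 0"
    and v: "v \<in> finite_energy j" "AE x in lebesgue. R < \<bar>x\<bar> \<longrightarrow> rep_L2 v x = 0"
  shows "jump_form (J j) q v + inner q v = 0"
proof -
  note k = levy_kernel[OF j]
  have [measurable]: "j \<in> borel_measurable borel" using k by (rule kernel_measurable)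
  obtain g where g: "g \<in> borel_measurable borel" "AE x in lebesgue. rep_L2 v x = g x" "\<And>x. R < \<bar>x\<bar> \<Longrightarrow> g x = 0"
    "square_integrable g" "class_L2 g = v"
    by (rule ex_borel_version[OF v(2)]) blast
  have ig: "integrable lborel g" by (rule integrable_of_square_integrable[OF g(1,4,3)])
  have "\<exists>\<rho> K. mollifier \<rho> (1 / real (Suc n)) K" for n
    using ex_mollifier[of "1 / real (Suc n)"] by (metis of_nat_0_less_iff zero_less_Suc zero_less_divide_1_iff)
  then obtain \<rho> K where moll: "\<And>n. mollifier (\<rho> n) (1 / real (Suc n)) (K n)" by metis
  define \<phi> where "\<phi> n = mollifier.moll (\<rho> n) g" for n
  have \<phi>: "\<phi> n \<in> lip_compact" for n
    unfolding \<phi>_def by (rule mollifier.moll_lip_compact[OF moll ig g(3)])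
  have lim: "(\<lambda>n. class_L2 (\<phi> n)) \<longlonglongrightarrow> v"
    unfolding \<phi>_def using moll_tendsto[OF g(1,4,3) moll] g(5) by simp
  have eg: "energy j g = energy j (rep_L2 v)"
    by (rule energy_cong[OF k]) (use g(2) borel_imp_lebesgue_measurable[OF g(1)] in \<open>auto elim: eventually_mono\<close>)
  have "energy j (\<phi> n) \<le> ennreal (C + 1) * energy j g" for n
  proof -
    have "energy j (\<phi> n) \<le> ennreal (C + 1) * (\<integral>\<^sup>+x. \<integral>\<^sup>+y. ennreal ((\<phi> n x - \<phi> n y)\<^sup>2) * ennreal (j \<bar>x - y\<bar>) \<partial>lebesgue \<partial>lebesgue)"
      by (rule energy_le[OF k borel_imp_lebesgue_measurable[OF lip_compact_measurable[OF \<phi>]]])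
    also have "\<dots> \<le> ennreal (C + 1) * (\<integral>\<^sup>+x. \<integral>\<^sup>+y. ennreal ((g x - g y)\<^sup>2) * ennreal (j \<bar>x - y\<bar>) \<partial>lebesgue \<partial>lebesgue)"
      unfolding nn_integral_completion \<phi>_def by (intro mult_left_mono mollifier.moll_energy_le[OF moll ig]) auto
    also have "\<dots> \<le> ennreal (C + 1) * energy j g"
      by (intro mult_left_mono energy_ge k borel_imp_lebesgue_measurable g(1)) auto
    finally show ?thesis .
  qed
  then have b: "energy j (rep_L2 (class_L2 (\<phi> n))) \<le> ennreal (C + 1) * energy j (rep_L2 v)" for n
    by (simp add: energy_class[OF k lip_compact_square_integrable[OF \<phi>]] eg)
  define M where "M = (C + 1) * jump_form (J j) v v"
  have M: "0 \<le> M" using C_nonneg jump_energy_jump_form(2)[OF k v(1)] by (simp add: M_def)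
  have "ennreal (C + 1) * energy j (rep_L2 v) = ennreal (2 * M)"
    unfolding jump_energy_jump_form(3)[OF k v(1)] M_def using C_nonneg jump_energy_jump_form(2)[OF k v(1)]
    by (simp add: ennreal_mult[symmetric] mult.left_commute del: ennreal_plus)
  then have b': "energy j (rep_L2 (class_L2 (\<phi> n))) \<le> ennreal (2 * M)" for n using b[of n] by simp
  have in_lip: "class_L2 (\<phi> n) \<in> lip_L2" for n using \<phi> by (auto simp: lip_L2_def)
  show ?thesis
    by (rule orthogonal_limit(2)[OF k q(1) _ lim b' M q(2)[OF in_lip]]) (use in_lip lip_L2_subset[OF j] in auto)
qed

text \<open>The products of \<open>q\<close> with wide cutoffs have compact support and bounded
  energy and tend to \<open>q\<close> in L^2. So \<open>q\<close> is E_1-orthogonal to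
  itself.\<close>

lemma orthogonal_lip_L2_imp_0:
  assumes j: "levy j" and q: "q \<in> finite_energy j" "\<And>w. w \<in> lip_L2 \<Longrightarrow> jump_form (J j) q w + inner q w = 0"
  shows "q = 0"
proof -
  note k [measurable] = levy_kernel[OF j]
  have [measurable]: "j \<in> borel_measurable borel" using k by (rule kernel_measurable)
  define f where "f n x = cutoff (real (Suc n)) x * rep_L2 q x" for n x
  have cm: "cutoff (real (Suc n)) \<in> borel_measurable lebesgue" for n
    by (intro borel_imp_lebesgue_measurable lip_compact_measurable cutoff_lip_compact) simp
  have fm [measurable]: "f n \<in> borel_measurable lebesgue" for n unfolding f_def using cm[of n] by measurable
  have fle: "\<bar>f n x\<bar> \<le> \<bar>rep_L2 q x\<bar>" for n x
    unfolding f_def abs_mult using cutoff_range[of "real (Suc n)" x]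
    by (intro mult_left_le_one_le) auto
  have sq: "square_integrable (f n)" for n
    by (rule square_integrable_dominated[OF square_integrable_rep_L2[of q] fm]) (simp add: fle)
  define v where "v n = class_L2 (f n)" for n
  define \<Lambda> where "\<Lambda> = (\<integral>\<^sup>+z. ennreal (min 1 (z\<^sup>2) * j \<bar>z\<bar>) \<partial>lborel)"
  \<comment> \<open>From the product rule: \<eta>(x) q(x) - \<eta>(y) q(y) = \<eta>(x) (q(x) - q(y))
    + q(y) (\<eta>(x) - \<eta>(y)). The first term costs the energy of \<open>q\<close>, the second
    its L^2 norm times the Levy integral \<open>\<Lambda>\<close>.\<close>
  define D where "D = 2 * energy j (rep_L2 q) + ennreal (2 * (C + 1)) * (ennreal ((norm q)\<^sup>2) * \<Lambda>)"
  have D: "D < \<infinity>"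
    using q(1) j by (simp add: D_def finite_energy_def \<Lambda>_def levy_def ennreal_mult_less_top)
  have energy_v: "energy j (rep_L2 (v n)) \<le> D" for n
  proof -
    let ?\<eta> = "cutoff (real (Suc n))"
    have "energy j (f n) \<le> (\<integral>\<^sup>+x. \<integral>\<^sup>+y. 2 * ennreal ((rep_L2 q x - rep_L2 q y)\<^sup>2 * J j x y)
        + ennreal (2 * (C + 1)) * (ennreal ((rep_L2 q y)\<^sup>2) * ennreal (min 1 ((x - y)\<^sup>2) * j \<bar>x - y\<bar>)) \<partial>lebesgue \<partial>lebesgue)"
      unfolding energy_iterated[OF k fm]
    proof (intro nn_integral_mono)
      fix x y
      define a b where "a = ?\<eta> x * (rep_L2 q x - rep_L2 q y)" "b = rep_L2 q y * (?\<eta> x - ?\<eta> y)"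
      note d = this
      have J0: "0 \<le> J j x y" by (rule J_nonneg[OF k])
      have j0: "0 \<le> j \<bar>x - y\<bar>" by (rule kernel_nonneg[OF k])
      have "f n x - f n y = a + b" by (simp add: f_def d algebra_simps)
      then have "(f n x - f n y)\<^sup>2 \<le> 2 * a\<^sup>2 + 2 * b\<^sup>2" using sum_squares_bound[of a b] by (simp add: power2_sum)
      moreover have "a\<^sup>2 \<le> (rep_L2 q x - rep_L2 q y)\<^sup>2"
        unfolding abs_le_square_iff[symmetric] d abs_mult using cutoff_range[of "real (Suc n)" x]
        by (intro mult_left_le_one_le) auto
      moreover have "b\<^sup>2 \<le> (rep_L2 q y)\<^sup>2 * min 1 ((x - y)\<^sup>2)"
      proof -
        have "(?\<eta> x - ?\<eta> y)\<^sup>2 \<le> min 1 ((x - y)\<^sup>2 / (real (Suc n))\<^sup>2)" by (rule cutoff_diff_square) simp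
        also have "\<dots> \<le> min 1 ((x - y)\<^sup>2 / 1)"
          by (intro min.mono divide_left_mono order_refl) auto
        finally show ?thesis unfolding d power_mult_distrib by (intro mult_left_mono) auto
      qed
      ultimately have "(f n x - f n y)\<^sup>2 \<le> 2 * (rep_L2 q x - rep_L2 q y)\<^sup>2 + 2 * ((rep_L2 q y)\<^sup>2 * min 1 ((x - y)\<^sup>2))" by linarith
      then have "(f n x - f n y)\<^sup>2 * J j x y
          \<le> (2 * (rep_L2 q x - rep_L2 q y)\<^sup>2 + 2 * ((rep_L2 q y)\<^sup>2 * min 1 ((x - y)\<^sup>2))) * J j x y"
        using J0 by (rule mult_right_mono)
      also have "\<dots> \<le> 2 * ((rep_L2 q x - rep_L2 q y)\<^sup>2 * J j x y)
          + 2 * ((rep_L2 q y)\<^sup>2 * min 1 ((x - y)\<^sup>2)) * ((C + 1) * j \<bar>x - y\<bar>)"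
        using mult_left_mono[OF J_le[OF k, of x y], of "2 * ((rep_L2 q y)\<^sup>2 * min 1 ((x - y)\<^sup>2))"]
        by (simp add: distrib_right)
      finally have "ennreal ((f n x - f n y)\<^sup>2 * J j x y) \<le> ennreal (2 * ((rep_L2 q x - rep_L2 q y)\<^sup>2 * J j x y)
          + 2 * (C + 1) * ((rep_L2 q y)\<^sup>2 * (min 1 ((x - y)\<^sup>2) * j \<bar>x - y\<bar>)))"
        by (intro ennreal_leI) (simp add: algebra_simps)
      also have "\<dots> = 2 * ennreal ((rep_L2 q x - rep_L2 q y)\<^sup>2 * J j x y)
        + ennreal (2 * (C + 1)) * (ennreal ((rep_L2 q y)\<^sup>2) * ennreal (min 1 ((x - y)\<^sup>2) * j \<bar>x - y\<bar>))"
        using J0 j0 C_nonneg by (simp add: ennreal_mult ennreal_mult')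
      finally show "ennreal ((f n x - f n y)\<^sup>2 * J j x y) \<le> 2 * ennreal ((rep_L2 q x - rep_L2 q y)\<^sup>2 * J j x y)
        + ennreal (2 * (C + 1)) * (ennreal ((rep_L2 q y)\<^sup>2) * ennreal (min 1 ((x - y)\<^sup>2) * j \<bar>x - y\<bar>))" .
    qed
    also have "\<dots> = (\<integral>\<^sup>+x. (\<integral>\<^sup>+y. 2 * ennreal ((rep_L2 q x - rep_L2 q y)\<^sup>2 * J j x y) \<partial>lebesgue)
        + (\<integral>\<^sup>+y. ennreal (2 * (C + 1)) * (ennreal ((rep_L2 q y)\<^sup>2) * ennreal (min 1 ((x - y)\<^sup>2) * j \<bar>x - y\<bar>)) \<partial>lebesgue) \<partial>lebesgue)"
      by (intro nn_integral_cong nn_integral_add) measurable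
    also have "\<dots> = (\<integral>\<^sup>+x. (\<integral>\<^sup>+y. 2 * ennreal ((rep_L2 q x - rep_L2 q y)\<^sup>2 * J j x y) \<partial>lebesgue) \<partial>lebesgue)
        + (\<integral>\<^sup>+x. (\<integral>\<^sup>+y. ennreal (2 * (C + 1)) * (ennreal ((rep_L2 q y)\<^sup>2) * ennreal (min 1 ((x - y)\<^sup>2) * j \<bar>x - y\<bar>)) \<partial>lebesgue) \<partial>lebesgue)"
      by (intro nn_integral_add) measurable
    also have "(\<integral>\<^sup>+x. (\<integral>\<^sup>+y. 2 * ennreal ((rep_L2 q x - rep_L2 q y)\<^sup>2 * J j x y) \<partial>lebesgue) \<partial>lebesgue) = 2 * energy j (rep_L2 q)"
      unfolding energy_iterated[OF k rep_L2_measurable]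
      by (subst nn_integral_cmult[symmetric]) (auto intro!: nn_integral_cong nn_integral_cmult)
    also have "(\<integral>\<^sup>+x. (\<integral>\<^sup>+y. ennreal (2 * (C + 1)) * (ennreal ((rep_L2 q y)\<^sup>2) * ennreal (min 1 ((x - y)\<^sup>2) * j \<bar>x - y\<bar>)) \<partial>lebesgue) \<partial>lebesgue)
        = ennreal (2 * (C + 1)) * (\<integral>\<^sup>+x. (\<integral>\<^sup>+y. ennreal ((rep_L2 q y)\<^sup>2) * ennreal (min 1 ((x - y)\<^sup>2) * j \<bar>x - y\<bar>) \<partial>lebesgue) \<partial>lebesgue)"
      by (subst nn_integral_cmult[symmetric]) (auto intro!: nn_integral_cong nn_integral_cmult)
    also have "(\<integral>\<^sup>+x. (\<integral>\<^sup>+y. ennreal ((rep_L2 q y)\<^sup>2) * ennreal (min 1 ((x - y)\<^sup>2) * j \<bar>x - y\<bar>) \<partial>lebesgue) \<partial>lebesgue)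
        = ennreal ((norm q)\<^sup>2) * \<Lambda>"
      unfolding \<Lambda>_def norm_L2_eq_nn_integral
      using nn_integral_conv_right[of "\<lambda>y. ennreal ((rep_L2 q y)\<^sup>2)" "\<lambda>z. ennreal (min 1 (z\<^sup>2) * j \<bar>z\<bar>)"] by simp
    finally show ?thesis by (simp add: v_def D_def energy_class[OF k sq])
  qed
  have vf: "v n \<in> finite_energy j" for n using energy_v[of n] D by (auto simp: finite_energy_def intro: le_less_trans)
  have rv: "AE x in lebesgue. rep_L2 (v n) x = f n x" for n unfolding v_def by (rule rep_class_L2[OF sq])
  have orth: "jump_form (J j) q (v n) + inner q (v n) = 0" for n
  proof (rule orthogonal_compact_support[OF j q vf])
    show "AE x in lebesgue. 2 * real (Suc n) < \<bar>x\<bar> \<longrightarrow> rep_L2 (v n) x = 0"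
      using rv[of n] by eventually_elim (simp add: f_def cutoff_eq_0 del: of_nat_Suc)
  qed
  have lim: "v \<longlonglongrightarrow> q"
  proof -
    have "(\<lambda>n. \<integral>\<^sup>+x. ennreal ((f n x - rep_L2 q x)\<^sup>2) \<partial>lebesgue) \<longlonglongrightarrow> (\<integral>\<^sup>+x. 0 \<partial>(lebesgue::real measure))"
    proof (rule nn_integral_dominated_convergence[where w = "\<lambda>x. ennreal ((rep_L2 q x)\<^sup>2)"])
      show "AE x in lebesgue. ennreal ((f n x - rep_L2 q x)\<^sup>2) \<le> ennreal ((rep_L2 q x)\<^sup>2)" for n
      proof (intro AE_I2 ennreal_leI)
        fix x
        have "f n x - rep_L2 q x = - ((1 - cutoff (real (Suc n)) x) * rep_L2 q x)" by (simp add: f_def algebra_simps)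
        then have "\<bar>f n x - rep_L2 q x\<bar> = (1 - cutoff (real (Suc n)) x) * \<bar>rep_L2 q x\<bar>"
          using cutoff_range[of "real (Suc n)" x] by (simp add: abs_mult)
        also have "\<dots> \<le> \<bar>rep_L2 q x\<bar>" using cutoff_range[of "real (Suc n)" x] by (intro mult_left_le_one_le) auto
        finally show "(f n x - rep_L2 q x)\<^sup>2 \<le> (rep_L2 q x)\<^sup>2" by (simp add: abs_le_square_iff)
      qed
      show "(\<integral>\<^sup>+x. ennreal ((rep_L2 q x)\<^sup>2) \<partial>lebesgue) < \<infinity>"
        unfolding norm_L2_eq_nn_integral[symmetric] by simp
      show "AE x in lebesgue. (\<lambda>n. ennreal ((f n x - rep_L2 q x)\<^sup>2)) \<longlonglongrightarrow> 0"
      proof (intro AE_I2 tendsto_eventually)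
        fix x :: real
        obtain N where "\<bar>x\<bar> \<le> real N" using real_arch_simple by blast
        then show "\<forall>\<^sub>F n in sequentially. ennreal ((f n x - rep_L2 q x)\<^sup>2) = 0"
          by (intro eventually_sequentiallyI[of N]) (simp add: f_def cutoff_eq_1)
      qed
    qed auto
    moreover have "(\<integral>\<^sup>+x. ennreal ((f n x - rep_L2 q x)\<^sup>2) \<partial>lebesgue) = ennreal ((norm (v n - q))\<^sup>2)" for n
      using norm_diff_class_L2[OF sq[of n] square_integrable_rep_L2[of q]] by (simp add: v_def class_rep_L2)
    ultimately have "(\<lambda>n. ennreal ((norm (v n - q))\<^sup>2)) \<longlonglongrightarrow> ennreal 0" by simp
    then have "(\<lambda>n. (norm (v n - q))\<^sup>2) \<longlonglongrightarrow> 0" by (subst (asm) tendsto_ennreal_iff) auto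
    then have "(\<lambda>n. sqrt ((norm (v n - q))\<^sup>2)) \<longlonglongrightarrow> sqrt 0" by (intro tendsto_intros)
    then show ?thesis by (simp add: tendsto_norm_zero_iff LIM_zero_iff)
  qed
  obtain M where M: "D = ennreal (2 * M)" "0 \<le> M"
  proof -
    obtain r where "D = ennreal r" "0 \<le> r" using D by (cases D) auto
    then show thesis using that[of "r / 2"] by simp
  qed
  have "jump_form (J j) q q + inner q q = 0"
    by (rule orthogonal_limit(2)[OF k q(1) vf lim _ M(2) orth]) (use energy_v M(1) in simp)
  then have "inner q q \<le> 0" using jump_energy_jump_form(2)[OF k q(1)] by linarith
  then have "inner q q = 0" using inner_ge_zero by (rule antisym)
  then show ?thesis by simp
qed

text \<open>Projection for E_1: the residual is E_1-orthogonal to the Lipschitz functions, hence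
  0.\<close>

lemma lip_L2_approx:
  assumes j: "levy j" and u: "u \<in> finite_energy j"
  obtains X where "\<And>k::nat. X k \<in> lip_L2"
    "(\<lambda>k. jump_form (J j) (X k - u) (X k - u) + inner (X k - u) (X k - u)) \<longlonglongrightarrow> 0"
proof -
  note k = levy_kernel[OF j]
  let ?Q = "\<lambda>u v. jump_form (J j) u v + inner u v"
  interpret Q: semi_inner "finite_energy j" ?Q by (rule semi_inner_E1[OF k])
  obtain p X where p: "p \<in> finite_energy j" "\<And>k::nat. X k \<in> lip_L2" "(\<lambda>k. ?Q (X k - p) (X k - p)) \<longlonglongrightarrow> 0"
    "\<And>w. w \<in> lip_L2 \<Longrightarrow> ?Q p w = ?Q u w"
  proof (rule Q.projection[where W = lip_L2 and l = "?Q u" and M = "?Q u u"])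
    show "\<exists>u\<in>finite_energy j. (\<lambda>k. ?Q (X k - u) (X k - u)) \<longlonglongrightarrow> 0"
      if "\<forall>k::nat. X k \<in> finite_energy j" "\<forall>e>0. \<exists>N. \<forall>j\<ge>N. \<forall>k\<ge>N. ?Q (X j - X k) (X j - X k) < e" for X
    proof -
      have "\<forall>X. (\<forall>k::nat. X k \<in> finite_energy j) \<longrightarrow>
          (\<forall>e>0. \<exists>N. \<forall>j\<ge>N. \<forall>k\<ge>N. ?Q (X j - X k) (X j - X k) < e) \<longrightarrow>
          (\<exists>u\<in>finite_energy j. (\<lambda>k. ?Q (X k - u) (X k - u)) \<longlonglongrightarrow> 0)"
        using closed_form_finite_energy[OF k] unfolding closed_form_def by (elim conjE)
      from mp[OF mp[OF spec[OF this] that(1)] that(2)] show ?thesis .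
    qed
    show "(?Q u w)\<^sup>2 \<le> ?Q u u * ?Q w w" if "w \<in> lip_L2" for w
      using that lip_L2_subset[OF j] by (intro Q.Cauchy_Schwarz u) auto
  qed (use lip_L2_subset[OF j] subspace_lip_L2 u Q.add_right Q.scale_right Q.nonneg in \<open>auto simp: subset_iff\<close>)
  have "u - p = 0"
  proof (rule orthogonal_lip_L2_imp_0[OF j])
    show "u - p \<in> finite_energy j" using u p(1) by auto
    show "?Q (u - p) w = 0" if "w \<in> lip_L2" for w
      using Q.diff_left[OF u p(1), of w] p(4)[OF that] that lip_L2_subset[OF j] by auto
  qed
  then show thesis using that[of X] p(2,3) by simp
qed

lemma jump_domain_eq:
  assumes j: "levy j"
  shows "jump_domain (J j) = finite_energy j"
proof (intro set_eqI iffI)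
  note k = levy_kernel[OF j]
  fix u assume "u \<in> jump_domain (J j)"
  then have "1/2 * energy j (rep_L2 u) < \<infinity>" by (simp add: jump_domain_def jump_energy_eq)
  then show "u \<in> finite_energy j" by (auto simp: finite_energy_def ennreal_mult_less_top ennreal_divide_eq_0_iff)
next
  note k = levy_kernel[OF j]
  interpret Q: semi_inner "finite_energy j" "jump_form (J j)" by (rule semi_inner_jump_form[OF k])
  fix u assume u: "u \<in> finite_energy j"
  obtain X where X: "\<And>k::nat. X k \<in> lip_L2"
    "(\<lambda>k. jump_form (J j) (X k - u) (X k - u) + inner (X k - u) (X k - u)) \<longlonglongrightarrow> 0"
    by (rule lip_L2_approx[OF j u]) blast
  obtain \<phi> where \<phi>: "\<And>k. \<phi> k \<in> lip_compact" "\<And>k. X k = class_L2 (\<phi> k)"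
    using X(1) unfolding lip_L2_def image_iff Bex_def by metis
  have Xf: "X n \<in> finite_energy j" for n using X(1) lip_L2_subset[OF j] by auto
  have "jump_energy (J j) (u - class_L2 (\<phi> n)) + ennreal ((norm (u - class_L2 (\<phi> n)))\<^sup>2)
      = ennreal (jump_form (J j) (X n - u) (X n - u) + inner (X n - u) (X n - u))" for n
  proof -
    have uX: "u - X n \<in> finite_energy j" "X n - u \<in> finite_energy j" using u Xf by auto
    have "jump_form (J j) (u - X n) (u - X n) = jump_form (J j) (X n - u) (X n - u)"
      using Q.quad_diff[OF u Xf] Q.quad_diff[OF Xf u] Q.sym[OF u Xf] by simp
    moreover have "(norm (u - X n))\<^sup>2 = inner (X n - u) (X n - u)"
      by (metis norm_minus_commute power2_norm_eq_inner)
    ultimately show ?thesis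
      using jump_energy_jump_form(1,2)[OF k uX(1)] by (simp add: \<phi>(2)[symmetric] ennreal_plus[symmetric] del: ennreal_plus)
  qed
  then have "(\<lambda>n. jump_energy (J j) (u - class_L2 (\<phi> n)) + ennreal ((norm (u - class_L2 (\<phi> n)))\<^sup>2)) \<longlonglongrightarrow> ennreal 0"
    using tendsto_ennrealI[OF X(2)] by simp
  then show "u \<in> jump_domain (J j)"
    using \<phi>(1) jump_energy_jump_form(1)[OF k u] by (auto simp: jump_domain_def)
qed

lemma dirichlet_jump_form:
  assumes j: "levy j"
  shows "dirichlet_form (jump_form (J j)) (jump_domain (J j))"
  unfolding dirichlet_form_def jump_domain_eq[OF j]
proof (intro conjI ballI)
  note k = levy_kernel[OF j]
  show "closed_form (jump_form (J j)) (finite_energy j)" by (rule closed_form_finite_energy[OF k])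
  show "closure (finite_energy j) = UNIV"
    using closure_mono[OF lip_L2_subset[OF j]] lip_L2_dense by auto
  fix u assume "u \<in> finite_energy j"
  then show "clip_L2 u \<in> finite_energy j" "jump_form (J j) (clip_L2 u) (clip_L2 u) \<le> jump_form (J j) u u"
    by (rule clip_finite_energy[OF k])+
qed

end

section \<open>Mosco convergence of jump forms\<close>

text \<open>Diagonal extraction. For each n one takes the finest accuracy 1/k with k \<le> n that is
  already achieved by some vector at index n; this accuracy improves without bound.\<close>

lemma recovery_sequence:
  fixes \<Phi> :: "nat \<Rightarrow> 'a::metric_space \<Rightarrow> ereal"
  assumes ex: "\<And>e. 0 < e \<Longrightarrow> \<exists>v. dist v u < e \<and> (\<forall>\<^sub>F n in sequentially. \<Phi> n v \<le> ereal (r + e))"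
  shows "\<exists>un. un \<longlonglongrightarrow> u \<and> limsup (\<lambda>n. \<Phi> n (un n)) \<le> ereal r"
proof -
  define P where "P n k v \<longleftrightarrow> dist v u < 1 / real k \<and> \<Phi> n v \<le> ereal (r + 1 / real k)" for n k v
  define K where "K n = Max {k. k \<le> n \<and> (k = 0 \<or> (\<exists>v. P n k v))}" for n
  define un where "un n = (SOME v. P n (K n) v)" for n
  have K: "K n \<in> {k. k \<le> n \<and> (k = 0 \<or> (\<exists>v. P n k v))}" for n
    unfolding K_def by (rule Max_in) (auto intro: finite_subset[of _ "{..n}"])
  have P: "P n (K n) (un n)" if "K n \<noteq> 0" for n
    unfolding un_def using K[of n] that by (auto intro: someI_ex)
  have ev: "\<forall>\<^sub>F n in sequentially. k \<le> K n" if "0 < k" for k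
  proof -
    obtain v where v: "dist v u < 1 / real k" "\<forall>\<^sub>F n in sequentially. \<Phi> n v \<le> ereal (r + 1 / real k)"
      using ex[of "1 / real k"] \<open>0 < k\<close> by auto
    from v(2) eventually_ge_at_top[of k] show ?thesis
    proof eventually_elim
      case (elim n)
      then have "P n k v" using v(1) by (simp add: P_def)
      then show ?case unfolding K_def
        using elim by (intro Max_ge) (auto intro: finite_subset[of _ "{..n}"])
    qed
  qed
  have main: "\<forall>\<^sub>F n in sequentially. dist (un n) u < e \<and> \<Phi> n (un n) \<le> ereal (r + e)" if e: "0 < e" for e
  proof -
    obtain k where k: "1 / e < real k" using reals_Archimedean2 by blast
    then have k0: "0 < k" using e by (cases k) (auto simp: field_simps)
    have ke: "1 / real k < e" using k k0 e by (simp add: field_simps)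
    from ev[OF k0] show ?thesis
    proof eventually_elim
      case (elim n)
      have p: "P n (K n) (un n)" using P[of n] elim k0 by simp
      have "1 / real (K n) \<le> 1 / real k" using elim k0 by (simp add: frac_le)
      then have le: "1 / real (K n) \<le> e" using ke by simp
      have "\<Phi> n (un n) \<le> ereal (r + 1 / real (K n))" using p by (simp add: P_def)
      also have "\<dots> \<le> ereal (r + e)" using le by simp
      finally show ?case using p le by (auto simp: P_def)
    qed
  qed
  have "un \<longlonglongrightarrow> u"
  proof (rule tendstoI)
    fix e :: real assume "0 < e"
    from main[OF this] show "\<forall>\<^sub>F n in sequentially. dist (un n) u < e" by eventually_elim simp
  qed
  moreover have "limsup (\<lambda>n. \<Phi> n (un n)) \<le> ereal r"
  proof (rule ereal_le_epsilon2)
    fix e :: real assume "0 < e"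
    from main[OF this] have "\<forall>\<^sub>F n in sequentially. \<Phi> n (un n) \<le> ereal (r + e)" by (auto elim: eventually_mono)
    then show "limsup (\<lambda>n. \<Phi> n (un n)) \<le> ereal r + ereal e" by (simp add: Limsup_bounded)
  qed
  ultimately show ?thesis by blast
qed

text \<open>Energies live in \<open>ennreal\<close>, Mosco convergence in \<open>ereal\<close>.
  Negative levels are treated apart because \<open>e2ennreal\<close> truncates them to 0.\<close>

lemma enn2ereal_le_liminf:
  assumes "a \<le> liminf b"
  shows "enn2ereal a \<le> liminf (\<lambda>n. enn2ereal (b n))"
  unfolding le_Liminf_iff
proof (intro allI impI)
  fix y assume y: "y < enn2ereal a"
  show "\<forall>\<^sub>F n in sequentially. y < enn2ereal (b n)"
  proof (cases "y < 0")
    case True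
    then show ?thesis by (auto intro!: always_eventually intro: less_le_trans)
  next
    case False
    then have e: "enn2ereal (e2ennreal y) = y" by (simp add: enn2ereal_e2ennreal)
    then have "e2ennreal y < a" using y by (simp add: less_ennreal.rep_eq)
    then have "\<forall>\<^sub>F n in sequentially. e2ennreal y < b n" using assms unfolding le_Liminf_iff by blast
    then show ?thesis by eventually_elim (simp add: less_ennreal.rep_eq e)
  qed
qed

context coefficient
begin

lemma jump_kernel_half: "jump_kernel j \<Longrightarrow> jump_kernel (\<lambda>z. j z / 2)"
  unfolding jump_kernel_def by auto

text \<open>The factor 1/2 of the form is absorbed into the kernel, so that lower semicontinuity of
  \<open>energy\<close> applies to \<open>jump_energy\<close> as it stands.\<close>

lemma jump_energy_half:
  assumes k [measurable]: "jump_kernel j"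
  shows "jump_energy (J j) u = energy (\<lambda>z. j z / 2) (rep_L2 u)"
proof -
  have half: "1/2 = ennreal (1/2)"
    by (metis divide_ennreal ennreal_1 ennreal_numeral zero_le_numeral zero_le_one zero_less_numeral)
  show ?thesis
    unfolding jump_energy_eq energy_def half
    by (subst nn_integral_cmult[symmetric], measurable)
      (intro nn_integral_cong, simp add: J_def ennreal_mult'[symmetric] del: ennreal_half)
qed

lemma form_ext_eq:
  assumes j: "levy j"
  shows "form_ext (jump_form (J j)) (jump_domain (J j)) u = enn2ereal (jump_energy (J j) u)"
proof (cases "u \<in> finite_energy j")
  case True
  then show ?thesis
    using jump_energy_jump_form(1,2)[OF levy_kernel[OF j] True]
    by (simp add: form_ext_def jump_domain_eq[OF j] enn2ereal_ennreal)
next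
  case False
  then have "energy j (rep_L2 u) = top" by (simp add: finite_energy_def not_less top_unique)
  then have "jump_energy (J j) u = top" by (simp add: jump_energy_eq ennreal_mult_top ennreal_divide_eq_0_iff)
  then show ?thesis using False by (simp add: form_ext_def jump_domain_eq[OF j])
qed

lemma energy_lip_tendsto:
  assumes k: "\<And>n. jump_kernel (jn n)" "jump_kernel j" and H: "levy H"
    and le: "\<And>n z. 0 < z \<Longrightarrow> jn n z \<le> H z" and lim: "\<And>z. 0 < z \<Longrightarrow> (\<lambda>n. jn n z) \<longlonglongrightarrow> j z"
    and \<phi>: "\<phi> \<in> lip_compact"
  shows "(\<lambda>n. energy (jn n) \<phi>) \<longlonglongrightarrow> energy j \<phi>"
proof -
  obtain B R where B: "0 \<le> B" "0 \<le> R"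
    "\<And>x y. (\<phi> x - \<phi> y)\<^sup>2 \<le> B * min 1 ((x - y)\<^sup>2) * (indicator {- R..R} x + indicator {- R..R} y)"
    by (rule lip_compact_diff_bound[OF \<phi>]) blast
  note kH = levy_kernel[OF H]
  have [measurable]: "H \<in> borel_measurable borel" using kH by (rule kernel_measurable)
  have [measurable]: "\<phi> \<in> borel_measurable lebesgue" using borel_imp_lebesgue_measurable[OF lip_compact_measurable[OF \<phi>]] .
  have fm [measurable]: "(\<lambda>\<omega>. \<phi> (fst \<omega>)) \<in> borel_measurable (lebesgue \<Otimes>\<^sub>M (lebesgue :: real measure))"
    by (rule measurable_compose[OF measurable_fst]) measurable
  have fm' [measurable]: "(\<lambda>\<omega>. \<phi> (snd \<omega>)) \<in> borel_measurable ((lebesgue :: real measure) \<Otimes>\<^sub>M lebesgue)"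
    by (rule measurable_compose[OF measurable_snd]) measurable
  \<comment> \<open>The bound of \<open>lip_compact_diff_bound\<close> times the majorant kernel;
    \<open>pair_bound\<close> computes its integral from the Levy integral of
    \<open>H\<close>.\<close>
  define w where "w \<omega> = ennreal ((C + 1) * B) * ((indicator {- R..R} (fst \<omega>) + indicator {- R..R} (snd \<omega>))
      * ennreal (min 1 ((fst \<omega> - snd \<omega>)\<^sup>2) * H \<bar>fst \<omega> - snd \<omega>\<bar>))" for \<omega> :: "real \<times> real"
  have wm: "w \<in> borel_measurable (lebesgue \<Otimes>\<^sub>M lebesgue)" unfolding w_def[abs_def] by measurable
  show ?thesis
    unfolding energy_def
  proof (rule nn_integral_dominated_convergence[where w = w, OF _ _ wm])
    show "(\<lambda>\<omega>. ennreal ((\<phi> (fst \<omega>) - \<phi> (snd \<omega>))\<^sup>2 * J (jn n) (fst \<omega>) (snd \<omega>))) \<in> borel_measurable (lebesgue \<Otimes>\<^sub>M lebesgue)" for n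
      using J_measurable(1)[OF k(1)[of n]] by measurable
    show "(\<lambda>\<omega>. ennreal ((\<phi> (fst \<omega>) - \<phi> (snd \<omega>))\<^sup>2 * J j (fst \<omega>) (snd \<omega>))) \<in> borel_measurable (lebesgue \<Otimes>\<^sub>M lebesgue)"
      using J_measurable(1)[OF k(2)] by measurable
    show "AE \<omega> in lebesgue \<Otimes>\<^sub>M lebesgue. ennreal ((\<phi> (fst \<omega>) - \<phi> (snd \<omega>))\<^sup>2 * J (jn n) (fst \<omega>) (snd \<omega>)) \<le> w \<omega>" for n
    proof (intro AE_I2)
      fix \<omega> :: "real \<times> real"
      obtain x y where \<omega>: "\<omega> = (x, y)" by (cases \<omega>)
      show "ennreal ((\<phi> (fst \<omega>) - \<phi> (snd \<omega>))\<^sup>2 * J (jn n) (fst \<omega>) (snd \<omega>)) \<le> w \<omega>"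
      proof (cases "x = y")
        case False
        let ?i = "indicator {- R..R} x + indicator {- R..R} y :: real"
        have h: "0 \<le> H \<bar>x - y\<bar>" by (rule kernel_nonneg[OF kH])
        have "J (jn n) x y \<le> (C + 1) * jn n \<bar>x - y\<bar>" by (rule J_le[OF k(1)])
        also have "\<dots> \<le> (C + 1) * H \<bar>x - y\<bar>" using C_nonneg False by (intro mult_left_mono le) auto
        finally have "(\<phi> x - \<phi> y)\<^sup>2 * J (jn n) x y \<le> B * min 1 ((x - y)\<^sup>2) * ?i * ((C + 1) * H \<bar>x - y\<bar>)"
          using B J_nonneg[OF k(1)] by (intro mult_mono) (auto intro!: mult_nonneg_nonneg add_nonneg_nonneg)
        then have "ennreal ((\<phi> x - \<phi> y)\<^sup>2 * J (jn n) x y) \<le> ennreal ((C + 1) * B * (?i * (min 1 ((x - y)\<^sup>2) * H \<bar>x - y\<bar>)))"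
          by (intro ennreal_leI) (simp add: mult_ac)
        also have "\<dots> = ennreal ((C + 1) * B) * (ennreal ?i * ennreal (min 1 ((x - y)\<^sup>2) * H \<bar>x - y\<bar>))"
          using C_nonneg B h by (subst ennreal_mult, simp, simp, subst ennreal_mult) auto
        also have "ennreal ?i = indicator {- R..R} x + indicator {- R..R} y"
          by (auto simp: indicator_def)
        finally show ?thesis by (simp add: \<omega> w_def)
      qed (simp add: \<omega>)
    qed
    have "(\<integral>\<^sup>+\<omega>. w \<omega> \<partial>(lebesgue \<Otimes>\<^sub>M lebesgue)) = ennreal ((C + 1) * B) *
        (\<integral>\<^sup>+\<omega>. (indicator {- R..R} (fst \<omega>) + indicator {- R..R} (snd \<omega>))
          * ennreal (min 1 ((fst \<omega> - snd \<omega>)\<^sup>2) * H \<bar>fst \<omega> - snd \<omega>\<bar>) \<partial>(lebesgue \<Otimes>\<^sub>M lebesgue))"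
      unfolding w_def by (rule nn_integral_cmult) measurable
    also have "(\<integral>\<^sup>+\<omega>. (indicator {- R..R} (fst \<omega>) + indicator {- R..R} (snd \<omega>))
          * ennreal (min 1 ((fst \<omega> - snd \<omega>)\<^sup>2) * H \<bar>fst \<omega> - snd \<omega>\<bar>) \<partial>(lebesgue \<Otimes>\<^sub>M lebesgue))
        = (\<integral>\<^sup>+x. \<integral>\<^sup>+y. (indicator {- R..R} x + indicator {- R..R} y) * ennreal (min 1 ((x - y)\<^sup>2) * H \<bar>x - y\<bar>) \<partial>lebesgue \<partial>lebesgue)"
      by (subst lebesgue.nn_integral_fst[symmetric]) simp_all
    also have "\<dots> = ennreal (4 * R) * (\<integral>\<^sup>+z. ennreal (min 1 (z\<^sup>2) * H \<bar>z\<bar>) \<partial>lborel)"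
      by (rule pair_bound[of "\<lambda>z. ennreal (min 1 (z\<^sup>2) * H \<bar>z\<bar>)", OF _ B(2)]) measurable
    also have "ennreal ((C + 1) * B) * \<dots> < \<infinity>"
      using H by (simp add: levy_def ennreal_mult_less_top)
    finally show "(\<integral>\<^sup>+\<omega>. w \<omega> \<partial>(lebesgue \<Otimes>\<^sub>M lebesgue)) < \<infinity>" .
    show "AE \<omega> in lebesgue \<Otimes>\<^sub>M lebesgue. (\<lambda>n. ennreal ((\<phi> (fst \<omega>) - \<phi> (snd \<omega>))\<^sup>2 * J (jn n) (fst \<omega>) (snd \<omega>)))
        \<longlonglongrightarrow> ennreal ((\<phi> (fst \<omega>) - \<phi> (snd \<omega>))\<^sup>2 * J j (fst \<omega>) (snd \<omega>))"
    proof (intro AE_I2 tendsto_ennrealI)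
      fix \<omega> :: "real \<times> real"
      show "(\<lambda>n. (\<phi> (fst \<omega>) - \<phi> (snd \<omega>))\<^sup>2 * J (jn n) (fst \<omega>) (snd \<omega>)) \<longlonglongrightarrow> (\<phi> (fst \<omega>) - \<phi> (snd \<omega>))\<^sup>2 * J j (fst \<omega>) (snd \<omega>)"
        by (cases "fst \<omega> = snd \<omega>") (auto simp: J_def intro!: tendsto_intros lim)
    qed
  qed
qed

theorem mosco_jump_forms:
  assumes Jn: "\<And>n. N \<le> n \<Longrightarrow> Jn n = J (jn n)"
    and jn: "\<And>n. N \<le> n \<Longrightarrow> levy (jn n)" and j: "levy j" and H: "levy H"
    and le: "\<And>n z. N \<le> n \<Longrightarrow> 0 < z \<Longrightarrow> jn n z \<le> H z" "\<And>z. 0 < z \<Longrightarrow> j z \<le> H z"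
    and lim: "\<And>z. 0 < z \<Longrightarrow> (\<lambda>n. jn n z) \<longlonglongrightarrow> j z"
  shows "mosco_converges (\<lambda>n. jump_form (Jn n)) (\<lambda>n. jump_domain (Jn n)) (jump_form (J j)) (jump_domain (J j))"
proof -
  note k = levy_kernel[OF j]
  \<comment> \<open>Below \<open>N\<close> nothing is known about \<open>jn n\<close>; replacing it
    by \<open>j\<close> gives Levy kernels at all indices without changing any limit.\<close>
  define j' where "j' n = (if N \<le> n then jn n else j)" for n
  have j': "levy (j' n)" for n using jn j by (simp add: j'_def)
  note k' = levy_kernel[OF j']
  have lim': "(\<lambda>n. j' n z) \<longlonglongrightarrow> j z" if "0 < z" for z
    by (rule Lim_transform_eventually[OF lim[OF that]])
      (auto simp: j'_def intro: eventually_sequentiallyI[of N])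
  have le': "j' n z \<le> H z" if "0 < z" for n z using le that by (simp add: j'_def)
  define \<Phi> where "\<Phi> n u = form_ext (jump_form (Jn n)) (jump_domain (Jn n)) u" for n u
  have \<Phi>: "\<Phi> n u = enn2ereal (jump_energy (J (j' n)) u)" if "N \<le> n" for n u
    using form_ext_eq[OF j'[of n], of u] that by (simp add: \<Phi>_def Jn j'_def)
  have ev: "\<forall>\<^sub>F n in sequentially. enn2ereal (jump_energy (J (j' n)) (un n)) = \<Phi> n (un n)" for un
    using \<Phi> by (intro eventually_sequentiallyI[of N]) auto
  show ?thesis
    unfolding mosco_converges_def
  proof (intro conjI allI impI)
    show "\<forall>\<^sub>F n in sequentially. closed_form (jump_form (Jn n)) (jump_domain (Jn n))"
      using closed_form_finite_energy[OF levy_kernel[OF jn]]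
      by (intro eventually_sequentiallyI[of N]) (simp add: Jn jump_domain_eq[OF jn])
    show "closed_form (jump_form (J j)) (jump_domain (J j))"
      using closed_form_finite_energy[OF k] by (simp add: jump_domain_eq[OF j])
  next
    fix u :: L2 and un assume w: "weakly_tendsto un u"
    have "energy (\<lambda>z. j z / 2) (rep_L2 u) \<le> liminf (\<lambda>n. energy (\<lambda>z. j' n z / 2) (rep_L2 (un n)))"
      by (rule energy_lsc[OF jump_kernel_half[OF k'] jump_kernel_half[OF k] _ w]) (intro tendsto_intros lim', auto)
    then have "jump_energy (J j) u \<le> liminf (\<lambda>n. jump_energy (J (j' n)) (un n))"
      by (simp only: jump_energy_half[OF k] jump_energy_half[OF k'])
    then have "enn2ereal (jump_energy (J j) u) \<le> liminf (\<lambda>n. enn2ereal (jump_energy (J (j' n)) (un n)))"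
      by (rule enn2ereal_le_liminf)
    also have "\<dots> = liminf (\<lambda>n. \<Phi> n (un n))" by (rule Liminf_eq[OF ev])
    finally show "form_ext (jump_form (J j)) (jump_domain (J j)) u
        \<le> liminf (\<lambda>n. form_ext (jump_form (Jn n)) (jump_domain (Jn n)) (un n))"
      by (simp add: form_ext_eq[OF j] \<Phi>_def)
  next
    fix u :: L2
    show "\<exists>un. un \<longlonglongrightarrow> u \<and> limsup (\<lambda>n. form_ext (jump_form (Jn n)) (jump_domain (Jn n)) (un n))
        \<le> form_ext (jump_form (J j)) (jump_domain (J j)) u"
    proof (cases "u \<in> finite_energy j")
      case False
      then show ?thesis by (intro exI[of _ "\<lambda>n. u"]) (simp add: form_ext_def jump_domain_eq[OF j])
    next
      case u: True
      interpret Q: semi_inner "finite_energy j" "jump_form (J j)" by (rule semi_inner_jump_form[OF k])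
      let ?Q = "jump_form (J j)"
      \<comment> \<open>A Lipschitz function near \<open>u\<close> in L^2 and in energy; at a fixed
        such function the energies of the approximating forms converge.\<close>
      have "\<exists>v. dist v u < e \<and> (\<forall>\<^sub>F n in sequentially. \<Phi> n v \<le> ereal (?Q u u + e))" if e: "0 < e" for e
      proof -
        obtain X where X: "\<And>k::nat. X k \<in> lip_L2"
          "(\<lambda>k. ?Q (X k - u) (X k - u) + inner (X k - u) (X k - u)) \<longlonglongrightarrow> 0"
          by (rule lip_L2_approx[OF j u]) blast
        have Xf: "X n \<in> finite_energy j" for n using X(1) lip_L2_subset[OF j] by auto
        have Xu: "X n - u \<in> finite_energy j" for n using Xf u by auto
        have q0: "(\<lambda>k. ?Q (X k - u) (X k - u)) \<longlonglongrightarrow> 0"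
          by (rule Lim_null_comparison[OF _ X(2)]) (simp add: Q.nonneg[OF Xu])
        have "(\<lambda>k. inner (X k - u) (X k - u)) \<longlonglongrightarrow> 0"
          by (rule Lim_null_comparison[OF _ X(2)]) (simp add: Q.nonneg[OF Xu])
        then have "(\<lambda>k. sqrt (inner (X k - u) (X k - u))) \<longlonglongrightarrow> sqrt 0" by (intro tendsto_intros)
        then have "(\<lambda>k. dist (X k) u) \<longlonglongrightarrow> 0" by (simp add: dist_norm norm_eq_sqrt_inner)
        then have e1: "\<forall>\<^sub>F k in sequentially. dist (X k) u < e" by (rule order_tendstoD(2)) (rule e)
        have "(\<lambda>k. ?Q (X k) u) \<longlonglongrightarrow> ?Q u u" by (rule Q.tendsto_left[OF Xf u u q0])
        then have "(\<lambda>k. ?Q (X k - u) (X k - u) + 2 * ?Q (X k) u - ?Q u u) \<longlonglongrightarrow> 0 + 2 * ?Q u u - ?Q u u"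
          by (intro tendsto_intros q0)
        then have "(\<lambda>k. ?Q (X k) (X k)) \<longlonglongrightarrow> ?Q u u" by (simp add: Q.quad_diff[OF Xf u])
        then have e2: "\<forall>\<^sub>F k in sequentially. ?Q (X k) (X k) < ?Q u u + e" by (rule order_tendstoD(2)) (use e in simp)
        obtain n where n: "dist (X n) u < e" "?Q (X n) (X n) < ?Q u u + e"
          using eventually_happens'[OF sequentially_bot eventually_conj[OF e1 e2]] by blast
        obtain \<phi> where \<phi>: "\<phi> \<in> lip_compact" "X n = class_L2 \<phi>" using X(1)[of n] by (auto simp: lip_L2_def)
        have "(\<lambda>n. energy (j' n) \<phi>) \<longlonglongrightarrow> energy j \<phi>"
          by (rule energy_lip_tendsto[OF k' k H le' lim' \<phi>(1)])
        then have "(\<lambda>m. energy (j' m) (rep_L2 (X n))) \<longlonglongrightarrow> energy j (rep_L2 (X n))"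
          by (simp add: \<phi>(2) energy_class[OF k' lip_compact_square_integrable[OF \<phi>(1)]]
              energy_class[OF k lip_compact_square_integrable[OF \<phi>(1)]])
        moreover have "energy j (rep_L2 (X n)) < ennreal (2 * (?Q u u + e))"
          unfolding jump_energy_jump_form(3)[OF k Xf] using n(2) Q.nonneg[OF u] e by (intro ennreal_lessI) auto
        ultimately have "\<forall>\<^sub>F m in sequentially. energy (j' m) (rep_L2 (X n)) < ennreal (2 * (?Q u u + e))"
          by (rule order_tendstoD(2))
        then have "\<forall>\<^sub>F m in sequentially. \<Phi> m (X n) \<le> ereal (?Q u u + e)"
          using eventually_ge_at_top[of N]
        proof eventually_elim
          case (elim m)
          have fe: "X n \<in> finite_energy (j' m)"
            using elim(1) by (auto simp: finite_energy_def intro: less_trans)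
          have "2 * jump_form (J (j' m)) (X n) (X n) < 2 * (?Q u u + e)"
            using elim(1) unfolding jump_energy_jump_form(3)[OF k' fe]
            using jump_energy_jump_form(2)[OF k' fe] by (subst (asm) ennreal_less_iff) auto
          then show ?case
            using jump_energy_jump_form(1,2)[OF k' fe] by (simp add: \<Phi>[OF elim(2)] enn2ereal_ennreal)
        qed
        then show ?thesis using n(1) by blast
      qed
      from recovery_sequence[OF this] show ?thesis
        using u by (simp add: form_ext_def[of "jump_form (J j)"] jump_domain_eq[OF j] \<Phi>_def)
    qed
  qed
qed

end

section \<open>Recurrence and transience of jump forms\<close>

lemma nn_integral_inverse_square_tail:
  assumes R: "0 < R"
  shows "(\<integral>\<^sup>+z. ennreal (1 / z\<^sup>2) * indicator {z. R \<le> \<bar>z\<bar>} z \<partial>lborel) \<le> ennreal (2 / R)"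
proof -
  have pos: "(\<integral>\<^sup>+z. ennreal (1 / z\<^sup>2) * indicator {R..} z \<partial>lborel) = ennreal (1 / R)"
  proof -
    have "(\<integral>\<^sup>+z. ennreal (1 / z\<^sup>2) * indicator {R..} z \<partial>lborel) = ennreal (0 - - inverse R)"
    proof (rule nn_integral_FTC_atLeast)
      show "DERIV (\<lambda>z. - inverse z) z :> 1 / z\<^sup>2" if "R \<le> z" for z
        using that R by (auto intro!: derivative_eq_intros simp: power2_eq_square divide_inverse)
      show "((\<lambda>z::real. - inverse z) \<longlongrightarrow> 0) at_top"
        using tendsto_minus[OF tendsto_inverse_0_at_top[OF filterlim_ident[of "at_top :: real filter"]]] by simp
    qed auto
    then show ?thesis by (simp add: inverse_eq_divide)
  qed
  have "(\<integral>\<^sup>+z. ennreal (1 / z\<^sup>2) * indicator {z. R \<le> \<bar>z\<bar>} z \<partial>lborel)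
      \<le> (\<integral>\<^sup>+z. ennreal (1 / z\<^sup>2) * indicator {R..} z + ennreal (1 / (- z)\<^sup>2) * indicator {R..} (- z) \<partial>lborel)"
    by (intro nn_integral_mono) (auto simp: indicator_def)
  also have "\<dots> = (\<integral>\<^sup>+z. ennreal (1 / z\<^sup>2) * indicator {R..} z \<partial>lborel)
      + (\<integral>\<^sup>+z. ennreal (1 / (- z)\<^sup>2) * indicator {R..} (- z) \<partial>lborel)"
    by (rule nn_integral_add) measurable
  also have "(\<integral>\<^sup>+z. ennreal (1 / (- z)\<^sup>2) * indicator {R..} (- z) \<partial>lborel)
      = (\<integral>\<^sup>+z. ennreal (1 / z\<^sup>2) * indicator {R..} z \<partial>lborel)"
    using nn_integral_real_affine[of "\<lambda>z. ennreal (1 / z\<^sup>2) * indicator {R..} z" "-1" 0] by simp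
  also have "(\<integral>\<^sup>+z. ennreal (1 / z\<^sup>2) * indicator {R..} z \<partial>lborel) + (\<integral>\<^sup>+z. ennreal (1 / z\<^sup>2) * indicator {R..} z \<partial>lborel)
      = ennreal (2 / R)"
    unfolding pos using R by (subst ennreal_plus[symmetric]) auto
  finally show ?thesis .
qed

context coefficient
begin

text \<open>Scaling. The jumps |z| < 1, 1 \<le> |z| \<le> R and |z| > R contribute \<Lambda>/R^2,
  2M/R and 2M/R to the Levy integral of min(1, z^2/R^2), which balances the length of the support,
  of order R.\<close>

lemma energy_cutoff_bound:
  assumes j: "levy j" and M: "\<And>z. 1 \<le> z \<Longrightarrow> j z \<le> M / z\<^sup>2" "0 \<le> M"
  shows "\<exists>S\<ge>0. \<forall>R\<ge>1. energy j (cutoff R) \<le> ennreal S"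
proof -
  note k = levy_kernel[OF j]
  have [measurable]: "j \<in> borel_measurable borel" using k by (rule kernel_measurable)
  obtain \<Lambda> where \<Lambda>: "(\<integral>\<^sup>+z. ennreal (min 1 (z\<^sup>2) * j \<bar>z\<bar>) \<partial>lborel) = ennreal \<Lambda>" "0 \<le> \<Lambda>"
    using j unfolding levy_def by (cases "\<integral>\<^sup>+z. ennreal (min 1 (z\<^sup>2) * j \<bar>z\<bar>) \<partial>lborel") auto
  \<comment> \<open>The support [- 2 R, 2 R] gives the factor 8 R of \<open>energy_le_bound\<close>,
    and the integral is at most (\<Lambda> + 4 M) / R.\<close>
  define S where "S = (C + 1) * 8 * (\<Lambda> + 4 * M)"
  have "energy j (cutoff R) \<le> ennreal S" if R: "1 \<le> R" for R
  proof -
    have R0: "0 < R" using R by simp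
    have "energy j (cutoff R) \<le> ennreal ((C + 1) * (4 * (2 * R))) * (\<integral>\<^sup>+z. ennreal (min 1 (z\<^sup>2 / R\<^sup>2) * j \<bar>z\<bar>) \<partial>lborel)"
    proof (rule energy_le_bound[OF k])
      show "cutoff R \<in> borel_measurable lebesgue"
        by (intro borel_imp_lebesgue_measurable lip_compact_measurable cutoff_lip_compact R0)
      fix x y
      show "(cutoff R x - cutoff R y)\<^sup>2 \<le> min 1 ((x - y)\<^sup>2 / R\<^sup>2) * (indicator {- (2 * R)..2 * R} x + indicator {- (2 * R)..2 * R} y)"
      proof (cases "2 * R < \<bar>x\<bar> \<and> 2 * R < \<bar>y\<bar>")
        case True
        then show ?thesis using R0 by (simp add: cutoff_eq_0)
      next
        case False
        then have i: "1 \<le> (indicator {- (2 * R)..2 * R} x + indicator {- (2 * R)..2 * R} y :: real)"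
          by (auto simp: indicator_def abs_le_iff)
        have "0 \<le> min 1 ((x - y)\<^sup>2 / R\<^sup>2)" by simp
        from mult_left_mono[OF i this] show ?thesis
          unfolding mult_1_right by (rule order_trans[OF cutoff_diff_square[OF R0]])
      qed
    qed (use R in auto)
    also have "(\<integral>\<^sup>+z. ennreal (min 1 (z\<^sup>2 / R\<^sup>2) * j \<bar>z\<bar>) \<partial>lborel)
      \<le> (\<integral>\<^sup>+z. ennreal (1 / R\<^sup>2) * ennreal (min 1 (z\<^sup>2) * j \<bar>z\<bar>) + (ennreal (M / R\<^sup>2) * indicator {- R..R} z
          + ennreal M * (ennreal (1 / z\<^sup>2) * indicator {z. R \<le> \<bar>z\<bar>} z)) \<partial>lborel)"
    proof (intro nn_integral_mono)
      fix z :: real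
      have j0: "0 \<le> j \<bar>z\<bar>" by (rule kernel_nonneg[OF k])
      consider "\<bar>z\<bar> < 1" | "1 \<le> \<bar>z\<bar>" "\<bar>z\<bar> \<le> R" | "R < \<bar>z\<bar>" by linarith
      then show "ennreal (min 1 (z\<^sup>2 / R\<^sup>2) * j \<bar>z\<bar>) \<le> ennreal (1 / R\<^sup>2) * ennreal (min 1 (z\<^sup>2) * j \<bar>z\<bar>)
          + (ennreal (M / R\<^sup>2) * indicator {- R..R} z + ennreal M * (ennreal (1 / z\<^sup>2) * indicator {z. R \<le> \<bar>z\<bar>} z))"
      proof cases
        case 1
        then have "z\<^sup>2 \<le> 1" by (simp add: abs_square_le_1 less_imp_le)
        then have "min 1 (z\<^sup>2 / R\<^sup>2) * j \<bar>z\<bar> \<le> 1 / R\<^sup>2 * (min 1 (z\<^sup>2) * j \<bar>z\<bar>)"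
          using j0 mult_right_mono[of "min 1 (z\<^sup>2 / R\<^sup>2)" "z\<^sup>2 / R\<^sup>2" "j \<bar>z\<bar>"] by (simp add: min_def)
        then have "ennreal (min 1 (z\<^sup>2 / R\<^sup>2) * j \<bar>z\<bar>) \<le> ennreal (1 / R\<^sup>2) * ennreal (min 1 (z\<^sup>2) * j \<bar>z\<bar>)"
          using j0 by (subst ennreal_mult[symmetric]) (auto intro: ennreal_leI)
        then show ?thesis by (rule order_trans) simp
      next
        case 2
        have "min 1 (z\<^sup>2 / R\<^sup>2) * j \<bar>z\<bar> \<le> z\<^sup>2 / R\<^sup>2 * (M / \<bar>z\<bar>\<^sup>2)"
          using j0 M(1)[OF 2(1)] by (intro mult_mono) auto
        also have "\<dots> = M / R\<^sup>2" using 2(1) by simp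
        finally have "ennreal (min 1 (z\<^sup>2 / R\<^sup>2) * j \<bar>z\<bar>) \<le> ennreal (M / R\<^sup>2) * indicator {- R..R} z"
          using 2(2) by (auto simp: indicator_def abs_le_iff intro: ennreal_leI)
        then show ?thesis by (rule order_trans) (simp add: add_increasing)
      next
        case 3
        have "min 1 (z\<^sup>2 / R\<^sup>2) * j \<bar>z\<bar> \<le> 1 * (M / \<bar>z\<bar>\<^sup>2)"
          using j0 M(1)[of "\<bar>z\<bar>"] 3 R by (intro mult_mono) auto
        then have "min 1 (z\<^sup>2 / R\<^sup>2) * j \<bar>z\<bar> \<le> M * (1 / z\<^sup>2)" by simp
        then have "ennreal (min 1 (z\<^sup>2 / R\<^sup>2) * j \<bar>z\<bar>) \<le> ennreal M * ennreal (1 / z\<^sup>2)"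
          using M(2) by (subst ennreal_mult[symmetric]) (auto intro: ennreal_leI)
        then show ?thesis using 3 by (auto simp: add_increasing)
      qed
    qed
    also have "\<dots> = ennreal (1 / R\<^sup>2) * ennreal \<Lambda> + (ennreal (M / R\<^sup>2) * ennreal (2 * R)
        + ennreal M * (\<integral>\<^sup>+z. ennreal (1 / z\<^sup>2) * indicator {z. R \<le> \<bar>z\<bar>} z \<partial>lborel))"
      using R0 by (simp add: nn_integral_add nn_integral_cmult \<Lambda>(1) emeasure_lborel_Icc_eq)
    also have "\<dots> \<le> ennreal (1 / R\<^sup>2) * ennreal \<Lambda> + (ennreal (M / R\<^sup>2) * ennreal (2 * R) + ennreal M * ennreal (2 / R))"
      by (intro add_left_mono mult_left_mono nn_integral_inverse_square_tail R0) simp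
    also have "\<dots> = ennreal (1 / R\<^sup>2 * \<Lambda> + (M / R\<^sup>2 * (2 * R) + M * (2 / R)))"
      using R0 M(2) \<Lambda>(2)
      by (simp only: ennreal_plus ennreal_mult mult_nonneg_nonneg divide_nonneg_nonneg add_nonneg_nonneg
        zero_le_power2 zero_le_one zero_le_numeral less_imp_le)
    also have "\<dots> \<le> ennreal ((\<Lambda> + 4 * M) / R)"
    proof (rule ennreal_leI)
      have "1 / R\<^sup>2 * \<Lambda> \<le> 1 / R * \<Lambda>"
        using R \<Lambda>(2) by (intro mult_right_mono) (auto simp: field_simps power2_eq_square)
      moreover have "M / R\<^sup>2 * (2 * R) = 2 * M / R" using R0 by (simp add: power2_eq_square)
      ultimately show "1 / R\<^sup>2 * \<Lambda> + (M / R\<^sup>2 * (2 * R) + M * (2 / R)) \<le> (\<Lambda> + 4 * M) / R"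
        by (simp add: add_divide_distrib)
    qed
    finally have "energy j (cutoff R) \<le> ennreal ((C + 1) * (4 * (2 * R))) * ennreal ((\<Lambda> + 4 * M) / R)"
      by (simp add: mult_left_mono)
    also have "\<dots> = ennreal S"
    proof -
      have "(C + 1) * (4 * (2 * R)) * ((\<Lambda> + 4 * M) / R) = S"
        using R0 by (simp add: S_def field_simps)
      then show ?thesis
        using R0 C_nonneg M(2) \<Lambda>(2) by (subst ennreal_mult[symmetric]) auto
    qed
    finally show ?thesis .
  qed
  moreover have "0 \<le> S" using C_nonneg M(2) \<Lambda>(2) by (simp add: S_def)
  ultimately show ?thesis by blast
qed

text \<open>Cutoffs are constant on growing squares, so only the energy of w outside these squares
  meets them; it tends to 0 by integrability, while the cutoffs keep bounded energy.\<close>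

theorem recurrent_jump_form:
  assumes j: "levy j" and M: "\<And>z. 1 \<le> z \<Longrightarrow> j z \<le> M / z\<^sup>2" "0 \<le> M"
  shows "recurrent_form (jump_form (J j)) (jump_domain (J j))"
proof -
  note k [measurable] = levy_kernel[OF j]
  let ?Q = "jump_form (J j)"
  interpret dirichlet ?Q "jump_domain (J j)" by unfold_locales (rule dirichlet_jump_form[OF j])
  obtain S where S: "0 \<le> S" "\<And>R. 1 \<le> R \<Longrightarrow> energy j (cutoff R) \<le> ennreal S"
    using energy_cutoff_bound[OF j M] by blast
  define \<phi> where "\<phi> n = cutoff (real (Suc n))" for n
  define \<eta> where "\<eta> n = class_L2 (\<phi> n)" for n
  have lip: "\<phi> n \<in> lip_compact" for n unfolding \<phi>_def by (rule cutoff_lip_compact) simp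
  note sq = lip_compact_square_integrable[OF lip]
  have r\<eta>: "AE x in lebesgue. rep_L2 (\<eta> n) x = \<phi> n x" for n unfolding \<eta>_def by (rule rep_class_L2[OF sq])
  have e\<eta>: "energy j (rep_L2 (\<eta> n)) \<le> ennreal S" for n
    using S(2)[of "real (Suc n)"] unfolding \<eta>_def energy_class[OF k sq] by (simp add: \<phi>_def)
  have \<eta>f: "\<eta> n \<in> finite_energy j" for n using e\<eta>[of n] by (auto simp: finite_energy_def intro: le_less_trans)
  have Q\<eta>: "?Q (\<eta> n) (\<eta> n) \<le> S / 2" for n
    using e\<eta>[of n] S(1) unfolding jump_energy_jump_form(3)[OF k \<eta>f] by (subst (asm) ennreal_le_iff) auto
  have weak: "(\<lambda>n. ?Q w (\<eta> n)) \<longlonglongrightarrow> 0" if w: "w \<in> finite_energy j" for w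
  proof (rule LIMSEQ_I)
    fix r :: real assume r: "0 < r"
    \<comment> \<open>The parameter of Young's inequality, chosen to keep the cutoff term s S / 4 at
      most r / 4.\<close>
    define s where "s = r / (S + 1)"
    have s: "0 < s" using r S(1) by (simp add: s_def)
    define A where "A n = {\<omega> :: real \<times> real. \<bar>fst \<omega>\<bar> \<le> real (Suc n) \<and> \<bar>snd \<omega>\<bar> \<le> real (Suc n)}" for n
    have Am [measurable]: "A n \<in> sets (lebesgue \<Otimes>\<^sub>M lebesgue)" for n
    proof -
      have "{\<omega> \<in> space (lebesgue \<Otimes>\<^sub>M lebesgue). \<bar>fst \<omega>\<bar> \<le> real (Suc n) \<and> \<bar>snd \<omega>\<bar> \<le> real (Suc n)} \<in> sets (lebesgue \<Otimes>\<^sub>M (lebesgue :: real measure))"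
        by measurable
      then show ?thesis by (simp add: A_def space_pair_measure)
    qed
    have [measurable]: "- A n \<in> sets (lebesgue \<Otimes>\<^sub>M lebesgue)" for n
      using sets.compl_sets[OF Am[of n]] by (simp add: Compl_eq_Diff_UNIV space_pair_measure)
    define a where "a n = (LINT \<omega>|(lebesgue \<Otimes>\<^sub>M lebesgue). diff_form j w w \<omega> * indicator (- A n) \<omega>)" for n
    have iw: "integrable (lebesgue \<Otimes>\<^sub>M lebesgue) (diff_form j w w)" by (rule integrable_diff_form_self[OF k w])
    have a0: "a \<longlonglongrightarrow> 0"
    proof -
      have "(\<lambda>n. LINT \<omega>|(lebesgue \<Otimes>\<^sub>M lebesgue). diff_form j w w \<omega> * indicator (- A n) \<omega>)
          \<longlonglongrightarrow> (LINT \<omega>|(lebesgue \<Otimes>\<^sub>M lebesgue :: (real \<times> real) measure). 0)"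
      proof (rule integral_dominated_convergence[OF _ _ iw])
        show "AE \<omega> in lebesgue \<Otimes>\<^sub>M lebesgue. (\<lambda>n. diff_form j w w \<omega> * indicator (- A n) \<omega>) \<longlonglongrightarrow> 0"
        proof (intro AE_I2 tendsto_eventually)
          fix \<omega> :: "real \<times> real"
          obtain N where "max \<bar>fst \<omega>\<bar> \<bar>snd \<omega>\<bar> \<le> real N" using real_arch_simple by blast
          then show "\<forall>\<^sub>F n in sequentially. diff_form j w w \<omega> * indicator (- A n) \<omega> = 0"
            by (intro eventually_sequentiallyI[of N]) (auto simp: A_def)
        qed
        show "AE \<omega> in lebesgue \<Otimes>\<^sub>M lebesgue. norm (diff_form j w w \<omega> * indicator (- A n) \<omega>) \<le> diff_form j w w \<omega>" for n
          using diff_form_nonneg[OF k] by (auto simp: indicator_def)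
      qed measurable
      then show ?thesis by (simp add: a_def[abs_def])
    qed
    have le: "\<bar>?Q w (\<eta> n)\<bar> \<le> a n / (4 * s) + s * S / 4" for n
    proof -
      have "\<bar>LINT \<omega>|(lebesgue \<Otimes>\<^sub>M lebesgue). diff_form j w (\<eta> n) \<omega>\<bar> \<le> (LINT \<omega>|(lebesgue \<Otimes>\<^sub>M lebesgue). \<bar>diff_form j w (\<eta> n) \<omega>\<bar>)"
        by (rule integral_abs_bound)
      also have "\<dots> \<le> (LINT \<omega>|(lebesgue \<Otimes>\<^sub>M lebesgue). 1 / (2 * s) * (diff_form j w w \<omega> * indicator (- A n) \<omega>) + s / 2 * diff_form j (\<eta> n) (\<eta> n) \<omega>)"
      proof (rule integral_mono_AE)
        show "integrable (lebesgue \<Otimes>\<^sub>M lebesgue) (\<lambda>\<omega>. \<bar>diff_form j w (\<eta> n) \<omega>\<bar>)"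
          by (intro integrable_abs integrable_diff_form k w \<eta>f)
        have "integrable (lebesgue \<Otimes>\<^sub>M lebesgue) (\<lambda>\<omega>. diff_form j w w \<omega> * indicator (- A n) \<omega>)"
          by (intro integrable_real_mult_indicator iw) measurable
        then show "integrable (lebesgue \<Otimes>\<^sub>M lebesgue) (\<lambda>\<omega>. 1 / (2 * s) * (diff_form j w w \<omega> * indicator (- A n) \<omega>) + s / 2 * diff_form j (\<eta> n) (\<eta> n) \<omega>)"
          by (intro Bochner_Integration.integrable_add integrable_mult_right integrable_diff_form_self k \<eta>f)
        show "AE \<omega> in lebesgue \<Otimes>\<^sub>M lebesgue. \<bar>diff_form j w (\<eta> n) \<omega>\<bar>
          \<le> 1 / (2 * s) * (diff_form j w w \<omega> * indicator (- A n) \<omega>) + s / 2 * diff_form j (\<eta> n) (\<eta> n) \<omega>"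
          using AE_fst_snd[OF r\<eta>[of n]]
        proof eventually_elim
          case (elim \<omega>)
          define p q t where "p = rep_L2 w (fst \<omega>) - rep_L2 w (snd \<omega>)"
            "q = rep_L2 (\<eta> n) (fst \<omega>) - rep_L2 (\<eta> n) (snd \<omega>)" "t = J j (fst \<omega>) (snd \<omega>)"
          note d = this
          have t: "0 \<le> t" unfolding d by (rule J_nonneg[OF k])
          show ?case
          proof (cases "\<omega> \<in> A n")
            case True
            then have "q = 0" using elim by (simp add: d A_def \<phi>_def cutoff_eq_1 del: of_nat_Suc)
            then show ?thesis using True by (simp add: diff_form_def d[symmetric])
          next
            case False
            have "0 \<le> (\<bar>p\<bar> - s * \<bar>q\<bar>)\<^sup>2" by simp
            then have "2 * s * (\<bar>p\<bar> * \<bar>q\<bar>) \<le> p\<^sup>2 + s\<^sup>2 * q\<^sup>2"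
              by (simp add: power2_diff power_mult_distrib algebra_simps)
            then have "\<bar>p\<bar> * \<bar>q\<bar> \<le> 1 / (2 * s) * p\<^sup>2 + s / 2 * q\<^sup>2"
              using s by (simp add: field_simps power2_eq_square)
            from mult_right_mono[OF this t] have "\<bar>p * q * t\<bar> \<le> 1 / (2 * s) * (p * p * t) + s / 2 * (q * q * t)"
              using t by (simp add: abs_mult distrib_right power2_eq_square mult.assoc)
            then show ?thesis using False by (simp add: diff_form_def d[symmetric])
          qed
        qed
      qed
      also have "\<dots> = 1 / (2 * s) * a n + s / 2 * (2 * ?Q (\<eta> n) (\<eta> n))"
      proof -
        have "integrable (lebesgue \<Otimes>\<^sub>M lebesgue) (\<lambda>\<omega>. diff_form j w w \<omega> * indicator (- A n) \<omega>)"
          by (intro integrable_real_mult_indicator iw) measurable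
        moreover have "integrable (lebesgue \<Otimes>\<^sub>M lebesgue) (diff_form j (\<eta> n) (\<eta> n))"
          by (intro integrable_diff_form_self k \<eta>f)
        ultimately show ?thesis by (simp add: a_def jump_form_eq)
      qed
      also have "\<dots> \<le> 1 / (2 * s) * a n + s / 2 * S"
        using Q\<eta>[of n] s by (intro add_left_mono mult_left_mono) auto
      finally show ?thesis by (simp add: jump_form_eq abs_mult mult_ac)
    qed
    have "(\<lambda>n. a n / (4 * s)) \<longlonglongrightarrow> 0 / (4 * s)" using s by (intro tendsto_intros a0) simp
    then have "\<forall>\<^sub>F n in sequentially. a n / (4 * s) < r / 2" by (rule order_tendstoD(2)) (use r in simp)
    then obtain N where N: "\<And>n. n \<ge> N \<Longrightarrow> a n / (4 * s) < r / 2" by (auto simp: eventually_sequentially)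
    have "s * S \<le> r" using S(1) r by (simp add: s_def field_simps)
    then have "norm (?Q w (\<eta> n) - 0) < r" if "n \<ge> N" for n using le[of n] N[OF that] r by simp
    then show "\<exists>N. \<forall>n\<ge>N. norm (?Q w (\<eta> n) - 0) < r" by blast
  qed
  show ?thesis
  proof (rule recurrent_criterion[where \<eta> = \<eta> and S = "S / 2"])
    show "\<eta> n \<in> jump_domain (J j)" for n using \<eta>f by (simp add: jump_domain_eq[OF j])
    show "nonneg_L2 (\<eta> n)" for n
      unfolding nonneg_L2_def using r\<eta>[of n] by eventually_elim (simp add: \<phi>_def cutoff_range)
    show "AE x in lebesgue. x \<in> {- real n..real n} \<longrightarrow> rep_L2 (\<eta> n) x = 1" for n
      using r\<eta>[of n] by eventually_elim (auto simp: \<phi>_def intro!: cutoff_eq_1)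
    show "(\<lambda>n. ?Q w (\<eta> n)) \<longlonglongrightarrow> 0" if "w \<in> jump_domain (J j)" for w
      using weak that by (simp add: jump_domain_eq[OF j])
  qed (rule Q\<eta>)
qed

text \<open>Average u(x) \<le> u(y) + t over x and y in the two intervals, where t = u(x) - u(y)
  \<le> s/2 + t^2/(2 s). The kernel is at least \<open>m\<close> at the distances that occur, so the
  square is paid for by the energy. The free parameter \<open>s\<close> is optimized by the
  caller.\<close>

lemma dyadic_average_step:
  fixes L L' :: real
  assumes j: "levy j" and u: "u \<in> finite_energy j" "nonneg_L2 u" and L: "0 < L" "0 < L'"
    and m: "0 < m" "\<And>z. 0 < z \<Longrightarrow> z \<le> L + L' \<Longrightarrow> m \<le> j z" and s: "0 < s"
  shows "inner u (ind_L2 {- L..L}) / (2 * L) \<le> inner u (ind_L2 {- L'..L'}) / (2 * L') + s / 2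
    + jump_form (J j) u u / (4 * L * L' * m * s)"
proof -
  note k [measurable] = levy_kernel[OF j]
  let ?I = "{- L..L}" and ?I' = "{- L'..L'}"
  let ?i = "indicator ?I :: real \<Rightarrow> ennreal" and ?i' = "indicator ?I' :: real \<Rightarrow> ennreal"
  define Q where "Q = jump_form (J j) u u"
  have Q: "energy j (rep_L2 u) = ennreal (2 * Q)" "0 \<le> Q"
    unfolding Q_def using jump_energy_jump_form[OF k u(1)] by auto
  define A A' where "A = inner u (ind_L2 ?I)" "A' = inner u (ind_L2 ?I')"
  have A0: "0 \<le> A" "0 \<le> A'"
    unfolding A_A'_def by (intro ennreal_inner_L2 u nonneg_ind_L2, auto simp: emeasure_lborel_Icc_eq)+
  have A: "(\<integral>\<^sup>+x\<in>?I. ennreal (rep_L2 u x) \<partial>lebesgue) = ennreal A" "(\<integral>\<^sup>+x\<in>?I'. ennreal (rep_L2 u x) \<partial>lebesgue) = ennreal A'"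
    unfolding A_A'_def by (intro ennreal_inner_ind_L2[symmetric] u, auto simp: emeasure_lborel_Icc_eq)+
  have i: "(\<integral>\<^sup>+x. ?i x \<partial>lebesgue) = ennreal (2 * L)" "(\<integral>\<^sup>+x. ?i' x \<partial>lebesgue) = ennreal (2 * L')"
    using L by (auto simp: emeasure_lborel_Icc_eq)
  have im [measurable]: "?i \<in> borel_measurable lebesgue" "?i' \<in> borel_measurable lebesgue"
    by (rule borel_measurable_indicator, simp)+
  \<comment> \<open>Then t^2 / (2 s) = d t^2 m \<le> d t^2 J.\<close>
  define d where "d = 1 / (2 * s * m)"
  have d: "0 < d" using s m by (simp add: d_def)
  have "ennreal A * ennreal (2 * L') = (\<integral>\<^sup>+x. (\<integral>\<^sup>+y. ennreal (rep_L2 u x) * ?i x * ?i' y \<partial>lebesgue) \<partial>lebesgue)"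
    using A(1) i(2) by (simp add: nn_integral_cmult nn_integral_multc)
  also have "\<dots> \<le> (\<integral>\<^sup>+x. (\<integral>\<^sup>+y. ?i x * (ennreal (rep_L2 u y) * ?i' y) + (ennreal (s / 2) * ?i x * ?i' y
      + ennreal d * ennreal ((rep_L2 u x - rep_L2 u y)\<^sup>2 * J j x y)) \<partial>lebesgue) \<partial>lebesgue)"
  proof (rule nn_integral_mono_AE)
    show "AE x in lebesgue. (\<integral>\<^sup>+y. ennreal (rep_L2 u x) * ?i x * ?i' y \<partial>lebesgue)
        \<le> (\<integral>\<^sup>+y. ?i x * (ennreal (rep_L2 u y) * ?i' y) + (ennreal (s / 2) * ?i x * ?i' y
          + ennreal d * ennreal ((rep_L2 u x - rep_L2 u y)\<^sup>2 * J j x y)) \<partial>lebesgue)"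
    proof (rule AE_I2, rule nn_integral_mono_AE)
      fix x
      show "AE y in lebesgue. ennreal (rep_L2 u x) * ?i x * ?i' y \<le> ?i x * (ennreal (rep_L2 u y) * ?i' y)
          + (ennreal (s / 2) * ?i x * ?i' y + ennreal d * ennreal ((rep_L2 u x - rep_L2 u y)\<^sup>2 * J j x y))"
        using u(2)[unfolded nonneg_L2_def]
      proof eventually_elim
        case (elim y)
        show ?case
        proof (cases "x \<in> ?I \<and> y \<in> ?I'")
          case True
          define t where "t = rep_L2 u x - rep_L2 u y"
          have J0: "0 \<le> J j x y" by (rule J_nonneg[OF k])
          have "t \<le> s / 2 + d * (t\<^sup>2 * J j x y)"
          proof (cases "x = y")
            case False
            then have "m \<le> j \<bar>x - y\<bar>" using True by (intro m(2)) (auto simp: abs_le_iff)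
            also have "\<dots> \<le> J j x y" by (rule J_ge[OF k])
            finally have "d * (t\<^sup>2 * m) \<le> d * (t\<^sup>2 * J j x y)" using d by (intro mult_left_mono) auto
            moreover have "d * (t\<^sup>2 * m) = t\<^sup>2 / (2 * s)" using m s by (simp add: d_def)
            moreover have "t \<le> s / 2 + t\<^sup>2 / (2 * s)"
            proof -
              have "0 \<le> (t - s)\<^sup>2" by simp
              then have "2 * s * t \<le> s\<^sup>2 + t\<^sup>2" by (simp add: power2_diff algebra_simps)
              then show ?thesis using s by (simp add: field_simps power2_eq_square)
            qed
            ultimately show ?thesis by linarith
          qed (use s in \<open>simp add: t_def\<close>)
          then have "ennreal (rep_L2 u x) \<le> ennreal (rep_L2 u y + (s / 2 + d * (t\<^sup>2 * J j x y)))"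
            by (intro ennreal_leI) (simp add: t_def)
          also have "\<dots> = ennreal (rep_L2 u y) + (ennreal (s / 2) + ennreal d * ennreal (t\<^sup>2 * J j x y))"
            using elim s d J0 by (simp add: ennreal_mult)
          finally show ?thesis using True by (simp add: t_def)
        qed (auto simp: indicator_def)
      qed
    qed
  qed
  also have "\<dots> = (\<integral>\<^sup>+x. ?i x * (\<integral>\<^sup>+y. ennreal (rep_L2 u y) * ?i' y \<partial>lebesgue) + (ennreal (s / 2) * ?i x * (\<integral>\<^sup>+y. ?i' y \<partial>lebesgue)
      + ennreal d * (\<integral>\<^sup>+y. ennreal ((rep_L2 u x - rep_L2 u y)\<^sup>2 * J j x y) \<partial>lebesgue)) \<partial>lebesgue)"
    by (intro nn_integral_cong) (simp add: nn_integral_add nn_integral_cmult del: nn_integral_indicator)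
  also have "\<dots> = (\<integral>\<^sup>+x. ?i x \<partial>lebesgue) * (\<integral>\<^sup>+y. ennreal (rep_L2 u y) * ?i' y \<partial>lebesgue)
      + (ennreal (s / 2) * (\<integral>\<^sup>+x. ?i x \<partial>lebesgue) * (\<integral>\<^sup>+y. ?i' y \<partial>lebesgue)
      + ennreal d * (\<integral>\<^sup>+x. \<integral>\<^sup>+y. ennreal ((rep_L2 u x - rep_L2 u y)\<^sup>2 * J j x y) \<partial>lebesgue \<partial>lebesgue))"
    by (simp add: nn_integral_add nn_integral_cmult nn_integral_multc del: nn_integral_indicator)
  also have "\<dots> = ennreal (2 * L) * ennreal A' + (ennreal (s / 2) * ennreal (2 * L) * ennreal (2 * L') + ennreal d * ennreal (2 * Q))"
    unfolding i A(2) energy_iterated[OF k rep_L2_measurable, symmetric] Q(1) ..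
  also have "\<dots> = ennreal (2 * L * A' + (s / 2 * (2 * L) * (2 * L') + d * (2 * Q)))"
    using L A0 s d Q(2)
    by (simp only: ennreal_plus ennreal_mult mult_nonneg_nonneg divide_nonneg_nonneg add_nonneg_nonneg
      zero_le_numeral less_imp_le)
  finally have "ennreal (A * (2 * L')) \<le> ennreal (2 * L * A' + (s / 2 * (2 * L) * (2 * L') + d * (2 * Q)))"
    using A0 L by (simp add: ennreal_mult)
  then have "A * (2 * L') \<le> 2 * L * A' + (s / 2 * (2 * L) * (2 * L') + d * (2 * Q))"
    using L A0 s d Q(2) by (subst (asm) ennreal_le_iff) auto
  then have "A / (2 * L) \<le> A' / (2 * L') + s / 2 + d * Q / (2 * L * L')"
    using L by (simp add: field_simps)
  also have "d * Q / (2 * L * L') = Q / (4 * L * L' * m * s)" by (simp add: d_def)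
  finally show ?thesis by (simp add: A_A'_def Q_def)
qed

text \<open>The average over [- 2^n, 2^n] is telescoped over dyadic intervals. Averages of an L^2
  function over growing intervals tend to 0, so what remains is the summable series of steps times
  sqrt(E(u, u)). The index \<open>l + 2\<close> of a step covers the largest distance, 3 *
  2^l.\<close>

theorem transient_jump_form:
  assumes j: "levy j" and mono: "\<And>z w. 0 < z \<Longrightarrow> z \<le> w \<Longrightarrow> 1 \<le> w \<Longrightarrow> j w \<le> j z" and pos: "\<And>z. 1 \<le> z \<Longrightarrow> 0 < j z"
    and summ: "summable (\<lambda>k. 1 / sqrt (4 ^ k * j (2 ^ k)))"
  shows "transient_form (jump_form (J j)) (jump_domain (J j))"
proof -
  note k = levy_kernel[OF j]
  let ?Q = "jump_form (J j)"
  interpret dirichlet ?Q "jump_domain (J j)" by unfold_locales (rule dirichlet_jump_form[OF j])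
  define b where "b k = 1 / sqrt (4 ^ k * j (2 ^ k))" for k :: nat
  have b0: "0 \<le> b k" for k using pos[of "2 ^ k"] by (simp add: b_def less_imp_le)
  define B where "B = (\<Sum>k. b k)"
  have sb: "summable b" using summ by (simp add: b_def[abs_def])
  have avg: "inner u (ind_L2 {- (2 ^ n)..2 ^ n}) / (2 * 2 ^ n) \<le> 2 * sqrt (?Q u u) * B"
    if u: "u \<in> finite_energy j" "nonneg_L2 u" for u and n :: nat
  proof -
    define a where "a l = inner u (ind_L2 {- (2 ^ l)..2 ^ l}) / (2 * 2 ^ l)" for l :: nat
    have Q0: "0 \<le> ?Q u u" by (rule jump_energy_jump_form(2)[OF k u(1)])
    have step: "a l \<le> a (Suc l) + 2 * sqrt (?Q u u) * b (l + 2)" for l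
    proof -
      define m where "m = j (2 ^ (l + 2))"
      have m0: "0 < m" unfolding m_def by (rule pos) (rule one_le_power, simp)
      have m: "m \<le> j z" if "0 < z" "z \<le> 2 ^ l + 2 ^ Suc l" for z
        unfolding m_def
      proof (rule mono[OF that(1)])
        have e: "(2::real) ^ (l + 2) = 4 * 2 ^ l" "(2::real) ^ Suc l = 2 * 2 ^ l" "(0::real) < 2 ^ l" by simp_all
        show "z \<le> 2 ^ (l + 2)" using that(2) e(3) unfolding e(1,2) by linarith
      qed (rule one_le_power, simp)
      \<comment> \<open>The optimal \<open>s\<close>: with L = 2^l and L' = 2^(l + 1), v^2 = E(u, u)
        / (2 L L' m). It may be 0, so the estimate is made for s > v and then passed to the
        limit.\<close>
      define v where "v = 2 * sqrt (?Q u u) * b (l + 2)"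
      have v0: "0 \<le> v" using b0 Q0 by (simp add: v_def)
      have v2: "v\<^sup>2 = ?Q u u / (4 ^ (l + 1) * m)"
        using Q0 m0 by (simp add: v_def b_def m_def power_mult_distrib power_divide)
      have eps: "a l \<le> a (Suc l) + s" if s: "v < s" for s
      proof -
        have s0: "0 < s" using s v0 by simp
        have "a l \<le> a (Suc l) + s / 2 + ?Q u u / (4 * 2 ^ l * 2 ^ Suc l * m * s)"
          unfolding a_def by (rule dyadic_average_step[OF j u _ _ m0 m s0]) auto
        also have "?Q u u / (4 * 2 ^ l * 2 ^ Suc l * m * s) = v\<^sup>2 / (2 * s)"
        proof -
          have "(4::real) * 2 ^ l * 2 ^ Suc l = 2 * 4 ^ (l + 1)"
            using power_mult_distrib[of "2::real" 2 l] by simp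
          then have "?Q u u / (4 * 2 ^ l * 2 ^ Suc l * m * s) = ?Q u u / (2 * 4 ^ (l + 1) * m * s)" by (simp only:)
          then show ?thesis unfolding v2 by (simp add: mult_ac)
        qed
        also have "v\<^sup>2 / (2 * s) \<le> s\<^sup>2 / (2 * s)"
          using s v0 s0 by (intro divide_right_mono power_mono) auto
        also have "s\<^sup>2 / (2 * s) = s / 2" using s0 by (simp add: power2_eq_square)
        finally show ?thesis by simp
      qed
      have "a l \<le> a (Suc l) + v"
      proof (rule field_le_epsilon)
        fix e :: real assume "0 < e"
        then show "a l \<le> a (Suc l) + v + e" using eps[of "v + e"] by linarith
      qed
      then show ?thesis by (simp add: v_def)
    qed
    have part: "a n \<le> a (n + l) + 2 * sqrt (?Q u u) * (\<Sum>i<l. b (n + i + 2))" for l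
    proof (induction l)
      case (Suc l)
      then show ?case using step[of "n + l"] by (simp add: distrib_left)
    qed simp
    have sum_le: "(\<Sum>i<l. b (n + i + 2)) \<le> B" for l
    proof -
      have "(\<Sum>i<l. b (n + i + 2)) = sum b ((\<lambda>i. n + i + 2) ` {..<l})" by (subst sum.reindex) (auto simp: inj_on_def)
      also have "\<dots> \<le> B" unfolding B_def by (rule sum_le_suminf[OF sb]) (auto simp: b0)
      finally show ?thesis .
    qed
    have up: "a n \<le> a (n + l) + 2 * sqrt (?Q u u) * B" for l
      using part[of l] mult_left_mono[OF sum_le[of l], of "2 * sqrt (?Q u u)"] Q0 by simp
    have a_le: "a l \<le> norm u * (1 / sqrt (2 * 2 ^ l))" for l
    proof -
      have ni: "norm (ind_L2 {- (2 ^ l)..2 ^ l}) \<le> 1 * sqrt (2 * 2 ^ l)"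
        unfolding ind_L2_def by (rule norm_class_L2_bounded_support) (auto simp: indicator_def abs_le_iff)
      have "inner u (ind_L2 {- (2 ^ l)..2 ^ l}) \<le> norm u * norm (ind_L2 {- (2 ^ l)..2 ^ l})" by (rule norm_cauchy_schwarz)
      also have "\<dots> \<le> norm u * sqrt (2 * 2 ^ l)" using ni by (intro mult_left_mono) auto
      finally have "a l \<le> norm u * sqrt (2 * 2 ^ l) / (2 * 2 ^ l)" unfolding a_def by (intro divide_right_mono) auto
      also have "\<dots> = norm u * (1 / sqrt (2 * 2 ^ l))"
        using real_div_sqrt[of "2 * 2 ^ l :: real"] by (simp add: field_simps)
      finally show ?thesis .
    qed
    have lim: "(\<lambda>l. norm u * (1 / sqrt (2 * 2 ^ (n + l))) + 2 * sqrt (?Q u u) * B) \<longlonglongrightarrow> norm u * 0 + 2 * sqrt (?Q u u) * B"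
    proof (intro tendsto_intros)
      have "(\<lambda>l. sqrt (1 / (2 * 2 ^ n) * (1/2) ^ l)) \<longlonglongrightarrow> sqrt (1 / (2 * 2 ^ n) * 0)"
        by (intro tendsto_intros LIMSEQ_power_zero) auto
      moreover have "sqrt (1 / (2 * 2 ^ n) * (1/2) ^ l) = 1 / sqrt (2 * 2 ^ (n + l))" for l
        by (simp add: real_sqrt_divide power_add power_one_over)
      ultimately show "(\<lambda>l. 1 / sqrt (2 * 2 ^ (n + l))) \<longlonglongrightarrow> 0" by simp
    qed
    have "a n \<le> norm u * 0 + 2 * sqrt (?Q u u) * B"
    proof (rule LIMSEQ_le_const[OF lim], intro exI allI impI)
      fix l
      show "a n \<le> norm u * (1 / sqrt (2 * 2 ^ (n + l))) + 2 * sqrt (?Q u u) * B"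
        using up[of l] a_le[of "n + l"] by linarith
    qed
    then show ?thesis by (simp add: a_def)
  qed
  show ?thesis
  proof (rule transient_criterion)
    fix m :: nat
    show "\<exists>C. \<forall>u\<in>jump_domain (J j). nonneg_L2 u \<longrightarrow> inner u (ind_L2 {- real m..real m}) \<le> C * sqrt (?Q u u)"
    proof (intro exI ballI impI)
      fix u assume "u \<in> jump_domain (J j)" and nn: "nonneg_L2 u"
      then have u: "u \<in> finite_energy j" by (simp add: jump_domain_eq[OF j])
      have "m \<le> 2 ^ m" by (rule less_imp_le[OF less_exp])
      then have m2: "real m \<le> 2 ^ m" by (metis of_nat_le_iff of_nat_numeral of_nat_power)
      have "nonneg_L2 (ind_L2 {- (2 ^ m)..2 ^ m} - ind_L2 {- real m..real m})"
        unfolding nonneg_L2_def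
        using rep_L2_diff[of "ind_L2 {- (2 ^ m)..2 ^ m}" "ind_L2 {- real m..real m}"]
          rep_ind_L2[of "{- (2 ^ m)..2 ^ m}", simplified] rep_ind_L2[of "{- real m..real m}", simplified]
      proof eventually_elim
        case (elim x)
        have "x \<in> {- (2 ^ m)..2 ^ m}" if "x \<in> {- real m..real m}"
          using that m2 unfolding atLeastAtMost_iff by linarith
        then show ?case using elim by (auto simp: indicator_def)
      qed
      from inner_nonneg_mono[OF this nn] have "inner u (ind_L2 {- real m..real m}) \<le> inner u (ind_L2 {- (2 ^ m)..2 ^ m})"
        by (simp add: inner_commute)
      also have "\<dots> \<le> 2 * sqrt (?Q u u) * B * (2 * 2 ^ m)"
        using avg[OF u nn, of m] by (simp add: pos_divide_le_eq)
      finally show "inner u (ind_L2 {- real m..real m}) \<le> (4 * B * 2 ^ m) * sqrt (?Q u u)" by (simp add: mult_ac)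
    qed
  qed
qed

end

section \<open>The logarithmically perturbed kernels\<close>

definition log_weight :: "real \<Rightarrow> real" where
  "log_weight z = ln (z + (exp 1)\<^sup>2)"

text \<open>One family for both parts: \<delta> = 1/n with \<beta> = 1/2 in the first, \<delta> = 0
  with \<beta> = 1 - 1/n in the second. The exponent is - 1 - \<alpha> with \<alpha> = 1 + \<delta>
  - L^(- \<beta>).\<close>

definition log_kernel :: "real \<Rightarrow> real \<Rightarrow> real \<Rightarrow> real" where
  "log_kernel \<delta> \<beta> z = \<bar>z\<bar> powr (- 2 - \<delta> + log_weight \<bar>z\<bar> powr (- \<beta>))"

lemma exp_1_square: "(exp 1)\<^sup>2 = (exp 2 :: real)"
  using exp_double[of "1 :: real"] by simp

lemma log_weight_mono: "0 \<le> z \<Longrightarrow> z \<le> w \<Longrightarrow> log_weight z \<le> log_weight w"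
  unfolding log_weight_def by (subst ln_le_cancel_iff) (auto intro: add_nonneg_pos)

lemma log_weight_ge_2: "0 \<le> z \<Longrightarrow> 2 \<le> log_weight z"
  using log_weight_mono[of 0 z] by (simp add: log_weight_def exp_1_square)

lemma log_weight_ge_ln: "0 < z \<Longrightarrow> ln z \<le> log_weight z"
  unfolding log_weight_def by (subst ln_le_cancel_iff) (auto intro: add_pos_pos)

lemma log_weight_le:
  assumes "1 \<le> z"
  shows "log_weight z \<le> ln z + 3"
proof -
  have e: "1 + exp 2 \<le> (exp 3 :: real)"
  proof -
    have "1 + exp 2 \<le> exp 2 + exp (2 :: real)" by simp
    also have "\<dots> = 2 * exp 2" by simp
    also have "\<dots> \<le> exp 1 * exp 2" using exp_ge_add_one_self[of 1] by (intro mult_right_mono) auto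
    also have "\<dots> = exp 3" by (simp flip: exp_add)
    finally show ?thesis .
  qed
  have "z + exp 2 \<le> z * 1 + z * exp 2" using assms by simp
  also have "\<dots> = z * (1 + exp 2)" by (simp add: distrib_left)
  also have "\<dots> \<le> z * exp 3" using assms e by (intro mult_left_mono) auto
  finally have "ln (z + exp 2) \<le> ln (z * exp 3)"
    using assms by (subst ln_le_cancel_iff) (auto intro: add_pos_pos)
  also have "\<dots> = ln z + 3" using assms by (simp add: ln_mult)
  finally show ?thesis by (simp add: log_weight_def exp_1_square)
qed

text \<open>As L \<ge> 2, the extreme case is 2^(- 1/2), which is below 3/4.\<close>

lemma log_weight_powr_le:
  assumes "0 \<le> z" "1 / 2 \<le> \<beta>"
  shows "log_weight z powr (- \<beta>) \<le> 3 / 4"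
proof -
  note L = log_weight_ge_2[OF assms(1)]
  have "log_weight z powr (- \<beta>) \<le> log_weight z powr (- (1 / 2))" using L assms(2) by (intro powr_mono) auto
  also have "\<dots> \<le> 2 powr (- (1 / 2))" using L by (intro powr_mono2') auto
  also have "\<dots> = 1 / sqrt 2" by (simp add: powr_minus_divide powr_half_sqrt)
  also have "\<dots> \<le> 3 / 4"
  proof -
    have "4 / 3 \<le> sqrt (2 :: real)" by (rule real_le_rsqrt) (simp add: power2_eq_square)
    then show ?thesis by (simp add: field_simps)
  qed
  finally show ?thesis .
qed

text \<open>On [0, 1] the logarithm is at most 3, so the extreme case is \<beta> = 1.\<close>

lemma log_weight_powr_ge:
  assumes "0 \<le> z" "z \<le> 1" "0 \<le> \<beta>" "\<beta> \<le> 1"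
  shows "1 / 3 \<le> log_weight z powr (- \<beta>)"
proof -
  note L = log_weight_ge_2[OF assms(1)]
  have L3: "log_weight z \<le> 3" using log_weight_mono[OF assms(1,2)] log_weight_le[of 1] by simp
  have "1 / 3 = 3 powr (- 1 :: real)" by (simp add: powr_minus_divide)
  also have "\<dots> \<le> 3 powr (- \<beta>)" using assms(4) by (intro powr_mono) auto
  also have "\<dots> \<le> log_weight z powr (- \<beta>)" using L L3 assms(3) by (intro powr_mono2') auto
  finally show ?thesis .
qed

text \<open>The extreme exponents: - 3 + 1/3 = - 8/3 near 0, with \<delta> = 1, and - 2 + 3/4 = -
  5/4 at large distances, with \<delta> = 0.\<close>

definition log_kernel_bound :: "real \<Rightarrow> real" where
  "log_kernel_bound z = (if \<bar>z\<bar> \<le> 1 then \<bar>z\<bar> powr (- 8 / 3) else \<bar>z\<bar> powr (- 5 / 4))"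

lemma log_kernel_le_bound:
  assumes "0 \<le> \<delta>" "\<delta> \<le> 1" "1 / 2 \<le> \<beta>" "\<beta> \<le> 1" and z: "0 < z"
  shows "log_kernel \<delta> \<beta> z \<le> log_kernel_bound z"
proof (cases "z \<le> 1")
  case True
  then have "z powr (- 2 - \<delta> + log_weight z powr (- \<beta>)) \<le> z powr (- 8 / 3)"
    using assms log_weight_powr_ge[of z \<beta>] by (intro powr_mono') auto
  then show ?thesis using True z by (simp add: log_kernel_def log_kernel_bound_def)
next
  case False
  then have "z powr (- 2 - \<delta> + log_weight z powr (- \<beta>)) \<le> z powr (- 5 / 4)"
    using assms log_weight_powr_le[of z \<beta>] by (intro powr_mono) auto
  then show ?thesis using False z by (simp add: log_kernel_def log_kernel_bound_def)
qed

lemma levy_dominated: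
  assumes j: "jump_kernel j" and H: "levy H" and le: "\<And>z. 0 < z \<Longrightarrow> j z \<le> H z"
  shows "levy j"
proof -
  have "(\<integral>\<^sup>+z. ennreal (min 1 (z\<^sup>2) * j \<bar>z\<bar>) \<partial>lborel) \<le> (\<integral>\<^sup>+z. ennreal (min 1 (z\<^sup>2) * H \<bar>z\<bar>) \<partial>lborel)"
  proof (intro nn_integral_mono ennreal_leI)
    fix z :: real
    show "min 1 (z\<^sup>2) * j \<bar>z\<bar> \<le> min 1 (z\<^sup>2) * H \<bar>z\<bar>"
      by (cases "z = 0") (auto intro!: mult_left_mono le)
  qed
  then show ?thesis using j H by (auto simp: levy_def intro: le_less_trans)
qed

text \<open>After the factor min(1, z^2) the exponents are - 2/3 on the unit interval and - 5/4
  beyond it, on the integrable side of - 1 in both cases.\<close>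

lemma levy_log_kernel_bound: "levy log_kernel_bound"
proof -
  define g :: "real \<Rightarrow> ennreal" where
    "g z = ennreal (indicator {0..1} z * z powr (- 2 / 3)) + ennreal (indicator {1..} z * z powr (- 5 / 4))" for z
  have [measurable]: "g \<in> borel_measurable borel" unfolding g_def by measurable
  have "(\<integral>\<^sup>+z. g z \<partial>lborel) = ennreal (1 powr (- 2 / 3 + 1) / (- 2 / 3 + 1)) + ennreal (- (1 powr (- 5 / 4 + 1)) / (- 5 / 4 + 1))"
    unfolding g_def
    by (subst nn_integral_add)
      (measurable, intro arg_cong2[of _ _ _ _ plus] nn_integral_has_integral_lebesgue has_integral_powr_from_0 has_integral_powr_to_inf, auto)
  then have fin: "(\<integral>\<^sup>+z. g z \<partial>lborel) < \<infinity>" by simp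
  have "(\<integral>\<^sup>+z. ennreal (min 1 (z\<^sup>2) * log_kernel_bound \<bar>z\<bar>) \<partial>lborel) \<le> (\<integral>\<^sup>+z. g z + g (- z) \<partial>lborel)"
  proof (intro nn_integral_mono)
    fix z :: real
    have pw: "\<bar>z\<bar>\<^sup>2 * \<bar>z\<bar> powr (- 8 / 3) = \<bar>z\<bar> powr (- 2 / 3)" if "z \<noteq> 0"
      using that powr_add[of "\<bar>z\<bar>" 2 "- 8 / 3"] by simp
    have "ennreal (min 1 (z\<^sup>2) * log_kernel_bound \<bar>z\<bar>) \<le> g \<bar>z\<bar>"
    proof (cases "\<bar>z\<bar> \<le> 1")
      case True
      then have "min 1 (z\<^sup>2) = \<bar>z\<bar>\<^sup>2" by (simp add: abs_square_le_1 min_absorb2)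
      then have "min 1 (z\<^sup>2) * log_kernel_bound \<bar>z\<bar> = \<bar>z\<bar> powr (- 2 / 3)"
        using True pw by (cases "z = 0") (auto simp: log_kernel_bound_def)
      then show ?thesis using True by (simp add: g_def)
    next
      case False
      then have "min 1 (z\<^sup>2) * log_kernel_bound \<bar>z\<bar> \<le> \<bar>z\<bar> powr (- 5 / 4)"
        using mult_right_mono[of "min 1 (z\<^sup>2)" 1 "\<bar>z\<bar> powr (- 5 / 4)"] by (simp add: log_kernel_bound_def)
      then show ?thesis using False by (simp add: g_def ennreal_leI)
    qed
    also have "\<dots> \<le> g z + g (- z)" by (cases "0 \<le> z") (auto simp: add_increasing add_increasing2)
    finally show "ennreal (min 1 (z\<^sup>2) * log_kernel_bound \<bar>z\<bar>) \<le> g z + g (- z)" .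
  qed
  also have "\<dots> = (\<integral>\<^sup>+z. g z \<partial>lborel) + (\<integral>\<^sup>+z. g (- z) \<partial>lborel)" by (rule nn_integral_add) measurable
  also have "(\<integral>\<^sup>+z. g (- z) \<partial>lborel) = (\<integral>\<^sup>+z. g z \<partial>lborel)"
    using nn_integral_real_affine[of g "-1" 0] by simp
  finally have "(\<integral>\<^sup>+z. ennreal (min 1 (z\<^sup>2) * log_kernel_bound \<bar>z\<bar>) \<partial>lborel) < \<infinity>"
    using fin by (auto intro: le_less_trans)
  moreover have "log_kernel_bound \<in> borel_measurable borel"
    unfolding log_kernel_bound_def[abs_def] by measurable
  moreover have "0 \<le> log_kernel_bound z" for z by (simp add: log_kernel_bound_def)
  ultimately show ?thesis by (auto simp: levy_def jump_kernel_def)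
qed

lemma levy_log_kernel:
  assumes "0 \<le> \<delta>" "\<delta> \<le> 1" "1 / 2 \<le> \<beta>" "\<beta> \<le> 1"
  shows "levy (log_kernel \<delta> \<beta>)"
proof (rule levy_dominated[OF _ levy_log_kernel_bound])
  have "log_kernel \<delta> \<beta> \<in> borel_measurable borel"
    unfolding log_kernel_def[abs_def] log_weight_def by measurable
  then show "jump_kernel (log_kernel \<delta> \<beta>)" by (simp add: jump_kernel_def log_kernel_def)
qed (rule log_kernel_le_bound[OF assms])

lemma tendsto_log_kernel:
  assumes "\<delta>n \<longlonglongrightarrow> \<delta>" "\<beta>n \<longlonglongrightarrow> \<beta>" "0 < z"
  shows "(\<lambda>n. log_kernel (\<delta>n n) (\<beta>n n) z) \<longlonglongrightarrow> log_kernel \<delta> \<beta> z"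
  unfolding log_kernel_def
  by (intro tendsto_intros assms) (use assms(3) log_weight_ge_2[of z] in auto)

lemma log_kernel_eq:
  assumes "0 < z"
  shows "log_kernel \<delta> \<beta> z = exp ((log_weight z powr (- \<beta>) - \<delta>) * ln z) / z\<^sup>2"
proof -
  have "log_kernel \<delta> \<beta> z = z powr (log_weight z powr (- \<beta>) - \<delta>) * z powr (- 2)"
    unfolding powr_add[symmetric] using assms by (simp add: log_kernel_def algebra_simps)
  then show ?thesis using assms by (simp add: powr_def[of z "_ - _"] powr_minus_divide)
qed

lemma log_kernel_le_inverse_square:
  assumes z: "1 \<le> z" and M: "(log_weight z powr (- \<beta>) - \<delta>) * ln z \<le> M"
  shows "log_kernel \<delta> \<beta> z \<le> exp M / z\<^sup>2"
  using z M by (subst log_kernel_eq) (auto intro!: divide_right_mono)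

text \<open>With s = sqrt L and s^2 - 3 \<le> ln z \<le> s^2, the left side is at most s - \<delta>
  s^2 + 3 \<delta>, and the parabola s - \<delta> s^2 has maximum 1/(4 \<delta>).\<close>

lemma log_kernel_half_bound:
  assumes \<delta>: "0 < \<delta>" and z: "1 \<le> z"
  shows "(log_weight z powr (- (1 / 2)) - \<delta>) * ln z \<le> 1 / (4 * \<delta>) + 3 * \<delta>"
proof -
  define s where "s = sqrt (log_weight z)"
  have L: "2 \<le> log_weight z" using z by (intro log_weight_ge_2) simp
  have s: "0 < s" "s\<^sup>2 = log_weight z" using L by (simp_all add: s_def)
  have "log_weight z powr (- (1 / 2)) = 1 / s"
    using L by (simp add: s_def powr_minus_divide powr_half_sqrt)
  moreover have "1 / s * ln z \<le> 1 / s * s\<^sup>2"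
    using s z log_weight_ge_ln[of z] by (intro mult_left_mono) auto
  moreover have "1 / s * s\<^sup>2 = s" using s(1) unfolding power2_eq_square by simp
  moreover have "\<delta> * (s\<^sup>2 - 3) \<le> \<delta> * ln z"
    using \<delta> s log_weight_le[OF z] by (intro mult_left_mono) auto
  moreover have "s \<le> \<delta> * s\<^sup>2 + 1 / (4 * \<delta>)"
  proof -
    have "0 \<le> (2 * \<delta> * s - 1)\<^sup>2" by simp
    then have "s * (4 * \<delta>) \<le> \<delta> * s\<^sup>2 * (4 * \<delta>) + 1" by (simp add: power2_eq_square algebra_simps)
    then have "s \<le> (\<delta> * s\<^sup>2 * (4 * \<delta>) + 1) / (4 * \<delta>)" using \<delta> by (subst pos_le_divide_eq) auto
    then show ?thesis using \<delta> by (simp add: add_divide_distrib)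
  qed
  ultimately show ?thesis by (simp add: algebra_simps)
qed

lemma log_kernel_one_bound:
  assumes z: "1 \<le> z"
  shows "(log_weight z powr (- 1) - 0) * ln z \<le> 1"
  using z log_weight_ge_2[of z] log_weight_ge_ln[of z] by (simp add: powr_minus field_simps)

text \<open>Minus the logarithm of the kernel is (2 - L^(- \<beta>)) ln v. For v \<ge> 1 both
  factors increase; for z \<le> 1 the product is at most 0, hence below its value at w.\<close>

lemma log_kernel_mono:
  assumes \<beta>: "1 / 2 \<le> \<beta>" and z: "0 < z" "z \<le> w" "1 \<le> w"
  shows "log_kernel 0 \<beta> w \<le> log_kernel 0 \<beta> z"
proof -
  define p where "p v = 2 - log_weight v powr (- \<beta>)" for v
  have p: "5 / 4 \<le> p v" if "0 \<le> v" for v using log_weight_powr_le[OF that \<beta>] by (simp add: p_def)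
  have eq: "log_kernel 0 \<beta> v = exp (- (p v * ln v))" if "0 < v" for v
    using that by (simp add: log_kernel_def powr_def p_def algebra_simps)
  have "p z * ln z \<le> p w * ln w"
  proof (cases "z \<le> 1")
    case True
    have "p z * ln z \<le> 0" using True z p[of z] by (intro mult_nonneg_nonpos) auto
    also have "0 \<le> p w * ln w" using z p[of w] by (intro mult_nonneg_nonneg) auto
    finally show ?thesis .
  next
    case False
    have "p z \<le> p w"
      unfolding p_def using z \<beta> log_weight_ge_2[of z] log_weight_mono[of z w]
      by (intro diff_left_mono powr_mono2') auto
    then show ?thesis using False z p[of w] by (intro mult_mono) auto
  qed
  then show ?thesis using z by (simp add: eq)
qed

text \<open>The exponential dominates every power: exp y \<ge> (y / m)^m, and m with \<gamma> m
  \<ge> 2 leaves a comparison with the sum of 1/k^2.\<close>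

lemma summable_exp_neg_powr:
  fixes a \<gamma> :: real
  assumes a: "0 < a" and \<gamma>: "0 < \<gamma>"
  shows "summable (\<lambda>k :: nat. exp (- (a * real k powr \<gamma>)))"
proof -
  define m where "m = Suc (nat \<lceil>2 / \<gamma>\<rceil>)"
  have m0: "0 < m" by (simp add: m_def)
  have m: "2 \<le> \<gamma> * real m"
  proof -
    have "2 / \<gamma> \<le> real m" unfolding m_def by linarith
    then show ?thesis using \<gamma> by (simp add: field_simps)
  qed
  have "summable (\<lambda>k :: nat. (real m / a) ^ m * inverse (real k ^ 2))"
    by (intro summable_mult inverse_power_summable) simp
  then show ?thesis
  proof (rule summable_comparison_test'[where N = 1])
    fix k :: nat assume k: "1 \<le> k"
    define y where "y = a * real k powr \<gamma>"
    have y: "0 < y" using a k by (simp add: y_def)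
    have "(y / real m) ^ m \<le> exp (y / real m) ^ m"
      using y exp_ge_add_one_self[of "y / real m"] by (intro power_mono) (linarith, simp)
    also have "\<dots> = exp y" using m0 by (simp flip: exp_of_nat_mult)
    finally have "exp (- y) \<le> inverse ((y / real m) ^ m)"
      using y m0 by (simp add: exp_minus)
    also have "\<dots> = (real m / a) ^ m * inverse ((real k powr \<gamma>) ^ m)"
      by (simp add: y_def power_divide power_mult_distrib inverse_eq_divide)
    also have "\<dots> \<le> (real m / a) ^ m * inverse (real k ^ 2)"
    proof -
      have "real k ^ 2 = real k powr 2" using k by simp
      also have "\<dots> \<le> real k powr (\<gamma> * real m)" using k m by (intro powr_mono) auto
      also have "\<dots> = (real k powr \<gamma>) ^ m" using k by (simp add: powr_powr[symmetric] powr_realpow)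
      finally show ?thesis using k a by (intro mult_left_mono le_imp_inverse_le) auto
    qed
    finally show "norm (exp (- (a * real k powr \<gamma>))) \<le> (real m / a) ^ m * inverse (real k ^ 2)"
      by (simp add: y_def)
  qed
qed

lemma summable_log_kernel:
  assumes \<beta>: "1 / 2 \<le> \<beta>" "\<beta> < 1"
  shows "summable (\<lambda>k. 1 / sqrt (4 ^ k * log_kernel 0 \<beta> (2 ^ k)))"
proof (rule summable_comparison_test'[where N = 1])
  \<comment> \<open>At z = 2^k, z^2 j(z) = exp (L^(- \<beta>) k ln 2) and L \<le> k ln 2 + 3 \<le> 4
    k for k \<ge> 1. Half of the exponent is then at least a k^(1 - \<beta>).\<close>
  define a :: real where "a = ln 2 / 2 * 4 powr (- \<beta>)"
  show "summable (\<lambda>k :: nat. exp (- (a * real k powr (1 - \<beta>))))"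
    using \<beta> by (intro summable_exp_neg_powr) (auto simp: a_def)
  fix k :: nat assume k: "1 \<le> k"
  let ?p = "log_weight (2 ^ k) powr (- \<beta>)"
  have k1: "1 \<le> real k" using k by simp
  have "log_kernel 0 \<beta> (2 ^ k) = exp (?p * (real k * ln 2)) / (2 ^ k)\<^sup>2"
    by (subst log_kernel_eq) (simp_all add: ln_realpow)
  moreover have "((2 :: real) ^ k)\<^sup>2 = 4 ^ k" by (simp flip: power_mult_distrib add: power2_eq_square)
  ultimately have "4 ^ k * log_kernel 0 \<beta> (2 ^ k) = exp (?p * (real k * ln 2))" by simp
  also have "\<dots> = (exp (?p * (real k * ln 2) / 2))\<^sup>2" by (simp flip: exp_double)
  finally have "1 / sqrt (4 ^ k * log_kernel 0 \<beta> (2 ^ k)) = exp (- (?p * (real k * ln 2) / 2))"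
    by (simp add: exp_minus inverse_eq_divide)
  also have "\<dots> \<le> exp (- (a * real k powr (1 - \<beta>)))"
  proof -
    have "log_weight (2 ^ k) \<le> ln (2 ^ k) + 3" by (intro log_weight_le) simp
    also have "\<dots> = real k * ln 2 + 3" by (simp add: ln_realpow)
    also have "\<dots> \<le> real k * 1 + 3 * real k"
      using k1 ln_2_less_1 by (intro add_mono mult_left_mono) auto
    finally have "(4 * real k) powr (- \<beta>) \<le> ?p"
      using log_weight_ge_2[of "2 ^ k"] \<beta> by (intro powr_mono2') auto
    then have "(4 * real k) powr (- \<beta>) * (real k * ln 2) / 2 \<le> ?p * (real k * ln 2) / 2"
      by (intro divide_right_mono mult_right_mono) auto
    moreover have "a * real k powr (1 - \<beta>) = (4 * real k) powr (- \<beta>) * (real k * ln 2) / 2"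
      using k1 by (simp add: a_def powr_mult powr_add[of _ 1 "- \<beta>", simplified])
    ultimately show ?thesis by simp
  qed
  finally show "norm (1 / sqrt (4 ^ k * log_kernel 0 \<beta> (2 ^ k))) \<le> exp (- (a * real k powr (1 - \<beta>)))"
    by (simp add: log_kernel_def)
qed

context coefficient
begin

lemma stable_like_kernel_eq:
  assumes "\<And>u. 0 \<le> u \<Longrightarrow> \<alpha> u = 1 + \<delta> - ln (u + (exp 1)\<^sup>2) powr (- \<beta>)"
  shows "stable_like_kernel \<kappa> \<alpha> = J (log_kernel \<delta> \<beta>)"
proof (intro ext)
  fix x y
  have "- 1 - \<alpha> \<bar>x - y\<bar> = - 2 - \<delta> + log_weight \<bar>x - y\<bar> powr (- \<beta>)"
    using assms[of "\<bar>x - y\<bar>"] by (simp add: log_weight_def)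
  then show "stable_like_kernel \<kappa> \<alpha> x y = J (log_kernel \<delta> \<beta>) x y"
    by (simp only: stable_like_kernel_def J_def log_kernel_def abs_abs)
qed

lemma mosco_log_kernels:
  assumes \<delta>n: "\<And>n. N \<le> n \<Longrightarrow> 0 \<le> \<delta>n n \<and> \<delta>n n \<le> 1" "\<delta>n \<longlonglongrightarrow> \<delta>" "0 \<le> \<delta>" "\<delta> \<le> 1"
    and \<beta>n: "\<And>n. N \<le> n \<Longrightarrow> 1 / 2 \<le> \<beta>n n \<and> \<beta>n n \<le> 1" "\<beta>n \<longlonglongrightarrow> \<beta>" "1 / 2 \<le> \<beta>" "\<beta> \<le> 1"
    and Jn: "\<And>n. N \<le> n \<Longrightarrow> Jn n = J (log_kernel (\<delta>n n) (\<beta>n n))"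
  shows "mosco_converges (\<lambda>n. jump_form (Jn n)) (\<lambda>n. jump_domain (Jn n))
    (jump_form (J (log_kernel \<delta> \<beta>))) (jump_domain (J (log_kernel \<delta> \<beta>)))"
  by (rule mosco_jump_forms[OF Jn levy_log_kernel levy_log_kernel levy_log_kernel_bound
        log_kernel_le_bound log_kernel_le_bound tendsto_log_kernel]) (use \<delta>n \<beta>n in auto)

lemma recurrent_log_kernel_half:
  assumes "0 < \<delta>" "\<delta> \<le> 1"
  shows "recurrent_form (jump_form (J (log_kernel \<delta> (1 / 2)))) (jump_domain (J (log_kernel \<delta> (1 / 2))))"
  by (rule recurrent_jump_form[OF levy_log_kernel, where M = "exp (1 / (4 * \<delta>) + 3 * \<delta>)"])
    (use assms log_kernel_le_inverse_square[OF _ log_kernel_half_bound] in auto)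

lemma recurrent_log_kernel_one:
  "recurrent_form (jump_form (J (log_kernel 0 1))) (jump_domain (J (log_kernel 0 1)))"
  by (rule recurrent_jump_form[OF levy_log_kernel, where M = "exp 1"])
    (use log_kernel_le_inverse_square[OF _ log_kernel_one_bound] in auto)

lemma transient_log_kernel:
  assumes "1 / 2 \<le> \<beta>" "\<beta> < 1"
  shows "transient_form (jump_form (J (log_kernel 0 \<beta>))) (jump_domain (J (log_kernel 0 \<beta>)))"
  by (rule transient_jump_form[OF levy_log_kernel])
    (use assms log_kernel_mono summable_log_kernel in \<open>auto simp: log_kernel_def[of _ _ "_ :: real"]\<close>)

end

theorem proposition1p8:
  fixes \<kappa> :: "real \<Rightarrow> real" and c C :: real
  assumes "\<kappa> \<in> borel_measurable lebesgue"
    and "0 < c" and "c < C"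
    and "\<And>x. c \<le> \<kappa> x \<and> \<kappa> x \<le> C"
  defines "E \<equiv> \<lambda>\<alpha>. jump_form (stable_like_kernel \<kappa> \<alpha>)"
    and "F \<equiv> \<lambda>\<alpha>. jump_domain (stable_like_kernel \<kappa> \<alpha>)"
  shows
    "(\<forall>(\<alpha>n :: nat \<Rightarrow> real \<Rightarrow> real) (\<alpha> :: real \<Rightarrow> real).
        (\<forall>n\<ge>1. \<forall>u\<ge>0. \<alpha>n n u = 1 + 1 / real n - ln (u + (exp 1)\<^sup>2) powr (-1/2)) \<longrightarrow>
        (\<forall>u\<ge>0. \<alpha> u = 1 - ln (u + (exp 1)\<^sup>2) powr (-1/2)) \<longrightarrow>
        (\<forall>n\<ge>1. recurrent_form (E (\<alpha>n n)) (F (\<alpha>n n))) \<and>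
        mosco_converges (\<lambda>n. E (\<alpha>n n)) (\<lambda>n. F (\<alpha>n n)) (E \<alpha>) (F \<alpha>) \<and>
        transient_form (E \<alpha>) (F \<alpha>))
     \<and>
     (\<forall>(\<alpha>n :: nat \<Rightarrow> real \<Rightarrow> real) (\<alpha> :: real \<Rightarrow> real).
        (\<forall>n\<ge>2. \<forall>u\<ge>0. \<alpha>n n u = 1 - ln (u + (exp 1)\<^sup>2) powr (- (1 - 1 / real n))) \<longrightarrow>
        (\<forall>u\<ge>0. \<alpha> u = 1 - ln (u + (exp 1)\<^sup>2) powr (-1)) \<longrightarrow>
        (\<forall>n\<ge>2. transient_form (E (\<alpha>n n)) (F (\<alpha>n n))) \<and>
        mosco_converges (\<lambda>n. E (\<alpha>n n)) (\<lambda>n. F (\<alpha>n n)) (E \<alpha>) (F \<alpha>) \<and>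
        recurrent_form (E \<alpha>) (F \<alpha>))"
proof -
  interpret coefficient \<kappa> c C using assms by unfold_locales
  show ?thesis
  proof (intro conjI allI impI)
    fix \<alpha>n :: "nat \<Rightarrow> real \<Rightarrow> real" and \<alpha> :: "real \<Rightarrow> real"
    assume \<alpha>n: "\<forall>n\<ge>1. \<forall>u\<ge>0. \<alpha>n n u = 1 + 1 / real n - ln (u + (exp 1)\<^sup>2) powr (-1/2)"
      and \<alpha>: "\<forall>u\<ge>0. \<alpha> u = 1 - ln (u + (exp 1)\<^sup>2) powr (-1/2)"
    have Jn: "stable_like_kernel \<kappa> (\<alpha>n n) = J (log_kernel (1 / real n) (1 / 2))" if "1 \<le> n" for n
      using \<alpha>n that by (intro stable_like_kernel_eq) simp
    have J: "stable_like_kernel \<kappa> \<alpha> = J (log_kernel 0 (1 / 2))"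
      using \<alpha> by (intro stable_like_kernel_eq) simp
    show "recurrent_form (E (\<alpha>n n)) (F (\<alpha>n n))" if "1 \<le> n" for n
      unfolding E_def F_def Jn[OF that] using that by (intro recurrent_log_kernel_half) auto
    show "transient_form (E \<alpha>) (F \<alpha>)"
      unfolding E_def F_def J by (rule transient_log_kernel) auto
    show "mosco_converges (\<lambda>n. E (\<alpha>n n)) (\<lambda>n. F (\<alpha>n n)) (E \<alpha>) (F \<alpha>)"
      unfolding E_def F_def J
      by (rule mosco_log_kernels[where N = 1 and \<delta>n = "\<lambda>n. 1 / real n" and \<beta>n = "\<lambda>_. 1 / 2"])
        (auto simp: Jn intro: lim_1_over_n)
  next
    fix \<alpha>n :: "nat \<Rightarrow> real \<Rightarrow> real" and \<alpha> :: "real \<Rightarrow> real"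
    assume \<alpha>n: "\<forall>n\<ge>2. \<forall>u\<ge>0. \<alpha>n n u = 1 - ln (u + (exp 1)\<^sup>2) powr (- (1 - 1 / real n))"
      and \<alpha>: "\<forall>u\<ge>0. \<alpha> u = 1 - ln (u + (exp 1)\<^sup>2) powr (-1)"
    have Jn: "stable_like_kernel \<kappa> (\<alpha>n n) = J (log_kernel 0 (1 - 1 / real n))" if "2 \<le> n" for n
      using \<alpha>n that by (intro stable_like_kernel_eq) simp
    have J: "stable_like_kernel \<kappa> \<alpha> = J (log_kernel 0 1)"
      using \<alpha> by (intro stable_like_kernel_eq) simp
    \<comment> \<open>From n = 2 on, the exponents stay in the range [1/2, 1] on which the common
      Levy majorant was established.\<close>
    have half: "1 / 2 \<le> 1 - 1 / real n" if "2 \<le> n" for n using that by (simp add: field_simps)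
    show "transient_form (E (\<alpha>n n)) (F (\<alpha>n n))" if "2 \<le> n" for n
      unfolding E_def F_def Jn[OF that] using half[OF that] that by (intro transient_log_kernel) auto
    show "recurrent_form (E \<alpha>) (F \<alpha>)"
      unfolding E_def F_def J by (rule recurrent_log_kernel_one)
    have "(\<lambda>n. 1 - 1 / real n) \<longlonglongrightarrow> 1 - 0" by (intro tendsto_intros lim_1_over_n)
    then show "mosco_converges (\<lambda>n. E (\<alpha>n n)) (\<lambda>n. F (\<alpha>n n)) (E \<alpha>) (F \<alpha>)"
      unfolding E_def F_def J
      by (intro mosco_log_kernels[where N = 2 and \<delta>n = "\<lambda>_. 0" and \<beta>n = "\<lambda>n. 1 - 1 / real n"])
        (auto simp: Jn half)
  qed
qed

end
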